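(* Let $\mathcal{K}^*$ be a KSWN* on $n$ nodes (defined in the context) and let Algorithm 2 (defined in the context), with $c$ a sufficiently large constant, be used to route a message from a source node $s$ to a target node $t$. Then Algorithm 2 delivers the message in $O(\lg n \, \lg \lg n)$ expected number of hops.
   Context: All logarithms $\lg$ are base $2$. A KSWN* on $n$ nodes is the random directed graph defined as follows. The nodes are $0,1,\dots,n-1$ arranged on a ring, with arithmetic modulo $n$, and $Dist(u,v)$ denotes the ring distance between $u$ and $v$. Each node $u$ has: (i) an R-link to $(u+1) \bmod n$; (ii) one K-link to a node $v\neq u$ chosen at random with $\Pr[u\to v]=\frac{1}{Z_u\,Dist(u,v)}$, where $Z_u=\sum_{z\neq u} \frac{1}{Dist(u,z)}$ ($v$ is the K-neighbor of $u$); (iii) two AL-links, each to a node chosen uniformly at random from $(u,u+\lg^2 n]$ (modulo $n$) (the AL-neighbors of $u$). All random choices are independent. The immediate neighbors of $u$ are the endpoints of its R-link, K-link and AL-links. For a node $x$ define $T_0=\{x\}$, $T_{i+1}$ = the set of AL-neighbors of nodes in $T_i$, $H_i=\bigcup_{j\le i}T_j$, and $A_x(k)=H_k$. Algorithm 2 (oblivious), with current node $x$ initially $s$: while $Dist(x,t)\ge c\lg^2 n\,\lg\lg n$: let $z$ be a node of $A_x(\lg\lg n)$ whose K-neighbor is within distance $Dist(x,t)/2$ of $t$ and which is closest to $x$ in terms of AL-links (ties broken arbitrarily). If no such $z$ exists, route the message to the immediate neighbor of $x$ closest to $t$; otherwise compute a shortest path $\pi$ from $x$ to $z$ along AL-links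 within $A_x(\lg\lg n)$; if $\pi$ consists only of $x$, route the message to $x$'s K-neighbor, else route it to the next node of $\pi$. Final phase: repeatedly route the message to the immediate neighbor of the current node closest to $t$ until it reaches $t$. A hop is one transmission of the message along a link; expectations are over the random construction of the network.
   Formalization: Dist(u,v) is taken as the clockwise ring distance (v−u) mod n, in the K-link probabilities and in the algorithm; with the symmetric ring distance greedy routing can cycle forever (t−3, t+1, t+2, t+3, t−3) with positive probability, making the expectation infinite. *)

theory Defs
  imports "HOL-Probability.Probability"
begin

text \<open>Nodes are the naturals below \<open>n\<close>.  All local links of the network lead clockwise,
  from \<open>u\<close> towards \<open>u + 1\<close>, and the ring distance from \<open>u\<close> to \<open>v\<close> is measured in this
  direction; it is the number of R-links on the way from \<open>u\<close> to \<open>v\<close>.  (With the undirected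
  distance, greedy routing can overshoot \<open>t\<close> and then cycle forever with positive probability,
  e.g. through \<open>t-3\<close>, \<open>t+1\<close>, \<open>t+2\<close>, \<open>t+3\<close>, \<open>t-3\<close>, so that the expected number of hops
  would be infinite.)\<close>

definition ring_dist :: "nat \<Rightarrow> nat \<Rightarrow> nat \<Rightarrow> nat" where
  "ring_dist n u v = nat ((int v - int u) mod int n)"

abbreviation lg :: "real \<Rightarrow> real" where
  "lg \<equiv> log 2"


subsection \<open>The random network\<close>

text \<open>A network assigns to each node its K-neighbor and the endpoints of its two AL-links.
  The R-links are not random and hence not part of the data.\<close>

type_synonym network = "nat \<Rightarrow> nat \<times> nat \<times> nat"

definition K_nbr :: "network \<Rightarrow> nat \<Rightarrow> nat" where
  "K_nbr G u = fst (G u)"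

definition AL_nbrs :: "network \<Rightarrow> nat \<Rightarrow> nat set" where
  "AL_nbrs G u = {fst (snd (G u)), snd (snd (G u))}"

definition immediate_nbrs :: "nat \<Rightarrow> network \<Rightarrow> nat \<Rightarrow> nat set" where
  "immediate_nbrs n G u = {(u + 1) mod n, K_nbr G u} \<union> AL_nbrs G u"

definition Z_sum :: "nat \<Rightarrow> nat \<Rightarrow> real" where
  "Z_sum n u = (\<Sum>z\<in>{..<n} - {u}. 1 / real (ring_dist n u z))"

definition K_link_pmf :: "nat \<Rightarrow> nat \<Rightarrow> nat pmf" where
  "K_link_pmf n u =
     embed_pmf (\<lambda>v. if v < n \<and> v \<noteq> u then 1 / (Z_sum n u * real (ring_dist n u v)) else 0)"

definition AL_link_pmf :: "nat \<Rightarrow> nat \<Rightarrow> nat pmf" where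
  "AL_link_pmf n u =
     map_pmf (\<lambda>v. v mod n) (pmf_of_set {v. u < v \<and> real v \<le> real u + (lg (real n))\<^sup>2})"

definition KSWN_star :: "nat \<Rightarrow> network pmf" where
  "KSWN_star n = Pi_pmf {..<n} (0, 0, 0)
     (\<lambda>u. pair_pmf (K_link_pmf n u) (pair_pmf (AL_link_pmf n u) (AL_link_pmf n u)))"

lemma ring_dist_pos:
  assumes "u < n" "v < n" "u \<noteq> v"
  shows "ring_dist n u v > 0"
proof -
  have "(int v - int u) mod int n \<noteq> 0"
  proof
    assume "(int v - int u) mod int n = 0"
    then have "int v mod int n = int u mod int n"
      by (simp add: mod_eq_dvd_iff mod_0_imp_dvd)
    then show False using assms by simp
  qed
  moreover have "(int v - int u) mod int n \<ge> 0" using assms by simp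
  ultimately show ?thesis unfolding ring_dist_def by linarith
qed

text \<open>The weights in \<open>K_link_pmf\<close> do form a probability distribution.\<close>

lemma pmf_K_link_pmf:
  assumes "u < n" "n \<ge> 2"
  shows "pmf (K_link_pmf n u) v =
           (if v < n \<and> v \<noteq> u then 1 / (Z_sum n u * real (ring_dist n u v)) else 0)"
proof -
  define f where
    "f = (\<lambda>v. if v < n \<and> v \<noteq> u then 1 / (Z_sum n u * real (ring_dist n u v)) else 0)"
  have ne: "{..<n} - {u} \<noteq> {}"
  proof -
    have "(if u = 0 then 1 else 0) \<in> {..<n} - {u}" using assms by auto
    then show ?thesis by blast
  qed
  have Zpos: "Z_sum n u > 0"
    unfolding Z_sum_def using assms ne by (intro sum_pos) (auto simp: ring_dist_pos)
  have nonneg: "f v \<ge> 0" for v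
    using Zpos by (simp add: f_def)
  have "(\<integral>\<^sup>+v. ennreal (f v) \<partial>count_space UNIV)
      = (\<integral>\<^sup>+v. ennreal (f v) \<partial>count_space ({..<n} - {u}))"
    by (rule nn_integral_count_space_eq) (auto simp: f_def)
  also have "\<dots> = (\<Sum>v\<in>{..<n} - {u}. ennreal (f v))"
    by (simp add: nn_integral_count_space_finite)
  also have "\<dots> = ennreal (\<Sum>v\<in>{..<n} - {u}. f v)"
    using nonneg by (simp add: sum_ennreal)
  also have "(\<Sum>v\<in>{..<n} - {u}. f v) = (\<Sum>v\<in>{..<n} - {u}. (1 / real (ring_dist n u v)) / Z_sum n u)"
    by (rule sum.cong) (auto simp: f_def)
  also have "\<dots> = Z_sum n u / Z_sum n u"
    unfolding sum_divide_distrib[symmetric] Z_sum_def ..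
  also have "\<dots> = 1" using Zpos by simp
  finally have "(\<integral>\<^sup>+v. ennreal (f v) \<partial>count_space UNIV) = 1" by simp
  then have "pmf (embed_pmf f) v = f v"
    using nonneg by (intro pmf_embed_pmf) auto
  then show ?thesis unfolding K_link_pmf_def f_def .
qed


subsection \<open>The routing algorithm\<close>

text \<open>\<open>T_set G x i\<close> is the set of nodes reached from \<open>x\<close> by exactly \<open>i\<close> AL-links.\<close>

primrec T_set :: "network \<Rightarrow> nat \<Rightarrow> nat \<Rightarrow> nat set" where
  "T_set G x 0 = {x}"
| "T_set G x (Suc i) = (\<Union>u\<in>T_set G x i. AL_nbrs G u)"

text \<open>The radius \<open>r\<close> is real since it will be instantiated with \<open>lg (lg n)\<close>, which need not be
  an integer.\<close>

definition A_set :: "network \<Rightarrow> nat \<Rightarrow> real \<Rightarrow> nat set" where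
  "A_set G x r = (\<Union>j\<in>{j. real j \<le> r}. T_set G x j)"

definition AL_dist :: "network \<Rightarrow> nat \<Rightarrow> nat \<Rightarrow> nat" where
  "AL_dist G x z = (LEAST j. z \<in> T_set G x j)"

definition AL_path :: "network \<Rightarrow> nat set \<Rightarrow> nat \<Rightarrow> nat \<Rightarrow> nat list \<Rightarrow> bool" where
  "AL_path G S x z \<pi> \<longleftrightarrow> \<pi> \<noteq> [] \<and> hd \<pi> = x \<and> last \<pi> = z \<and> set \<pi> \<subseteq> S \<and>
     successively (\<lambda>u v. v \<in> AL_nbrs G u) \<pi>"

definition shortest_AL_path :: "network \<Rightarrow> nat set \<Rightarrow> nat \<Rightarrow> nat \<Rightarrow> nat list \<Rightarrow> bool" where
  "shortest_AL_path G S x z \<pi> \<longleftrightarrow> is_arg_min length (AL_path G S x z) \<pi>"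

definition in_loop :: "real \<Rightarrow> nat \<Rightarrow> nat \<Rightarrow> nat \<Rightarrow> bool" where
  "in_loop c n t x \<longleftrightarrow> real (ring_dist n x t) \<ge> c * (lg (real n))\<^sup>2 * lg (lg (real n))"

definition candidates :: "nat \<Rightarrow> network \<Rightarrow> nat \<Rightarrow> nat \<Rightarrow> nat set" where
  "candidates n G t x = {z \<in> A_set G x (lg (lg (real n))).
     real (ring_dist n (K_nbr G z) t) \<le> real (ring_dist n x t) / 2}"

definition greedy_step :: "nat \<Rightarrow> network \<Rightarrow> nat \<Rightarrow> nat \<Rightarrow> nat \<Rightarrow> bool" where
  "greedy_step n G t x y \<longleftrightarrow>
     is_arg_min (\<lambda>v. ring_dist n v t) (\<lambda>v. v \<in> immediate_nbrs n G x) y"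

text \<open>The steps are relations: \<open>y\<close> is a possible next node for some way of choosing among
  equally close nodes \<open>z\<close> and among the shortest paths to \<open>z\<close>.\<close>

definition loop_step :: "nat \<Rightarrow> network \<Rightarrow> nat \<Rightarrow> nat \<Rightarrow> nat \<Rightarrow> bool" where
  "loop_step n G t x y \<longleftrightarrow>
     (if candidates n G t x = {} then greedy_step n G t x y
      else \<exists>z \<pi>. is_arg_min (AL_dist G x) (\<lambda>z. z \<in> candidates n G t x) z \<and>
             shortest_AL_path G (A_set G x (lg (lg (real n)))) x z \<pi> \<and>
             y = (if \<pi> = [x] then K_nbr G x else \<pi> ! 1))"

text \<open>\<open>p m\<close> is the position of the message after \<open>m\<close> hops; the message stays at \<open>t\<close> once it has
  arrived.  The loop is left for good when its condition is violated for the first time.\<close>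

definition algorithm2_run ::
    "real \<Rightarrow> nat \<Rightarrow> network \<Rightarrow> nat \<Rightarrow> nat \<Rightarrow> (nat \<Rightarrow> nat) \<Rightarrow> bool" where
  "algorithm2_run c n G s t p \<longleftrightarrow> p 0 = s \<and>
     (\<forall>m. if p m = t then p (Suc m) = t
          else if \<forall>i\<le>m. in_loop c n t (p i) then loop_step n G t (p m) (p (Suc m))
          else greedy_step n G t (p m) (p (Suc m)))"

text \<open>Every network admits a run, so that assuming \<open>algorithm2_run\<close> is never vacuous.\<close>

lemma ex_greedy_step: "\<exists>y. greedy_step n G t x y"
proof -
  have "(x + 1) mod n \<in> immediate_nbrs n G x"
    by (simp add: immediate_nbrs_def)
  then show ?thesis
    unfolding greedy_step_def by (metis is_arg_min_arg_min_nat)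
qed

lemma ex_AL_path:
  assumes "z \<in> T_set G x j" "real j \<le> r"
  shows "\<exists>\<pi>. AL_path G (A_set G x r) x z \<pi>"
  using assms
proof (induction j arbitrary: z)
  case 0
  then have "AL_path G (A_set G x r) x z [x]"
    by (auto simp: AL_path_def A_set_def intro!: exI[of _ "0::nat"])
  then show ?case ..
next
  case (Suc j)
  from Suc.prems obtain u where u: "u \<in> T_set G x j" "z \<in> AL_nbrs G u" by auto
  with Suc.IH[of u] Suc.prems obtain \<pi> where \<pi>: "AL_path G (A_set G x r) x u \<pi>" by auto
  have "z \<in> A_set G x r" using Suc.prems unfolding A_set_def by blast
  with \<pi> u have "AL_path G (A_set G x r) x z (\<pi> @ [z])"
    by (auto simp: AL_path_def successively_append_iff)
  then show ?case ..
qed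

lemma ex_loop_step: "\<exists>y. loop_step n G t x y"
proof (cases "candidates n G t x = {}")
  case True
  then show ?thesis using ex_greedy_step by (simp add: loop_step_def)
next
  case False
  then obtain z where z: "is_arg_min (AL_dist G x) (\<lambda>z. z \<in> candidates n G t x) z"
    by (metis ex_in_conv is_arg_min_arg_min_nat)
  then have "z \<in> A_set G x (lg (lg (real n)))"
    by (simp add: is_arg_min_def candidates_def)
  then obtain \<pi> where "AL_path G (A_set G x (lg (lg (real n)))) x z \<pi>"
    using ex_AL_path unfolding A_set_def by blast
  then obtain \<pi> where "shortest_AL_path G (A_set G x (lg (lg (real n)))) x z \<pi>"
    unfolding shortest_AL_path_def by (metis is_arg_min_arg_min_nat)
  with z False have "loop_step n G t x (if \<pi> = [x] then K_nbr G x else \<pi> ! 1)"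
    unfolding loop_step_def by (simp only: if_False) blast
  then show ?thesis by blast
qed

lemma ex_algorithm2_run: "\<exists>p. algorithm2_run c n G s t p"
proof -
  define nxt where "nxt b x = (if x = t then t
    else if b then SOME y. loop_step n G t x y else SOME y. greedy_step n G t x y)" for b x
  define q where "q = rec_nat (s, in_loop c n t s)
    (\<lambda>_ (x, b). (nxt b x, b \<and> in_loop c n t (nxt b x)))"
  have q_Suc: "q (Suc m) = (nxt (snd (q m)) (fst (q m)),
      snd (q m) \<and> in_loop c n t (nxt (snd (q m)) (fst (q m))))" for m
    by (simp add: q_def split: prod.split)
  have flag: "snd (q m) \<longleftrightarrow> (\<forall>i\<le>m. in_loop c n t (fst (q i)))" for m
  proof (induction m)
    case 0
    then show ?case by (simp add: q_def)
  next
    case (Suc m)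
    then show ?case by (auto simp: q_Suc le_Suc_eq)
  qed
  have step: "fst (q (Suc m)) = nxt (\<forall>i\<le>m. in_loop c n t (fst (q i))) (fst (q m))" for m
    by (simp only: q_Suc flag fst_conv)
  have "algorithm2_run c n G s t (\<lambda>m. fst (q m))"
    unfolding algorithm2_run_def step nxt_def
    using someI_ex[OF ex_loop_step] someI_ex[OF ex_greedy_step] by (auto simp: q_def)
  then show ?thesis by blast
qed

text \<open>The value is \<open>\<infinity>\<close> if the message never reaches \<open>t\<close>.\<close>

definition hops :: "(nat \<Rightarrow> nat) \<Rightarrow> nat \<Rightarrow> ennreal" where
  "hops p t = (INF m\<in>{m. p m = t}. of_nat m)"

end

theory Submission
  imports Defs "HOL-Real_Asymp.Real_Asymp"
begin

text \<open>Every link used in the loop decreases the distance \<open>d\<close> to \<open>t\<close>, so a run is a walk on distances.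
  By induction on \<open>d\<close>, the number \<open>m\<close> of loop steps has an exponential moment bounded by a potential
  \<open>phi d\<close> with \<open>ln (phi d) = O(lg n * lg (lg n))\<close>, whence the bound on the expectation of \<open>m\<close>.  The
  difficulty is that the algorithm inspects K-links of nodes up to \<open>k = \<lfloor>lg (lg n)\<rfloor>\<close> AL-links ahead of the message,
  so the K-links of the nodes it visits next are no longer independent of its past.  If nothing
  ahead has been inspected, consider the path that always takes the longer AL-link.  Each of its nodes
  can reach of the order of \<open>lg n\<close> nodes by \<open>k\<close> AL-links, which rarely coincide, and each of these has a
  K-link halving the distance with probability of the order of \<open>1 / lg n\<close>; hence such a K-link
  is met within \<open>O(1)\<close> steps with exponential tails.  If inspected nodes are
  still ahead, the AL-links carry the message past them in \<open>O(k)\<close> steps.  In the final phase the K-links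
  alone give the greedy time from \<open>d\<close> an exponential moment of at most \<open>d + 1\<close>, and a union bound over
  the distance at which the loop is left suffices.\<close>

subsection \<open>Independence in finite products\<close>

text \<open>What makes the bound affordable is the exponent \<open>Lam\<close> of the potential,
  which is of the order \<open>k\<close>. It adds \<open>O(lg n * lg (lg n))\<close> to
  \<open>ln (phi d)\<close>, exactly the target, and in return every move that cuts the distance by
  a constant factor gains a factor exponentially small in \<open>k\<close>. Against this gain one
  may sum over all \<open>2 ^ Suc k\<close> words, all planted targets and all ways of breaking
  ties, without asking how they depend on the links. Only moves that gain little distance need
  genuine probability: the drift of the AL-links within a stage, and the many K-links seen from a
  path that starts among uninspected nodes. Independence is mostly used in one form: an event that
  reads links strictly above a distance against a future that reads the other links, which works
  because moves decrease the distance. At the scale \<open>D0\<close>, of the order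
  \<open>(lg n) ^ 3\<close>, losing a target becomes rare enough for a sum over all words. Below it
  nothing is known about the links, but only \<open>O(lg n)\<close> AL-ranges are left to cross, and
  the exponential factor of \<open>phi\<close> pays for them.\<close>

definition depends_on :: "'a set \<Rightarrow> (('a \<Rightarrow> 'b) \<Rightarrow> 'c) \<Rightarrow> bool" where
  "depends_on B f \<longleftrightarrow> (\<forall>x y. (\<forall>i\<in>B. x i = y i) \<longrightarrow> f x = f y)"

lemma depends_onI:
  assumes "\<And>x y. (\<And>i. i \<in> B \<Longrightarrow> x i = y i) \<Longrightarrow> f x = f y"
  shows "depends_on B f"
  unfolding depends_on_def by (intro allI impI, rule assms) (rule bspec)

lemma depends_onD: "depends_on B f \<Longrightarrow> (\<And>i. i \<in> B \<Longrightarrow> x i = y i) \<Longrightarrow> f x = f y"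
  unfolding depends_on_def by (elim allE impE) auto

lemma depends_on_mono: "depends_on B f \<Longrightarrow> B \<subseteq> C \<Longrightarrow> depends_on C f"
  unfolding depends_on_def by blast

text \<open>\<open>Pi_pmf A\<close> is the product of its restrictions to
  \<open>A \<inter> B\<close> and \<open>A - B\<close>, and outside \<open>A\<close> every
  coordinate is the default. Hence \<open>B\<close> may be an infinite set such as
  \<open>{u<..}\<close>.\<close>

lemma nn_integral_Pi_pmf_mult:
  fixes f g :: "('a \<Rightarrow> 'b) \<Rightarrow> ennreal"
  assumes A: "finite A" and f: "depends_on B f" and g: "depends_on (- B) g"
  shows "(\<integral>\<^sup>+x. f x * g x \<partial>Pi_pmf A d p) = (\<integral>\<^sup>+x. f x \<partial>Pi_pmf A d p) * (\<integral>\<^sup>+x. g x \<partial>Pi_pmf A d p)"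
proof -
  have eq: "Pi_pmf A d p = map_pmf (\<lambda>(f, g) x. if x \<in> A \<inter> B then f x else g x)
      (pair_pmf (Pi_pmf (A \<inter> B) d p) (Pi_pmf (A - B) d p))"
    using Pi_pmf_union[of "A \<inter> B" "A - B" d p] A by (auto simp: Int_Diff_Un Int_Diff_disjoint)
  have out: "y i = d" if "y \<in> set_pmf (Pi_pmf (A \<inter> B) d p)" "i \<notin> A \<inter> B" for y i
    using set_Pi_pmf_subset[of "A \<inter> B" d p] A that by auto
  have out2: "y i = d" if "y \<in> set_pmf (Pi_pmf (A - B) d p)" "i \<notin> A - B" for y i
    using set_Pi_pmf_subset[of "A - B" d p] A that by auto
  have f': "f (\<lambda>i. if i \<in> A \<and> i \<in> B then y i else z i) = f y"
    if "y \<in> set_pmf (Pi_pmf (A \<inter> B) d p)" "z \<in> set_pmf (Pi_pmf (A - B) d p)" for y z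
    by (rule depends_onD[OF f]) (use out[OF that(1)] out2[OF that(2)] in auto)
  have g': "g (\<lambda>i. if i \<in> A \<and> i \<in> B then y i else z i) = g z"
    if "y \<in> set_pmf (Pi_pmf (A \<inter> B) d p)" "z \<in> set_pmf (Pi_pmf (A - B) d p)" for y z
    by (rule depends_onD[OF g]) (use out[OF that(1)] out2[OF that(2)] in auto)
  have "(\<integral>\<^sup>+x. f x * g x \<partial>Pi_pmf A d p) =
     (\<integral>\<^sup>+y. \<integral>\<^sup>+z. f y * g z \<partial>Pi_pmf (A - B) d p \<partial>Pi_pmf (A \<inter> B) d p)"
    by (subst eq) (auto simp: nn_integral_pair_pmf' f' g' intro!: nn_integral_cong_AE AE_pmfI)
  moreover have "(\<integral>\<^sup>+x. f x \<partial>Pi_pmf A d p) =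
     (\<integral>\<^sup>+y. \<integral>\<^sup>+z. f y \<partial>Pi_pmf (A - B) d p \<partial>Pi_pmf (A \<inter> B) d p)"
    by (subst eq) (auto simp: nn_integral_pair_pmf' f' simp del: nn_integral_const intro!: nn_integral_cong_AE AE_pmfI)
  moreover have "(\<integral>\<^sup>+x. g x \<partial>Pi_pmf A d p) =
     (\<integral>\<^sup>+y. \<integral>\<^sup>+z. g z \<partial>Pi_pmf (A - B) d p \<partial>Pi_pmf (A \<inter> B) d p)"
    by (subst eq) (auto simp: nn_integral_pair_pmf' g' simp del: nn_integral_const intro!: nn_integral_cong_AE AE_pmfI)
  ultimately show ?thesis
    by (simp add: nn_integral_cmult nn_integral_multc measure_pmf.emeasure_space_1)
qed

text \<open>The inner integral keeps all of \<open>A\<close> and merely overwrites coordinate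
  \<open>i\<close>, so that the measure stays the same and bounds proved for it apply without
  change.\<close>

lemma nn_integral_Pi_pmf_resample:
  fixes f :: "('a \<Rightarrow> 'b) \<Rightarrow> ennreal" and p :: "'a \<Rightarrow> 'b pmf"
  assumes A: "finite A" and i: "i \<in> A"
  shows "(\<integral>\<^sup>+x. f x \<partial>Pi_pmf A d p) = (\<integral>\<^sup>+v. (\<integral>\<^sup>+x. f (x(i := v)) \<partial>Pi_pmf A d p) \<partial>p i)"
proof -
  have eq: "Pi_pmf A d p = map_pmf (\<lambda>(y,f). f(i:=y)) (pair_pmf (p i) (Pi_pmf (A - {i}) d p))"
    using Pi_pmf_insert[of "A - {i}" i d p] A i by (simp add: insert_absorb)
  have *: "(\<integral>\<^sup>+x. g x \<partial>Pi_pmf A d p) = (\<integral>\<^sup>+v. (\<integral>\<^sup>+x. g (x(i := v)) \<partial>Pi_pmf (A - {i}) d p) \<partial>p i)"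
    for g :: "_ \<Rightarrow> ennreal"
    unfolding eq by (simp add: nn_integral_pair_pmf')
  have "(\<integral>\<^sup>+x. f (x(i := v)) \<partial>Pi_pmf A d p) = (\<integral>\<^sup>+x. f (x(i := v)) \<partial>Pi_pmf (A - {i}) d p)" for v
    unfolding *[of "\<lambda>x. f (x(i := v))"] by (simp add: measure_pmf.emeasure_space_1)
  with *[of f] show ?thesis by simp
qed

lemma nn_integral_Pi_pmf_prod_le_power:
  fixes f :: "'b \<Rightarrow> ennreal" and p :: "'a \<Rightarrow> 'b pmf"
  assumes A: "finite A" and V: "finite V" "V \<subseteq> A"
    and q: "\<And>z. z \<in> V \<Longrightarrow> (\<integral>\<^sup>+v. f v \<partial>p z) \<le> q"
  shows "(\<integral>\<^sup>+x. (\<Prod>z\<in>V. f (x z)) \<partial>Pi_pmf A d p) \<le> q ^ card V"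
  using V q
proof (induction V rule: finite_induct)
  case empty
  then show ?case by simp
next
  case (insert z V)
  have "(\<integral>\<^sup>+x. (\<Prod>z\<in>insert z V. f (x z)) \<partial>Pi_pmf A d p) =
        (\<integral>\<^sup>+x. f (x z) * (\<Prod>z\<in>V. f (x z)) \<partial>Pi_pmf A d p)"
    using insert.hyps by simp
  also have "\<dots> = (\<integral>\<^sup>+x. f (x z) \<partial>Pi_pmf A d p) * (\<integral>\<^sup>+x. (\<Prod>z\<in>V. f (x z)) \<partial>Pi_pmf A d p)"
    by (rule nn_integral_Pi_pmf_mult[where B = "{z}"])
       (use A insert.hyps in \<open>auto intro!: depends_onI prod.cong arg_cong[of _ _ f]\<close>)
  also have "(\<integral>\<^sup>+x. f (x z) \<partial>Pi_pmf A d p) = (\<integral>\<^sup>+v. f v \<partial>p z)"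
    by (subst nn_integral_Pi_pmf_resample[where i = z]) (use A insert.prems in \<open>auto simp: measure_pmf.emeasure_space_1\<close>)
  also have "\<dots> * (\<integral>\<^sup>+x. (\<Prod>z\<in>V. f (x z)) \<partial>Pi_pmf A d p) \<le> q * q ^ card V"
    using insert by (intro mult_mono) auto
  finally show ?case using insert.hyps by simp
qed

subsection \<open>The loop in distance coordinates\<close>

text \<open>The charge per hop. It has to lose against the drift \<open>1 - theta / 3\<close> of an
  AL-step, and \<open>(gam - 1) * 20\<close> has to fit into the slack of
  \<open>exit_bound_le\<close>.\<close>

definition gam :: real where "gam = 1 + 1 / 2000"

lemma gam_gt_1: "1 < gam" by (simp add: gam_def)

abbreviation egam :: ennreal where "egam \<equiv> ennreal gam"

lemma egam_ge_1: "1 \<le> egam"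
  using gam_gt_1 by (simp add: ennreal_leI flip: ennreal_1)

definition pick :: "bool \<Rightarrow> 'a \<times> 'a \<Rightarrow> 'a" where
  "pick b x = (if b then fst x else snd x)"

text \<open>A word selects one of the two AL-links at every step.  AL-links of length \<open>a + 1\<close> are stored as
  \<open>a\<close>, so that they are uniform on \<open>{..<M}\<close>.\<close>

fun node :: "(nat \<Rightarrow> nat \<times> nat) \<Rightarrow> nat \<Rightarrow> bool list \<Rightarrow> nat" where
  "node \<alpha> d [] = d"
| "node \<alpha> d (b # w) = node \<alpha> (d - Suc (pick b (\<alpha> d))) w"

definition far_AL :: "(nat \<Rightarrow> nat \<times> nat) \<Rightarrow> nat \<Rightarrow> nat" where
  "far_AL \<alpha> d = min (d - Suc (fst (\<alpha> d))) (d - Suc (snd (\<alpha> d)))"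

lemma far_AL_le: "far_AL \<alpha> d \<le> d - 1" by (auto simp: far_AL_def)

lemma far_AL_pick: "\<exists>b. far_AL \<alpha> d = d - Suc (pick b (\<alpha> d))"
  by (cases "d - Suc (fst (\<alpha> d)) \<le> d - Suc (snd (\<alpha> d))")
     (auto simp: far_AL_def pick_def intro: exI[of _ True] exI[of _ False])

lemma node_le: "node \<alpha> d w \<le> d"
proof (induction w arbitrary: d)
  case (Cons b w)
  show ?case using Cons.IH[of "d - Suc (pick b (\<alpha> d))"] by simp
qed simp

lemma node_append: "node \<alpha> d (u @ w) = node \<alpha> (node \<alpha> d u) w"
  by (induction u arbitrary: d) auto

lemma node_less: "0 < d \<Longrightarrow> w \<noteq> [] \<Longrightarrow> node \<alpha> d w < d"
  by (cases w) (auto intro: le_less_trans[OF node_le])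

lemma node_cong: "(\<And>i. i \<le> d \<Longrightarrow> \<alpha> i = \<alpha>' i) \<Longrightarrow> node \<alpha> d w = node \<alpha>' d w"
proof (induction w arbitrary: d)
  case (Cons b w)
  have "node \<alpha> (d - Suc (pick b (\<alpha> d))) w = node \<alpha>' (d - Suc (pick b (\<alpha> d))) w"
    by (rule Cons.IH) (rule Cons.prems, simp)
  then show ?case using Cons.prems[of d] by simp
qed auto

text \<open>AL-links strictly decrease a positive distance, so a word that ends at \<open>u\<close>
  or above has read links strictly above \<open>u\<close> only. Subtraction is truncated and makes
  \<open>0\<close> a fixed point, whence \<open>0 < u\<close>. Through
  \<open>node_eq_iff_above\<close>, the event that a word ends at \<open>u\<close> becomes
  independent of all links at or below \<open>u\<close>.\<close>

lemma node_cong_above: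
  assumes "\<And>i. u < i \<Longrightarrow> \<alpha> i = \<alpha>' i" "u \<le> node \<alpha> d w" "0 < u"
  shows "node \<alpha>' d w = node \<alpha> d w"
  using assms(2)
proof (induction w arbitrary: d)
  case (Cons b w)
  have le: "u \<le> d - Suc (pick b (\<alpha> d))" using Cons.prems node_le[of \<alpha> "d - Suc (pick b (\<alpha> d))" w] by simp
  then have "u < d" using \<open>0 < u\<close> by linarith
  then have "\<alpha>' d = \<alpha> d" using assms(1) by simp
  then show ?case using Cons.IH[of "d - Suc (pick b (\<alpha> d))"] Cons.prems by simp
qed simp

lemma node_eq_iff_above:
  assumes "\<And>i. u < i \<Longrightarrow> \<alpha> i = \<alpha>' i" "0 < u" "u \<le> v"
  shows "node \<alpha> d w = v \<longleftrightarrow> node \<alpha>' d w = v"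
  using node_cong_above[of u \<alpha> \<alpha>' d w] node_cong_above[of u \<alpha>' \<alpha> d w] assms by auto

definition bounded_AL :: "nat \<Rightarrow> (nat \<Rightarrow> nat \<times> nat) \<Rightarrow> bool" where
  "bounded_AL M \<alpha> \<longleftrightarrow> (\<forall>i. fst (\<alpha> i) < M \<and> snd (\<alpha> i) < M)"

lemma bounded_AL_pick: "bounded_AL M \<alpha> \<Longrightarrow> Suc (pick b (\<alpha> i)) \<le> M"
  by (auto simp: bounded_AL_def pick_def Suc_le_eq)

lemma node_ge: "bounded_AL M \<alpha> \<Longrightarrow> d - length w * M \<le> node \<alpha> d w"
proof (induction w arbitrary: d)
  case (Cons b w)
  have "d - (M + length w * M) \<le> d - Suc (pick b (\<alpha> d)) - length w * M"
    using bounded_AL_pick[OF Cons.prems, of b d] by linarith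
  also have "\<dots> \<le> node \<alpha> (d - Suc (pick b (\<alpha> d))) w" by (rule Cons.IH[OF Cons.prems])
  finally show ?case by simp
qed simp

lemma node_ge_le: "bounded_AL M \<alpha> \<Longrightarrow> length w \<le> k \<Longrightarrow> d - k * M \<le> node \<alpha> d w"
  using node_ge[of M \<alpha> d w] mult_le_mono1[of "length w" k M] by linarith

lemma far_AL_ge: "bounded_AL M \<alpha> \<Longrightarrow> d - M \<le> far_AL \<alpha> d"
  using far_AL_pick[of \<alpha> d] bounded_AL_pick[of M \<alpha>] by (metis diff_le_mono2)

lemma of_bool_mult_split:
  fixes x y z r :: ennreal
  shows "x \<le> y + z \<Longrightarrow> of_bool P * x + r \<le> of_bool P * y + (z + r)"
  by (cases P) (simp_all add: add_increasing add.assoc[symmetric] add_right_mono)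

text \<open>To be instantiated with \<open>k = \<lfloor>lg (lg n)\<rfloor>\<close> and with the distance \<open>D1\<close> below which the loop is left.  The
  K-link of the node at distance \<open>d\<close> leads to distance \<open>\<kappa> d\<close>, its AL-links are encoded by \<open>\<alpha> d\<close>.\<close>

locale loop_params =
  fixes k :: nat and D1 :: nat
begin

section \<open>The walk of the loop and its worst-case charge\<close>

definition cand :: "(nat \<Rightarrow> nat) \<Rightarrow> (nat \<Rightarrow> nat \<times> nat) \<Rightarrow> nat \<Rightarrow> bool list \<Rightarrow> bool" where
  "cand \<kappa> \<alpha> d w \<longleftrightarrow> length w \<le> k \<and> 2 * \<kappa> (node \<alpha> d w) \<le> d"

definition lstep :: "(nat \<Rightarrow> nat) \<Rightarrow> (nat \<Rightarrow> nat \<times> nat) \<Rightarrow> nat \<Rightarrow> nat \<Rightarrow> bool" where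
  "lstep \<kappa> \<alpha> d d' \<longleftrightarrow>
     (if \<exists>w. cand \<kappa> \<alpha> d w
      then \<exists>w. cand \<kappa> \<alpha> d w \<and> (\<forall>w'. cand \<kappa> \<alpha> d w' \<longrightarrow> length w \<le> length w') \<and>
             d' = (case w of [] \<Rightarrow> \<kappa> d | b # _ \<Rightarrow> d - Suc (pick b (\<alpha> d)))
      else d' = min (\<kappa> d) (far_AL \<alpha> d))"

primrec chain :: "(nat \<Rightarrow> nat) \<Rightarrow> (nat \<Rightarrow> nat \<times> nat) \<Rightarrow> nat \<Rightarrow> nat \<Rightarrow> bool" where
  "chain \<kappa> \<alpha> 0 d = True"
| "chain \<kappa> \<alpha> (Suc m) d = (D1 \<le> d \<and> (\<exists>d'. lstep \<kappa> \<alpha> d d' \<and> chain \<kappa> \<alpha> m d'))"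

text \<open>The supremum over all chains makes every resolution of ties count at once, so a bound on
  its expectation covers runs whose choices depend on the whole network.\<close>

definition val :: "(nat \<Rightarrow> nat) \<Rightarrow> (nat \<Rightarrow> nat \<times> nat) \<Rightarrow> nat \<Rightarrow> ennreal" where
  "val \<kappa> \<alpha> d = (SUP m\<in>{m. chain \<kappa> \<alpha> m d}. egam ^ m)"

lemma chain_le_val: "chain \<kappa> \<alpha> m d \<Longrightarrow> egam ^ m \<le> val \<kappa> \<alpha> d"
  unfolding val_def by (intro SUP_upper) auto

lemma val_below: "d < D1 \<Longrightarrow> val \<kappa> \<alpha> d = 1"
proof -
  assume "d < D1"
  then have "chain \<kappa> \<alpha> m d \<longleftrightarrow> m = 0" for m
    by (cases m) auto
  then show ?thesis by (simp add: val_def)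
qed

lemma val_ge_1: "1 \<le> val \<kappa> \<alpha> d"
  using chain_le_val[of \<kappa> \<alpha> 0 d] by simp

lemma cand_cong:
  assumes "\<And>i. i \<le> d \<Longrightarrow> \<kappa> i = \<kappa>' i" "\<And>i. i \<le> d \<Longrightarrow> \<alpha> i = \<alpha>' i"
  shows "cand \<kappa> \<alpha> d w = cand \<kappa>' \<alpha>' d w"
  using assms node_cong[of d \<alpha> \<alpha>' w] node_le[of \<alpha> d w] by (simp add: cand_def)

lemma lstep_cong:
  assumes "\<And>i. i \<le> d \<Longrightarrow> \<kappa> i = \<kappa>' i" "\<And>i. i \<le> d \<Longrightarrow> \<alpha> i = \<alpha>' i"
  shows "lstep \<kappa> \<alpha> d d' = lstep \<kappa>' \<alpha>' d d'"
proof -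
  have "cand \<kappa> \<alpha> d w = cand \<kappa>' \<alpha>' d w" for w by (rule cand_cong) (auto intro: assms)
  then have "cand \<kappa> \<alpha> d = cand \<kappa>' \<alpha>' d" by blast
  then show ?thesis using assms[of d] by (simp add: lstep_def far_AL_def cong: if_cong list.case_cong)
qed

lemma lstep_le: "lstep \<kappa> \<alpha> d d' \<Longrightarrow> d' \<le> d"
  using far_AL_le[of \<alpha> d] by (auto simp: lstep_def cand_def split: if_splits) (auto split: list.splits)

lemma ex_lstep: "\<exists>d'. lstep \<kappa> \<alpha> d d'"
proof (cases "\<exists>w. cand \<kappa> \<alpha> d w")
  case True
  then obtain w where "cand \<kappa> \<alpha> d w" "\<forall>w'. cand \<kappa> \<alpha> d w' \<longrightarrow> length w \<le> length w'"
    using arg_min_nat_lemma[of "cand \<kappa> \<alpha> d" _ length] by metis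
  then show ?thesis using True by (auto simp: lstep_def)
qed (auto simp: lstep_def)

lemma chain_cong:
  assumes "\<And>i. i \<le> d \<Longrightarrow> \<kappa> i = \<kappa>' i" "\<And>i. i \<le> d \<Longrightarrow> \<alpha> i = \<alpha>' i"
  shows "chain \<kappa> \<alpha> m d = chain \<kappa>' \<alpha>' m d"
  using assms
proof (induction m arbitrary: d)
  case (Suc m)
  have "chain \<kappa> \<alpha> m d' = chain \<kappa>' \<alpha>' m d'" if "lstep \<kappa> \<alpha> d d'" for d'
    using Suc.IH[of d'] Suc.prems lstep_le[OF that] by simp
  then show ?case using lstep_cong[OF Suc.prems] by auto
qed simp

text \<open>The walk never moves away from the target, so its future from \<open>d\<close> reads
  only links at or below \<open>d\<close>. This is the other half of the independence
  arguments.\<close>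

lemma val_cong:
  assumes "\<And>i. i \<le> d \<Longrightarrow> \<kappa> i = \<kappa>' i" "\<And>i. i \<le> d \<Longrightarrow> \<alpha> i = \<alpha>' i"
  shows "val \<kappa> \<alpha> d = val \<kappa>' \<alpha>' d"
  using chain_cong[OF assms] by (simp add: val_def)

text \<open>There are finitely many possible next positions, all at most \<open>d\<close>, so a
  worst one exists. It turns the supremum into a one-step recursion.\<close>

lemma val_attained:
  assumes "D1 \<le> d"
  obtains d' where "lstep \<kappa> \<alpha> d d'" "val \<kappa> \<alpha> d \<le> egam * val \<kappa> \<alpha> d'"
proof -
  let ?S = "{d'. lstep \<kappa> \<alpha> d d'}"
  have fin: "finite ?S" by (rule finite_subset[of _ "{..d}"]) (auto dest: lstep_le)
  have ne: "?S \<noteq> {}" using ex_lstep by blast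
  obtain d0 where d0: "d0 \<in> ?S" "\<And>d'. d' \<in> ?S \<Longrightarrow> val \<kappa> \<alpha> d' \<le> val \<kappa> \<alpha> d0"
  proof -
    have "Max (val \<kappa> \<alpha> ` ?S) \<in> val \<kappa> \<alpha> ` ?S" using fin ne by (intro Max_in) auto
    then obtain d0 where "d0 \<in> ?S" "Max (val \<kappa> \<alpha> ` ?S) = val \<kappa> \<alpha> d0" by blast
    then show ?thesis using that[of d0] fin by (metis Max_ge finite_imageI imageI)
  qed
  have "val \<kappa> \<alpha> d \<le> egam * val \<kappa> \<alpha> d0"
    unfolding val_def[of \<kappa> \<alpha> d]
  proof (rule SUP_least)
    fix m assume m: "m \<in> {m. chain \<kappa> \<alpha> m d}"
    show "egam ^ m \<le> egam * val \<kappa> \<alpha> d0"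
    proof (cases m)
      case 0
      then show ?thesis using mult_mono[OF egam_ge_1 val_ge_1[of \<kappa> \<alpha> d0]] by simp
    next
      case (Suc m')
      then obtain d' where "lstep \<kappa> \<alpha> d d'" "chain \<kappa> \<alpha> m' d'" using m by auto
      then have "egam ^ m' \<le> val \<kappa> \<alpha> d0" using chain_le_val d0(2)[of d'] order_trans by blast
      then show ?thesis using Suc by (simp add: mult_left_mono)
    qed
  qed
  then show ?thesis using that d0(1) by blast
qed

text \<open>The crude step used below \<open>D0\<close>: instead of asking which move is made, all
  of them are summed. A halving K-link can be charged to the third term because
  \<open>2 * M \<le> d\<close> lets it reach as far as both AL-links.\<close>

lemma val_wild:
  assumes d: "D1 \<le> d" "2 * M \<le> d" and \<alpha>: "bounded_AL M \<alpha>"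
  shows "val \<kappa> \<alpha> d \<le> egam * (val \<kappa> \<alpha> (d - Suc (fst (\<alpha> d))) + val \<kappa> \<alpha> (d - Suc (snd (\<alpha> d)))
      + of_bool (\<kappa> d \<le> far_AL \<alpha> d) * val \<kappa> \<alpha> (\<kappa> d))"
proof -
  obtain d' where d': "lstep \<kappa> \<alpha> d d'" "val \<kappa> \<alpha> d \<le> egam * val \<kappa> \<alpha> d'"
    by (rule val_attained[OF d(1)])
  have "d' = \<kappa> d \<and> \<kappa> d \<le> far_AL \<alpha> d \<or> d' = d - Suc (fst (\<alpha> d)) \<or> d' = d - Suc (snd (\<alpha> d))"
  proof (cases "\<exists>w. cand \<kappa> \<alpha> d w")
    case True
    then obtain w where w: "cand \<kappa> \<alpha> d w" "d' = (case w of [] \<Rightarrow> \<kappa> d | b # _ \<Rightarrow> d - Suc (pick b (\<alpha> d)))"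
      using d'(1) by (auto simp: lstep_def)
    show ?thesis
    proof (cases w)
      case Nil
      then have "2 * \<kappa> d \<le> d" using w by (simp add: cand_def)
      then have "\<kappa> d \<le> d - M" using d(2) by linarith
      then show ?thesis using Nil w far_AL_ge[OF \<alpha>, of d] by auto
    qed (use w in \<open>auto simp: pick_def\<close>)
  next
    case False
    then show ?thesis using d'(1) by (auto simp: lstep_def far_AL_def min_def split: if_splits)
  qed
  then have "val \<kappa> \<alpha> d' \<le> val \<kappa> \<alpha> (d - Suc (fst (\<alpha> d))) + val \<kappa> \<alpha> (d - Suc (snd (\<alpha> d)))
      + of_bool (\<kappa> d \<le> far_AL \<alpha> d) * val \<kappa> \<alpha> (\<kappa> d)"
    by (elim disjE conjE) (auto intro: add_increasing add_increasing2)
  then show ?thesis using d'(2) by (meson mult_left_mono order_trans zero_le)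
qed

text \<open>Either the message follows an AL-path to the end and halves its distance, or the node it is
  heading for ceases to be a candidate on the way.\<close>

lemma val_path:
  assumes "D1 + l * M \<le> d" "bounded_AL M \<alpha>"
    and "cand \<kappa> \<alpha> d w" "length w = l" "\<forall>w'. cand \<kappa> \<alpha> d w' \<longrightarrow> l \<le> length w'"
  shows "\<exists>w. length w = l \<and> 2 * \<kappa> (node \<alpha> d w) \<le> d \<and>
     (val \<kappa> \<alpha> d \<le> egam ^ Suc l * val \<kappa> \<alpha> (\<kappa> (node \<alpha> d w)) \<or>
      (\<exists>i\<in>{1..l}. node \<alpha> d (take i w) < 2 * \<kappa> (node \<alpha> d w) \<and>
          val \<kappa> \<alpha> d \<le> egam ^ i * val \<kappa> \<alpha> (node \<alpha> d (take i w))))"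
  using assms
proof (induction l arbitrary: d w)
  case 0
  obtain d' where d': "lstep \<kappa> \<alpha> d d'" "val \<kappa> \<alpha> d \<le> egam * val \<kappa> \<alpha> d'"
    by (rule val_attained[of d]) (use 0 in simp)
  have c0: "cand \<kappa> \<alpha> d []" using 0 by simp
  then obtain v where "cand \<kappa> \<alpha> d v" "length v \<le> length ([]::bool list)"
      "d' = (case v of [] \<Rightarrow> \<kappa> d | b # _ \<Rightarrow> d - Suc (pick b (\<alpha> d)))"
    using d'(1) unfolding lstep_def by (metis)
  then have "d' = \<kappa> d" by simp
  then show ?case using d'(2) c0 by (auto simp: cand_def)
next
  case (Suc l)
  obtain d' where d': "lstep \<kappa> \<alpha> d d'" "val \<kappa> \<alpha> d \<le> egam * val \<kappa> \<alpha> d'"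
    by (rule val_attained[of d]) (use Suc in simp)
  obtain v where v: "cand \<kappa> \<alpha> d v" "length v \<le> length w"
      "d' = (case v of [] \<Rightarrow> \<kappa> d | b # _ \<Rightarrow> d - Suc (pick b (\<alpha> d)))"
    using d'(1) Suc.prems(3) unfolding lstep_def by metis
  have "length v = Suc l" using v Suc.prems by (simp add: le_antisym)
  then obtain b v' where bv: "v = b # v'" "length v' = l" by (cases v) auto
  define u where "u = d - Suc (pick b (\<alpha> d))"
  have d'u: "d' = u" using v bv by (simp add: u_def)
  have lk: "Suc l \<le> k" and hv: "2 * \<kappa> (node \<alpha> u v') \<le> d"
    using v bv by (auto simp: cand_def u_def)
  have ud: "u \<le> d" "d - M \<le> u" using bounded_AL_pick[OF Suc.prems(2), of b d] by (auto simp: u_def)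
  show ?case
  proof (cases "2 * \<kappa> (node \<alpha> u v') \<le> u")
    case True
    have min: "\<forall>w'. cand \<kappa> \<alpha> u w' \<longrightarrow> l \<le> length w'"
    proof (intro allI impI, rule ccontr)
      fix w' assume w': "cand \<kappa> \<alpha> u w'" "\<not> l \<le> length w'"
      then have "cand \<kappa> \<alpha> d (b # w')" using ud lk by (auto simp: cand_def u_def)
      then show False using Suc.prems(5) w' by fastforce
    qed
    have le: "D1 + l * M \<le> u" using Suc.prems(1) ud by simp
    have "cand \<kappa> \<alpha> u v'" using True lk bv by (simp add: cand_def)
    \<comment> \<open>The target is recomputed after every hop, so the induction hypothesis may
      return another word of the same length.\<close>
    then obtain w' where w': "length w' = l" "2 * \<kappa> (node \<alpha> u w') \<le> u"
     "val \<kappa> \<alpha> u \<le> egam ^ Suc l * val \<kappa> \<alpha> (\<kappa> (node \<alpha> u w')) \<or>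
      (\<exists>i\<in>{1..l}. node \<alpha> u (take i w') < 2 * \<kappa> (node \<alpha> u w') \<and>
          val \<kappa> \<alpha> u \<le> egam ^ i * val \<kappa> \<alpha> (node \<alpha> u (take i w')))"
      using Suc.IH[of u v', OF le Suc.prems(2) _ bv(2) min] \<open>cand \<kappa> \<alpha> u v'\<close> by blast
    have *: "val \<kappa> \<alpha> d \<le> egam * X" if "val \<kappa> \<alpha> u \<le> X" for X
      using d'(2) that d'u by (meson mult_left_mono order_trans zero_le)
    from w'(3) show ?thesis
    proof
      assume "val \<kappa> \<alpha> u \<le> egam ^ Suc l * val \<kappa> \<alpha> (\<kappa> (node \<alpha> u w'))"
      from *[OF this] show ?thesis using w' ud
        by (intro exI[of _ "b # w'"]) (auto simp: u_def mult_ac)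
    next
      assume "\<exists>i\<in>{1..l}. node \<alpha> u (take i w') < 2 * \<kappa> (node \<alpha> u w') \<and>
          val \<kappa> \<alpha> u \<le> egam ^ i * val \<kappa> \<alpha> (node \<alpha> u (take i w'))"
      then obtain i where i: "i \<in> {1..l}" "node \<alpha> u (take i w') < 2 * \<kappa> (node \<alpha> u w')"
        "val \<kappa> \<alpha> u \<le> egam ^ i * val \<kappa> \<alpha> (node \<alpha> u (take i w'))" by blast
      have "val \<kappa> \<alpha> d \<le> egam ^ Suc i * val \<kappa> \<alpha> (node \<alpha> u (take i w'))"
        using *[OF i(3)] by (simp add: mult_ac)
      then have "\<exists>i\<in>{1..Suc l}. node \<alpha> d (take i (b # w')) < 2 * \<kappa> (node \<alpha> d (b # w')) \<and>
          val \<kappa> \<alpha> d \<le> egam ^ i * val \<kappa> \<alpha> (node \<alpha> d (take i (b # w')))"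
        using i by (intro bexI[of _ "Suc i"]) (auto simp: u_def)
      then show ?thesis using w' ud by (intro exI[of _ "b # w'"]) (auto simp: u_def)
    qed
  next
    case False
    then have "\<exists>i\<in>{1..Suc l}. node \<alpha> d (take i v) < 2 * \<kappa> (node \<alpha> d v) \<and>
          val \<kappa> \<alpha> d \<le> egam ^ i * val \<kappa> \<alpha> (node \<alpha> d (take i v))"
      using bv d'(2) d'u by (intro bexI[of _ 1]) (auto simp: u_def)
    then show ?thesis using bv hv by (intro exI[of _ v]) (auto simp: u_def)
  qed
qed

section \<open>Sums over all words\<close>

definition words :: "bool list set" where "words = {w. length w \<le> k}"

lemma finite_words: "finite words"
  using finite_lists_length_le[of "UNIV :: bool set" k] by (simp add: words_def)

text \<open>Which word is followed depends on the links in a complicated way; summing over all words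
  avoids the question. The power \<open>Suc k\<close> covers up to \<open>k\<close> AL-links and the
  final K-link.\<close>

definition halving :: "(nat \<Rightarrow> nat) \<Rightarrow> (nat \<Rightarrow> nat \<times> nat) \<Rightarrow> nat \<Rightarrow> ennreal" where
  "halving \<kappa> \<alpha> d = (\<Sum>w\<in>words. of_bool (2 * \<kappa> (node \<alpha> d w) \<le> d) * (egam ^ Suc k * val \<kappa> \<alpha> (\<kappa> (node \<alpha> d w))))"

text \<open>A target lost at the \<open>i\<close>-th node has \<open>2 * \<kappa>\<close> in the
  window between that node and \<open>d\<close>. The window has width at most \<open>k * M\<close>,
  which makes the event rare for large \<open>d\<close>.\<close>

definition losing :: "(nat \<Rightarrow> nat) \<Rightarrow> (nat \<Rightarrow> nat \<times> nat) \<Rightarrow> nat \<Rightarrow> ennreal" where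
  "losing \<kappa> \<alpha> d = (\<Sum>w\<in>words. \<Sum>i\<in>{1..length w}.
     of_bool (node \<alpha> d (take i w) < 2 * \<kappa> (node \<alpha> d w) \<and> 2 * \<kappa> (node \<alpha> d w) \<le> d)
       * (egam ^ k * val \<kappa> \<alpha> (node \<alpha> d (take i w))))"

text \<open>The surplus \<open>k * M\<close> in the hypothesis keeps every node of an AL-path of
  length at most \<open>k\<close> within the loop.\<close>

lemma val_le_greedy_or_path:
  assumes d: "D1 + k * M \<le> d" and \<alpha>: "bounded_AL M \<alpha>"
  shows "val \<kappa> \<alpha> d \<le> of_bool (\<forall>w\<in>words. d < 2 * \<kappa> (node \<alpha> d w)) * (egam * val \<kappa> \<alpha> (min (\<kappa> d) (far_AL \<alpha> d)))
      + (halving \<kappa> \<alpha> d + losing \<kappa> \<alpha> d)"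
proof (cases "\<exists>w. cand \<kappa> \<alpha> d w")
  case True
  then obtain w where w: "cand \<kappa> \<alpha> d w" "\<forall>w'. cand \<kappa> \<alpha> d w' \<longrightarrow> length w \<le> length w'"
    using arg_min_nat_lemma[of "cand \<kappa> \<alpha> d" _ length] by metis
  define l where "l = length w"
  have lk: "l \<le> k" using w by (simp add: l_def cand_def)
  then have "D1 + l * M \<le> d" using d mult_le_mono1[OF lk, of M] by linarith
  then obtain v where v:
    "length v = l" "2 * \<kappa> (node \<alpha> d v) \<le> d" and v3:
     "val \<kappa> \<alpha> d \<le> egam ^ Suc l * val \<kappa> \<alpha> (\<kappa> (node \<alpha> d v)) \<or>
      (\<exists>i\<in>{1..l}. node \<alpha> d (take i v) < 2 * \<kappa> (node \<alpha> d v) \<and>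
          val \<kappa> \<alpha> d \<le> egam ^ i * val \<kappa> \<alpha> (node \<alpha> d (take i v)))"
    using val_path[OF _ \<alpha> w(1) l_def[symmetric]] w(2) unfolding l_def by blast
  have vw: "v \<in> words" using v lk by (simp add: words_def)
  from v3 have "val \<kappa> \<alpha> d \<le> halving \<kappa> \<alpha> d + losing \<kappa> \<alpha> d"
  proof
    assume *: "val \<kappa> \<alpha> d \<le> egam ^ Suc l * val \<kappa> \<alpha> (\<kappa> (node \<alpha> d v))"
    have "egam ^ Suc l \<le> egam ^ Suc k" using lk egam_ge_1 by (intro power_increasing) auto
    then have "val \<kappa> \<alpha> d \<le> egam ^ Suc k * val \<kappa> \<alpha> (\<kappa> (node \<alpha> d v))"
      using * by (meson mult_right_mono order_trans zero_le)
    also have "\<dots> = of_bool (2 * \<kappa> (node \<alpha> d v) \<le> d) * (egam ^ Suc k * val \<kappa> \<alpha> (\<kappa> (node \<alpha> d v)))"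
      using v by simp
    also have "\<dots> \<le> halving \<kappa> \<alpha> d"
      unfolding halving_def by (rule member_le_sum[OF vw]) (auto simp: finite_words)
    finally show ?thesis by (simp add: add_increasing2)
  next
    assume "\<exists>i\<in>{1..l}. node \<alpha> d (take i v) < 2 * \<kappa> (node \<alpha> d v) \<and>
          val \<kappa> \<alpha> d \<le> egam ^ i * val \<kappa> \<alpha> (node \<alpha> d (take i v))"
    then obtain i where i: "i \<in> {1..length v}" "node \<alpha> d (take i v) < 2 * \<kappa> (node \<alpha> d v)"
        and *: "val \<kappa> \<alpha> d \<le> egam ^ i * val \<kappa> \<alpha> (node \<alpha> d (take i v))" using v by auto
    have "egam ^ i \<le> egam ^ k" using lk i v egam_ge_1 by (intro power_increasing) auto
    then have "val \<kappa> \<alpha> d \<le> egam ^ k * val \<kappa> \<alpha> (node \<alpha> d (take i v))"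
      using * by (meson mult_right_mono order_trans zero_le)
    also have "\<dots> = of_bool (node \<alpha> d (take i v) < 2 * \<kappa> (node \<alpha> d v) \<and> 2 * \<kappa> (node \<alpha> d v) \<le> d) * \<dots>"
      using v i by simp
    also have "\<dots> \<le> (\<Sum>i\<in>{1..length v}. of_bool (node \<alpha> d (take i v) < 2 * \<kappa> (node \<alpha> d v) \<and> 2 * \<kappa> (node \<alpha> d v) \<le> d) * (egam ^ k * val \<kappa> \<alpha> (node \<alpha> d (take i v))))"
      by (rule member_le_sum[OF i(1)]) auto
    also have "\<dots> \<le> losing \<kappa> \<alpha> d"
      unfolding losing_def
      by (rule member_le_sum[OF vw, of "\<lambda>v. \<Sum>i\<in>{1..length v}. of_bool (node \<alpha> d (take i v) < 2 * \<kappa> (node \<alpha> d v) \<and> 2 * \<kappa> (node \<alpha> d v) \<le> d) * (egam ^ k * val \<kappa> \<alpha> (node \<alpha> d (take i v)))"])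
         (auto simp: finite_words)
    finally show ?thesis by (simp add: add_increasing)
  qed
  then show ?thesis by (simp add: add_increasing)
next
  case False
  obtain d' where d': "lstep \<kappa> \<alpha> d d'" "val \<kappa> \<alpha> d \<le> egam * val \<kappa> \<alpha> d'"
    by (rule val_attained[of d]) (use d in simp)
  have "d' = min (\<kappa> d) (far_AL \<alpha> d)" using d' False by (simp add: lstep_def)
  moreover have "\<forall>w\<in>words. d < 2 * \<kappa> (node \<alpha> d w)"
    using False by (metis cand_def mem_Collect_eq not_le words_def)
  ultimately show ?thesis using d'(2) by (simp add: add_increasing2)
qed

text \<open>\<open>e\<close> is the border between nodes that may have been inspected and nodes
  below that have not. A K-link to a node at or below \<open>e\<close> gives a fresh start; one that
  ends strictly between \<open>e\<close> and \<open>d\<close> is counted as an error, affordable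
  because so short a link is rare.\<close>

lemma val_one_step:
  assumes d: "D1 + k * M \<le> d" "0 < d" and \<alpha>: "bounded_AL M \<alpha>"
  shows "val \<kappa> \<alpha> d \<le> of_bool (\<forall>w\<in>words. d < 2 * \<kappa> (node \<alpha> d w)) * (egam *
        (of_bool (\<kappa> d < far_AL \<alpha> d \<and> \<kappa> d \<le> e) * val \<kappa> \<alpha> (\<kappa> d) + of_bool (far_AL \<alpha> d \<le> \<kappa> d) * val \<kappa> \<alpha> (far_AL \<alpha> d)))
      + (egam * (of_bool (e < \<kappa> d \<and> \<kappa> d < d) * val \<kappa> \<alpha> (\<kappa> d)) + halving \<kappa> \<alpha> d + losing \<kappa> \<alpha> d)"
proof -
  define R where "R = halving \<kappa> \<alpha> d + losing \<kappa> \<alpha> d"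
  have "far_AL \<alpha> d < d" using far_AL_le[of \<alpha> d] d(2) by linarith
  then have "egam * val \<kappa> \<alpha> (min (\<kappa> d) (far_AL \<alpha> d)) \<le> egam *
        (of_bool (\<kappa> d < far_AL \<alpha> d \<and> \<kappa> d \<le> e) * val \<kappa> \<alpha> (\<kappa> d) + of_bool (far_AL \<alpha> d \<le> \<kappa> d) * val \<kappa> \<alpha> (far_AL \<alpha> d))
        + egam * (of_bool (e < \<kappa> d \<and> \<kappa> d < d) * val \<kappa> \<alpha> (\<kappa> d))"
    by (auto simp: min_def not_le)
  then have "of_bool (\<forall>w\<in>words. d < 2 * \<kappa> (node \<alpha> d w)) * (egam * val \<kappa> \<alpha> (min (\<kappa> d) (far_AL \<alpha> d))) + R \<le>
    of_bool (\<forall>w\<in>words. d < 2 * \<kappa> (node \<alpha> d w)) * (egam *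
        (of_bool (\<kappa> d < far_AL \<alpha> d \<and> \<kappa> d \<le> e) * val \<kappa> \<alpha> (\<kappa> d) + of_bool (far_AL \<alpha> d \<le> \<kappa> d) * val \<kappa> \<alpha> (far_AL \<alpha> d)))
      + (egam * (of_bool (e < \<kappa> d \<and> \<kappa> d < d) * val \<kappa> \<alpha> (\<kappa> d)) + R)"
    by (rule of_bool_mult_split)
  note mid = this
  have fst: "val \<kappa> \<alpha> d \<le> of_bool (\<forall>w\<in>words. d < 2 * \<kappa> (node \<alpha> d w)) * (egam * val \<kappa> \<alpha> (min (\<kappa> d) (far_AL \<alpha> d))) + R"
    unfolding R_def by (rule val_le_greedy_or_path[OF d(1) \<alpha>])
  show ?thesis using order_trans[OF fst mid] unfolding R_def add.assoc .
qed

end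

subsection \<open>Exponential moments of the routing time\<close>

lemma nn_integral_pmf_swap:
  fixes f :: "'a \<Rightarrow> 'b \<Rightarrow> ennreal"
  shows "(\<integral>\<^sup>+x. (\<integral>\<^sup>+y. f x y \<partial>measure_pmf q) \<partial>measure_pmf p) = (\<integral>\<^sup>+y. (\<integral>\<^sup>+x. f x y \<partial>measure_pmf p) \<partial>measure_pmf q)"
proof -
  have "(\<integral>\<^sup>+x. (\<integral>\<^sup>+y. f x y \<partial>measure_pmf q) \<partial>measure_pmf p) = (\<integral>\<^sup>+z. f (fst z) (snd z) \<partial>pair_pmf p q)"
    by (simp add: nn_integral_pair_pmf')
  also have "\<dots> = (\<integral>\<^sup>+z. f (snd z) (fst z) \<partial>pair_pmf q p)"
    by (subst pair_commute_pmf) (simp add: case_prod_unfold)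
  finally show ?thesis by (simp add: nn_integral_pair_pmf')
qed

lemma nn_integral_pmf_le_const:
  "(\<And>x. x \<in> set_pmf p \<Longrightarrow> f x \<le> c) \<Longrightarrow> (\<integral>\<^sup>+x. f x \<partial>measure_pmf p) \<le> c"
proof -
  assume "\<And>x. x \<in> set_pmf p \<Longrightarrow> f x \<le> c"
  then have "(\<integral>\<^sup>+x. f x \<partial>measure_pmf p) \<le> (\<integral>\<^sup>+x. c \<partial>measure_pmf p)"
    by (intro nn_integral_mono_AE AE_pmfI)
  then show ?thesis by (simp add: measure_pmf.emeasure_space_1)
qed

lemma nn_integral_pmf_on_finite_le:
  fixes h :: "'a \<Rightarrow> ennreal"
  assumes "finite S" "\<And>v. v \<in> S \<Longrightarrow> pmf p v \<le> c"
  shows "(\<integral>\<^sup>+v. of_bool (v \<in> S) * h v \<partial>measure_pmf p) \<le> (\<Sum>v\<in>S. ennreal c * h v)"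
proof -
  have "(\<integral>\<^sup>+v. of_bool (v \<in> S) * h v \<partial>measure_pmf p) = (\<Sum>v\<in>S. of_bool (v \<in> S) * h v * pmf p v)"
    by (intro nn_integral_measure_pmf_support) (auto simp: assms)
  also have "\<dots> \<le> (\<Sum>v\<in>S. ennreal c * h v)"
    using assms(2) by (intro sum_mono) (auto simp: mult.commute[of _ "ennreal (pmf _ _)"] intro!: mult_right_mono ennreal_leI)
  finally show ?thesis .
qed

text \<open>The rate of the exponential factor within a stage. The drift \<open>theta / 3\<close>
  exceeds \<open>gam - 1\<close>, while the total \<open>exp (2 * theta * k) = exp (k / 50)\<close>
  over a stage of width \<open>2 * (k * M)\<close> is dwarfed by the errors, which decay roughly
  like \<open>exp (- k / 2)\<close>.\<close>

definition theta :: real where "theta = 1 / 100"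

text \<open>\<open>N\<close> is the number of nodes, \<open>M\<close> the AL-range and
  \<open>Z\<close> the normalization of the K-links. Only jumps towards the target have a prescribed
  probability; the others are never taken. \<open>D1_ge\<close> is where a large constant
  \<open>c\<close> enters: seen from inside the loop, \<open>k\<close> AL-links change the distance
  by at most an eighth.\<close>

locale routing = loop_params k D1 for k D1 :: nat +
  fixes N M :: nat and Z :: real and Kd :: "nat \<Rightarrow> nat pmf"
  assumes pmf_Kd: "v < d \<Longrightarrow> d < N \<Longrightarrow> pmf (Kd d) v = 1 / (Z * real (d - v))"
    and Z_pos: "0 < Z" and Z_le: "Z \<le> 2 ^ Suc k" and M_pos: "0 < M" and k_pos: "0 < k"
    and D1_ge: "8 * (k * M) \<le> D1"
    and D0_ge: "2 * (D1 + 3 * (k * M)) \<le> 8 ^ Suc k"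
begin

abbreviation "Kp \<equiv> Pi_pmf {..<N} (0::nat) Kd"

definition ALd :: "(nat \<times> nat) pmf" where
  "ALd = pair_pmf (pmf_of_set {..<M}) (pmf_of_set {..<M})"

abbreviation "Ap \<equiv> Pi_pmf {..<N} (0::nat, 0::nat) (\<lambda>_. ALd)"

lemma set_AL: "set_pmf (pmf_of_set {..<M}) = {..<M}"
  using M_pos by (intro set_pmf_of_set) auto

lemma set_ALd: "set_pmf ALd = {..<M} \<times> {..<M}"
  by (simp add: ALd_def set_AL)

lemma bounded_AL_set:
  assumes "\<alpha> \<in> set_pmf Ap"
  shows "bounded_AL M \<alpha>"
  unfolding bounded_AL_def
proof
  fix i
  have *: "\<alpha> \<in> PiE_dflt {..<N} (0, 0) (\<lambda>_. {..<M} \<times> {..<M})"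
    using assms set_Pi_pmf[of "{..<N}" "(0,0)" "\<lambda>_. ALd"] by (simp add: set_ALd comp_def)
  have "\<alpha> i \<in> {..<M} \<times> {..<M} \<or> \<alpha> i = (0, 0)"
    using * by (cases "i < N") (simp_all add: PiE_dflt_def)
  then show "fst (\<alpha> i) < M \<and> snd (\<alpha> i) < M" using M_pos by auto
qed

section \<open>K-links that have been inspected\<close>

definition plant :: "(nat \<rightharpoonup> nat) \<Rightarrow> (nat \<Rightarrow> nat) \<Rightarrow> nat \<Rightarrow> nat" where
  "plant P \<kappa> i = (case P i of None \<Rightarrow> \<kappa> i | Some v \<Rightarrow> v)"

text \<open>A planted K-link is one that was a candidate earlier and has ceased to be one.  The moment is
  maximized over the planted links before averaging over the AL-links, because which node gets
  planted depends on the AL-links ahead of the message.\<close>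

definition plants :: "nat \<Rightarrow> nat \<Rightarrow> (nat \<rightharpoonup> nat) set" where
  "plants d e = {P. \<forall>z v. P z = Some v \<longrightarrow> e < z \<and> z \<le> d \<and> d < 2 * v \<and> 2 * v \<le> z + k * M}"

definition F :: "(nat \<Rightarrow> nat \<times> nat) \<Rightarrow> nat \<Rightarrow> nat \<Rightarrow> ennreal" where
  "F \<alpha> d e = (SUP P\<in>plants d e. \<integral>\<^sup>+\<kappa>. val (plant P \<kappa>) \<alpha> d \<partial>Kp)"

text \<open>A lost target stays lost, since \<open>d < 2 * v\<close> persists when \<open>d\<close>
  decreases. The upper bound on \<open>v\<close> does not mention \<open>d\<close>: the message was
  at most \<open>k * M\<close> above \<open>z\<close> when the link was a candidate.\<close>

lemma plants_restrict:
  assumes "P \<in> plants d e" "x \<le> d"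
  shows "P |` {..x} \<in> plants x e"
  unfolding plants_def
proof (intro CollectI allI impI)
  fix z v assume "(P |` {..x}) z = Some v"
  then have "z \<le> x" "P z = Some v" by (auto simp: restrict_map_def split: if_splits)
  moreover from this have "e < z \<and> z \<le> d \<and> d < 2 * v \<and> 2 * v \<le> z + k * M"
    using assms(1) unfolding plants_def by blast
  ultimately show "e < z \<and> z \<le> x \<and> x < 2 * v \<and> 2 * v \<le> z + k * M" using assms(2) by linarith
qed

lemma val_plant_le_F:
  assumes "P \<in> plants d e" "x \<le> d"
  shows "(\<integral>\<^sup>+\<kappa>. val (plant P \<kappa>) \<alpha> x \<partial>Kp) \<le> F \<alpha> x e"
proof -
  have "(\<integral>\<^sup>+\<kappa>. val (plant P \<kappa>) \<alpha> x \<partial>Kp) = (\<integral>\<^sup>+\<kappa>. val (plant (P |` {..x}) \<kappa>) \<alpha> x \<partial>Kp)"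
    by (intro nn_integral_cong val_cong) (auto simp: plant_def restrict_map_def)
  also have "\<dots> \<le> F \<alpha> x e" unfolding F_def by (intro SUP_upper plants_restrict[OF assms])
  finally show ?thesis .
qed

lemma empty_in_plants: "Map.empty \<in> plants d e"
  by (simp add: plants_def)

lemma plant_empty [simp]: "plant Map.empty \<kappa> = \<kappa>"
  by (simp add: plant_def fun_eq_iff)

lemma F_fresh: "d \<le> e \<Longrightarrow> F \<alpha> d e = (\<integral>\<^sup>+\<kappa>. val \<kappa> \<alpha> d \<partial>Kp)"
proof -
  assume "d \<le> e"
  have "P = Map.empty" if P: "P \<in> plants d e" for P
  proof
    fix z
    show "P z = None"
    proof (cases "P z")
      case (Some v)
      then have "e < z" "z \<le> d" using P unfolding plants_def by blast+
      then show ?thesis using \<open>d \<le> e\<close> by simp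
    qed
  qed
  then have "plants d e = {Map.empty}" using empty_in_plants by blast
  then show ?thesis by (simp add: F_def)
qed

lemma F_cong: "(\<And>i. i \<le> d \<Longrightarrow> \<alpha> i = \<alpha>' i) \<Longrightarrow> F \<alpha> d e = F \<alpha>' d e"
  unfolding F_def by (intro SUP_cong nn_integral_cong val_cong) auto

lemma depends_on_F: "depends_on {..d} (\<lambda>\<alpha>. F \<alpha> d e)"
  by (intro depends_onI F_cong) auto

lemma F_below: "d < D1 \<Longrightarrow> F \<alpha> d e = 1"
proof -
  assume "d < D1"
  moreover have "plants d e \<noteq> {}" using empty_in_plants by blast
  ultimately show ?thesis by (simp add: F_def val_below measure_pmf.emeasure_space_1)
qed

text \<open>The message leaves through the K-link of \<open>z\<close> and lands below
  \<open>z\<close>, where that link is never read again. It can therefore be averaged separately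
  from everything that matters later.\<close>

lemma jump_le_F:
  assumes P: "P \<in> plants d e" "P z = None" and z: "z < N" "z \<le> d"
    and g: "\<And>v. g v \<noteq> 0 \<Longrightarrow> v < z"
  shows "(\<integral>\<^sup>+\<kappa>. g (plant P \<kappa> z) * val (plant P \<kappa>) \<alpha> (plant P \<kappa> z) \<partial>Kp) \<le> (\<integral>\<^sup>+v. g v * F \<alpha> v e \<partial>Kd z)"
proof -
  have "(\<integral>\<^sup>+\<kappa>. g (plant P \<kappa> z) * val (plant P \<kappa>) \<alpha> (plant P \<kappa> z) \<partial>Kp)
      = (\<integral>\<^sup>+v. (\<integral>\<^sup>+\<kappa>. g v * val (plant P (\<kappa>(z := v))) \<alpha> v \<partial>Kp) \<partial>Kd z)"
    by (subst nn_integral_Pi_pmf_resample[where i = z]) (use z P(2) in \<open>auto simp: plant_def\<close>)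
  also have "\<dots> \<le> (\<integral>\<^sup>+v. g v * F \<alpha> v e \<partial>Kd z)"
  proof (intro nn_integral_mono)
    fix v
    show "(\<integral>\<^sup>+\<kappa>. g v * val (plant P (\<kappa>(z := v))) \<alpha> v \<partial>Kp) \<le> g v * F \<alpha> v e"
    proof (cases "g v = 0")
      case False
      then have v: "v < z" using g by blast
      have "(\<integral>\<^sup>+\<kappa>. val (plant P (\<kappa>(z := v))) \<alpha> v \<partial>Kp) = (\<integral>\<^sup>+\<kappa>. val (plant P \<kappa>) \<alpha> v \<partial>Kp)"
        using v by (intro nn_integral_cong val_cong) (auto simp: plant_def split: option.split)
      also have "\<dots> \<le> F \<alpha> v e" using v z by (intro val_plant_le_F[OF P(1)]) simp
      finally show ?thesis by (simp add: nn_integral_cmult mult_left_mono)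
    qed simp
  qed
  finally show ?thesis .
qed

lemma stay_le_F:
  assumes P: "P \<in> plants d e" "P z = None" and z: "z < N" "x < z" "x \<le> d"
  shows "(\<integral>\<^sup>+\<kappa>. g (plant P \<kappa> z) * val (plant P \<kappa>) \<alpha> x \<partial>Kp) \<le> (\<integral>\<^sup>+v. g v * F \<alpha> x e \<partial>Kd z)"
proof -
  have "(\<integral>\<^sup>+\<kappa>. g (plant P \<kappa> z) * val (plant P \<kappa>) \<alpha> x \<partial>Kp)
      = (\<integral>\<^sup>+v. (\<integral>\<^sup>+\<kappa>. g v * val (plant P (\<kappa>(z := v))) \<alpha> x \<partial>Kp) \<partial>Kd z)"
    by (subst nn_integral_Pi_pmf_resample[where i = z]) (use z P(2) in \<open>auto simp: plant_def\<close>)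
  also have "\<dots> \<le> (\<integral>\<^sup>+v. g v * F \<alpha> x e \<partial>Kd z)"
  proof (intro nn_integral_mono)
    fix v
    have "(\<integral>\<^sup>+\<kappa>. val (plant P (\<kappa>(z := v))) \<alpha> x \<partial>Kp) = (\<integral>\<^sup>+\<kappa>. val (plant P \<kappa>) \<alpha> x \<partial>Kp)"
      using z by (intro nn_integral_cong val_cong) (auto simp: plant_def split: option.split)
    also have "\<dots> \<le> F \<alpha> x e" using z by (intro val_plant_le_F[OF P(1)]) simp
    finally show "(\<integral>\<^sup>+\<kappa>. g v * val (plant P (\<kappa>(z := v))) \<alpha> x \<partial>Kp) \<le> g v * F \<alpha> x e"
      by (simp add: nn_integral_cmult mult_left_mono)
  qed
  finally show ?thesis .
qed

text \<open>Here \<open>z\<close> is still at or ahead of the message at \<open>x\<close>, so its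
  link cannot be averaged away: its value, known to be a lost target, is recorded as a new planted
  link. The border drops from \<open>e\<close> to \<open>e'\<close> to make room for
  \<open>z\<close>.\<close>

lemma lost_le_F:
  assumes P: "P \<in> plants d e" "P z = None" and z: "z < N" "z \<le> x" "x \<le> d" "e' < z" "e' \<le> e"
    and g: "\<And>v. g v \<noteq> 0 \<Longrightarrow> x < 2 * v \<and> 2 * v \<le> z + k * M"
  shows "(\<integral>\<^sup>+\<kappa>. g (plant P \<kappa> z) * val (plant P \<kappa>) \<alpha> x \<partial>Kp) \<le> (\<integral>\<^sup>+v. g v * F \<alpha> x e' \<partial>Kd z)"
proof -
  have "(\<integral>\<^sup>+\<kappa>. g (plant P \<kappa> z) * val (plant P \<kappa>) \<alpha> x \<partial>Kp)
      = (\<integral>\<^sup>+v. (\<integral>\<^sup>+\<kappa>. g v * val (plant P (\<kappa>(z := v))) \<alpha> x \<partial>Kp) \<partial>Kd z)"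
    by (subst nn_integral_Pi_pmf_resample[where i = z]) (use z P(2) in \<open>auto simp: plant_def\<close>)
  also have "\<dots> \<le> (\<integral>\<^sup>+v. g v * F \<alpha> x e' \<partial>Kd z)"
  proof (intro nn_integral_mono)
    fix v
    show "(\<integral>\<^sup>+\<kappa>. g v * val (plant P (\<kappa>(z := v))) \<alpha> x \<partial>Kp) \<le> g v * F \<alpha> x e'"
    proof (cases "g v = 0")
      case False
      then have v: "x < 2 * v \<and> 2 * v \<le> z + k * M" using g by blast
      define Q where "Q = (P |` {..x})(z \<mapsto> v)"
      have P': "P |` {..x} \<in> plants x e" by (rule plants_restrict[OF P(1) z(3)])
      have Q: "Q \<in> plants x e'"
        unfolding plants_def
      proof (intro CollectI allI impI)
        fix y u assume yu: "Q y = Some u"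
        show "e' < y \<and> y \<le> x \<and> x < 2 * u \<and> 2 * u \<le> y + k * M"
        proof (cases "y = z")
          case True
          then show ?thesis using yu v z by (simp add: Q_def)
        next
          case False
          then have "(P |` {..x}) y = Some u" using yu by (simp add: Q_def)
          then have "e < y \<and> y \<le> x \<and> x < 2 * u \<and> 2 * u \<le> y + k * M"
            using P' unfolding plants_def by blast
          then show ?thesis using z(5) by linarith
        qed
      qed
      have "(\<integral>\<^sup>+\<kappa>. val (plant P (\<kappa>(z := v))) \<alpha> x \<partial>Kp) = (\<integral>\<^sup>+\<kappa>. val (plant Q \<kappa>) \<alpha> x \<partial>Kp)"
        using P(2) by (intro nn_integral_cong val_cong) (auto simp: plant_def Q_def restrict_map_def split: option.split)
      also have "\<dots> \<le> F \<alpha> x e'" by (rule val_plant_le_F[OF Q]) simp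
      finally show ?thesis by (simp add: nn_integral_cmult mult_left_mono)
    qed simp
  qed
  finally show ?thesis .
qed

text \<open>As \<open>k * M\<close> is at most \<open>d / 8\<close>, the node \<open>z\<close> is at
  \<open>7 * d / 8\<close> or more and \<open>v\<close> at \<open>9 * d / 16\<close> or less, so the
  link has length at least \<open>d / 4\<close>.\<close>

lemma pmf_Kd_le:
  assumes z: "z \<le> d" "d \<le> z + k * M" "8 * (k * M) \<le> d" "z < N" and v: "2 * v \<le> d + k * M"
  shows "pmf (Kd z) v \<le> 4 / (Z * real d)" "v < z"
proof -
  have kM: "0 < k * M" using k_pos M_pos by simp
  show vz: "v < z" using z v kM by linarith
  have "real d \<le> 4 * real (z - v)"
  proof -
    have "d + 4 * v \<le> 4 * z" using z v kM by linarith
    then show ?thesis using vz by linarith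
  qed
  moreover have "0 < real d" using z(3) kM by linarith
  moreover have "1 / real n \<le> 4 / real d" if "real d \<le> 4 * real n" "0 < real d" for n
    using that by (simp add: field_simps)
  ultimately have "1 / real (z - v) \<le> 4 / real d" by blast
  then have "1 / (Z * real (z - v)) \<le> 4 / (Z * real d)"
    using Z_pos by (simp add: divide_right_mono flip: divide_divide_eq_left mult.commute[of "real _" Z])
  then show "pmf (Kd z) v \<le> 4 / (Z * real d)" using pmf_Kd[OF vz z(4)] by simp
qed

text \<open>The targets that \<open>plants\<close> permits for a link planted at the message's own
  node, \<open>z = d\<close>.\<close>

definition planted_range :: "nat \<Rightarrow> nat set" where
  "planted_range d = {v. d < 2 * v \<and> 2 * v \<le> d + k * M}"

lemma finite_planted_range: "finite (planted_range d)"
  by (rule finite_subset[of _ "{..d + k * M}"]) (auto simp: planted_range_def)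

definition ahead :: "(nat \<Rightarrow> nat \<times> nat) \<Rightarrow> nat \<Rightarrow> nat \<Rightarrow> ennreal" where
  "ahead \<alpha> d e = (\<integral>\<^sup>+v. of_bool (v < far_AL \<alpha> d \<and> v \<le> e) * F \<alpha> v e
     + of_bool (far_AL \<alpha> d \<le> v) * F \<alpha> (far_AL \<alpha> d) e \<partial>Kd d)"

text \<open>What a step can do beyond \<open>ahead\<close>: a short K-link into the inspected zone,
  an AL-path to a halving K-link, and a lost target. In the last case the border moves to
  \<open>d - 2 * (k * M)\<close>, below every node that can be inspected from
  \<open>d\<close>.\<close>

definition rest :: "(nat \<Rightarrow> nat \<times> nat) \<Rightarrow> nat \<Rightarrow> nat \<Rightarrow> ennreal" where
  "rest \<alpha> d e = (\<integral>\<^sup>+v. egam * of_bool (e < v \<and> v < d) * F \<alpha> v e \<partial>Kd d)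
    + (\<Sum>w\<in>words. \<Sum>v\<in>{v. 2 * v \<le> d}. ennreal (4 / (Z * real d)) * (egam ^ Suc k * F \<alpha> v e))
    + (\<Sum>w\<in>words. \<Sum>i\<in>{1..length w}. ennreal (real (k * M) * (4 / (Z * real d))) * (egam ^ k * F \<alpha> (node \<alpha> d (take i w)) (d - 2 * (k * M))))"

text \<open>A planted link misses the halving by at most \<open>k * M / 2\<close>. It is therefore a
  very good link: it overtakes both AL-links and lands below the inspected zone.\<close>

lemma planted_le:
  assumes "P \<in> plants d e" "P d = Some v" "8 * (k * M) \<le> d" "d \<le> e + 2 * (k * M)" "bounded_AL M \<alpha>"
  shows "v \<in> planted_range d" "v \<le> e" "v < far_AL \<alpha> d"
proof -
  have kM: "0 < k * M" "M \<le> k * M" using k_pos M_pos by auto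
  show *: "v \<in> planted_range d" using assms(1,2) by (auto simp: plants_def planted_range_def)
  then show "v \<le> e" using assms(3,4) by (auto simp: planted_range_def)
  have "2 * v \<le> d + k * M" using * by (simp add: planted_range_def)
  then have "v < d - M" using assms(3) kM by linarith
  then show "v < far_AL \<alpha> d" using far_AL_ge[OF assms(5), of d] by linarith
qed

text \<open>Planted links drop out, since they satisfy \<open>d < 2 * v\<close>. Any other link is
  averaged by \<open>jump_le_F\<close>, and \<open>pmf_Kd_le\<close> gives one bound for all its
  halving targets.\<close>

lemma halving_le:
  assumes P: "P \<in> plants d e" and d: "8 * (k * M) \<le> d" "d < N" and \<alpha>: "bounded_AL M \<alpha>"
  shows "(\<integral>\<^sup>+\<kappa>. halving (plant P \<kappa>) \<alpha> d \<partial>Kp)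
     \<le> (\<Sum>w\<in>words. \<Sum>v\<in>{v. 2 * v \<le> d}. ennreal (4 / (Z * real d)) * (egam ^ Suc k * F \<alpha> v e))"
proof -
  have fin: "finite {v. 2 * v \<le> d}" by (rule finite_subset[of _ "{..d}"]) auto
  have "(\<integral>\<^sup>+\<kappa>. of_bool (2 * plant P \<kappa> (node \<alpha> d w) \<le> d) * (egam ^ Suc k * val (plant P \<kappa>) \<alpha> (plant P \<kappa> (node \<alpha> d w))) \<partial>Kp)
     \<le> (\<Sum>v\<in>{v. 2 * v \<le> d}. ennreal (4 / (Z * real d)) * (egam ^ Suc k * F \<alpha> v e))" if w: "w \<in> words" for w
  proof -
    define z where "z = node \<alpha> d w"
    have z: "z \<le> d" "d \<le> z + k * M" "z < N"
      using node_le[of \<alpha> d w] node_ge_le[OF \<alpha>, of w k d] w d(2) by (auto simp: z_def words_def)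
    show ?thesis
    proof (cases "P z")
      case None
      have "(\<integral>\<^sup>+\<kappa>. (of_bool (2 * plant P \<kappa> z \<le> d) * egam ^ Suc k) * val (plant P \<kappa>) \<alpha> (plant P \<kappa> z) \<partial>Kp)
         \<le> (\<integral>\<^sup>+v. (of_bool (2 * v \<le> d) * egam ^ Suc k) * F \<alpha> v e \<partial>Kd z)"
        by (rule jump_le_F[OF P None z(3) z(1), of "\<lambda>v. of_bool (2 * v \<le> d) * egam ^ Suc k"])
           (use pmf_Kd_le(2)[OF z(1,2) d(1) z(3)] in auto)
      also have "\<dots> = (\<integral>\<^sup>+v. of_bool (v \<in> {v. 2 * v \<le> d}) * (egam ^ Suc k * F \<alpha> v e) \<partial>Kd z)"
        by (simp add: mult.assoc)
      also have "\<dots> \<le> (\<Sum>v\<in>{v. 2 * v \<le> d}. ennreal (4 / (Z * real d)) * (egam ^ Suc k * F \<alpha> v e))"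
        by (rule nn_integral_pmf_on_finite_le[OF fin]) (rule pmf_Kd_le(1)[OF z(1,2) d(1) z(3)], simp)
      finally show ?thesis by (simp add: z_def mult.assoc)
    next
      case (Some v)
      then have "d < 2 * v" using P by (auto simp: plants_def)
      then show ?thesis using Some by (simp add: z_def plant_def)
    qed
  qed
  then show ?thesis unfolding halving_def
    by (subst nn_integral_sum, simp) (rule sum_mono)
qed

text \<open>The window between \<open>u\<close> and \<open>d\<close> contains at most
  \<open>k * M\<close> values of \<open>v\<close>, each of probability at most
  \<open>4 / (Z * d)\<close>; the lost link is planted by \<open>lost_le_F\<close>. Links planted
  earlier cannot be lost again.\<close>

lemma losing_le:
  assumes P: "P \<in> plants d e" and d: "8 * (k * M) \<le> d" "d < N" "d \<le> e + 2 * (k * M)" and \<alpha>: "bounded_AL M \<alpha>"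
  shows "(\<integral>\<^sup>+\<kappa>. losing (plant P \<kappa>) \<alpha> d \<partial>Kp)
     \<le> (\<Sum>w\<in>words. \<Sum>i\<in>{1..length w}. ennreal (real (k * M) * (4 / (Z * real d))) * (egam ^ k * F \<alpha> (node \<alpha> d (take i w)) (d - 2 * (k * M))))"
proof -
  have kM: "0 < k * M" using k_pos M_pos by simp
  have "(\<integral>\<^sup>+\<kappa>. of_bool (node \<alpha> d (take i w) < 2 * plant P \<kappa> (node \<alpha> d w) \<and> 2 * plant P \<kappa> (node \<alpha> d w) \<le> d)
        * (egam ^ k * val (plant P \<kappa>) \<alpha> (node \<alpha> d (take i w))) \<partial>Kp)
     \<le> ennreal (real (k * M) * (4 / (Z * real d))) * (egam ^ k * F \<alpha> (node \<alpha> d (take i w)) (d - 2 * (k * M)))"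
    if w: "w \<in> words" and i: "i \<in> {1..length w}" for w i
  proof -
    define z where "z = node \<alpha> d w"
    define u where "u = node \<alpha> d (take i w)"
    have zu: "z \<le> u"
      using node_append[of \<alpha> d "take i w" "drop i w"] node_le[of \<alpha> u "drop i w"] by (simp add: z_def u_def)
    have z: "z \<le> d" "d \<le> z + k * M" "z < N"
      using node_le[of \<alpha> d w] node_ge_le[OF \<alpha>, of w k d] w d(2) by (auto simp: z_def words_def)
    have u: "u \<le> d" using node_le by (simp add: u_def)
    define S where "S = {v. u < 2 * v \<and> 2 * v \<le> d}"
    have "S \<subseteq> {u div 2 <.. d div 2}" by (auto simp: S_def)
    then have S: "finite S" "card S \<le> d div 2 - u div 2"
      using card_mono[of "{u div 2 <.. d div 2}" S] by (auto intro: finite_subset)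
    have ze: "d - 2 * (k * M) < z" using z(2) d(1) kM by linarith
    have cS: "card S \<le> k * M" using S(2) z(2) zu kM by linarith
    show ?thesis
    proof (cases "P z")
      case None
      have "(\<integral>\<^sup>+\<kappa>. (of_bool (u < 2 * plant P \<kappa> z \<and> 2 * plant P \<kappa> z \<le> d) * egam ^ k) * val (plant P \<kappa>) \<alpha> u \<partial>Kp)
         \<le> (\<integral>\<^sup>+v. (of_bool (u < 2 * v \<and> 2 * v \<le> d) * egam ^ k) * F \<alpha> u (d - 2 * (k * M)) \<partial>Kd z)"
        by (rule lost_le_F[OF P None z(3) zu u, of _ "\<lambda>v. of_bool (u < 2 * v \<and> 2 * v \<le> d) * egam ^ k"])
           (use z(2) d ze in auto)
      also have "\<dots> = (\<integral>\<^sup>+v. of_bool (v \<in> S) * (egam ^ k * F \<alpha> u (d - 2 * (k * M))) \<partial>Kd z)"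
        by (simp add: mult.assoc S_def)
      also have "\<dots> \<le> (\<Sum>v\<in>S. ennreal (4 / (Z * real d)) * (egam ^ k * F \<alpha> u (d - 2 * (k * M))))"
        by (rule nn_integral_pmf_on_finite_le[OF S(1)])
           (rule pmf_Kd_le(1)[OF z(1,2) d(1) z(3)], simp add: S_def)
      also have "\<dots> = ennreal (real (card S) * (4 / (Z * real d))) * (egam ^ k * F \<alpha> u (d - 2 * (k * M)))"
        using Z_pos
        by (subst ennreal_mult) (simp_all add: ennreal_of_nat_eq_real_of_nat mult.assoc)
      also have "\<dots> \<le> ennreal (real (k * M) * (4 / (Z * real d))) * (egam ^ k * F \<alpha> u (d - 2 * (k * M)))"
        using cS Z_pos by (intro mult_right_mono ennreal_leI) (auto simp del: of_nat_mult)
      finally show ?thesis by (simp add: z_def u_def mult.assoc)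
    next
      case (Some v)
      then have "d < 2 * v" using P by (auto simp: plants_def)
      then show ?thesis using Some by (simp add: z_def plant_def)
    qed
  qed
  then show ?thesis unfolding losing_def
    by (subst nn_integral_sum, simp) (rule sum_mono, subst nn_integral_sum, simp, rule sum_mono)
qed

lemma rest_le:
  assumes P: "P \<in> plants d e" and d: "8 * (k * M) \<le> d" "d < N" "d \<le> e + 2 * (k * M)" and \<alpha>: "bounded_AL M \<alpha>"
  shows "(\<integral>\<^sup>+\<kappa>. egam * (of_bool (e < plant P \<kappa> d \<and> plant P \<kappa> d < d) * val (plant P \<kappa>) \<alpha> (plant P \<kappa> d))
      + halving (plant P \<kappa>) \<alpha> d + losing (plant P \<kappa>) \<alpha> d \<partial>Kp) \<le> rest \<alpha> d e"
proof -
  have "(\<integral>\<^sup>+\<kappa>. egam * (of_bool (e < plant P \<kappa> d \<and> plant P \<kappa> d < d) * val (plant P \<kappa>) \<alpha> (plant P \<kappa> d)) \<partial>Kp)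
     \<le> (\<integral>\<^sup>+v. egam * of_bool (e < v \<and> v < d) * F \<alpha> v e \<partial>Kd d)"
  proof (cases "P d")
    case None
    show ?thesis
      using jump_le_F[OF P None d(2), of "\<lambda>v. egam * of_bool (e < v \<and> v < d)" \<alpha>] by (simp add: mult.assoc)
  next
    case (Some v)
    then show ?thesis using planted_le(2)[OF P Some d(1,3) \<alpha>] by (simp add: plant_def)
  qed
  then show ?thesis unfolding rest_def
    by (subst nn_integral_add, simp, simp, subst nn_integral_add, simp, simp)
       (intro add_mono halving_le[OF P d(1,2) \<alpha>] losing_le[OF P d \<alpha>])
qed

lemma F_step:
  assumes d: "D1 + k * M \<le> d" "d < N" "d \<le> e + 2 * (k * M)" and \<alpha>: "bounded_AL M \<alpha>"
  shows "F \<alpha> d e \<le> egam * ahead \<alpha> d e + egam * (\<Sum>v\<in>planted_range d. F \<alpha> v e) + rest \<alpha> d e"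
  unfolding F_def[of \<alpha> d e]
proof (rule SUP_least)
  fix P assume P: "P \<in> plants d e"
  have kM: "0 < k * M" using k_pos M_pos by simp
  have d8: "8 * (k * M) \<le> d" "0 < d" using d(1) D1_ge kM by linarith+
  let ?m = "far_AL \<alpha> d"
  have m: "?m < d" using far_AL_le[of \<alpha> d] d8 by linarith
  let ?R = "\<lambda>\<kappa>. egam * (of_bool (e < plant P \<kappa> d \<and> plant P \<kappa> d < d) * val (plant P \<kappa>) \<alpha> (plant P \<kappa> d))
      + halving (plant P \<kappa>) \<alpha> d + losing (plant P \<kappa>) \<alpha> d"
  let ?J = "\<lambda>\<kappa>. of_bool (plant P \<kappa> d < ?m \<and> plant P \<kappa> d \<le> e) * val (plant P \<kappa>) \<alpha> (plant P \<kappa> d)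
        + of_bool (?m \<le> plant P \<kappa> d) * val (plant P \<kappa>) \<alpha> ?m"
  have "(\<integral>\<^sup>+\<kappa>. val (plant P \<kappa>) \<alpha> d \<partial>Kp) \<le> (\<integral>\<^sup>+\<kappa>. egam * ?J \<kappa> + ?R \<kappa> \<partial>Kp)"
  proof (intro nn_integral_mono)
    fix \<kappa>
    have "val (plant P \<kappa>) \<alpha> d \<le> of_bool (\<forall>w\<in>words. d < 2 * plant P \<kappa> (node \<alpha> d w)) * (egam * ?J \<kappa>) + ?R \<kappa>"
      by (rule val_one_step[OF d(1) d8(2) \<alpha>])
    \<comment> \<open>The absence of candidates is given up here: within a stage the drift of the
      AL-links alone is enough.\<close>
    also have "\<dots> \<le> egam * ?J \<kappa> + ?R \<kappa>"
      by (intro add_right_mono) (auto simp: of_bool_def)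
    finally show "val (plant P \<kappa>) \<alpha> d \<le> egam * ?J \<kappa> + ?R \<kappa>" .
  qed
  also have "\<dots> = egam * (\<integral>\<^sup>+\<kappa>. ?J \<kappa> \<partial>Kp) + (\<integral>\<^sup>+\<kappa>. ?R \<kappa> \<partial>Kp)"
    by (subst nn_integral_add, simp, simp, subst nn_integral_cmult) simp_all
  also have "(\<integral>\<^sup>+\<kappa>. ?R \<kappa> \<partial>Kp) \<le> rest \<alpha> d e" by (rule rest_le[OF P d8(1) d(2,3) \<alpha>])
  also have "(\<integral>\<^sup>+\<kappa>. ?J \<kappa> \<partial>Kp) \<le> ahead \<alpha> d e + (\<Sum>v\<in>planted_range d. F \<alpha> v e)"
  proof (cases "P d")
    case None
    have "(\<integral>\<^sup>+\<kappa>. ?J \<kappa> \<partial>Kp) = (\<integral>\<^sup>+\<kappa>. of_bool (plant P \<kappa> d < ?m \<and> plant P \<kappa> d \<le> e) * val (plant P \<kappa>) \<alpha> (plant P \<kappa> d) \<partial>Kp)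
        + (\<integral>\<^sup>+\<kappa>. of_bool (?m \<le> plant P \<kappa> d) * val (plant P \<kappa>) \<alpha> ?m \<partial>Kp)"
      by (subst nn_integral_add) simp_all
    also have "\<dots> \<le> (\<integral>\<^sup>+v. of_bool (v < ?m \<and> v \<le> e) * F \<alpha> v e \<partial>Kd d) + (\<integral>\<^sup>+v. of_bool (?m \<le> v) * F \<alpha> ?m e \<partial>Kd d)"
      by (intro add_mono jump_le_F[OF P None d(2), of "\<lambda>v. of_bool (v < ?m \<and> v \<le> e)"]
           stay_le_F[OF P None d(2), of _ "\<lambda>v. of_bool (?m \<le> v)"]) (use m in auto)
    also have "\<dots> = ahead \<alpha> d e" unfolding ahead_def by (subst nn_integral_add) simp_all
    finally show ?thesis by (simp add: add_increasing2)
  next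
    case (Some v)
    note v = planted_le[OF P Some d8(1) d(3) \<alpha>]
    have "(\<integral>\<^sup>+\<kappa>. ?J \<kappa> \<partial>Kp) = (\<integral>\<^sup>+\<kappa>. val (plant P \<kappa>) \<alpha> v \<partial>Kp)"
      using v Some by (intro nn_integral_cong) (simp add: plant_def)
    also have "\<dots> \<le> F \<alpha> v e" using v(3) m by (intro val_plant_le_F[OF P]) linarith
    also have "\<dots> \<le> (\<Sum>v\<in>planted_range d. F \<alpha> v e)"
      by (rule member_le_sum[OF v(1)]) (auto simp: finite_planted_range)
    finally show ?thesis by (simp add: add_increasing)
  qed
  finally show "(\<integral>\<^sup>+\<kappa>. val (plant P \<kappa>) \<alpha> d \<partial>Kp)
    \<le> egam * ahead \<alpha> d e + egam * (\<Sum>v\<in>planted_range d. F \<alpha> v e) + rest \<alpha> d e"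
    by (simp add: distrib_left mult_left_mono add_right_mono)
qed

lemma F_wild:
  assumes d: "D1 \<le> d" "d < N" and \<alpha>: "bounded_AL M \<alpha>"
  shows "F \<alpha> d e \<le> egam * (F \<alpha> (d - Suc (fst (\<alpha> d))) e + F \<alpha> (d - Suc (snd (\<alpha> d))) e
      + (\<integral>\<^sup>+v. of_bool (v \<le> far_AL \<alpha> d) * F \<alpha> v e \<partial>Kd d) + (\<Sum>v\<in>planted_range d. F \<alpha> v e))"
  unfolding F_def[of \<alpha> d e]
proof (rule SUP_least)
  fix P assume P: "P \<in> plants d e"
  have kM: "0 < k * M" "M \<le> k * M" using k_pos M_pos by auto
  have d8: "8 * (k * M) \<le> d" "0 < d" "2 * M \<le> d" using d(1) D1_ge kM by linarith+
  let ?m = "far_AL \<alpha> d"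
  have m: "?m < d" using far_AL_le[of \<alpha> d] d8 by linarith
  let ?J = "\<lambda>\<kappa>. of_bool (plant P \<kappa> d \<le> ?m) * val (plant P \<kappa>) \<alpha> (plant P \<kappa> d)"
  have J: "(\<integral>\<^sup>+\<kappa>. ?J \<kappa> \<partial>Kp) \<le> (\<integral>\<^sup>+v. of_bool (v \<le> ?m) * F \<alpha> v e \<partial>Kd d) + (\<Sum>v\<in>planted_range d. F \<alpha> v e)"
  proof (cases "P d")
    case None
    have "(\<integral>\<^sup>+\<kappa>. ?J \<kappa> \<partial>Kp) \<le> (\<integral>\<^sup>+v. of_bool (v \<le> ?m) * F \<alpha> v e \<partial>Kd d)"
      by (rule jump_le_F[OF P None d(2), of "\<lambda>v. of_bool (v \<le> ?m)"]) (use m in auto)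
    then show ?thesis by (simp add: add_increasing2)
  next
    case (Some v)
    have v: "v \<in> planted_range d" using P Some by (auto simp: plants_def planted_range_def)
    then have vd: "v \<le> d" using d8 by (auto simp: planted_range_def)
    have "(\<integral>\<^sup>+\<kappa>. ?J \<kappa> \<partial>Kp) \<le> (\<integral>\<^sup>+\<kappa>. val (plant P \<kappa>) \<alpha> v \<partial>Kp)"
      using v Some by (intro nn_integral_mono) (simp add: plant_def of_bool_def)
    also have "\<dots> \<le> F \<alpha> v e" using vd by (intro val_plant_le_F[OF P])
    also have "\<dots> \<le> (\<Sum>v\<in>planted_range d. F \<alpha> v e)"
      by (rule member_le_sum[OF v]) (auto simp: finite_planted_range)
    finally show ?thesis by (simp add: add_increasing)
  qed
  have "(\<integral>\<^sup>+\<kappa>. val (plant P \<kappa>) \<alpha> d \<partial>Kp) \<le> (\<integral>\<^sup>+\<kappa>. egam * (val (plant P \<kappa>) \<alpha> (d - Suc (fst (\<alpha> d)))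
      + val (plant P \<kappa>) \<alpha> (d - Suc (snd (\<alpha> d))) + ?J \<kappa>) \<partial>Kp)"
    by (intro nn_integral_mono val_wild[OF d(1) d8(3) \<alpha>])
  also have "\<dots> = egam * ((\<integral>\<^sup>+\<kappa>. val (plant P \<kappa>) \<alpha> (d - Suc (fst (\<alpha> d))) \<partial>Kp)
      + (\<integral>\<^sup>+\<kappa>. val (plant P \<kappa>) \<alpha> (d - Suc (snd (\<alpha> d))) \<partial>Kp) + (\<integral>\<^sup>+\<kappa>. ?J \<kappa> \<partial>Kp))"
    by (simp add: nn_integral_cmult nn_integral_add)
  also have "\<dots> \<le> egam * (F \<alpha> (d - Suc (fst (\<alpha> d))) e + F \<alpha> (d - Suc (snd (\<alpha> d))) e
      + ((\<integral>\<^sup>+v. of_bool (v \<le> far_AL \<alpha> d) * F \<alpha> v e \<partial>Kd d) + (\<Sum>v\<in>planted_range d. F \<alpha> v e)))"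
    by (intro mult_left_mono add_mono J val_plant_le_F[OF P]) auto
  finally show "(\<integral>\<^sup>+\<kappa>. val (plant P \<kappa>) \<alpha> d \<partial>Kp) \<le> egam * (F \<alpha> (d - Suc (fst (\<alpha> d))) e + F \<alpha> (d - Suc (snd (\<alpha> d))) e
      + (\<integral>\<^sup>+v. of_bool (v \<le> far_AL \<alpha> d) * F \<alpha> v e \<partial>Kd d) + (\<Sum>v\<in>planted_range d. F \<alpha> v e))"
    by (simp add: add.assoc)
qed

end

lemma sum_ennreal_const: "0 \<le> x \<Longrightarrow> (\<Sum>a\<in>A. ennreal x) = ennreal (real (card A) * x)"
  by (simp add: ennreal_mult ennreal_of_nat_eq_real_of_nat)

section \<open>The potential and its expected decrease\<close>

context routing
begin

text \<open>Of the order \<open>(lg n) ^ 3\<close>. This is large enough for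
  \<open>eps_lose\<close>, where the window probability \<open>k * M / (Z * D0)\<close> has to beat
  the number of words, and small enough that \<open>D0 / M\<close> is \<open>O(lg n)\<close>, so
  that the exponential factor in \<open>phi\<close> is cheap.\<close>

definition D0 :: nat where "D0 = 8 ^ Suc k"

definition Lam :: nat where "Lam = 20 * Suc k"

text \<open>The exponential factor pays for walking by AL-links alone below \<open>D0\<close>.  The exponent \<open>Lam\<close> is so
  large that halving the distance once outweighs a union bound over all words of length at most
  \<open>k\<close>.\<close>

definition phi :: "nat \<Rightarrow> real" where
  "phi d = exp (8 * real (min d D0) / real M) * (real d + 1) ^ Lam"

text \<open>If \<open>e < d\<close>, nodes between \<open>e\<close> and \<open>d\<close> may carry planted links.  An AL-step decreases the
  exponential factor on average by the factor \<open>1 - theta / 3\<close>, which outweighs the factor \<open>gam\<close> per step.\<close>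

definition bnd :: "nat \<Rightarrow> nat \<Rightarrow> real" where
  "bnd d e = (if d \<le> e then phi d else 2 * phi d * exp (theta * (real d - real e) / real M))"

lemma phi_ge_1: "1 \<le> phi d"
proof -
  have "1 * 1 \<le> phi d" unfolding phi_def by (intro mult_mono one_le_power) auto
  then show ?thesis by simp
qed

lemma phi_nonneg [simp]: "0 \<le> phi d"
  using phi_ge_1[of d] by simp

lemma phi_mono: "v \<le> d \<Longrightarrow> phi v \<le> phi d"
  unfolding phi_def by (intro mult_mono power_mono) (auto intro!: divide_right_mono)

text \<open>The factor \<open>3/4\<close> instead of \<open>1/2\<close> leaves room for planted
  targets, which lie slightly above \<open>d / 2\<close>, and for the added
  \<open>1\<close>.\<close>

lemma phi_drop: "4 * (v + 1) \<le> 3 * (d + 1) \<Longrightarrow> phi v \<le> (3/4) ^ Lam * phi d"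
proof -
  assume *: "4 * (v + 1) \<le> 3 * (d + 1)"
  then have "(real v + 1) ^ Lam \<le> (3/4 * (real d + 1)) ^ Lam" by (intro power_mono) auto
  moreover have "exp (8 * real (min v D0) / real M) \<le> exp (8 * real (min d D0) / real M)"
    using * by (auto intro!: divide_right_mono)
  ultimately have "phi v \<le> exp (8 * real (min d D0) / real M) * (3/4 * (real d + 1)) ^ Lam"
    unfolding phi_def by (intro mult_mono) auto
  then show ?thesis unfolding phi_def power_mult_distrib by (simp only: mult_ac)
qed

lemma bnd_le: "v \<le> d \<Longrightarrow> v \<le> e + 2 * (k * M) \<Longrightarrow> bnd v e \<le> 2 * phi d * exp (2 * theta * k)"
proof (cases "v \<le> e")
  case True
  assume "v \<le> d"
  then have "bnd v e \<le> phi d" using True phi_mono by (simp add: bnd_def)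
  moreover have "phi d * 1 \<le> (2 * phi d) * exp (2 * theta * k)"
    using phi_ge_1[of d] by (intro mult_mono) (auto simp: theta_def)
  ultimately show ?thesis by simp
next
  case False
  assume *: "v \<le> d" "v \<le> e + 2 * (k * M)"
  have "real v - real e \<le> 2 * real k * real M"
    using of_nat_mono[OF *(2), where 'a = real] by (simp add: algebra_simps)
  then have "(real v - real e) / real M \<le> 2 * real k"
    using M_pos by (simp add: divide_simps mult_ac)
  then have "theta * ((real v - real e) / real M) \<le> theta * (2 * real k)"
    by (intro mult_left_mono) (auto simp: theta_def)
  then show ?thesis using False phi_mono[OF *(1)] phi_ge_1[of v]
    by (auto simp: bnd_def mult_ac intro!: mult_mono)
qed

lemma bnd_nonneg: "0 \<le> bnd d e"
  using phi_ge_1[of d] by (auto simp: bnd_def intro!: mult_nonneg_nonneg)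

lemma phi_le_bnd: "e < d \<Longrightarrow> phi d \<le> bnd d e"
proof -
  assume "e < d"
  then have "1 * 1 \<le> 2 * exp (theta * (real d - real e) / real M)"
    by (intro mult_mono) (auto simp: theta_def)
  then show ?thesis using \<open>e < d\<close> phi_ge_1[of d] by (simp add: bnd_def)
qed

lemma nn_integral_ALd:
  assumes "\<And>a. a < M \<Longrightarrow> 0 \<le> f a"
  shows "(\<integral>\<^sup>+ab. ennreal (f (fst ab)) \<partial>ALd) = ennreal ((\<Sum>a<M. f a) / real M)"
    and "(\<integral>\<^sup>+ab. ennreal (f (snd ab)) \<partial>ALd) = ennreal ((\<Sum>a<M. f a) / real M)"
proof -
  have "(\<integral>\<^sup>+a. ennreal (f a) \<partial>pmf_of_set {..<M}) = ennreal ((\<Sum>a<M. f a) / real M)"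
  proof -
    have "(\<Sum>a<M. ennreal (f a)) = ennreal (\<Sum>a<M. f a)" using assms by (intro sum_ennreal) auto
    moreover have "0 \<le> (\<Sum>a<M. f a)" using assms by (intro sum_nonneg) auto
    ultimately show ?thesis
      using M_pos by (subst nn_integral_pmf_of_set) (auto simp: divide_ennreal ennreal_of_nat_eq_real_of_nat)
  qed
  then show "(\<integral>\<^sup>+ab. ennreal (f (fst ab)) \<partial>ALd) = ennreal ((\<Sum>a<M. f a) / real M)"
    "(\<integral>\<^sup>+ab. ennreal (f (snd ab)) \<partial>ALd) = ennreal ((\<Sum>a<M. f a) / real M)"
    by (simp_all add: ALd_def nn_integral_pair_pmf' measure_pmf.emeasure_space_1)
qed

text \<open>The mean advance is above \<open>M / 2\<close>, so a second-order expansion gives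
  \<open>1 - theta / 2 + theta ^ 2\<close>, which is within the bound because \<open>theta\<close>
  is below \<open>1 / 6\<close>.\<close>

lemma avg_exp_theta: "(\<Sum>a<M. exp (- (theta * (real a + 1) / real M))) / real M \<le> 1 - theta / 3"
proof -
  have e: "exp (- y) \<le> 1 - y + y\<^sup>2" if "0 \<le> y" for y :: real
  proof -
    have "exp (- y) \<le> 1 / (1 + y)"
      using that exp_ge_add_one_self[of y] by (simp add: exp_minus divide_simps)
    also have "\<dots> \<le> 1 - y + y\<^sup>2"
    proof -
      have "1 \<le> (1 - y + y\<^sup>2) * (1 + y)" using that by (simp add: algebra_simps power2_eq_square power3_eq_cube)
      then show ?thesis using that by (simp add: divide_le_eq)
    qed
    finally show ?thesis .
  qed
  have "exp (- (theta * (real a + 1) / real M)) \<le> 1 - theta * (real a + 1) / real M + theta\<^sup>2" if "a < M" for a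
  proof -
    let ?y = "theta * (real a + 1) / real M"
    have y: "0 \<le> ?y" "?y \<le> theta" using that by (auto simp: theta_def divide_le_eq)
    have "exp (- ?y) \<le> 1 - ?y + ?y\<^sup>2" by (rule e[OF y(1)])
    moreover have "?y\<^sup>2 \<le> theta\<^sup>2" using y by (intro power_mono)
    ultimately show ?thesis by linarith
  qed
  then have "(\<Sum>a<M. exp (- (theta * (real a + 1) / real M))) \<le> (\<Sum>a<M. 1 - theta * (real a + 1) / real M + theta\<^sup>2)"
    by (intro sum_mono) auto
  also have "\<dots> = real M * (1 + theta\<^sup>2) - theta / real M * (\<Sum>a<M. real a + 1)"
    by (simp add: sum.distrib sum_subtractf sum_distrib_left sum_divide_distrib algebra_simps add_divide_distrib)
  also have "(\<Sum>a<n. real a + 1) = real n * (real n + 1) / 2" for n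
    by (induction n) (auto simp: field_simps)
  also have "real M * (1 + theta\<^sup>2) - theta / real M * (real M * (real M + 1) / 2) \<le> real M * (1 - theta / 3)"
    using M_pos by (simp add: theta_def power2_eq_square field_simps)
  finally show ?thesis using M_pos by (simp add: divide_le_eq mult.commute)
qed

text \<open>A Riemann sum of \<open>exp (- 8 * x)\<close> over the unit interval, estimated by
  telescoping. The rate \<open>8\<close> makes it so small that the three moves summed in
  \<open>wild_moment\<close> together stay below \<open>1 / 2\<close>.\<close>

lemma avg_exp_8: "(\<Sum>a<M. exp (- (8 * (real a + 1) / real M))) / real M \<le> 1 / 8"
proof -
  have "8 / real M * exp (- (8 * (real a + 1) / real M)) \<le> exp (- (8 * real a / real M)) - exp (- (8 * real (Suc a) / real M))" for a
  proof -
    have "8 / real M \<le> exp (8 / real M) - 1" using exp_ge_add_one_self[of "8 / real M"] by linarith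
    then have "8 / real M * exp (- (8 * (real a + 1) / real M)) \<le> (exp (8 / real M) - 1) * exp (- (8 * (real a + 1) / real M))"
      by (intro mult_right_mono) auto
    also have "exp (8 / real M) * exp (- (8 * (real a + 1) / real M)) = exp (- (8 * real a / real M))"
      by (simp add: exp_add[symmetric] add_divide_distrib algebra_simps)
    then have "(exp (8 / real M) - 1) * exp (- (8 * (real a + 1) / real M)) = exp (- (8 * real a / real M)) - exp (- (8 * real (Suc a) / real M))"
      by (simp add: left_diff_distrib algebra_simps)
    finally show ?thesis .
  qed
  then have "(\<Sum>a<M. 8 / real M * exp (- (8 * (real a + 1) / real M))) \<le> (\<Sum>a<M. exp (- (8 * real a / real M)) - exp (- (8 * real (Suc a) / real M)))"
    by (intro sum_mono) auto
  also have "\<dots> = 1 - exp (- (8 * real M / real M))"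
    by (subst sum_lessThan_telescope') simp
  also have "\<dots> \<le> 1" by simp
  finally have "8 / real M * (\<Sum>a<M. exp (- (8 * (real a + 1) / real M))) \<le> 1" by (simp only: sum_distrib_left)
  then show ?thesis using M_pos by (simp add: divide_simps)
qed

lemma nn_integral_Ap_node:
  fixes G :: "(nat \<Rightarrow> nat \<times> nat) \<Rightarrow> nat \<times> nat \<Rightarrow> ennreal"
  assumes "d < N" "\<And>\<alpha> ab ab'. G (\<alpha>(d := ab')) ab = G \<alpha> ab"
  shows "(\<integral>\<^sup>+\<alpha>. G \<alpha> (\<alpha> d) \<partial>Ap) = (\<integral>\<^sup>+ab. (\<integral>\<^sup>+\<alpha>. G \<alpha> ab \<partial>Ap) \<partial>ALd)"
  by (subst nn_integral_Pi_pmf_resample[where i = d]) (use assms in auto)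

definition far :: "nat \<Rightarrow> nat \<times> nat \<Rightarrow> nat" where
  "far d ab = min (d - Suc (fst ab)) (d - Suc (snd ab))"

lemma far_AL_far: "far_AL \<alpha> d = far d (\<alpha> d)" by (simp add: far_AL_def far_def)

lemma far_less: "0 < d \<Longrightarrow> far d ab < d" by (auto simp: far_def)

lemma F_upd: "x < d \<Longrightarrow> F (\<alpha>(d := ab)) x e = F \<alpha> x e"
  by (rule F_cong) auto

text \<open>Whatever the K-link does, the outcome is at most \<open>bnd d e\<close> times
  \<open>exp (- theta * (a + 1) / M)\<close>, where \<open>a + 1\<close> is the length of the first
  AL-link; the longer of the two advances at least as far. Averaging over \<open>a\<close> gives the
  drift.\<close>

lemma ahead_moment:
  assumes d: "e < d" "d \<le> e + 2 * (k * M)" "d < N" "M < d"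
    and IH: "\<And>x. x < d \<Longrightarrow> (\<integral>\<^sup>+\<alpha>. F \<alpha> x e \<partial>Ap) \<le> ennreal (bnd x e)"
  shows "(\<integral>\<^sup>+\<alpha>. ahead \<alpha> d e \<partial>Ap) \<le> ennreal (bnd d e * (1 - theta / 3))"
proof -
  let ?G = "\<lambda>\<alpha> ab. \<integral>\<^sup>+v. of_bool (v < far d ab \<and> v \<le> e) * F \<alpha> v e + of_bool (far d ab \<le> v) * F \<alpha> (far d ab) e \<partial>Kd d"
  have fd: "far d ab < d" for ab using far_less d by simp
  have "(\<integral>\<^sup>+\<alpha>. ahead \<alpha> d e \<partial>Ap) = (\<integral>\<^sup>+\<alpha>. ?G \<alpha> (\<alpha> d) \<partial>Ap)"
    by (simp add: ahead_def far_AL_far)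
  also have "\<dots> = (\<integral>\<^sup>+ab. (\<integral>\<^sup>+\<alpha>. ?G \<alpha> ab \<partial>Ap) \<partial>ALd)"
  proof (rule nn_integral_Ap_node[OF d(3)])
    fix \<alpha> ab ab'
    have "of_bool (v < far d ab \<and> v \<le> e) * F (\<alpha>(d := ab')) v e = of_bool (v < far d ab \<and> v \<le> e) * F \<alpha> v e" for v
      using fd[of ab] by (cases "v < far d ab") (auto simp: F_upd)
    then show "?G (\<alpha>(d := ab')) ab = ?G \<alpha> ab" using fd[of ab] by (simp add: F_upd)
  qed
  also have "\<dots> \<le> (\<integral>\<^sup>+ab. ennreal (bnd d e * exp (- (theta * (real (fst ab) + 1) / real M))) \<partial>ALd)"
  proof (intro nn_integral_mono_AE AE_pmfI)
    fix ab assume "ab \<in> set_pmf ALd"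
    then have a: "fst ab < M" by (auto simp: set_ALd)
    let ?X = "bnd d e * exp (- (theta * (real (fst ab) + 1) / real M))"
    let ?m = "far d ab"
    have m: "?m \<le> d - Suc (fst ab)" by (simp add: far_def)
    have X1: "phi d \<le> ?X"
    proof -
      have "theta * (real (fst ab) + 1) / real M \<le> theta" using a by (auto simp: theta_def divide_le_eq)
      then have "exp (- theta) \<le> exp (- (theta * (real (fst ab) + 1) / real M))" by simp
      moreover have "1 / 2 \<le> exp (- theta)" using exp_ge_add_one_self[of "- theta"] by (simp add: theta_def)
      ultimately have h: "1 / 2 \<le> exp (- (theta * (real (fst ab) + 1) / real M))" by linarith
      \<comment> \<open>This is what the factor \<open>2\<close> in \<open>bnd\<close> is for: a
        move that leaves the stage lands where the bound is plain \<open>phi\<close>, and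
        \<open>phi d\<close> must still fit below \<open>bnd d e\<close> times a factor that may be
        as small as \<open>exp (- theta)\<close>.\<close>
      have "2 * phi d * 1 \<le> bnd d e"
        using d(1) phi_ge_1[of d] by (auto simp: bnd_def theta_def intro!: mult_left_mono)
      then have "2 * phi d * (1 / 2) \<le> ?X" using h phi_ge_1[of d] by (intro mult_mono) auto
      then show ?thesis by simp
    qed
    have Xm: "bnd ?m e \<le> ?X"
    proof (cases "?m \<le> e")
      case True
      then show ?thesis using X1 phi_mono[of ?m d] fd[of ab] by (simp add: bnd_def)
    next
      case False
      have "real ?m \<le> real d - (real (fst ab) + 1)" using m False a d(4) by linarith
      then have "theta * (real ?m - real e) / real M \<le> theta * (real d - real e) / real M + - (theta * (real (fst ab) + 1) / real M)"
      proof -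
        have "theta * (real ?m - real e) \<le> theta * (real d - real e) - theta * (real (fst ab) + 1)"
        proof -
          have h: "real ?m - real e \<le> (real d - real e) - (real (fst ab) + 1)"
            using \<open>real ?m \<le> real d - (real (fst ab) + 1)\<close> by linarith
          have "theta * (real ?m - real e) \<le> theta * ((real d - real e) - (real (fst ab) + 1))"
            by (rule mult_left_mono[OF h]) (simp add: theta_def)
          then show ?thesis by (simp only: right_diff_distrib)
        qed
        from divide_right_mono[OF this, of "real M"] show ?thesis by (simp add: diff_divide_distrib)
      qed
      then have "exp (theta * (real ?m - real e) / real M) \<le> exp (theta * (real d - real e) / real M) * exp (- (theta * (real (fst ab) + 1) / real M))"
        by (simp flip: exp_add)
      then have "2 * phi ?m * exp (theta * (real ?m - real e) / real M) \<le> 2 * phi d * (exp (theta * (real d - real e) / real M) * exp (- (theta * (real (fst ab) + 1) / real M)))"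
        using phi_mono[of ?m d] fd[of ab] phi_ge_1[of ?m] phi_ge_1[of d] by (intro mult_mono) auto
      then show ?thesis using False d(1) by (simp add: bnd_def mult_ac)
    qed
    have "(\<integral>\<^sup>+\<alpha>. ?G \<alpha> ab \<partial>Ap) = (\<integral>\<^sup>+v. (\<integral>\<^sup>+\<alpha>. of_bool (v < ?m \<and> v \<le> e) * F \<alpha> v e + of_bool (?m \<le> v) * F \<alpha> ?m e \<partial>Ap) \<partial>Kd d)"
      by (rule nn_integral_pmf_swap)
    also have "\<dots> \<le> ennreal ?X"
    proof (rule nn_integral_pmf_le_const)
      fix v
      have "(\<integral>\<^sup>+\<alpha>. of_bool (v < ?m \<and> v \<le> e) * F \<alpha> v e + of_bool (?m \<le> v) * F \<alpha> ?m e \<partial>Ap)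
         = of_bool (v < ?m \<and> v \<le> e) * (\<integral>\<^sup>+\<alpha>. F \<alpha> v e \<partial>Ap) + of_bool (?m \<le> v) * (\<integral>\<^sup>+\<alpha>. F \<alpha> ?m e \<partial>Ap)"
        by (simp add: nn_integral_add nn_integral_cmult)
      also have "\<dots> \<le> ennreal ?X"
      proof (cases "?m \<le> v")
        case True
        then show ?thesis using IH[OF fd, of ab] Xm by (simp add: ennreal_leI order_trans)
      next
        case False
        show ?thesis
        proof (cases "v \<le> e")
          case True
          have "v < d" using False fd[of ab] by simp
          have "(\<integral>\<^sup>+\<alpha>. F \<alpha> v e \<partial>Ap) \<le> ennreal (phi v)" using IH[OF \<open>v < d\<close>] True by (simp add: bnd_def)
          also have "\<dots> \<le> ennreal ?X" using X1 phi_mono[of v d] \<open>v < d\<close> by (intro ennreal_leI) linarith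
          finally show ?thesis using False True by simp
        qed (use False in simp)
      qed
      finally show "(\<integral>\<^sup>+\<alpha>. of_bool (v < ?m \<and> v \<le> e) * F \<alpha> v e + of_bool (?m \<le> v) * F \<alpha> ?m e \<partial>Ap) \<le> ennreal ?X" .
    qed
    finally show "(\<integral>\<^sup>+\<alpha>. ?G \<alpha> ab \<partial>Ap) \<le> ennreal ?X" .
  qed
  also have "\<dots> = ennreal ((\<Sum>a<M. bnd d e * exp (- (theta * (real a + 1) / real M))) / real M)"
    by (rule nn_integral_ALd(1)) (simp add: bnd_nonneg)
  also have "\<dots> \<le> ennreal (bnd d e * (1 - theta / 3))"
    using avg_exp_theta bnd_nonneg[of d e]
    by (intro ennreal_leI) (simp flip: sum_distrib_left times_divide_eq_right add: mult_left_mono)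
  finally show ?thesis .
qed

lemma planted_range_drop:
  assumes "8 * (k * M) \<le> d" "v \<in> planted_range d"
  shows "phi v \<le> (3/4) ^ Lam * phi d" "v < d"
proof -
  have kM: "0 < k * M" using k_pos M_pos by simp
  have v: "2 * v \<le> d + k * M" using assms(2) by (simp add: planted_range_def)
  show "v < d" using v assms(1) kM by linarith
  have "2 * v \<le> d + K \<Longrightarrow> 8 * K \<le> d \<Longrightarrow> 0 < K \<Longrightarrow> 4 * (v + 1) \<le> 3 * (d + 1)" for K :: nat by simp
  from phi_drop[OF this[OF v assms(1) kM]] show "phi v \<le> (3/4) ^ Lam * phi d" .
qed

lemma card_planted_range: "card (planted_range d) \<le> k * M"
proof -
  have kM: "0 < k * M" using k_pos M_pos by simp
  have "planted_range d \<subseteq> {d div 2 <.. (d + k * M) div 2}" by (auto simp: planted_range_def)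
  then have "card (planted_range d) \<le> (d + k * M) div 2 - d div 2"
    using card_mono[of "{d div 2 <.. (d + k * M) div 2}"] by fastforce
  then show ?thesis using kM by linarith
qed

definition eps_plant :: real where "eps_plant = gam * (real (k * M) * (3/4) ^ Lam)"

lemma planted_moment:
  assumes d: "8 * (k * M) \<le> d"
    and IH: "\<And>v. v \<in> planted_range d \<Longrightarrow> (\<integral>\<^sup>+\<alpha>. F \<alpha> v e \<partial>Ap) \<le> ennreal (phi v)"
  shows "egam * (\<integral>\<^sup>+\<alpha>. (\<Sum>v\<in>planted_range d. F \<alpha> v e) \<partial>Ap) \<le> ennreal (eps_plant * phi d)"
proof -
  have "(\<integral>\<^sup>+\<alpha>. (\<Sum>v\<in>planted_range d. F \<alpha> v e) \<partial>Ap) = (\<Sum>v\<in>planted_range d. \<integral>\<^sup>+\<alpha>. F \<alpha> v e \<partial>Ap)"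
    by (rule nn_integral_sum) simp
  also have "\<dots> \<le> (\<Sum>v\<in>planted_range d. ennreal ((3/4) ^ Lam * phi d))"
    using planted_range_drop(1)[OF d] IH by (intro sum_mono) (meson ennreal_leI order_trans)
  also have "\<dots> = ennreal (real (card (planted_range d)) * ((3/4) ^ Lam * phi d))"
    using phi_ge_1[of d] by (subst sum_ennreal) auto
  also have "\<dots> \<le> ennreal (real (k * M) * ((3/4) ^ Lam * phi d))"
    using card_planted_range[of d] phi_ge_1[of d] by (intro ennreal_leI mult_right_mono) (auto simp del: of_nat_mult)
  finally have "egam * (\<integral>\<^sup>+\<alpha>. (\<Sum>v\<in>planted_range d. F \<alpha> v e) \<partial>Ap) \<le> egam * ennreal (real (k * M) * ((3/4) ^ Lam * phi d))"
    by (intro mult_left_mono) auto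
  also have "\<dots> = ennreal (eps_plant * phi d)"
    using gam_gt_1 phi_ge_1[of d] by (subst ennreal_mult[symmetric]) (auto simp: eps_plant_def mult_ac)
  finally show ?thesis .
qed

text \<open>This and the next two measure the parts of \<open>rest\<close> relative to
  \<open>phi d\<close>. Here \<open>harm (2 * (k * M)) / Z\<close> bounds the chance of a K-link of
  length at most \<open>2 * (k * M)\<close>; \<open>eps_half\<close> sets the gain from halving
  against all words, and \<open>eps_lose\<close> sets the window probability at scale
  \<open>D0\<close> against all words and positions.\<close>

definition eps_short :: real where
  "eps_short = gam * (2 * exp (2 * theta * k)) * (harm (2 * (k * M)) / Z)"

definition eps_half :: real where
  "eps_half = 2 ^ Suc k * gam ^ Suc k * (4 / Z) * (3/4) ^ Lam"

definition eps_lose :: real where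
  "eps_lose = 2 ^ Suc k * real k * gam ^ k * (real (k * M) * (8 / (Z * real D0))) * (2 * exp (2 * theta * k))"

lemma card_words: "card words \<le> 2 ^ Suc k"
proof -
  have "words = {xs. set xs \<subseteq> (UNIV :: bool set) \<and> length xs \<le> k}" by (auto simp: words_def)
  then have "card words = (\<Sum>i\<le>k. 2 ^ i)"
    using card_lists_length_le[of "UNIV :: bool set" k] by simp
  also have "(\<Sum>i\<le>n. (2::nat) ^ i) < 2 ^ Suc n" for n by (induction n) auto
  finally show ?thesis by simp
qed

text \<open>A strong Markov property: sum over the node \<open>u\<close> where the word ends. That
  event reads links above \<open>u\<close>, whereas \<open>G \<alpha> u\<close> reads links at or
  below \<open>u\<close>. The bound \<open>l * M < d\<close> keeps all these nodes positive, as
  \<open>node_eq_iff_above\<close> demands.\<close>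

lemma node_moment:
  assumes d: "l * M < d" and w: "length w \<le> l"
    and B: "\<And>u. u \<le> d \<Longrightarrow> (w \<noteq> [] \<Longrightarrow> u < d) \<Longrightarrow> d - l * M \<le> u \<Longrightarrow> (\<integral>\<^sup>+\<alpha>. G \<alpha> u \<partial>Ap) \<le> B"
    and dep: "\<And>u. depends_on {..u} (\<lambda>\<alpha>. G \<alpha> u)"
  shows "(\<integral>\<^sup>+\<alpha>. G \<alpha> (node \<alpha> d w) \<partial>Ap) \<le> B"
proof -
  let ?U = "{u \<in> {d - l * M..d}. w \<noteq> [] \<longrightarrow> u < d}"
  have mem: "node \<alpha> d w \<in> ?U" if "\<alpha> \<in> set_pmf Ap" for \<alpha>
  proof -
    have "d - l * M \<le> node \<alpha> d w" by (rule node_ge_le[OF bounded_AL_set[OF that] w])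
    moreover have "node \<alpha> d w < d" if "w \<noteq> []" by (rule node_less[OF _ that]) (use d in linarith)
    ultimately show ?thesis by (simp add: node_le)
  qed
  have "(\<integral>\<^sup>+\<alpha>. G \<alpha> (node \<alpha> d w) \<partial>Ap) = (\<integral>\<^sup>+\<alpha>. (\<Sum>u\<in>?U. of_bool (node \<alpha> d w = u) * G \<alpha> u) \<partial>Ap)"
  proof (intro nn_integral_cong_AE AE_pmfI)
    fix \<alpha> assume "\<alpha> \<in> set_pmf Ap"
    from mem[OF this] show "G \<alpha> (node \<alpha> d w) = (\<Sum>u\<in>?U. of_bool (node \<alpha> d w = u) * G \<alpha> u)"
      by (subst sum.remove[where x = "node \<alpha> d w"]) (auto intro!: sum.neutral)
  qed
  also have "\<dots> = (\<Sum>u\<in>?U. \<integral>\<^sup>+\<alpha>. of_bool (node \<alpha> d w = u) * G \<alpha> u \<partial>Ap)"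
    by (rule nn_integral_sum) simp
  also have "\<dots> = (\<Sum>u\<in>?U. (\<integral>\<^sup>+\<alpha>. of_bool (node \<alpha> d w = u) \<partial>Ap) * (\<integral>\<^sup>+\<alpha>. G \<alpha> u \<partial>Ap))"
  proof (intro sum.cong refl)
    fix u assume u: "u \<in> ?U"
    have "depends_on {u<..} (\<lambda>\<alpha>. of_bool (node \<alpha> d w = u) :: ennreal)"
    proof (rule depends_onI)
      fix x y :: "nat \<Rightarrow> nat \<times> nat" assume "\<And>i. i \<in> {u<..} \<Longrightarrow> x i = y i"
      then have "node x d w = u \<longleftrightarrow> node y d w = u" using u d by (intro node_eq_iff_above[of u]) auto
      then show "of_bool (node x d w = u) = (of_bool (node y d w = u) :: ennreal)" by simp
    qed
    moreover have "depends_on (- {u<..}) (\<lambda>\<alpha>. G \<alpha> u)"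
      using dep[of u] by (rule depends_on_mono) auto
    ultimately show "(\<integral>\<^sup>+\<alpha>. of_bool (node \<alpha> d w = u) * G \<alpha> u \<partial>Ap) = (\<integral>\<^sup>+\<alpha>. of_bool (node \<alpha> d w = u) \<partial>Ap) * (\<integral>\<^sup>+\<alpha>. G \<alpha> u \<partial>Ap)"
      by (intro nn_integral_Pi_pmf_mult) auto
  qed
  also have "\<dots> \<le> (\<Sum>u\<in>?U. (\<integral>\<^sup>+\<alpha>. of_bool (node \<alpha> d w = u) \<partial>Ap) * B)"
    by (intro sum_mono mult_left_mono B) auto
  also have "\<dots> = (\<integral>\<^sup>+\<alpha>. (\<Sum>u\<in>?U. of_bool (node \<alpha> d w = u)) \<partial>Ap) * B"
    by (subst nn_integral_sum) (simp_all add: sum_distrib_right)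
  also have "\<dots> \<le> 1 * B"
    by (intro mult_right_mono nn_integral_pmf_le_const) (auto simp: sum.delta' of_bool_def)
  finally show ?thesis by simp
qed

text \<open>\<open>D0 \<le> 2 * d\<close> rather than \<open>D0 \<le> d\<close>, because the
  estimate is also used at nodes of a path that starts at \<open>D0\<close> or above and has moved
  down somewhat. The induction hypothesis ranges over all \<open>e\<close>, as a lost target changes
  the border.\<close>

lemma rest_moment:
  assumes d: "D0 \<le> 2 * d" "d < N" "d \<le> e + 2 * (k * M)" "e < d" "8 * (k * M) \<le> d"
    and IH: "\<And>x e. x < d \<Longrightarrow> x \<le> e + 2 * (k * M) \<Longrightarrow> (\<integral>\<^sup>+\<alpha>. F \<alpha> x e \<partial>Ap) \<le> ennreal (bnd x e)"
  shows "(\<integral>\<^sup>+\<alpha>. rest \<alpha> d e \<partial>Ap) \<le> ennreal ((eps_short + eps_half + eps_lose) * phi d)"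
proof -
  have kM: "0 < k * M" using k_pos M_pos by simp
  have d0: "0 < d" and d2: "2 \<le> d" using d(5) kM by linarith+
  let ?B = "2 * phi d * exp (2 * theta * k)"
  have B0: "0 \<le> ?B" using phi_ge_1[of d] by simp
  have "(\<integral>\<^sup>+\<alpha>. (\<integral>\<^sup>+v. egam * of_bool (e < v \<and> v < d) * F \<alpha> v e \<partial>Kd d) \<partial>Ap)
      = (\<integral>\<^sup>+v. (\<integral>\<^sup>+\<alpha>. egam * of_bool (e < v \<and> v < d) * F \<alpha> v e \<partial>Ap) \<partial>Kd d)"
    by (rule nn_integral_pmf_swap)
  also have "\<dots> \<le> (\<integral>\<^sup>+v. of_bool (v \<in> {e<..<d}) * ennreal (gam * ?B) \<partial>Kd d)"
  proof (intro nn_integral_mono)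
    fix v
    show "(\<integral>\<^sup>+\<alpha>. egam * of_bool (e < v \<and> v < d) * F \<alpha> v e \<partial>Ap) \<le> of_bool (v \<in> {e<..<d}) * ennreal (gam * ?B)"
    proof (cases "e < v \<and> v < d")
      case True
      then have "(\<integral>\<^sup>+\<alpha>. F \<alpha> v e \<partial>Ap) \<le> ennreal ?B"
        using IH[of v e] bnd_le[of v d e] d(3) by (meson ennreal_leI less_imp_le order_trans)
      then show ?thesis using True gam_gt_1 B0
        by (simp add: nn_integral_cmult mult_left_mono ennreal_mult)
    qed auto
  qed
  also have "\<dots> = (\<Sum>v\<in>{e<..<d}. of_bool (v \<in> {e<..<d}) * ennreal (gam * ?B) * pmf (Kd d) v)"
    by (rule nn_integral_measure_pmf_support) auto
  also have "\<dots> = (\<Sum>v\<in>{e<..<d}. ennreal (gam * ?B * (1 / (Z * real (d - v)))))"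
    using gam_gt_1 B0 Z_pos d(2)
    by (intro sum.cong refl) (auto simp: pmf_Kd ennreal_mult[symmetric])
  also have "\<dots> = ennreal (\<Sum>v\<in>{e<..<d}. gam * ?B * (1 / (Z * real (d - v))))"
    using gam_gt_1 B0 Z_pos by (intro sum_ennreal mult_nonneg_nonneg) auto
  also have "\<dots> \<le> ennreal (gam * ?B * (harm (2 * (k * M)) / Z))"
  proof (intro ennreal_leI)
    have "(\<Sum>v\<in>{e<..<d}. 1 / real (d - v)) = (\<Sum>j\<in>{1..<d - e}. 1 / real j)"
      by (rule sum.reindex_bij_witness[of _ "\<lambda>j. d - j" "\<lambda>v. d - v"]) auto
    also have "\<dots> \<le> (\<Sum>j\<in>{1..2 * (k * M)}. 1 / real j)"
      using d(3) by (intro sum_mono2) auto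
    finally have "(\<Sum>v\<in>{e<..<d}. 1 / real (d - v)) \<le> harm (2 * (k * M))"
      by (simp add: harm_def inverse_eq_divide)
    then have "(\<Sum>v\<in>{e<..<d}. 1 / real (d - v)) / Z \<le> harm (2 * (k * M)) / Z"
      using Z_pos by (intro divide_right_mono) auto
    then have "gam * ?B * ((\<Sum>v\<in>{e<..<d}. 1 / real (d - v)) / Z) \<le> gam * ?B * (harm (2 * (k * M)) / Z)"
      using gam_gt_1 B0 by (intro mult_left_mono) auto
    moreover have "(\<Sum>v\<in>{e<..<d}. gam * ?B * (1 / (Z * real (d - v)))) = (\<Sum>v\<in>{e<..<d}. gam * ?B * (1 / real (d - v) / Z))"
      by (intro sum.cong refl) (simp add: mult.commute)
    moreover have "\<dots> = gam * ?B * ((\<Sum>v\<in>{e<..<d}. 1 / real (d - v)) / Z)"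
      by (simp only: sum_distrib_left sum_divide_distrib)
    ultimately show "(\<Sum>v\<in>{e<..<d}. gam * ?B * (1 / (Z * real (d - v)))) \<le> gam * ?B * (harm (2 * (k * M)) / Z)"
      by simp
  qed
  also have "gam * ?B * (harm (2 * (k * M)) / Z) = eps_short * phi d" by (simp add: eps_short_def)
  finally have 1: "(\<integral>\<^sup>+\<alpha>. (\<integral>\<^sup>+v. egam * of_bool (e < v \<and> v < d) * F \<alpha> v e \<partial>Kd d) \<partial>Ap) \<le> ennreal (eps_short * phi d)" .
  have fin: "finite {v. 2 * v \<le> d}" by (rule finite_subset[of _ "{..d}"]) auto
  have cardhalf: "card {v. 2 * v \<le> d} \<le> d"
  proof -
    have "{v. 2 * v \<le> d} \<subseteq> {..d div 2}" by auto
    then have "card {v. 2 * v \<le> d} \<le> Suc (d div 2)" using card_mono[of "{..d div 2}"] by fastforce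
    then show ?thesis using d(5) kM by linarith
  qed
  have "(\<integral>\<^sup>+\<alpha>. (\<Sum>w\<in>words. \<Sum>v\<in>{v. 2 * v \<le> d}. ennreal (4 / (Z * real d)) * (egam ^ Suc k * F \<alpha> v e)) \<partial>Ap)
      = (\<Sum>w\<in>words. \<Sum>v\<in>{v. 2 * v \<le> d}. ennreal (4 / (Z * real d)) * (egam ^ Suc k * (\<integral>\<^sup>+\<alpha>. F \<alpha> v e \<partial>Ap)))"
    by (simp add: nn_integral_sum nn_integral_cmult)
  also have "\<dots> \<le> (\<Sum>w\<in>words. \<Sum>v\<in>{v. 2 * v \<le> d}. ennreal (4 / (Z * real d) * (gam ^ Suc k * ((3/4) ^ Lam * phi d))))"
  proof (intro sum_mono)
    fix v assume v: "v \<in> {v. 2 * v \<le> d}"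
    then have ve: "v \<le> e" using d(3,5) by simp
    have "(\<integral>\<^sup>+\<alpha>. F \<alpha> v e \<partial>Ap) \<le> ennreal (phi v)"
      using IH[of v e] v d0 ve by (simp add: bnd_def)
    also have "\<dots> \<le> ennreal ((3/4) ^ Lam * phi d)"
      using v d2 by (intro ennreal_leI phi_drop) simp
    finally have "ennreal (4 / (Z * real d)) * (egam ^ Suc k * (\<integral>\<^sup>+\<alpha>. F \<alpha> v e \<partial>Ap))
      \<le> ennreal (4 / (Z * real d)) * (egam ^ Suc k * ennreal ((3/4) ^ Lam * phi d))"
      by (intro mult_left_mono) auto
    also have "\<dots> = ennreal (4 / (Z * real d) * (gam ^ Suc k * ((3/4) ^ Lam * phi d)))"
      using gam_gt_1 phi_ge_1[of d] Z_pos
      by (simp only: ennreal_mult[symmetric] ennreal_power zero_le_power mult_nonneg_nonneg divide_nonneg_nonneg less_imp_le)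
    finally show "ennreal (4 / (Z * real d)) * (egam ^ Suc k * (\<integral>\<^sup>+\<alpha>. F \<alpha> v e \<partial>Ap))
      \<le> ennreal (4 / (Z * real d) * (gam ^ Suc k * ((3/4) ^ Lam * phi d)))" .
  qed
  also have "\<dots> = ennreal (real (card words) * (real (card {v. 2 * v \<le> d}) * (4 / (Z * real d) * (gam ^ Suc k * ((3/4) ^ Lam * phi d)))))"
  proof -
    have "0 \<le> 4 / (Z * real d) * (gam ^ Suc k * ((3/4) ^ Lam * phi d))"
      using gam_gt_1 Z_pos by (intro mult_nonneg_nonneg) auto
    then show ?thesis by (simp only: sum_ennreal_const mult_nonneg_nonneg of_nat_0_le_iff)
  qed
  also have "\<dots> \<le> ennreal (2 ^ Suc k * (real d * (4 / (Z * real d) * (gam ^ Suc k * ((3/4) ^ Lam * phi d)))))"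
  proof (intro ennreal_leI mult_mono)
    have "real (card words) \<le> real (2 ^ Suc k)" using card_words by (intro of_nat_mono)
    then show "real (card words) \<le> 2 ^ Suc k" by simp
  qed (use gam_gt_1 phi_ge_1[of d] Z_pos cardhalf in auto)
  also have "2 ^ Suc k * (real d * (4 / (Z * real d) * (gam ^ Suc k * ((3/4) ^ Lam * phi d)))) = eps_half * phi d"
    using d0 by (simp add: eps_half_def)
  finally have 2: "(\<integral>\<^sup>+\<alpha>. (\<Sum>w\<in>words. \<Sum>v\<in>{v. 2 * v \<le> d}. ennreal (4 / (Z * real d)) * (egam ^ Suc k * F \<alpha> v e)) \<partial>Ap)
     \<le> ennreal (eps_half * phi d)" .
  let ?r = "real (k * M) * (4 / (Z * real d))"
  have r: "0 \<le> ?r" "?r \<le> real (k * M) * (8 / (Z * real D0))"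
  proof -
    show "0 \<le> ?r" using Z_pos by simp
    have "0 < D0" by (simp add: D0_def)
    then have "4 / real d \<le> 8 / real D0" using d(1) d0 by (simp add: divide_simps)
    then have "4 / real d / Z \<le> 8 / real D0 / Z" using Z_pos by (intro divide_right_mono) auto
    then show "?r \<le> real (k * M) * (8 / (Z * real D0))"
      by (intro mult_left_mono) (auto simp: mult.commute)
  qed
  have "(\<integral>\<^sup>+\<alpha>. (\<Sum>w\<in>words. \<Sum>i\<in>{1..length w}. ennreal ?r * (egam ^ k * F \<alpha> (node \<alpha> d (take i w)) (d - 2 * (k * M)))) \<partial>Ap)
     = (\<Sum>w\<in>words. \<Sum>i\<in>{1..length w}. ennreal ?r * (egam ^ k * (\<integral>\<^sup>+\<alpha>. F \<alpha> (node \<alpha> d (take i w)) (d - 2 * (k * M)) \<partial>Ap)))"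
    by (simp add: nn_integral_sum nn_integral_cmult)
  also have "\<dots> \<le> (\<Sum>w\<in>words. \<Sum>i\<in>{1..k}. ennreal (?r * (gam ^ k * ?B)))"
  proof (intro sum_mono)
    fix w assume w: "w \<in> words"
    have "ennreal ?r * (egam ^ k * (\<integral>\<^sup>+\<alpha>. F \<alpha> (node \<alpha> d (take i w)) (d - 2 * (k * M)) \<partial>Ap)) \<le> ennreal (?r * (gam ^ k * ?B))"
      if i: "i \<in> {1..length w}" for i
    proof -
      have "(\<integral>\<^sup>+\<alpha>. F \<alpha> (node \<alpha> d (take i w)) (d - 2 * (k * M)) \<partial>Ap) \<le> ennreal ?B"
      proof (rule node_moment)
        show "k * M < d" using d(5) kM by linarith
        show "length (take i w) \<le> k" using w by (simp add: words_def)
        show "depends_on {..u} (\<lambda>\<alpha>. F \<alpha> u (d - 2 * (k * M)))" for u by (rule depends_on_F)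
        show "(\<integral>\<^sup>+\<alpha>. F \<alpha> u (d - 2 * (k * M)) \<partial>Ap) \<le> ennreal ?B" if "take i w \<noteq> [] \<Longrightarrow> u < d" for u
        proof -
          have "take i w \<noteq> []" using i by auto
          from that[OF this] show ?thesis
          using IH[of u "d - 2 * (k * M)"] bnd_le[of u d "d - 2 * (k * M)"]
          by (meson ennreal_leI le_diff_conv less_imp_le order_trans diff_le_self add_le_mono1 le_refl)
        qed
      qed
      then have "ennreal ?r * (egam ^ k * (\<integral>\<^sup>+\<alpha>. F \<alpha> (node \<alpha> d (take i w)) (d - 2 * (k * M)) \<partial>Ap)) \<le> ennreal ?r * (egam ^ k * ennreal ?B)"
        by (intro mult_left_mono) auto
      also have "\<dots> = ennreal (?r * (gam ^ k * ?B))"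
      proof -
        have g: "0 \<le> gam ^ k" "egam ^ k = ennreal (gam ^ k)" using gam_gt_1 by (auto simp: ennreal_power)
        show ?thesis
          unfolding ennreal_mult[OF r(1) mult_nonneg_nonneg[OF g(1) B0]] ennreal_mult[OF g(1) B0] g(2) ..
      qed
      finally show ?thesis .
    qed
    then have "(\<Sum>i\<in>{1..length w}. ennreal ?r * (egam ^ k * (\<integral>\<^sup>+\<alpha>. F \<alpha> (node \<alpha> d (take i w)) (d - 2 * (k * M)) \<partial>Ap)))
      \<le> (\<Sum>i\<in>{1..length w}. ennreal (?r * (gam ^ k * ?B)))" by (intro sum_mono)
    also have "\<dots> \<le> (\<Sum>i\<in>{1..k}. ennreal (?r * (gam ^ k * ?B)))"
      using w by (intro sum_mono2) (auto simp: words_def)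
    finally show "(\<Sum>i\<in>{1..length w}. ennreal ?r * (egam ^ k * (\<integral>\<^sup>+\<alpha>. F \<alpha> (node \<alpha> d (take i w)) (d - 2 * (k * M)) \<partial>Ap)))
      \<le> (\<Sum>i\<in>{1..k}. ennreal (?r * (gam ^ k * ?B)))" .
  qed
  also have "\<dots> = ennreal (real (card words) * (real k * (?r * (gam ^ k * ?B))))"
  proof -
    have "0 \<le> gam ^ k * ?B" using gam_gt_1 B0 by (intro mult_nonneg_nonneg) auto
    from mult_nonneg_nonneg[OF r(1) this] have "0 \<le> ?r * (gam ^ k * ?B)" .
    then show ?thesis by (simp only: sum_ennreal_const mult_nonneg_nonneg of_nat_0_le_iff card_atLeastAtMost diff_Suc_1)
  qed
  also have "\<dots> \<le> ennreal (2 ^ Suc k * (real k * ((real (k * M) * (8 / (Z * real D0))) * (gam ^ k * ?B))))"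
  proof (intro ennreal_leI)
    have g: "0 \<le> gam ^ k * ?B" using gam_gt_1 B0 by (intro mult_nonneg_nonneg) auto
    have "real (card words) \<le> real (2 ^ Suc k)" using card_words by (intro of_nat_mono)
    then have c: "real (card words) \<le> 2 ^ Suc k" by simp
    have "?r * (gam ^ k * ?B) \<le> (real (k * M) * (8 / (Z * real D0))) * (gam ^ k * ?B)"
      by (rule mult_right_mono[OF r(2) g])
    then have "real k * (?r * (gam ^ k * ?B)) \<le> real k * ((real (k * M) * (8 / (Z * real D0))) * (gam ^ k * ?B))"
      by (rule mult_left_mono) simp
    moreover have "0 \<le> real k * (?r * (gam ^ k * ?B))"
      by (rule mult_nonneg_nonneg[OF of_nat_0_le_iff mult_nonneg_nonneg[OF r(1) g]])
    ultimately show "real (card words) * (real k * (?r * (gam ^ k * ?B)))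
      \<le> 2 ^ Suc k * (real k * ((real (k * M) * (8 / (Z * real D0))) * (gam ^ k * ?B)))"
      using c by (intro mult_mono[of "real (card words)"]) simp_all
  qed
  also have "2 ^ Suc k * (real k * ((real (k * M) * (8 / (Z * real D0))) * (gam ^ k * ?B))) = eps_lose * phi d"
    by (simp add: eps_lose_def)
  finally have 3: "(\<integral>\<^sup>+\<alpha>. (\<Sum>w\<in>words. \<Sum>i\<in>{1..length w}. ennreal ?r * (egam ^ k * F \<alpha> (node \<alpha> d (take i w)) (d - 2 * (k * M)))) \<partial>Ap)
     \<le> ennreal (eps_lose * phi d)" .
  have eps0: "0 \<le> eps_short" "0 \<le> eps_half" "0 \<le> eps_lose"
    using gam_gt_1 Z_pos harm_nonneg[of "2 * (k * M)", where 'a = real] by (auto simp: eps_short_def eps_half_def eps_lose_def)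
  have "(\<integral>\<^sup>+\<alpha>. rest \<alpha> d e \<partial>Ap) \<le> ennreal (eps_short * phi d) + ennreal (eps_half * phi d) + ennreal (eps_lose * phi d)"
    unfolding rest_def
    by (subst nn_integral_add, simp, simp, subst nn_integral_add, simp, simp) (intro add_mono 1 2 3)
  also have "\<dots> = ennreal ((eps_short + eps_half + eps_lose) * phi d)"
    using eps0 phi_ge_1[of d] by (simp add: ennreal_plus[symmetric] distrib_right del: ennreal_plus)
  finally show ?thesis .
qed

end

lemma add_three_mono:
  fixes x :: "'a :: ordered_ab_semigroup_add"
  assumes "v \<le> a + b + x" "x \<le> r + t + c"
  shows "v \<le> (a + r) + (b + t) + c"
proof -
  have "v \<le> a + b + (r + t + c)" using assms(1) add_left_mono[OF assms(2)] by (rule order_trans)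
  then show ?thesis by (simp add: add_ac)
qed

section \<open>Induction steps below \<open>D0\<close> and within a stage\<close>

context routing
begin

lemma phi_AL_le:
  assumes "d \<le> D0" "a < M" "M \<le> d"
  shows "phi (d - Suc a) \<le> phi d * exp (- (8 * (real a + 1) / real M))"
proof -
  have "real (d - Suc a) = real d - (real a + 1)" using assms by linarith
  then have "8 * real (min (d - Suc a) D0) / real M = 8 * real (min d D0) / real M + - (8 * (real a + 1) / real M)"
    using assms by (simp add: right_diff_distrib diff_divide_distrib del: of_nat_diff)
  then have "exp (8 * real (min (d - Suc a) D0) / real M) = exp (8 * real (min d D0) / real M) * exp (- (8 * (real a + 1) / real M))"
    by (simp only: exp_add)
  moreover have "(real (d - Suc a) + 1) ^ Lam \<le> (real d + 1) ^ Lam" by (intro power_mono) auto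
  ultimately show ?thesis by (simp add: phi_def mult_left_mono mult_ac)
qed

text \<open>Apart from planted targets there are three moves, each of which advances at least as far
  as one of the AL-links; by \<open>avg_exp_8\<close> each costs at most \<open>phi d / 8\<close>.
  Nothing is assumed about inspected nodes, so \<open>e\<close> is arbitrary.\<close>

lemma wild_moment:
  assumes d: "D1 \<le> d" "d < D0" "d < N" and eps: "eps_plant \<le> 1 / 2"
    and IH: "\<And>x. x < d \<Longrightarrow> (\<integral>\<^sup>+\<alpha>. F \<alpha> x e \<partial>Ap) \<le> ennreal (phi x)"
  shows "(\<integral>\<^sup>+\<alpha>. F \<alpha> d e \<partial>Ap) \<le> ennreal (phi d)"
proof -
  have kM: "0 < k * M" "M \<le> k * M" using k_pos M_pos by auto
  have d8: "8 * (k * M) \<le> d" "0 < d" "M \<le> d" using d(1) D1_ge kM by linarith+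
  let ?X = "\<lambda>a. phi d * exp (- (8 * (real a + 1) / real M))"
  have phiX: "phi (d - Suc a) \<le> ?X a" if "a < M" for a
    using phi_AL_le[of d a] d that d8 by simp
  have IHX: "(\<integral>\<^sup>+\<alpha>. F \<alpha> (d - Suc a) e \<partial>Ap) \<le> ennreal (?X a)" if "a < M" for a
  proof -
    have "(\<integral>\<^sup>+\<alpha>. F \<alpha> (d - Suc a) e \<partial>Ap) \<le> ennreal (phi (d - Suc a))" by (rule IH) (use d8 in simp)
    also have "\<dots> \<le> ennreal (?X a)" by (rule ennreal_leI[OF phiX[OF that]])
    finally show ?thesis .
  qed
  have avg: "(\<Sum>a<M. ?X a) / real M \<le> phi d / 8"
    using mult_left_mono[OF avg_exp_8 phi_nonneg[of d]] by (simp add: sum_distrib_left[symmetric])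
  have 1: "(\<integral>\<^sup>+\<alpha>. F \<alpha> (d - Suc (fst (\<alpha> d))) e \<partial>Ap) \<le> ennreal (phi d / 8)"
  proof -
    have "(\<integral>\<^sup>+\<alpha>. F \<alpha> (d - Suc (fst (\<alpha> d))) e \<partial>Ap) = (\<integral>\<^sup>+ab. (\<integral>\<^sup>+\<alpha>. F \<alpha> (d - Suc (fst ab)) e \<partial>Ap) \<partial>ALd)"
      using d8 by (intro nn_integral_Ap_node[OF d(3), of "\<lambda>\<alpha> ab. F \<alpha> (d - Suc (fst ab)) e"] F_upd) auto
    also have "\<dots> \<le> (\<integral>\<^sup>+ab. ennreal (?X (fst ab)) \<partial>ALd)"
      by (intro nn_integral_mono_AE AE_pmfI IHX) (auto simp: set_ALd)
    also have "\<dots> \<le> ennreal (phi d / 8)"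
      using avg by (subst nn_integral_ALd) (auto intro: ennreal_leI)
    finally show ?thesis .
  qed
  have 2: "(\<integral>\<^sup>+\<alpha>. F \<alpha> (d - Suc (snd (\<alpha> d))) e \<partial>Ap) \<le> ennreal (phi d / 8)"
  proof -
    have "(\<integral>\<^sup>+\<alpha>. F \<alpha> (d - Suc (snd (\<alpha> d))) e \<partial>Ap) = (\<integral>\<^sup>+ab. (\<integral>\<^sup>+\<alpha>. F \<alpha> (d - Suc (snd ab)) e \<partial>Ap) \<partial>ALd)"
      using d8 by (intro nn_integral_Ap_node[OF d(3), of "\<lambda>\<alpha> ab. F \<alpha> (d - Suc (snd ab)) e"] F_upd) auto
    also have "\<dots> \<le> (\<integral>\<^sup>+ab. ennreal (?X (snd ab)) \<partial>ALd)"
      by (intro nn_integral_mono_AE AE_pmfI IHX) (auto simp: set_ALd)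
    also have "\<dots> \<le> ennreal (phi d / 8)"
      using avg by (subst nn_integral_ALd) (auto intro: ennreal_leI)
    finally show ?thesis .
  qed
  have 3: "(\<integral>\<^sup>+\<alpha>. (\<integral>\<^sup>+v. of_bool (v \<le> far_AL \<alpha> d) * F \<alpha> v e \<partial>Kd d) \<partial>Ap) \<le> ennreal (phi d / 8)"
  proof -
    let ?G = "\<lambda>\<alpha> ab. \<integral>\<^sup>+v. of_bool (v \<le> far d ab) * F \<alpha> v e \<partial>Kd d"
    have "(\<integral>\<^sup>+\<alpha>. (\<integral>\<^sup>+v. of_bool (v \<le> far_AL \<alpha> d) * F \<alpha> v e \<partial>Kd d) \<partial>Ap) = (\<integral>\<^sup>+\<alpha>. ?G \<alpha> (\<alpha> d) \<partial>Ap)"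
      by (simp add: far_AL_far)
    also have "\<dots> = (\<integral>\<^sup>+ab. (\<integral>\<^sup>+\<alpha>. ?G \<alpha> ab \<partial>Ap) \<partial>ALd)"
    proof (rule nn_integral_Ap_node[OF d(3)])
      fix \<alpha> ab ab'
      have "of_bool (v \<le> far d ab) * F (\<alpha>(d := ab')) v e = of_bool (v \<le> far d ab) * F \<alpha> v e" for v
        using far_less[OF d8(2), of ab] by (cases "v \<le> far d ab") (auto simp: F_upd)
      then show "?G (\<alpha>(d := ab')) ab = ?G \<alpha> ab" by simp
    qed
    also have "\<dots> \<le> (\<integral>\<^sup>+ab. ennreal (?X (fst ab)) \<partial>ALd)"
    proof (intro nn_integral_mono_AE AE_pmfI)
      fix ab assume "ab \<in> set_pmf ALd"
      then have a: "fst ab < M" by (auto simp: set_ALd)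
      have "(\<integral>\<^sup>+\<alpha>. ?G \<alpha> ab \<partial>Ap) = (\<integral>\<^sup>+v. (\<integral>\<^sup>+\<alpha>. of_bool (v \<le> far d ab) * F \<alpha> v e \<partial>Ap) \<partial>Kd d)"
        by (rule nn_integral_pmf_swap)
      also have "\<dots> \<le> ennreal (?X (fst ab))"
      proof (rule nn_integral_pmf_le_const)
        fix v
        show "(\<integral>\<^sup>+\<alpha>. of_bool (v \<le> far d ab) * F \<alpha> v e \<partial>Ap) \<le> ennreal (?X (fst ab))"
        proof (cases "v \<le> far d ab")
          case True
          then have "v < d" "v \<le> d - Suc (fst ab)" using far_less[OF d8(2), of ab] by (auto simp: far_def)
          then have "phi v \<le> ?X (fst ab)" using phi_mono[of v "d - Suc (fst ab)"] phiX[OF a] by linarith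
          then show ?thesis using IH[OF \<open>v < d\<close>] True by (simp add: ennreal_leI order_trans)
        qed simp
      qed
      finally show "(\<integral>\<^sup>+\<alpha>. ?G \<alpha> ab \<partial>Ap) \<le> ennreal (?X (fst ab))" .
    qed
    also have "\<dots> \<le> ennreal (phi d / 8)"
      using avg by (subst nn_integral_ALd) (auto intro: ennreal_leI)
    finally show ?thesis .
  qed
  have 4: "egam * (\<integral>\<^sup>+\<alpha>. (\<Sum>v\<in>planted_range d. F \<alpha> v e) \<partial>Ap) \<le> ennreal (eps_plant * phi d)"
    by (rule planted_moment[OF d8(1)]) (use planted_range_drop(2)[OF d8(1)] IH in auto)
  have "(\<integral>\<^sup>+\<alpha>. F \<alpha> d e \<partial>Ap) \<le> (\<integral>\<^sup>+\<alpha>. egam * (F \<alpha> (d - Suc (fst (\<alpha> d))) e + F \<alpha> (d - Suc (snd (\<alpha> d))) e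
      + (\<integral>\<^sup>+v. of_bool (v \<le> far_AL \<alpha> d) * F \<alpha> v e \<partial>Kd d) + (\<Sum>v\<in>planted_range d. F \<alpha> v e)) \<partial>Ap)"
    by (intro nn_integral_mono_AE AE_pmfI F_wild[OF d(1,3)] bounded_AL_set)
  also have "\<dots> = egam * ((\<integral>\<^sup>+\<alpha>. F \<alpha> (d - Suc (fst (\<alpha> d))) e \<partial>Ap) + (\<integral>\<^sup>+\<alpha>. F \<alpha> (d - Suc (snd (\<alpha> d))) e \<partial>Ap)
      + (\<integral>\<^sup>+\<alpha>. (\<integral>\<^sup>+v. of_bool (v \<le> far_AL \<alpha> d) * F \<alpha> v e \<partial>Kd d) \<partial>Ap)) + egam * (\<integral>\<^sup>+\<alpha>. (\<Sum>v\<in>planted_range d. F \<alpha> v e) \<partial>Ap)"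
    by (simp add: nn_integral_cmult nn_integral_add distrib_left)
  also have "\<dots> \<le> egam * (ennreal (phi d / 8) + ennreal (phi d / 8) + ennreal (phi d / 8)) + ennreal (eps_plant * phi d)"
    by (intro add_mono mult_left_mono 1 2 3 4) auto
  also have "\<dots> = ennreal ((gam * 3 / 8 + eps_plant) * phi d)"
  proof -
    have "0 \<le> eps_plant" using gam_gt_1 by (simp add: eps_plant_def)
    have "ennreal (phi d / 8) + ennreal (phi d / 8) + ennreal (phi d / 8) = ennreal (phi d * 3 / 8)"
      by (simp flip: ennreal_plus)
    then have "egam * (ennreal (phi d / 8) + ennreal (phi d / 8) + ennreal (phi d / 8)) = ennreal (gam * (phi d * 3 / 8))"
      using gam_gt_1 by (simp only:) (subst ennreal_mult, auto)
    also have "\<dots> + ennreal (eps_plant * phi d) = ennreal (gam * (phi d * 3 / 8) + eps_plant * phi d)"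
      using gam_gt_1 \<open>0 \<le> eps_plant\<close> by (intro ennreal_plus[symmetric]) auto
    finally show ?thesis by (simp add: algebra_simps)
  qed
  also have "\<dots> \<le> ennreal (phi d)"
    using mult_right_mono[of "gam * 3 / 8 + eps_plant" 1 "phi d"] eps by (intro ennreal_leI) (simp add: gam_def)
  finally show ?thesis .
qed

lemma eps_nonneg: "0 \<le> eps_plant" "0 \<le> eps_short" "0 \<le> eps_half" "0 \<le> eps_lose"
  using gam_gt_1 Z_pos harm_nonneg[of "2 * (k * M)", where 'a = real]
  by (auto simp: eps_plant_def eps_short_def eps_half_def eps_lose_def)

lemma D0_D1: "2 * D1 + 6 * (k * M) \<le> D0" using D0_ge by (simp add: D0_def)

text \<open>The drift beats the charge with a margin,
  \<open>gam * (1 - theta / 3) \<le> 998 / 1000\<close>, and this margin absorbs the planted links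
  and \<open>rest\<close>.\<close>

lemma stage_moment:
  assumes d: "D0 \<le> d" "d < N" "e < d" "d \<le> e + 2 * (k * M)"
    and eps: "eps_plant + eps_short + eps_half + eps_lose \<le> 1 / 1000"
    and IH: "\<And>x e. x < d \<Longrightarrow> x \<le> e + 2 * (k * M) \<Longrightarrow> (\<integral>\<^sup>+\<alpha>. F \<alpha> x e \<partial>Ap) \<le> ennreal (bnd x e)"
  shows "(\<integral>\<^sup>+\<alpha>. F \<alpha> d e \<partial>Ap) \<le> ennreal (bnd d e)"
proof -
  have kM: "0 < k * M" "M \<le> k * M" using k_pos M_pos by auto
  have d8: "8 * (k * M) \<le> d" "0 < d" "M < d" "D1 + k * M \<le> d" using d(1) D0_D1 D1_ge kM by linarith+
  have IHe: "(\<integral>\<^sup>+\<alpha>. F \<alpha> x e \<partial>Ap) \<le> ennreal (bnd x e)" if "x < d" for x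
    by (rule IH) (use that d in auto)
  have 1: "(\<integral>\<^sup>+\<alpha>. ahead \<alpha> d e \<partial>Ap) \<le> ennreal (bnd d e * (1 - theta / 3))"
    by (rule ahead_moment[OF d(3,4,2) d8(3) IHe])
  have 2: "egam * (\<integral>\<^sup>+\<alpha>. (\<Sum>v\<in>planted_range d. F \<alpha> v e) \<partial>Ap) \<le> ennreal (eps_plant * phi d)"
  proof (rule planted_moment[OF d8(1)])
    fix v assume v: "v \<in> planted_range d"
    then have "v < d" by (rule planted_range_drop(2)[OF d8(1)])
    moreover have "v \<le> e" using v d8(1) d(4) by (auto simp: planted_range_def)
    ultimately show "(\<integral>\<^sup>+\<alpha>. F \<alpha> v e \<partial>Ap) \<le> ennreal (phi v)" using IHe[of v] by (simp add: bnd_def)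
  qed
  have 3: "(\<integral>\<^sup>+\<alpha>. rest \<alpha> d e \<partial>Ap) \<le> ennreal ((eps_short + eps_half + eps_lose) * phi d)"
    by (rule rest_moment[OF _ d(2,4,3) d8(1) IH]) (use d in auto)
  have "(\<integral>\<^sup>+\<alpha>. F \<alpha> d e \<partial>Ap) \<le> (\<integral>\<^sup>+\<alpha>. egam * ahead \<alpha> d e + egam * (\<Sum>v\<in>planted_range d. F \<alpha> v e) + rest \<alpha> d e \<partial>Ap)"
    by (intro nn_integral_mono_AE AE_pmfI F_step[OF d8(4) d(2,4)] bounded_AL_set)
  also have "\<dots> = egam * (\<integral>\<^sup>+\<alpha>. ahead \<alpha> d e \<partial>Ap) + egam * (\<integral>\<^sup>+\<alpha>. (\<Sum>v\<in>planted_range d. F \<alpha> v e) \<partial>Ap) + (\<integral>\<^sup>+\<alpha>. rest \<alpha> d e \<partial>Ap)"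
    by (simp add: nn_integral_cmult nn_integral_add)
  also have "\<dots> \<le> egam * ennreal (bnd d e * (1 - theta / 3)) + ennreal (eps_plant * phi d) + ennreal ((eps_short + eps_half + eps_lose) * phi d)"
    by (intro add_mono mult_left_mono 1 2 3) auto
  also have "\<dots> = ennreal (gam * (bnd d e * (1 - theta / 3)) + eps_plant * phi d + (eps_short + eps_half + eps_lose) * phi d)"
  proof -
    have X: "0 \<le> bnd d e * (1 - theta / 3)" using bnd_nonneg[of d e] by (simp add: theta_def)
    have "egam * ennreal (bnd d e * (1 - theta / 3)) = ennreal (gam * (bnd d e * (1 - theta / 3)))"
      by (rule ennreal_mult[symmetric, OF _ X]) (use gam_gt_1 in simp)
    moreover have "0 \<le> gam * (bnd d e * (1 - theta / 3))" by (rule mult_nonneg_nonneg[OF _ X]) (use gam_gt_1 in simp)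
    moreover have "0 \<le> eps_plant * phi d" "0 \<le> (eps_short + eps_half + eps_lose) * phi d" using eps_nonneg by auto
    ultimately show ?thesis by (simp only: ennreal_plus[symmetric] add_nonneg_nonneg)
  qed
  also have "\<dots> \<le> ennreal (bnd d e)"
  proof (intro ennreal_leI)
    have "(eps_plant + eps_short + eps_half + eps_lose) * phi d \<le> 1 / 1000 * bnd d e"
      using eps phi_le_bnd[OF d(3)] eps_nonneg by (intro mult_mono) auto
    moreover have "gam * (bnd d e * (1 - theta / 3)) \<le> 998 / 1000 * bnd d e"
      using bnd_nonneg[of d e] by (simp add: gam_def theta_def)
    ultimately show "gam * (bnd d e * (1 - theta / 3)) + eps_plant * phi d + (eps_short + eps_half + eps_lose) * phi d \<le> bnd d e"
      using bnd_nonneg[of d e] by (simp add: algebra_simps)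
  qed
  finally show ?thesis .
qed

section \<open>The path that always takes the longer AL-link\<close>

primrec path :: "(nat \<Rightarrow> nat \<times> nat) \<Rightarrow> nat \<Rightarrow> nat \<Rightarrow> nat" where
  "path \<alpha> d 0 = d"
| "path \<alpha> d (Suc j) = far_AL \<alpha> (path \<alpha> d j)"

lemma path_le: "path \<alpha> d j \<le> d - j"
proof (induction j)
  case (Suc j)
  then show ?case using far_AL_le[of \<alpha> "path \<alpha> d j"] by simp
qed simp

lemma path_antimono: "i \<le> j \<Longrightarrow> path \<alpha> d j \<le> path \<alpha> d i"
proof (induction j)
  case (Suc j)
  then show ?case using far_AL_le[of \<alpha> "path \<alpha> d j"] by (cases "i = Suc j") auto
qed simp

lemma path_node: "\<exists>w. length w = j \<and> (\<forall>i\<le>j. path \<alpha> d i = node \<alpha> d (take i w))"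
proof (induction j)
  case (Suc j)
  then obtain w where w: "length w = j" "\<forall>i\<le>j. path \<alpha> d i = node \<alpha> d (take i w)" by blast
  obtain b where b: "far_AL \<alpha> (path \<alpha> d j) = path \<alpha> d j - Suc (pick b (\<alpha> (path \<alpha> d j)))"
    using far_AL_pick by blast
  have "path \<alpha> d i = node \<alpha> d (take i (w @ [b]))" if "i \<le> Suc j" for i
  proof (cases "i = Suc j")
    case True
    then show ?thesis using w b by (simp add: node_append)
  next
    case False
    then show ?thesis using w that by simp
  qed
  then show ?case using w by (intro exI[of _ "w @ [b]"]) auto
qed simp

lemma path_cong_above:
  assumes "\<And>i. u < i \<Longrightarrow> \<alpha> i = \<alpha>' i" "u < path \<alpha> d j \<or> u \<le> path \<alpha> d (Suc j)" "0 < u"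
  shows "path \<alpha>' d j = path \<alpha> d j" "u < path \<alpha> d j"
proof -
  have step: "u < path \<alpha> d j" if "u \<le> path \<alpha> d (Suc j)" for j
    using that far_AL_le[of \<alpha> "path \<alpha> d j"] assms(3) by simp
  have "path \<alpha>' d j = path \<alpha> d j" if "u \<le> path \<alpha> d j" for j
    using that
  proof (induction j)
    case (Suc j)
    have u: "u < path \<alpha> d j" using step Suc.prems by blast
    then have "path \<alpha>' d j = path \<alpha> d j" using Suc.IH by simp
    then show ?case using assms(1)[OF u] by (simp add: far_AL_def)
  qed simp
  moreover show "u < path \<alpha> d j" using assms(2) step by blast
  ultimately show "path \<alpha>' d j = path \<alpha> d j" by simp
qed

lemma path_eq_iff_above:
  assumes "\<And>i. u < i \<Longrightarrow> \<alpha> i = \<alpha>' i" "0 < u" "u \<le> v"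
  shows "path \<alpha> d j = v \<longleftrightarrow> path \<alpha>' d j = v"
proof -
  have *: "path \<alpha>' d j = path \<alpha> d j" if "u \<le> path \<alpha> d j" "\<And>i. u < i \<Longrightarrow> \<alpha> i = \<alpha>' i" for \<alpha> \<alpha>'
  proof (cases j)
    case (Suc i)
    have u: "path \<alpha>' d i = path \<alpha> d i" "u < path \<alpha> d i"
      using path_cong_above[of u \<alpha> \<alpha>' d i] that assms(2) Suc by auto
    then show ?thesis using that(2)[of "path \<alpha> d i"] Suc by (simp add: far_AL_def)
  qed simp
  show ?thesis using *[of \<alpha> \<alpha>'] *[of \<alpha>' \<alpha>] assms by auto
qed

definition free :: "(nat \<Rightarrow> nat) \<Rightarrow> (nat \<Rightarrow> nat \<times> nat) \<Rightarrow> nat \<Rightarrow> bool" where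
  "free \<kappa> \<alpha> d \<longleftrightarrow> (\<forall>w\<in>words. d < 2 * \<kappa> (node \<alpha> d w))"

text \<open>As long as no word is a candidate, a greedy step follows \<open>path\<close> unless the
  K-link leads farther than both AL-links. The message is thus on a path determined by the AL-links
  alone until it jumps or passes \<open>e\<close>. The absence of candidates is kept apart, in
  \<open>free\<close>.\<close>

definition onpath :: "(nat \<Rightarrow> nat) \<Rightarrow> (nat \<Rightarrow> nat \<times> nat) \<Rightarrow> nat \<Rightarrow> nat \<Rightarrow> nat \<Rightarrow> bool" where
  "onpath \<kappa> \<alpha> d e j \<longleftrightarrow> (\<forall>i<j. e < path \<alpha> d (Suc i) \<and> path \<alpha> d (Suc i) \<le> \<kappa> (path \<alpha> d i))"

definition exit_to :: "(nat \<Rightarrow> nat) \<Rightarrow> (nat \<Rightarrow> nat \<times> nat) \<Rightarrow> nat \<Rightarrow> nat \<Rightarrow> nat \<Rightarrow> bool" where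
  "exit_to \<kappa> \<alpha> d j v \<longleftrightarrow> (\<kappa> (path \<alpha> d j) = v \<and> v < path \<alpha> d (Suc j)) \<or>
     (path \<alpha> d (Suc j) = v \<and> v \<le> \<kappa> (path \<alpha> d j))"

definition rest0 :: "(nat \<Rightarrow> nat) \<Rightarrow> (nat \<Rightarrow> nat \<times> nat) \<Rightarrow> nat \<Rightarrow> nat \<Rightarrow> ennreal" where
  "rest0 \<kappa> \<alpha> d e = egam * (of_bool (e < \<kappa> d \<and> \<kappa> d < d) * val \<kappa> \<alpha> (\<kappa> d)) + halving \<kappa> \<alpha> d + losing \<kappa> \<alpha> d"

lemma onpath_less: "onpath \<kappa> \<alpha> d e j \<Longrightarrow> e < d \<Longrightarrow> e < path \<alpha> d j"
  by (cases j) (auto simp: onpath_def)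

text \<open>Iterates \<open>val_one_step\<close> along \<open>path\<close>, this time retaining the
  absence of candidates: it becomes unlikely as the path grows, which makes late exits rare. The
  error terms keep only the weaker condition \<open>e < path \<alpha> d j\<close>, which depends on
  the AL-links alone.\<close>

lemma val_unroll:
  assumes \<alpha>: "bounded_AL M \<alpha>" and e: "D1 + k * M \<le> e" "e < d"
  shows "val \<kappa> \<alpha> d \<le> (\<Sum>j<n. egam ^ j * (of_bool (e < path \<alpha> d j) * rest0 \<kappa> \<alpha> (path \<alpha> d j) e))
     + (\<Sum>j<n. \<Sum>v\<le>e. egam ^ Suc j * of_bool (onpath \<kappa> \<alpha> d e j \<and> (\<forall>i\<le>j. free \<kappa> \<alpha> (path \<alpha> d i)) \<and> exit_to \<kappa> \<alpha> d j v) * val \<kappa> \<alpha> v)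
     + egam ^ n * (of_bool (onpath \<kappa> \<alpha> d e n \<and> (\<forall>i<n. free \<kappa> \<alpha> (path \<alpha> d i))) * val \<kappa> \<alpha> (path \<alpha> d n))"
proof (induction n)
  case 0
  then show ?case by (simp add: onpath_def)
next
  case (Suc n)
  let ?x = "path \<alpha> d n" and ?y = "path \<alpha> d (Suc n)"
  let ?A = "onpath \<kappa> \<alpha> d e n \<and> (\<forall>i<n. free \<kappa> \<alpha> (path \<alpha> d i))"
  let ?T = "\<Sum>v\<le>e. egam ^ Suc n * of_bool (onpath \<kappa> \<alpha> d e n \<and> (\<forall>i\<le>n. free \<kappa> \<alpha> (path \<alpha> d i)) \<and> exit_to \<kappa> \<alpha> d n v) * val \<kappa> \<alpha> v"
  let ?R = "egam ^ n * (of_bool (e < ?x) * rest0 \<kappa> \<alpha> ?x e)"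
  let ?B = "egam ^ Suc n * (of_bool (onpath \<kappa> \<alpha> d e (Suc n) \<and> (\<forall>i<Suc n. free \<kappa> \<alpha> (path \<alpha> d i))) * val \<kappa> \<alpha> ?y)"
  have "egam ^ n * (of_bool ?A * val \<kappa> \<alpha> ?x) \<le> ?R + ?T + ?B"
  proof (cases ?A)
    case True
    then have ex: "e < ?x" using onpath_less[of \<kappa> \<alpha> d e n] e by blast
    have x: "D1 + k * M \<le> ?x" "0 < ?x" using ex e by linarith+
    have fr: "(\<forall>i\<le>n. free \<kappa> \<alpha> (path \<alpha> d i)) \<longleftrightarrow> free \<kappa> \<alpha> ?x" "(\<forall>i<Suc n. free \<kappa> \<alpha> (path \<alpha> d i)) \<longleftrightarrow> free \<kappa> \<alpha> ?x"
      using True by (auto simp: le_less less_Suc_eq)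
    have op: "onpath \<kappa> \<alpha> d e (Suc n) \<longleftrightarrow> e < ?y \<and> ?y \<le> \<kappa> ?x"
      using True by (auto simp: onpath_def less_Suc_eq)
    have "of_bool (\<kappa> ?x < ?y \<and> \<kappa> ?x \<le> e) * val \<kappa> \<alpha> (\<kappa> ?x) + of_bool (?y \<le> \<kappa> ?x) * val \<kappa> \<alpha> ?y
      \<le> (\<Sum>v\<le>e. of_bool (exit_to \<kappa> \<alpha> d n v) * val \<kappa> \<alpha> v) + of_bool (e < ?y \<and> ?y \<le> \<kappa> ?x) * val \<kappa> \<alpha> ?y"
    proof -
      have mem: "val \<kappa> \<alpha> u \<le> (\<Sum>v\<le>e. of_bool (exit_to \<kappa> \<alpha> d n v) * val \<kappa> \<alpha> v)" if "u \<le> e" "exit_to \<kappa> \<alpha> d n u" for u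
        using member_le_sum[of u "{..e}" "\<lambda>v. of_bool (exit_to \<kappa> \<alpha> d n v) * val \<kappa> \<alpha> v"] that by simp
      show ?thesis
      proof (cases "\<kappa> ?x < ?y")
        case True
        then show ?thesis using mem[of "\<kappa> ?x"] by (cases "\<kappa> ?x \<le> e") (auto simp: exit_to_def add_increasing2)
      next
        case False
        then show ?thesis using mem[of ?y] by (cases "?y \<le> e") (auto simp: exit_to_def add_increasing2)
      qed
    qed
    then have J: "of_bool (free \<kappa> \<alpha> ?x) * (egam * (of_bool (\<kappa> ?x < ?y \<and> \<kappa> ?x \<le> e) * val \<kappa> \<alpha> (\<kappa> ?x) + of_bool (?y \<le> \<kappa> ?x) * val \<kappa> \<alpha> ?y))
      \<le> of_bool (free \<kappa> \<alpha> ?x) * (egam * ((\<Sum>v\<le>e. of_bool (exit_to \<kappa> \<alpha> d n v) * val \<kappa> \<alpha> v) + of_bool (e < ?y \<and> ?y \<le> \<kappa> ?x) * val \<kappa> \<alpha> ?y))"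
      by (intro mult_left_mono) auto
    have "val \<kappa> \<alpha> ?x \<le> of_bool (free \<kappa> \<alpha> ?x) * (egam * (of_bool (\<kappa> ?x < ?y \<and> \<kappa> ?x \<le> e) * val \<kappa> \<alpha> (\<kappa> ?x) + of_bool (?y \<le> \<kappa> ?x) * val \<kappa> \<alpha> ?y))
        + rest0 \<kappa> \<alpha> ?x e"
      using val_one_step[OF x \<alpha>, of \<kappa> e] by (simp add: free_def rest0_def)
    also have "\<dots> \<le> of_bool (free \<kappa> \<alpha> ?x) * (egam * ((\<Sum>v\<le>e. of_bool (exit_to \<kappa> \<alpha> d n v) * val \<kappa> \<alpha> v) + of_bool (e < ?y \<and> ?y \<le> \<kappa> ?x) * val \<kappa> \<alpha> ?y)) + rest0 \<kappa> \<alpha> ?x e"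
      by (intro add_right_mono J)
    finally have "egam ^ n * val \<kappa> \<alpha> ?x \<le> egam ^ n * \<dots>" by (rule mult_left_mono) simp
    also have "\<dots> = ?R + ?T + ?B"
    proof (cases "free \<kappa> \<alpha> ?x")
      case fx: True
      define S where "S = (\<Sum>v\<le>e. of_bool (exit_to \<kappa> \<alpha> d n v) * val \<kappa> \<alpha> v)"
      have "?T = (\<Sum>v\<le>e. egam ^ Suc n * (of_bool (exit_to \<kappa> \<alpha> d n v) * val \<kappa> \<alpha> v))"
        using True fx by (intro sum.cong) (auto simp: fr mult.assoc)
      then have T: "?T = egam ^ Suc n * S" by (simp only: S_def sum_distrib_left)
      show ?thesis unfolding T unfolding fr op S_def[symmetric]
        using ex fx by (simp add: distrib_left mult_ac add_ac)
    next
      case False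
      then have "?T = 0" "?B = 0" using fr by auto
      then show ?thesis using False ex by simp
    qed
    finally show ?thesis using True by simp
  next
    case False
    then have *: "of_bool ?A = (0::ennreal)" by simp
    show ?thesis unfolding * by (simp only: mult_zero_left mult_zero_right zero_le)
  qed
  from add_three_mono[OF Suc.IH this] show ?case unfolding sum.lessThan_Suc .
qed

end

section \<open>Collisions of AL-paths\<close>

lemma card_le_card_image_plus_collisions:
  assumes "finite W"
  shows "card W \<le> card (f ` W) + card {p \<in> W \<times> W. fst p \<noteq> snd p \<and> f (fst p) = f (snd p)}"
proof -
  let ?C = "{p \<in> W \<times> W. fst p \<noteq> snd p \<and> f (fst p) = f (snd p)}"
  have fin: "finite ?C" using assms by simp
  have "W \<subseteq> inv_into W f ` f ` W \<union> fst ` ?C"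
  proof
    fix a assume a: "a \<in> W"
    let ?b = "inv_into W f (f a)"
    have b: "?b \<in> W" "f ?b = f a" using a by (auto intro: inv_into_into f_inv_into_f)
    show "a \<in> inv_into W f ` f ` W \<union> fst ` ?C"
    proof (cases "a = ?b")
      case True
      then show ?thesis using a by blast
    next
      case False
      then have "(a, ?b) \<in> ?C" using a b by simp
      then have "fst (a, ?b) \<in> fst ` ?C" by (rule imageI)
      then show ?thesis by simp
    qed
  qed
  then have "card W \<le> card (inv_into W f ` f ` W \<union> fst ` ?C)"
    using assms fin by (intro card_mono) auto
  also have "\<dots> \<le> card (inv_into W f ` f ` W) + card (fst ` ?C)" by (rule card_Un_le)
  also have "\<dots> \<le> card (f ` W) + card ?C"
    using assms fin by (intro add_mono card_image_le) auto
  finally show ?thesis .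
qed

context routing
begin

lemma ALd_pick: "(\<integral>\<^sup>+ab. of_bool (pick b ab = c) \<partial>ALd) \<le> ennreal (1 / real M)"
proof -
  have s: "(\<Sum>a<M. of_bool (a = c)) \<le> (1::real)" by (simp add: of_bool_def sum.delta)
  have "(\<integral>\<^sup>+ab. of_bool (pick b ab = c) \<partial>ALd) = ennreal ((\<Sum>a<M. of_bool (a = c)) / real M)"
    using nn_integral_ALd[of "\<lambda>a. of_bool (a = c)"] by (cases b) (simp_all add: pick_def of_bool_def if_distrib[of ennreal] cong: if_cong)
  also have "\<dots> \<le> ennreal (1 / real M)" using s by (intro ennreal_leI divide_right_mono) auto
  finally show ?thesis .
qed

lemma ALd_twins: "(\<integral>\<^sup>+ab. of_bool (fst ab = snd ab) \<partial>ALd) \<le> ennreal (1 / real M)"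
proof -
  have "(\<integral>\<^sup>+ab. of_bool (fst ab = snd ab) \<partial>ALd)
      = (\<integral>\<^sup>+a. (\<integral>\<^sup>+b. of_bool (a = b) \<partial>pmf_of_set {..<M}) \<partial>pmf_of_set {..<M})"
    by (simp add: ALd_def nn_integral_pair_pmf')
  also have "\<dots> \<le> ennreal (1 / real M)"
  proof (rule nn_integral_pmf_le_const)
    fix a
    show "(\<integral>\<^sup>+b. of_bool (a = b) \<partial>pmf_of_set {..<M}) \<le> ennreal (1 / real M)"
      using ALd_pick[of False a] by (simp add: ALd_def pick_def nn_integral_pair_pmf' measure_pmf.emeasure_space_1 eq_commute[of a])
  qed
  finally show ?thesis .
qed

text \<open>Fix everything but the AL-links at \<open>x = node \<alpha> d u'\<close>, the parent
  closer to the target. The other word, including its last letter, has read only links above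
  \<open>x\<close>, so one uniform value has to hit a prescribed number, with probability at most
  \<open>1 / M\<close>. The length bound keeps \<open>x\<close> above \<open>M\<close>, where
  subtraction is not truncated.\<close>

lemma later_parent_collision:
  assumes d: "l * M < d" "d < N" and u': "Suc (length u') \<le> l"
  shows "(\<integral>\<^sup>+\<alpha>. of_bool (node \<alpha> d u' < node \<alpha> d u \<and> node \<alpha> d (u @ [b]) = node \<alpha> d (u' @ [b'])) \<partial>Ap)
    \<le> ennreal (1 / real M) * (\<integral>\<^sup>+\<alpha>. of_bool (node \<alpha> d u' < node \<alpha> d u) \<partial>Ap)"
proof -
  let ?C = "\<lambda>x \<alpha>. node \<alpha> d u' = x \<and> x < node \<alpha> d u"
  let ?U = "{x. M < x \<and> x \<le> d}"
  have fin: "finite ?U" by simp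
  have big: "node \<alpha> d u' \<in> ?U" if "bounded_AL M \<alpha>" for \<alpha>
  proof -
    have "M + length u' * M \<le> l * M" using mult_le_mono1[OF u', of M] by simp
    then show ?thesis using node_ge[OF that, of d u'] node_le[of \<alpha> d u'] d by simp
  qed
  have "(\<integral>\<^sup>+\<alpha>. of_bool (node \<alpha> d u' < node \<alpha> d u \<and> node \<alpha> d (u @ [b]) = node \<alpha> d (u' @ [b'])) \<partial>Ap)
     \<le> (\<integral>\<^sup>+\<alpha>. (\<Sum>x\<in>?U. of_bool (?C x \<alpha> \<and> node \<alpha> d (u @ [b]) = x - Suc (pick b' (\<alpha> x)))) \<partial>Ap)"
  proof (intro nn_integral_mono_AE AE_pmfI)
    fix \<alpha> assume "\<alpha> \<in> set_pmf Ap"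
    from big[OF bounded_AL_set[OF this]] show "of_bool (node \<alpha> d u' < node \<alpha> d u \<and> node \<alpha> d (u @ [b]) = node \<alpha> d (u' @ [b']))
      \<le> (\<Sum>x\<in>?U. of_bool (?C x \<alpha> \<and> node \<alpha> d (u @ [b]) = x - Suc (pick b' (\<alpha> x))) :: ennreal)"
      using member_le_sum[of "node \<alpha> d u'" ?U "\<lambda>x. of_bool (?C x \<alpha> \<and> node \<alpha> d (u @ [b]) = x - Suc (pick b' (\<alpha> x))) :: ennreal"] fin
      by (simp add: node_append)
  qed
  also have "\<dots> = (\<Sum>x\<in>?U. (\<integral>\<^sup>+\<alpha>. of_bool (?C x \<alpha> \<and> node \<alpha> d (u @ [b]) = x - Suc (pick b' (\<alpha> x))) \<partial>Ap))"
    by (rule nn_integral_sum) simp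
  also have "\<dots> \<le> (\<Sum>x\<in>?U. ennreal (1 / real M) * (\<integral>\<^sup>+\<alpha>. of_bool (?C x \<alpha>) \<partial>Ap))"
  proof (intro sum_mono)
    fix x assume x: "x \<in> ?U"
    have C: "?C x (\<alpha>(x := ab)) \<longleftrightarrow> ?C x \<alpha>" for \<alpha> ab
    proof -
      have e: "node (\<alpha>(x := ab)) d u' = x \<longleftrightarrow> node \<alpha> d u' = x"
        by (rule node_eq_iff_above[of x]) (use x in auto)
      have "node (\<alpha>(x := ab)) d u = node \<alpha> d u" if "x \<le> node \<alpha> d u"
        by (rule node_cong_above[of x \<alpha>, OF _ that]) (use x in auto)
      moreover have "node \<alpha> d u = node (\<alpha>(x := ab)) d u" if "x \<le> node (\<alpha>(x := ab)) d u"
        by (rule node_cong_above[of x "\<alpha>(x := ab)", OF _ that]) (use x in auto)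
      ultimately show ?thesis using e by (metis less_imp_le)
    qed
    have Y: "node (\<alpha>(x := ab)) d (u @ [b]) = node \<alpha> d (u @ [b])" if "x < node \<alpha> d u" for \<alpha> ab
    proof -
      have "node (\<alpha>(x := ab)) d u = node \<alpha> d u"
        by (rule node_cong_above[of x \<alpha>]) (use x that in auto)
      then show ?thesis using that by (simp add: node_append)
    qed
    have "(\<integral>\<^sup>+\<alpha>. of_bool (?C x \<alpha> \<and> node \<alpha> d (u @ [b]) = x - Suc (pick b' (\<alpha> x))) \<partial>Ap)
      = (\<integral>\<^sup>+ab. (\<integral>\<^sup>+\<alpha>. of_bool (?C x \<alpha> \<and> node \<alpha> d (u @ [b]) = x - Suc (pick b' ab)) \<partial>Ap) \<partial>ALd)"
      by (subst nn_integral_Pi_pmf_resample[where i = x])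
         (use x d C Y in \<open>auto intro!: nn_integral_cong simp: conj_commute cong: conj_cong\<close>)
    also have "\<dots> = (\<integral>\<^sup>+\<alpha>. (\<integral>\<^sup>+ab. of_bool (?C x \<alpha> \<and> node \<alpha> d (u @ [b]) = x - Suc (pick b' ab)) \<partial>ALd) \<partial>Ap)"
      by (rule nn_integral_pmf_swap)
    also have "\<dots> \<le> (\<integral>\<^sup>+\<alpha>. ennreal (1 / real M) * of_bool (?C x \<alpha>) \<partial>Ap)"
    proof (intro nn_integral_mono)
      fix \<alpha>
      show "(\<integral>\<^sup>+ab. of_bool (?C x \<alpha> \<and> node \<alpha> d (u @ [b]) = x - Suc (pick b' ab)) \<partial>ALd) \<le> ennreal (1 / real M) * of_bool (?C x \<alpha>)"
      proof (cases "?C x \<alpha>")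
        case True
        have "(\<integral>\<^sup>+ab. of_bool (?C x \<alpha> \<and> node \<alpha> d (u @ [b]) = x - Suc (pick b' ab)) \<partial>ALd)
          \<le> (\<integral>\<^sup>+ab. of_bool (pick b' ab = x - Suc (node \<alpha> d (u @ [b]))) \<partial>ALd)"
        proof (intro nn_integral_mono_AE AE_pmfI)
          fix ab assume "ab \<in> set_pmf ALd"
          then have "pick b' ab < M" by (auto simp: set_ALd pick_def)
          then show "of_bool (?C x \<alpha> \<and> node \<alpha> d (u @ [b]) = x - Suc (pick b' ab)) \<le> (of_bool (pick b' ab = x - Suc (node \<alpha> d (u @ [b]))) :: ennreal)"
            using x by auto
        qed
        also have "\<dots> \<le> ennreal (1 / real M)" by (rule ALd_pick)
        finally show ?thesis using True by simp
      qed (auto simp: of_bool_def)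
    qed
    also have "\<dots> = ennreal (1 / real M) * (\<integral>\<^sup>+\<alpha>. of_bool (?C x \<alpha>) \<partial>Ap)"
      by (rule nn_integral_cmult) simp
    finally show "(\<integral>\<^sup>+\<alpha>. of_bool (?C x \<alpha> \<and> node \<alpha> d (u @ [b]) = x - Suc (pick b' (\<alpha> x))) \<partial>Ap)
      \<le> ennreal (1 / real M) * (\<integral>\<^sup>+\<alpha>. of_bool (?C x \<alpha>) \<partial>Ap)" .
  qed
  also have "\<dots> = ennreal (1 / real M) * (\<integral>\<^sup>+\<alpha>. (\<Sum>x\<in>?U. of_bool (?C x \<alpha>)) \<partial>Ap)"
    by (subst nn_integral_sum) (simp_all add: sum_distrib_left)
  also have "\<dots> \<le> ennreal (1 / real M) * (\<integral>\<^sup>+\<alpha>. of_bool (node \<alpha> d u' < node \<alpha> d u) \<partial>Ap)"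
  proof (intro mult_left_mono nn_integral_mono)
    fix \<alpha>
    have "(\<Sum>x\<in>?U. of_bool (?C x \<alpha>)) \<le> (\<Sum>x\<in>?U. of_bool (node \<alpha> d u' = x) * of_bool (node \<alpha> d u' < node \<alpha> d u) :: ennreal)"
      by (intro sum_mono) (auto simp: of_bool_def)
    also have "\<dots> = (\<Sum>x\<in>?U. of_bool (node \<alpha> d u' = x)) * of_bool (node \<alpha> d u' < node \<alpha> d u)"
      by (rule sum_distrib_right[symmetric])
    also have "(\<Sum>x\<in>?U. of_bool (node \<alpha> d u' = x)) \<le> (1::ennreal)"
      using fin by (simp add: of_bool_def sum.delta')
    finally show "(\<Sum>x\<in>?U. of_bool (?C x \<alpha>)) \<le> (of_bool (node \<alpha> d u' < node \<alpha> d u) :: ennreal)"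
      by (simp add: mult_right_mono)
  qed simp
  finally show ?thesis .
qed

text \<open>Two nonempty colliding words have the same parent word, or parents that collide already,
  or distinct parent nodes of which one is closer to the target. The two orders of the parent nodes
  exclude each other, so each level adds just \<open>1 / M\<close>.\<close>

lemma node_collision:
  assumes d: "l * M < d" "d < N" and "length w \<le> l" "length w' \<le> l" "w \<noteq> w'"
  shows "(\<integral>\<^sup>+\<alpha>. of_bool (node \<alpha> d w = node \<alpha> d w') \<partial>Ap) \<le> ennreal (real l / real M)"
  using assms
proof (induction l arbitrary: w w')
  case 0
  then show ?case by simp
next
  case (Suc l)
  have d0: "0 < d" and dl: "l * M < d" using Suc.prems(1) by auto
  show ?case
  proof (cases "w = [] \<or> w' = []")
    case True
    then have "node \<alpha> d w \<noteq> node \<alpha> d w'" for \<alpha>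
      using node_less[OF d0, of w \<alpha>] node_less[OF d0, of w' \<alpha>] Suc.prems(5) by (cases "w = []") auto
    then show ?thesis by simp
  next
    case False
    then obtain u b u' b' where w: "w = u @ [b]" "w' = u' @ [b']" by (metis rev_exhaust)
    have len: "Suc (length u) \<le> Suc l" "Suc (length u') \<le> Suc l" using Suc.prems w by auto
    show ?thesis
    proof (cases "u = u'")
      case True
      then have b: "b \<noteq> b'" using Suc.prems(5) w by simp
      have "(\<integral>\<^sup>+\<alpha>. of_bool (node \<alpha> d w = node \<alpha> d w') \<partial>Ap)
         = (\<integral>\<^sup>+\<alpha>. of_bool (node \<alpha> d u - Suc (pick b (\<alpha> (node \<alpha> d u))) = node \<alpha> d u - Suc (pick b' (\<alpha> (node \<alpha> d u)))) \<partial>Ap)"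
        using w True by (simp add: node_append)
      also have "\<dots> \<le> ennreal (1 / real M)"
      proof (rule node_moment[where l = l and G = "\<lambda>\<alpha> x. of_bool (x - Suc (pick b (\<alpha> x)) = x - Suc (pick b' (\<alpha> x)))"])
        show "depends_on {..x} (\<lambda>\<alpha>. of_bool (x - Suc (pick b (\<alpha> x)) = x - Suc (pick b' (\<alpha> x))) :: ennreal)" for x
          by (rule depends_onI) simp
        fix x assume x: "x \<le> d" "d - l * M \<le> x"
        have xM: "M < x" using x(2) Suc.prems(1) by simp
        have "(\<integral>\<^sup>+\<alpha>. of_bool (x - Suc (pick b (\<alpha> x)) = x - Suc (pick b' (\<alpha> x))) \<partial>Ap)
          = (\<integral>\<^sup>+ab. (\<integral>\<^sup>+\<alpha>. of_bool (x - Suc (pick b ab) = x - Suc (pick b' ab)) \<partial>Ap) \<partial>ALd)"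
          by (rule nn_integral_Ap_node[of x "\<lambda>_ ab. of_bool (x - Suc (pick b ab) = x - Suc (pick b' ab))"]) (use x Suc.prems(2) in auto)
        also have "\<dots> \<le> (\<integral>\<^sup>+ab. of_bool (fst ab = snd ab) \<partial>ALd)"
        proof (intro nn_integral_mono_AE AE_pmfI)
          fix ab assume "ab \<in> set_pmf ALd"
          then have "fst ab < M" "snd ab < M" by (auto simp: set_ALd)
          then show "(\<integral>\<^sup>+\<alpha>. of_bool (x - Suc (pick b ab) = x - Suc (pick b' ab)) \<partial>Ap) \<le> of_bool (fst ab = snd ab)"
            using b xM by (cases b; cases b') (auto simp: pick_def measure_pmf.emeasure_space_1)
        qed
        also have "\<dots> \<le> ennreal (1 / real M)" by (rule ALd_twins)
        finally show "(\<integral>\<^sup>+\<alpha>. of_bool (x - Suc (pick b (\<alpha> x)) = x - Suc (pick b' (\<alpha> x))) \<partial>Ap) \<le> ennreal (1 / real M)" .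
      qed (use dl len in auto)
      also have "\<dots> \<le> ennreal (real (Suc l) / real M)" by (intro ennreal_leI divide_right_mono) auto
      finally show ?thesis .
    next
      case False
      have "(\<integral>\<^sup>+\<alpha>. of_bool (node \<alpha> d w = node \<alpha> d w') \<partial>Ap)
         \<le> (\<integral>\<^sup>+\<alpha>. of_bool (node \<alpha> d u = node \<alpha> d u') + of_bool (node \<alpha> d u' < node \<alpha> d u \<and> node \<alpha> d w = node \<alpha> d w')
             + of_bool (node \<alpha> d u < node \<alpha> d u' \<and> node \<alpha> d w' = node \<alpha> d w) \<partial>Ap)"
        by (intro nn_integral_mono) (auto simp: of_bool_def)
      also have "\<dots> = (\<integral>\<^sup>+\<alpha>. of_bool (node \<alpha> d u = node \<alpha> d u') \<partial>Ap)
           + (\<integral>\<^sup>+\<alpha>. of_bool (node \<alpha> d u' < node \<alpha> d u \<and> node \<alpha> d w = node \<alpha> d w') \<partial>Ap)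
           + (\<integral>\<^sup>+\<alpha>. of_bool (node \<alpha> d u < node \<alpha> d u' \<and> node \<alpha> d w' = node \<alpha> d w) \<partial>Ap)"
        by (subst nn_integral_add, simp, simp, subst nn_integral_add, simp, simp) (rule refl)
      also have "\<dots> \<le> ennreal (real l / real M)
           + ennreal (1 / real M) * (\<integral>\<^sup>+\<alpha>. of_bool (node \<alpha> d u' < node \<alpha> d u) \<partial>Ap)
           + ennreal (1 / real M) * (\<integral>\<^sup>+\<alpha>. of_bool (node \<alpha> d u < node \<alpha> d u') \<partial>Ap)"
      proof (intro add_mono)
        show "(\<integral>\<^sup>+\<alpha>. of_bool (node \<alpha> d u = node \<alpha> d u') \<partial>Ap) \<le> ennreal (real l / real M)"
          by (rule Suc.IH) (use dl len False Suc.prems in auto)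
        show "(\<integral>\<^sup>+\<alpha>. of_bool (node \<alpha> d u' < node \<alpha> d u \<and> node \<alpha> d w = node \<alpha> d w') \<partial>Ap)
          \<le> ennreal (1 / real M) * (\<integral>\<^sup>+\<alpha>. of_bool (node \<alpha> d u' < node \<alpha> d u) \<partial>Ap)"
          unfolding w by (rule later_parent_collision[OF Suc.prems(1,2) len(2)])
        show "(\<integral>\<^sup>+\<alpha>. of_bool (node \<alpha> d u < node \<alpha> d u' \<and> node \<alpha> d w' = node \<alpha> d w) \<partial>Ap)
          \<le> ennreal (1 / real M) * (\<integral>\<^sup>+\<alpha>. of_bool (node \<alpha> d u < node \<alpha> d u') \<partial>Ap)"
          unfolding w by (rule later_parent_collision[OF Suc.prems(1,2) len(1)])
      qed
      also have "\<dots> = ennreal (real l / real M) + ennreal (1 / real M) *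
          ((\<integral>\<^sup>+\<alpha>. of_bool (node \<alpha> d u' < node \<alpha> d u) \<partial>Ap) + (\<integral>\<^sup>+\<alpha>. of_bool (node \<alpha> d u < node \<alpha> d u') \<partial>Ap))"
        by (simp add: distrib_left add.assoc)
      also have "(\<integral>\<^sup>+\<alpha>. of_bool (node \<alpha> d u' < node \<alpha> d u) \<partial>Ap) + (\<integral>\<^sup>+\<alpha>. of_bool (node \<alpha> d u < node \<alpha> d u') \<partial>Ap)
         = (\<integral>\<^sup>+\<alpha>. of_bool (node \<alpha> d u' < node \<alpha> d u) + of_bool (node \<alpha> d u < node \<alpha> d u') \<partial>Ap)"
        by (rule nn_integral_add[symmetric]) simp_all
      also have "\<dots> \<le> 1" by (rule nn_integral_pmf_le_const) (auto simp: of_bool_def)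
      finally have "(\<integral>\<^sup>+\<alpha>. of_bool (node \<alpha> d w = node \<alpha> d w') \<partial>Ap) \<le> ennreal (real l / real M) + ennreal (1 / real M) * 1"
        by (simp add: mult_left_mono)
      also have "\<dots> = ennreal (real (Suc l) / real M)"
        by (simp add: ennreal_plus[symmetric] add_divide_distrib add.commute del: ennreal_plus)
      finally show ?thesis .
    qed
  qed
qed

section \<open>K-links seen from the path\<close>

definition fan :: "bool list \<Rightarrow> nat \<Rightarrow> bool list set" where
  "fan s j = (\<lambda>(i, w). take i s @ w) ` ({..j} \<times> {w. length w = k})"

text \<open>\<open>fan s j\<close> spells the nodes reached by exactly \<open>k\<close> AL-links
  from the first \<open>Suc j\<close> nodes along \<open>s\<close>. As \<open>w\<close> has length
  exactly \<open>k\<close>, the length of a word determines \<open>i\<close>, so no word arises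
  twice.\<close>

lemma fan_card:
  assumes "length s = j"
  shows "card (fan s j) = Suc j * 2 ^ k" "finite (fan s j)"
proof -
  have fin: "finite {w :: bool list. length w = k}" and c: "card {w :: bool list. length w = k} = 2 ^ k"
    using finite_lists_length_eq[of "UNIV :: bool set" k] card_lists_length_eq[of "UNIV :: bool set" k] by auto
  show "finite (fan s j)" unfolding fan_def using fin by (intro finite_imageI finite_cartesian_product) auto
  have "inj_on (\<lambda>(i, w). take i s @ w) ({..j} \<times> {w. length w = k})"
  proof (rule inj_onI)
    fix p q assume *: "p \<in> {..j} \<times> {w. length w = k}" "q \<in> {..j} \<times> {w. length w = k}"
      "(\<lambda>(i, w). take i s @ w) p = (\<lambda>(i, w). take i s @ w) q"
    obtain i w i' w' where pq: "p = (i, w)" "q = (i', w')" by (cases p, cases q)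
    have eq: "take i s @ w = take i' s @ w'" using *(3) by (simp add: pq)
    have "length (take i s) = i" "length (take i' s) = i'" using *(1,2) assms by (auto simp: pq)
    moreover have "length (take i s) + length w = length (take i' s) + length w'"
      using arg_cong[OF eq, of length] by (simp only: length_append)
    moreover have "length w = length w'" using * by (simp add: pq)
    ultimately have "i = i'" by linarith
    then show "p = q" using eq by (simp add: pq)
  qed
  then show "card (fan s j) = Suc j * 2 ^ k"
    unfolding fan_def using fin c by (simp add: card_image card_cartesian_product)
qed

definition crowded :: "(nat \<Rightarrow> nat \<times> nat) \<Rightarrow> nat \<Rightarrow> bool list \<Rightarrow> nat \<Rightarrow> bool" where
  "crowded \<alpha> d s j \<longleftrightarrow> 2 * card (node \<alpha> d ` fan s j) < Suc j * 2 ^ k"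

text \<open>Markov's inequality for the number of colliding pairs: a crowded fan of \<open>m\<close>
  words has at least \<open>m / 2\<close> of them, and their expected number is at most
  \<open>m ^ 2 * (k + j) / M\<close>.\<close>

lemma crowded_prob:
  assumes d: "(k + j) * M < d" "d < N" and s: "length s = j"
  shows "(\<integral>\<^sup>+\<alpha>. of_bool (crowded \<alpha> d s j) \<partial>Ap) \<le> ennreal (2 * (real (Suc j) * 2 ^ k) * (real (k + j) / real M))"
proof -
  let ?W = "fan s j" and ?n = "real (Suc j) * 2 ^ k"
  let ?P = "{p \<in> ?W \<times> ?W. fst p \<noteq> snd p}"
  note cW = fan_card[OF s]
  have "real (card ?W) = ?n" using cW by (simp add: algebra_simps)
  moreover have "0 < ?n" by simp
  ultimately have n: "real (card ?W) = ?n" "0 < ?n" .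
  have fin: "finite ?P" using cW by auto
  have len: "length w \<le> k + j" if "w \<in> ?W" for w using that s by (auto simp: fan_def)
  have "(\<integral>\<^sup>+\<alpha>. of_bool (crowded \<alpha> d s j) \<partial>Ap) \<le> (\<integral>\<^sup>+\<alpha>. ennreal (2 / ?n) * (\<Sum>p\<in>?P. of_bool (node \<alpha> d (fst p) = node \<alpha> d (snd p))) \<partial>Ap)"
  proof (intro nn_integral_mono)
    fix \<alpha>
    show "of_bool (crowded \<alpha> d s j) \<le> ennreal (2 / ?n) * (\<Sum>p\<in>?P. of_bool (node \<alpha> d (fst p) = node \<alpha> d (snd p)))"
    proof (cases "crowded \<alpha> d s j")
      case True
      let ?C = "{p \<in> ?W \<times> ?W. fst p \<noteq> snd p \<and> node \<alpha> d (fst p) = node \<alpha> d (snd p)}"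
      have "card ?W \<le> card (node \<alpha> d ` ?W) + card ?C"
        by (rule card_le_card_image_plus_collisions[OF cW(2)])
      then have "Suc j * 2 ^ k \<le> 2 * card ?C" using True cW(1) by (simp add: crowded_def)
      then have "real (Suc j * 2 ^ k) \<le> real (2 * card ?C)" by (rule of_nat_mono)
      then have "?n \<le> 2 * real (card ?C)" by (simp only: of_nat_mult of_nat_power of_nat_numeral)
      then have "1 \<le> 2 / ?n * real (card ?C)" using n by (simp add: divide_simps)
      moreover have "(\<Sum>p\<in>?P. of_bool (node \<alpha> d (fst p) = node \<alpha> d (snd p))) = ennreal (real (card ?C))"
      proof -
        have "?P \<inter> {p. node \<alpha> d (fst p) = node \<alpha> d (snd p)} = ?C" by auto
        then show ?thesis using fin by (simp add: sum_of_bool_eq ennreal_of_nat_eq_real_of_nat)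
      qed
      ultimately show ?thesis using True n by (simp add: ennreal_mult[symmetric] ennreal_leI flip: ennreal_1)
    qed simp
  qed
  also have "\<dots> = ennreal (2 / ?n) * (\<Sum>p\<in>?P. \<integral>\<^sup>+\<alpha>. of_bool (node \<alpha> d (fst p) = node \<alpha> d (snd p)) \<partial>Ap)"
    by (subst nn_integral_cmult, simp, subst nn_integral_sum) simp_all
  also have "\<dots> \<le> ennreal (2 / ?n) * (\<Sum>p\<in>?P. ennreal (real (k + j) / real M))"
    by (intro mult_left_mono sum_mono node_collision[OF d]) (auto intro: len)
  also have "(\<Sum>p\<in>?P. ennreal (real (k + j) / real M)) = ennreal (real (card ?P) * (real (k + j) / real M))"
    by (rule sum_ennreal_const) simp
  also have "\<dots> \<le> ennreal (?n\<^sup>2 * (real (k + j) / real M))"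
  proof (intro ennreal_leI mult_right_mono)
    have "card ?P \<le> card (?W \<times> ?W)" using cW by (intro card_mono) auto
    then have "real (card ?P) \<le> real (card (?W \<times> ?W))" by (rule of_nat_mono)
    then show "real (card ?P) \<le> ?n\<^sup>2" using n by (simp add: card_cartesian_product power2_eq_square)
  qed simp
  also have "ennreal (2 / ?n) * ennreal (?n\<^sup>2 * (real (k + j) / real M)) = ennreal (2 * ?n * (real (k + j) / real M))"
  proof -
    have "2 / ?n * (?n\<^sup>2 * (real (k + j) / real M)) = 2 * ?n * (real (k + j) / real M)"
      using n(2) by (simp add: power2_eq_square)
    moreover have "0 \<le> 2 / ?n" "0 \<le> ?n\<^sup>2 * (real (k + j) / real M)" using n by auto
    ultimately show ?thesis by (simp only: ennreal_mult[symmetric])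
  qed
  finally show ?thesis by (simp add: mult_left_mono)
qed

text \<open>A weakening of \<open>free\<close> along the first nodes of the path. The fixed
  threshold \<open>e\<close> replaces the moving distance, and only nodes above \<open>e\<close> are
  consulted, so that for a path above \<open>e\<close> the event reads links above \<open>e\<close>
  alone.\<close>

definition avoid :: "(nat \<Rightarrow> nat) \<Rightarrow> (nat \<Rightarrow> nat \<times> nat) \<Rightarrow> nat \<Rightarrow> nat \<Rightarrow> nat \<Rightarrow> bool" where
  "avoid \<kappa> \<alpha> d e j \<longleftrightarrow> (\<forall>i\<le>j. \<forall>w. length w = k \<longrightarrow> e < node \<alpha> (path \<alpha> d i) w \<longrightarrow> e < 2 * \<kappa> (node \<alpha> (path \<alpha> d i) w))"

lemma avoid_antimono: "i \<le> j \<Longrightarrow> avoid \<kappa> \<alpha> d e j \<Longrightarrow> avoid \<kappa> \<alpha> d e i"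
  by (auto simp: avoid_def)

text \<open>At least \<open>e / 2 \<ge> d / 4\<close> targets \<open>v\<close> satisfy
  \<open>2 * v \<le> e\<close>, each with probability at least \<open>1 / (Z * d)\<close>.\<close>

lemma no_jump_prob:
  assumes z: "e < z" "z \<le> d" "d < N" and e: "d \<le> 2 * e"
  shows "(\<integral>\<^sup>+v. of_bool (e < 2 * v) \<partial>Kd z) \<le> ennreal (1 - 1 / (4 * Z))"
proof -
  let ?T = "{v. 2 * v \<le> e}"
  have fin: "finite ?T" by (rule finite_subset[of _ "{..e}"]) auto
  have "1 / (4 * Z) \<le> (\<Sum>v\<in>?T. pmf (Kd z) v)"
  proof -
    have "?T = {..e div 2}" by auto
    then have c: "e \<le> 2 * card ?T" by simp
    have d0: "0 < d" using z by simp
    have "real d \<le> 4 * real (card ?T)" using c e by linarith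
    then have "1 / 4 \<le> real (card ?T) / real d" using d0 by (simp add: divide_simps)
    then have "1 / 4 / Z \<le> real (card ?T) / real d / Z" using Z_pos by (intro divide_right_mono) auto
    then have "1 / (4 * Z) \<le> real (card ?T) * (1 / (Z * real d))" by (simp add: mult.commute)
    also have "\<dots> = (\<Sum>v\<in>?T. 1 / (Z * real d))" by simp
    also have "\<dots> \<le> (\<Sum>v\<in>?T. pmf (Kd z) v)"
    proof (intro sum_mono)
      fix v assume "v \<in> ?T"
      then have v: "v < z" using z by simp
      show "1 / (Z * real d) \<le> pmf (Kd z) v"
        using v z Z_pos by (subst pmf_Kd) (auto intro!: divide_left_mono mult_left_mono mult_pos_pos)
    qed
    finally show ?thesis .
  qed
  also have "\<dots> = measure_pmf.prob (Kd z) ?T" using fin by (simp add: measure_measure_pmf_finite)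
  finally have p: "1 / (4 * Z) \<le> measure_pmf.prob (Kd z) ?T" .
  have "(\<integral>\<^sup>+v. of_bool (e < 2 * v) \<partial>Kd z) = (\<integral>\<^sup>+v. indicator (UNIV - ?T) v \<partial>Kd z)"
    by (intro nn_integral_cong) (auto simp: indicator_def of_bool_def)
  also have "\<dots> = ennreal (measure_pmf.prob (Kd z) (UNIV - ?T))"
    by (simp add: measure_pmf.emeasure_eq_measure)
  also have "\<dots> = ennreal (1 - measure_pmf.prob (Kd z) ?T)"
    using measure_pmf.prob_compl[of ?T "Kd z"] by simp
  also have "\<dots> \<le> ennreal (1 - 1 / (4 * Z))" using p by (intro ennreal_leI) simp
  finally show ?thesis .
qed

text \<open>For fixed AL-links the fan has at least \<open>Suc j * 2 ^ k / 2\<close> distinct nodes,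
  all above \<open>e\<close> because \<open>j < k\<close>, with independent K-links. Each avoids
  with probability at most \<open>exp (- 1 / (4 * Z))\<close>, and \<open>Z \<le> 2 ^ Suc k\<close>
  turns the product into the bound.\<close>

lemma avoid_prob_K:
  assumes d: "8 * (k * M) \<le> d" "d < N" and e: "e = d - 2 * (k * M)" and j: "j < k"
    and \<alpha>: "bounded_AL M \<alpha>" and nc: "\<And>s. length s = j \<Longrightarrow> \<not> crowded \<alpha> d s j"
  shows "(\<integral>\<^sup>+\<kappa>. of_bool (avoid \<kappa> \<alpha> d e j) \<partial>Kp) \<le> ennreal (exp (- (real (Suc j) / 16)))"
proof -
  obtain s where s: "length s = j" "\<And>i. i \<le> j \<Longrightarrow> path \<alpha> d i = node \<alpha> d (take i s)"
    using path_node by blast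
  define V where "V = node \<alpha> d ` fan s j"
  have fin: "finite V" using fan_card[OF s(1)] by (simp add: V_def)
  have kM: "0 < k * M" using k_pos M_pos by simp
  have Vbig: "e < z \<and> z \<le> d" if "z \<in> V" for z
  proof -
    obtain w where w: "w \<in> fan s j" "z = node \<alpha> d w" using \<open>z \<in> V\<close> unfolding V_def by blast
    then have "length w \<le> j + k" using s(1) by (auto simp: fan_def)
    then have "length w * M + M \<le> 2 * (k * M)" using j mult_le_mono1[of "Suc (length w)" "2 * k" M] by simp
    then have "length w * M < 2 * (k * M)" using M_pos by linarith
    then have "e < d - length w * M" using e d kM by linarith
    then show ?thesis using node_ge[OF \<alpha>, of d w] node_le[of \<alpha> d w] w by simp
  qed
  have "of_bool (avoid \<kappa> \<alpha> d e j) \<le> (\<Prod>z\<in>V. of_bool (e < 2 * \<kappa> z) :: ennreal)" for \<kappa>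
  proof (cases "avoid \<kappa> \<alpha> d e j")
    case True
    have "e < 2 * \<kappa> z" if "z \<in> V" for z
    proof -
      obtain i w where iw: "i \<le> j" "length w = k" "z = node \<alpha> d (take i s @ w)"
        using \<open>z \<in> V\<close> by (auto simp: V_def fan_def)
      then have "z = node \<alpha> (path \<alpha> d i) w" using s(2) by (simp add: node_append)
      then show ?thesis using True iw Vbig[OF that] by (auto simp: avoid_def)
    qed
    then show ?thesis by simp
  qed simp
  then have "(\<integral>\<^sup>+\<kappa>. of_bool (avoid \<kappa> \<alpha> d e j) \<partial>Kp) \<le> (\<integral>\<^sup>+\<kappa>. (\<Prod>z\<in>V. of_bool (e < 2 * \<kappa> z)) \<partial>Kp)"
    by (intro nn_integral_mono)
  also have "\<dots> \<le> ennreal (1 - 1 / (4 * Z)) ^ card V"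
  proof (rule nn_integral_Pi_pmf_prod_le_power[where f = "\<lambda>v. of_bool (e < 2 * v)", OF _ fin])
    show "V \<subseteq> {..<N}" using Vbig d by fastforce
    show "(\<integral>\<^sup>+v. of_bool (e < 2 * v) \<partial>Kd z) \<le> ennreal (1 - 1 / (4 * Z))" if "z \<in> V" for z
      by (rule no_jump_prob[of _ _ d]) (use Vbig[OF that] d e in auto)
  qed simp
  also have "\<dots> \<le> ennreal (exp (- (1 / (4 * Z)))) ^ card V"
    using exp_ge_add_one_self[of "- (1 / (4 * Z))"] by (intro power_mono ennreal_leI) auto
  also have "\<dots> = ennreal (exp (- (real (card V) / (4 * Z))))"
    by (simp add: ennreal_power exp_of_nat_mult[symmetric])
  also have "\<dots> \<le> ennreal (exp (- (real (Suc j) / 16)))"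
  proof (intro ennreal_leI)
    have "Suc j * 2 ^ k \<le> 2 * card V" using nc[OF s(1)] by (simp add: crowded_def V_def)
    then have "real (Suc j * 2 ^ k) \<le> real (2 * card V)" by (rule of_nat_mono)
    then have "real (Suc j) * 2 ^ k \<le> 2 * real (card V)" by (simp only: of_nat_mult of_nat_power of_nat_numeral)
    moreover have "real (Suc j) * Z \<le> real (Suc j) * (2 * 2 ^ k)" using Z_le by (intro mult_left_mono) auto
    ultimately have "real (Suc j) * Z \<le> 4 * real (card V)" by linarith
    then have "real (Suc j) / 16 \<le> real (card V) / (4 * Z)" using Z_pos by (simp add: field_simps)
    then show "exp (- (real (card V) / (4 * Z))) \<le> exp (- (real (Suc j) / 16))" by simp
  qed
  finally show ?thesis .
qed

text \<open>The word spelled by the path depends on the AL-links, so crowding is excluded for all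
  \<open>2 ^ j\<close> words by a union bound. This is affordable only for \<open>j\<close> up to a
  fraction of \<open>k\<close>, hence the cap \<open>J\<close>.\<close>

lemma avoid_prob:
  assumes d: "8 * (k * M) \<le> d" "d < N" and e: "e = d - 2 * (k * M)" and j: "j \<le> J" "J < k"
  shows "(\<integral>\<^sup>+\<alpha>. (\<integral>\<^sup>+\<kappa>. of_bool (avoid \<kappa> \<alpha> d e j) \<partial>Kp) \<partial>Ap)
    \<le> ennreal (exp (- (real (Suc j) / 16)) + 2 ^ J * (2 * (real (Suc J) * 2 ^ k) * (real (k + J) / real M)))"
proof -
  let ?S = "{s :: bool list. length s = j}"
  have fin: "finite ?S" "card ?S = 2 ^ j"
    using finite_lists_length_eq[of "UNIV :: bool set" j] card_lists_length_eq[of "UNIV :: bool set" j] by auto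
  have kM: "0 < k * M" using k_pos M_pos by simp
  have "(k + j) * M \<le> (2 * k) * M" using j by (intro mult_le_mono1) simp
  then have "(k + j) * M \<le> 2 * (k * M)" by (simp only: mult.assoc)
  then have dj: "(k + j) * M < d" using d(1) kM by linarith
  have "(\<integral>\<^sup>+\<alpha>. (\<integral>\<^sup>+\<kappa>. of_bool (avoid \<kappa> \<alpha> d e j) \<partial>Kp) \<partial>Ap)
     \<le> (\<integral>\<^sup>+\<alpha>. ennreal (exp (- (real (Suc j) / 16))) + (\<Sum>s\<in>?S. of_bool (crowded \<alpha> d s j)) \<partial>Ap)"
  proof (intro nn_integral_mono_AE AE_pmfI)
    fix \<alpha> assume "\<alpha> \<in> set_pmf Ap"
    then have \<alpha>: "bounded_AL M \<alpha>" by (rule bounded_AL_set)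
    show "(\<integral>\<^sup>+\<kappa>. of_bool (avoid \<kappa> \<alpha> d e j) \<partial>Kp) \<le> ennreal (exp (- (real (Suc j) / 16))) + (\<Sum>s\<in>?S. of_bool (crowded \<alpha> d s j))"
    proof (cases "\<exists>s. length s = j \<and> crowded \<alpha> d s j")
      case True
      then obtain s where s: "s \<in> ?S" "crowded \<alpha> d s j" by auto
      have "(\<integral>\<^sup>+\<kappa>. of_bool (avoid \<kappa> \<alpha> d e j) \<partial>Kp) \<le> 1" by (rule nn_integral_pmf_le_const) (simp add: of_bool_def)
      also have "1 \<le> (\<Sum>s\<in>?S. of_bool (crowded \<alpha> d s j) :: ennreal)"
        using member_le_sum[OF s(1), of "\<lambda>s. of_bool (crowded \<alpha> d s j) :: ennreal"] s(2) fin by simp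
      finally show ?thesis by (simp add: add_increasing)
    next
      case False
      then have "(\<integral>\<^sup>+\<kappa>. of_bool (avoid \<kappa> \<alpha> d e j) \<partial>Kp) \<le> ennreal (exp (- (real (Suc j) / 16)))"
        using j by (intro avoid_prob_K[OF d e _ \<alpha>]) auto
      then show ?thesis by (simp add: add_increasing2)
    qed
  qed
  also have "\<dots> = ennreal (exp (- (real (Suc j) / 16))) + (\<Sum>s\<in>?S. \<integral>\<^sup>+\<alpha>. of_bool (crowded \<alpha> d s j) \<partial>Ap)"
    by (subst nn_integral_add, simp, simp, subst nn_integral_sum) (simp_all add: measure_pmf.emeasure_space_1)
  also have "(\<Sum>s\<in>?S. \<integral>\<^sup>+\<alpha>. of_bool (crowded \<alpha> d s j) \<partial>Ap) \<le> (\<Sum>s\<in>?S. ennreal (2 * (real (Suc j) * 2 ^ k) * (real (k + j) / real M)))"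
    by (intro sum_mono crowded_prob[OF dj d(2)]) simp
  also have "\<dots> = ennreal (real (card ?S) * (2 * (real (Suc j) * 2 ^ k) * (real (k + j) / real M)))"
    by (rule sum_ennreal_const) simp
  also have "\<dots> \<le> ennreal (2 ^ J * (2 * (real (Suc J) * 2 ^ k) * (real (k + J) / real M)))"
  proof (intro ennreal_leI mult_mono)
    have "real (card ?S) = 2 ^ j" using fin by simp
    also have "\<dots> \<le> 2 ^ J" using j by (intro power_increasing) auto
    finally show "real (card ?S) \<le> 2 ^ J" .
  qed (use j in \<open>auto intro!: divide_right_mono\<close>)
  finally have "(\<integral>\<^sup>+\<alpha>. (\<integral>\<^sup>+\<kappa>. of_bool (avoid \<kappa> \<alpha> d e j) \<partial>Kp) \<partial>Ap)
    \<le> ennreal (exp (- (real (Suc j) / 16))) + ennreal (2 ^ J * (2 * (real (Suc J) * 2 ^ k) * (real (k + J) / real M)))"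
    by (simp add: add_left_mono)
  also have "\<dots> = ennreal (exp (- (real (Suc j) / 16)) + 2 ^ J * (2 * (real (Suc J) * 2 ^ k) * (real (k + J) / real M)))"
    by (intro ennreal_plus[symmetric]) (auto intro!: mult_nonneg_nonneg)
  finally show ?thesis .
qed

end

section \<open>How long the path lasts and where it is left\<close>

context routing
begin

lemma sum_path_eq:
  fixes f :: "nat \<Rightarrow> ennreal"
  shows "of_bool (e < path \<alpha> d j) * f (path \<alpha> d j) = (\<Sum>u\<in>{e<..d}. of_bool (path \<alpha> d j = u) * f u)"
proof -
  have le: "path \<alpha> d j \<le> d" using path_le[of \<alpha> d j] by simp
  show ?thesis
  proof (cases "e < path \<alpha> d j")
    case True
    then have "(\<Sum>u\<in>{e<..d}. of_bool (path \<alpha> d j = u) * f u) = f (path \<alpha> d j)"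
      using le by (subst sum.remove[of _ "path \<alpha> d j"]) (auto intro!: sum.neutral)
    then show ?thesis using True by simp
  qed (auto intro!: sum.neutral)
qed

text \<open>The counterpart of \<open>node_moment\<close> for \<open>path\<close>, with a bound that
  may depend on the node reached.\<close>

lemma path_moment:
  assumes dep: "\<And>u. depends_on {..u} (\<lambda>\<alpha>. G \<alpha> u)"
    and B: "\<And>u. e < u \<Longrightarrow> u \<le> d \<Longrightarrow> (\<integral>\<^sup>+\<alpha>. G \<alpha> u \<partial>Ap) \<le> B u"
  shows "(\<integral>\<^sup>+\<alpha>. of_bool (e < path \<alpha> d j) * G \<alpha> (path \<alpha> d j) \<partial>Ap)
    \<le> (\<integral>\<^sup>+\<alpha>. of_bool (e < path \<alpha> d j) * B (path \<alpha> d j) \<partial>Ap)"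
proof -
  have "(\<integral>\<^sup>+\<alpha>. of_bool (e < path \<alpha> d j) * G \<alpha> (path \<alpha> d j) \<partial>Ap)
     = (\<Sum>u\<in>{e<..d}. \<integral>\<^sup>+\<alpha>. of_bool (path \<alpha> d j = u) * G \<alpha> u \<partial>Ap)"
    by (subst sum_path_eq) (rule nn_integral_sum, simp)
  also have "\<dots> = (\<Sum>u\<in>{e<..d}. (\<integral>\<^sup>+\<alpha>. of_bool (path \<alpha> d j = u) \<partial>Ap) * (\<integral>\<^sup>+\<alpha>. G \<alpha> u \<partial>Ap))"
  proof (intro sum.cong refl)
    fix u assume u: "u \<in> {e<..d}"
    have "depends_on {u<..} (\<lambda>\<alpha>. of_bool (path \<alpha> d j = u) :: ennreal)"
    proof (rule depends_onI)
      fix x y :: "nat \<Rightarrow> nat \<times> nat" assume "\<And>i. i \<in> {u<..} \<Longrightarrow> x i = y i"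
      then have "path x d j = u \<longleftrightarrow> path y d j = u" using u by (intro path_eq_iff_above[of u]) auto
      then show "of_bool (path x d j = u) = (of_bool (path y d j = u) :: ennreal)" by simp
    qed
    moreover have "depends_on (- {u<..}) (\<lambda>\<alpha>. G \<alpha> u)"
      using dep[of u] by (rule depends_on_mono) auto
    ultimately show "(\<integral>\<^sup>+\<alpha>. of_bool (path \<alpha> d j = u) * G \<alpha> u \<partial>Ap) = (\<integral>\<^sup>+\<alpha>. of_bool (path \<alpha> d j = u) \<partial>Ap) * (\<integral>\<^sup>+\<alpha>. G \<alpha> u \<partial>Ap)"
      by (intro nn_integral_Pi_pmf_mult) auto
  qed
  also have "\<dots> \<le> (\<Sum>u\<in>{e<..d}. (\<integral>\<^sup>+\<alpha>. of_bool (path \<alpha> d j = u) \<partial>Ap) * B u)"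
    by (intro sum_mono mult_left_mono B) auto
  also have "\<dots> = (\<integral>\<^sup>+\<alpha>. (\<Sum>u\<in>{e<..d}. of_bool (path \<alpha> d j = u) * B u) \<partial>Ap)"
    by (subst nn_integral_sum) (simp_all add: nn_integral_multc)
  also have "\<dots> = (\<integral>\<^sup>+\<alpha>. of_bool (e < path \<alpha> d j) * B (path \<alpha> d j) \<partial>Ap)"
    by (subst sum_path_eq) (rule refl)
  finally show ?thesis .
qed

text \<open>A supermartingale argument: the AL-links at the current node have not been read before,
  so each step contributes the average of \<open>avg_exp_theta\<close> independently of the path so
  far.\<close>

lemma path_exp_moment:
  assumes "d < N"
  shows "(\<integral>\<^sup>+\<alpha>. of_bool (e < path \<alpha> d j) * ennreal (exp (theta * (real (path \<alpha> d j) - real d) / real M)) \<partial>Ap)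
     \<le> ennreal ((1 - theta / 3) ^ j)"
proof (induction j)
  case 0
  then show ?case by (simp add: measure_pmf.emeasure_space_1)
next
  case (Suc j)
  let ?E = "\<lambda>u. exp (theta * (real u - real d) / real M)"
  let ?g = "\<lambda>a. exp (- (theta * (real a + 1) / real M))"
  have "(\<integral>\<^sup>+\<alpha>. of_bool (e < path \<alpha> d (Suc j)) * ennreal (?E (path \<alpha> d (Suc j))) \<partial>Ap)
    \<le> (\<integral>\<^sup>+\<alpha>. of_bool (e < path \<alpha> d j) * ennreal (?E (path \<alpha> d j) * ?g (fst (\<alpha> (path \<alpha> d j)))) \<partial>Ap)"
  proof (intro nn_integral_mono)
    fix \<alpha>
    let ?x = "path \<alpha> d j" and ?y = "path \<alpha> d (Suc j)"
    show "of_bool (e < ?y) * ennreal (?E ?y) \<le> of_bool (e < ?x) * ennreal (?E ?x * ?g (fst (\<alpha> ?x)))"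
    proof (cases "e < ?y")
      case True
      have y: "?y \<le> ?x - Suc (fst (\<alpha> ?x))" by (simp add: far_AL_def)
      then have "e < ?x" "real ?y \<le> real ?x - (real (fst (\<alpha> ?x)) + 1)" using True by linarith+
      then have "theta * (real ?y - real d) \<le> theta * (real ?x - real d - (real (fst (\<alpha> ?x)) + 1))"
        by (intro mult_left_mono) (auto simp: theta_def)
      then have "theta * (real ?y - real d) / real M \<le> theta * (real ?x - real d - (real (fst (\<alpha> ?x)) + 1)) / real M"
        by (rule divide_right_mono) simp
      then have "?E ?y \<le> ?E ?x * ?g (fst (\<alpha> ?x))"
        by (simp add: exp_add[symmetric] diff_divide_distrib right_diff_distrib)
      then show ?thesis using True \<open>e < ?x\<close> by (simp add: ennreal_leI)
    qed simp
  qed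
  also have "\<dots> \<le> (\<integral>\<^sup>+\<alpha>. of_bool (e < path \<alpha> d j) * ennreal (?E (path \<alpha> d j) * (1 - theta / 3)) \<partial>Ap)"
  proof (rule path_moment[where G = "\<lambda>\<alpha> u. ennreal (?E u * ?g (fst (\<alpha> u)))" and B = "\<lambda>u. ennreal (?E u * (1 - theta / 3))"])
    show "depends_on {..u} (\<lambda>\<alpha>. ennreal (?E u * ?g (fst (\<alpha> u))))" for u
      by (rule depends_onI) simp
    fix u assume u: "e < u" "u \<le> d"
    have "(\<integral>\<^sup>+\<alpha>. ennreal (?E u * ?g (fst (\<alpha> u))) \<partial>Ap) = (\<integral>\<^sup>+ab. (\<integral>\<^sup>+\<alpha>. ennreal (?E u * ?g (fst ab)) \<partial>Ap) \<partial>ALd)"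
      by (rule nn_integral_Ap_node[of u "\<lambda>_ ab. ennreal (?E u * ?g (fst ab))"]) (use u assms in auto)
    also have "\<dots> = (\<integral>\<^sup>+ab. ennreal (?E u * ?g (fst ab)) \<partial>ALd)"
      by (simp add: measure_pmf.emeasure_space_1)
    also have "\<dots> = ennreal ((\<Sum>a<M. ?E u * ?g a) / real M)"
      by (rule nn_integral_ALd(1)) simp
    also have "\<dots> = ennreal (?E u * ((\<Sum>a<M. ?g a) / real M))" by (simp add: sum_distrib_left)
    also have "\<dots> \<le> ennreal (?E u * (1 - theta / 3))"
      by (intro ennreal_leI mult_left_mono avg_exp_theta) simp
    finally show "(\<integral>\<^sup>+\<alpha>. ennreal (?E u * ?g (fst (\<alpha> u))) \<partial>Ap) \<le> ennreal (?E u * (1 - theta / 3))" .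
  qed
  also have "\<dots> = (\<integral>\<^sup>+\<alpha>. of_bool (e < path \<alpha> d j) * ennreal (?E (path \<alpha> d j)) \<partial>Ap) * ennreal (1 - theta / 3)"
  proof -
    have "ennreal (?E u * (1 - theta / 3)) = ennreal (?E u) * ennreal (1 - theta / 3)" for u
      by (rule ennreal_mult) (auto simp: theta_def)
    then show ?thesis by (subst nn_integral_multc[symmetric]) (simp_all only: mult.assoc, simp)
  qed
  also have "\<dots> \<le> ennreal ((1 - theta / 3) ^ j) * ennreal (1 - theta / 3)"
    by (intro mult_right_mono Suc.IH) simp
  also have "\<dots> = ennreal ((1 - theta / 3) ^ Suc j)"
    by (simp add: ennreal_mult[symmetric] theta_def mult.commute)
  finally show ?case .
qed

text \<open>A Chernoff bound from \<open>path_exp_moment\<close>: a path still above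
  \<open>e\<close> has advanced by less than \<open>2 * (k * M)\<close>.\<close>

lemma path_prob:
  assumes "d < N" "e < d" "d \<le> e + 2 * (k * M)"
  shows "(\<integral>\<^sup>+\<alpha>. of_bool (e < path \<alpha> d j) \<partial>Ap) \<le> ennreal (exp (2 * theta * k) * (1 - theta / 3) ^ j)"
proof -
  have "real d - real e \<le> 2 * real k * real M"
    using of_nat_mono[OF assms(3), where 'a = real] by (simp add: algebra_simps)
  then have "theta * (real d - real e) \<le> theta * (2 * real k * real M)"
    by (intro mult_left_mono) (auto simp: theta_def)
  then have k: "theta * (real d - real e) / real M \<le> 2 * theta * real k"
    using M_pos by (simp add: divide_le_eq mult_ac)
  have "(\<integral>\<^sup>+\<alpha>. of_bool (e < path \<alpha> d j) \<partial>Ap) \<le>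
    (\<integral>\<^sup>+\<alpha>. ennreal (exp (2 * theta * k)) * (of_bool (e < path \<alpha> d j) * ennreal (exp (theta * (real (path \<alpha> d j) - real d) / real M))) \<partial>Ap)"
  proof (intro nn_integral_mono)
    fix \<alpha>
    let ?x = "path \<alpha> d j"
    show "of_bool (e < ?x) \<le> ennreal (exp (2 * theta * k)) * (of_bool (e < ?x) * ennreal (exp (theta * (real ?x - real d) / real M)))"
    proof (cases "e < ?x")
      case True
      then have "theta * (real e - real d) \<le> theta * (real ?x - real d)" by (intro mult_left_mono) (auto simp: theta_def)
      then have "theta * (real e - real d) / real M \<le> theta * (real ?x - real d) / real M"
        by (rule divide_right_mono) simp
      moreover have "theta * (real e - real d) / real M = - (theta * (real d - real e) / real M)"
        by (simp add: minus_divide_left right_diff_distrib)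
      ultimately have "0 \<le> 2 * theta * k + theta * (real ?x - real d) / real M" using k by linarith
      then have "1 \<le> exp (2 * theta * k) * exp (theta * (real ?x - real d) / real M)"
        by (simp add: exp_add[symmetric])
      then show ?thesis using True by (simp add: ennreal_mult[symmetric] ennreal_leI flip: ennreal_1)
    qed simp
  qed
  also have "\<dots> = ennreal (exp (2 * theta * k)) * (\<integral>\<^sup>+\<alpha>. of_bool (e < path \<alpha> d j) * ennreal (exp (theta * (real (path \<alpha> d j) - real d) / real M)) \<partial>Ap)"
    by (rule nn_integral_cmult) simp
  also have "\<dots> \<le> ennreal (exp (2 * theta * k)) * ennreal ((1 - theta / 3) ^ j)"
    by (intro mult_left_mono path_exp_moment[OF assms(1)]) simp
  also have "\<dots> = ennreal (exp (2 * theta * k) * (1 - theta / 3) ^ j)"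
    by (rule ennreal_mult[symmetric]) (auto simp: theta_def)
  finally show ?thesis .
qed

lemma depends_on_rest: "depends_on {..u} (\<lambda>\<alpha>. rest \<alpha> u e)"
proof (rule depends_onI)
  fix x y :: "nat \<Rightarrow> nat \<times> nat" assume "\<And>i. i \<in> {..u} \<Longrightarrow> x i = y i"
  then have xy: "x i = y i" if "i \<le> u" for i using that by simp
  have F: "F x v e' = F y v e'" if "v \<le> u" for v e' using that xy by (intro F_cong) auto
  have n: "node x u w = node y u w" for w using xy by (intro node_cong) auto
  have 1: "egam * of_bool (e < v \<and> v < u) * F x v e = egam * of_bool (e < v \<and> v < u) * F y v e" for v
    using F[of v] by (cases "v < u") auto
  have 2: "F x (node x u w) e' = F y (node y u w) e'" for w e'
    using F[OF node_le[of x u w]] n by simp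
  have 3: "F x v e = F y v e" if "2 * v \<le> u" for v using that F by simp
  show "rest x u e = rest y u e"
    unfolding rest_def 1 2 by (simp add: 3)
qed

text \<open>The total charge for leaving the path towards \<open>v\<close>. Avoidance is followed
  through the first \<open>J\<close> steps only, because the bound on crowding degenerates for
  longer words.\<close>

definition exit_weight :: "nat \<Rightarrow> nat \<Rightarrow> nat \<Rightarrow> nat \<Rightarrow> (nat \<Rightarrow> nat) \<Rightarrow> (nat \<Rightarrow> nat \<times> nat) \<Rightarrow> ennreal" where
  "exit_weight d e J v \<kappa> \<alpha> = (\<Sum>j<d. egam ^ Suc j *
     of_bool (onpath \<kappa> \<alpha> d e j \<and> avoid \<kappa> \<alpha> d e (min j J) \<and> exit_to \<kappa> \<alpha> d j v))"

lemma onpath_path_less: "onpath \<kappa> \<alpha> d e j \<Longrightarrow> e < d \<Longrightarrow> i \<le> j \<Longrightarrow> e < path \<alpha> d i"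
  using onpath_less path_antimono less_le_trans by blast

text \<open>Before the exit, all nodes of the path lie above \<open>e\<close>, and
  \<open>avoid\<close> consults only nodes above \<open>e\<close>. Together with
  \<open>val_cong\<close> this makes the exit independent of the walk after it, which starts at
  \<open>v \<le> e\<close>.\<close>

lemma exit_event_above:
  assumes eq: "\<And>i. e < i \<Longrightarrow> \<kappa> i = \<kappa>' i" "\<And>i. e < i \<Longrightarrow> \<alpha> i = \<alpha>' i" and e: "0 < e" "e < d"
    and ev: "onpath \<kappa> \<alpha> d e j \<and> avoid \<kappa> \<alpha> d e (min j J) \<and> exit_to \<kappa> \<alpha> d j v"
  shows "onpath \<kappa>' \<alpha>' d e j \<and> avoid \<kappa>' \<alpha>' d e (min j J) \<and> exit_to \<kappa>' \<alpha>' d j v"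
proof -
  have x: "e < path \<alpha> d i" if "i \<le> j" for i using onpath_path_less ev e that by blast
  have p: "path \<alpha>' d i = path \<alpha> d i" if "i \<le> j" for i
    by (rule path_cong_above(1)[of e]) (use eq x[OF that] e in auto)
  have pS: "path \<alpha>' d (Suc i) = path \<alpha> d (Suc i)" if "i \<le> j" for i
    using p[OF that] eq(2)[OF x[OF that]] by (simp add: far_AL_def)
  have K: "\<kappa>' (path \<alpha> d i) = \<kappa> (path \<alpha> d i)" if "i \<le> j" for i using eq(1)[OF x[OF that]] by simp
  have 1: "onpath \<kappa>' \<alpha>' d e j" using ev p pS K unfolding onpath_def by simp
  have 2: "exit_to \<kappa>' \<alpha>' d j v" using ev p pS K unfolding exit_to_def by simp
  have "avoid \<kappa>' \<alpha>' d e (min j J)"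
    unfolding avoid_def
  proof (intro allI impI)
    fix i w assume iw: "i \<le> min j J" "length w = k" "e < node \<alpha>' (path \<alpha>' d i) w"
    have pi: "path \<alpha>' d i = path \<alpha> d i" using p iw by simp
    have n: "node \<alpha> (path \<alpha> d i) w = node \<alpha>' (path \<alpha> d i) w"
      by (rule node_cong_above[of e]) (use eq iw e pi in auto)
    then have "e < 2 * \<kappa> (node \<alpha> (path \<alpha> d i) w)" using ev iw n pi unfolding avoid_def by metis
    then show "e < 2 * \<kappa>' (node \<alpha>' (path \<alpha>' d i) w)" using n pi eq(1) iw by simp
  qed
  then show ?thesis using 1 2 by blast
qed

lemma exit_weight_above:
  assumes eq: "\<And>i. e < i \<Longrightarrow> \<kappa> i = \<kappa>' i" "\<And>i. e < i \<Longrightarrow> \<alpha> i = \<alpha>' i" and e: "0 < e" "e < d"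
  shows "exit_weight d e J v \<kappa> \<alpha> = exit_weight d e J v \<kappa>' \<alpha>'"
proof -
  have "(onpath \<kappa> \<alpha> d e j \<and> avoid \<kappa> \<alpha> d e (min j J) \<and> exit_to \<kappa> \<alpha> d j v) \<longleftrightarrow>
    (onpath \<kappa>' \<alpha>' d e j \<and> avoid \<kappa>' \<alpha>' d e (min j J) \<and> exit_to \<kappa>' \<alpha>' d j v)" for j
    using exit_event_above[of e \<kappa> \<kappa>' \<alpha> \<alpha>' d j J v] exit_event_above[of e \<kappa>' \<kappa> \<alpha>' \<alpha> d j J v] eq e by metis
  then show ?thesis by (simp add: exit_weight_def)
qed

lemma geometric_unroll: "gam ^ Suc j = gam + (gam - 1) * (\<Sum>i\<in>{1..j}. gam ^ i)"
proof (induction j)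
  case (Suc j)
  have "(\<Sum>i\<in>{1..Suc j}. gam ^ i) = (\<Sum>i\<in>{1..j}. gam ^ i) + gam ^ Suc j" by simp
  then have "gam + (gam - 1) * (\<Sum>i\<in>{1..Suc j}. gam ^ i) = gam ^ Suc j + (gam - 1) * gam ^ Suc j"
    using Suc.IH by (simp only: distrib_left add.assoc[symmetric])
  then show ?case by (simp add: algebra_simps)
qed simp

text \<open>Summation by parts. At most one \<open>j\<close> is the exit step, so its charge
  \<open>gam ^ Suc j\<close> can be written as \<open>gam\<close> plus increments paid at each
  survived step. The increments carry the small factor \<open>gam - 1\<close>; adding the bounds on
  the survival probabilities without it would lead far beyond \<open>1\<close>.\<close>

lemma sum_single_exit:
  assumes E: "\<And>i j. E i \<Longrightarrow> E j \<Longrightarrow> i = j" and S: "\<And>i j. i \<le> j \<Longrightarrow> S j \<Longrightarrow> S i"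
  shows "(\<Sum>j<J. egam ^ Suc j * of_bool (E j \<and> S j))
    \<le> egam * of_bool (S 0) + ennreal (gam - 1) * (\<Sum>i\<in>{1..<J}. egam ^ i * of_bool (S i))"
proof (cases "\<exists>j<J. E j \<and> S j")
  case True
  then obtain j where j: "j < J" "E j" "S j" by blast
  have "(\<Sum>j<J. egam ^ Suc j * of_bool (E j \<and> S j)) = egam ^ Suc j"
    using j E by (subst sum.remove[of _ j]) (auto intro!: sum.neutral)
  also have "\<dots> = ennreal (gam ^ Suc j)" by (rule ennreal_power) (use gam_gt_1 in simp)
  also have "\<dots> = ennreal gam + ennreal (gam - 1) * ennreal (\<Sum>i\<in>{1..j}. gam ^ i)"
    using gam_gt_1 unfolding geometric_unroll by (subst ennreal_plus) (auto simp: ennreal_mult sum_nonneg)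
  also have "ennreal (\<Sum>i\<in>{1..j}. gam ^ i) = (\<Sum>i\<in>{1..j}. egam ^ i * of_bool (S i))"
    using gam_gt_1 S[OF _ j(3)] by (subst sum_ennreal[symmetric]) (auto simp: ennreal_power intro!: sum.cong)
  also have "\<dots> \<le> (\<Sum>i\<in>{1..<J}. egam ^ i * of_bool (S i))"
    using j by (intro sum_mono2) auto
  finally show ?thesis using S[OF _ j(3), of 0] by (simp add: add_left_mono mult_left_mono)
next
  case False
  then have *: "(\<Sum>j<J. egam ^ Suc j * of_bool (E j \<and> S j)) = 0" by (intro sum.neutral) auto
  show ?thesis unfolding * by (rule zero_le)
qed

text \<open>For each \<open>j\<close> there is one possible exit target, the smaller of the K-link's
  end and the next node of the path. From step \<open>J\<close> on, the fact that at most one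
  \<open>j\<close> is the exit step is no longer exploited.\<close>

lemma sum_exit_weight_le:
  assumes e: "e < d" and J: "J \<le> d"
  shows "(\<Sum>v\<le>e. exit_weight d e J v \<kappa> \<alpha>) \<le> egam * of_bool (avoid \<kappa> \<alpha> d e 0)
     + ennreal (gam - 1) * (\<Sum>i\<in>{1..<J}. egam ^ i * of_bool (avoid \<kappa> \<alpha> d e i))
     + (\<Sum>j\<in>{J..<d}. egam ^ Suc j * of_bool (e < path \<alpha> d j \<and> avoid \<kappa> \<alpha> d e J))"
proof -
  let ?E = "\<lambda>j. onpath \<kappa> \<alpha> d e j \<and> \<not> onpath \<kappa> \<alpha> d e (Suc j)"
  let ?S = "avoid \<kappa> \<alpha> d e"
  have "(\<Sum>v\<le>e. exit_weight d e J v \<kappa> \<alpha>) = (\<Sum>j<d. \<Sum>v\<le>e. egam ^ Suc j * of_bool (onpath \<kappa> \<alpha> d e j \<and> ?S (min j J) \<and> exit_to \<kappa> \<alpha> d j v))"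
    unfolding exit_weight_def by (rule sum.swap)
  also have "\<dots> \<le> (\<Sum>j<d. egam ^ Suc j * of_bool (?E j \<and> ?S (min j J)))"
  proof (intro sum_mono)
    fix j
    let ?m = "min (\<kappa> (path \<alpha> d j)) (path \<alpha> d (Suc j))"
    have "of_bool (onpath \<kappa> \<alpha> d e j \<and> ?S (min j J) \<and> exit_to \<kappa> \<alpha> d j v)
      \<le> (of_bool (v = ?m) * of_bool (?E j \<and> ?S (min j J)) :: ennreal)" if "v \<le> e" for v
      using that by (auto simp: exit_to_def onpath_def of_bool_def)
    then have "(\<Sum>v\<le>e. egam ^ Suc j * of_bool (onpath \<kappa> \<alpha> d e j \<and> ?S (min j J) \<and> exit_to \<kappa> \<alpha> d j v))
      \<le> (\<Sum>v\<le>e. egam ^ Suc j * (of_bool (v = ?m) * of_bool (?E j \<and> ?S (min j J))))"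
      by (intro sum_mono mult_left_mono) auto
    also have "\<dots> = egam ^ Suc j * ((\<Sum>v\<le>e. of_bool (v = ?m)) * of_bool (?E j \<and> ?S (min j J)))"
      by (simp only: sum_distrib_left sum_distrib_right)
    also have "(\<Sum>v\<le>e. of_bool (v = ?m)) \<le> (1::ennreal)"
      by (simp add: of_bool_def sum.delta)
    finally show "(\<Sum>v\<le>e. egam ^ Suc j * of_bool (onpath \<kappa> \<alpha> d e j \<and> ?S (min j J) \<and> exit_to \<kappa> \<alpha> d j v))
      \<le> egam ^ Suc j * of_bool (?E j \<and> ?S (min j J))"
      by (simp add: mult_left_mono mult_right_mono)
  qed
  also have "{..<d} = {..<J} \<union> {J..<d}" using J by auto
  also have "(\<Sum>j\<in>{..<J} \<union> {J..<d}. egam ^ Suc j * of_bool (?E j \<and> ?S (min j J)))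
     = (\<Sum>j<J. egam ^ Suc j * of_bool (?E j \<and> ?S (min j J))) + (\<Sum>j\<in>{J..<d}. egam ^ Suc j * of_bool (?E j \<and> ?S (min j J)))"
    by (rule sum.union_disjoint) auto
  also have "(\<Sum>j<J. egam ^ Suc j * of_bool (?E j \<and> ?S (min j J))) = (\<Sum>j<J. egam ^ Suc j * of_bool (?E j \<and> ?S j))"
    by (intro sum.cong) auto
  also have "\<dots> \<le> egam * of_bool (?S 0) + ennreal (gam - 1) * (\<Sum>i\<in>{1..<J}. egam ^ i * of_bool (?S i))"
  proof (rule sum_single_exit)
    show "i = j" if "?E i" "?E j" for i j
    proof (rule ccontr)
      assume "i \<noteq> j"
      then consider "Suc i \<le> j" | "Suc j \<le> i" by linarith
      then show False using that by cases (auto simp: onpath_def)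
    qed
    show "?S i" if "i \<le> j" "?S j" for i j using that by (rule avoid_antimono)
  qed
  also have "(\<Sum>j\<in>{J..<d}. egam ^ Suc j * of_bool (?E j \<and> ?S (min j J))) \<le> (\<Sum>j\<in>{J..<d}. egam ^ Suc j * of_bool (e < path \<alpha> d j \<and> ?S J))"
    using onpath_less[OF _ e] by (intro sum_mono mult_left_mono) (auto simp: of_bool_def min_def)
  finally show ?thesis by (simp add: add_mono)
qed

text \<open>The second summand bounds the probability that the AL-paths starting from the first \<open>J\<close> nodes of the path
  meet too often.\<close>

definition avoid_bound :: "nat \<Rightarrow> nat \<Rightarrow> real" where
  "avoid_bound J j = exp (- (real (Suc j) / 16)) + 2 ^ J * (2 * (real (Suc J) * 2 ^ k) * (real (k + J) / real M))"

lemma avoid_bound_nonneg: "0 \<le> avoid_bound J j"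
  by (auto simp: avoid_bound_def intro!: add_nonneg_nonneg mult_nonneg_nonneg)

text \<open>Charge times drift per step of the path.\<close>

definition lam :: real where "lam = gam * (1 - theta / 3)"

lemma lam: "0 < lam" "lam < 1" by (auto simp: lam_def gam_def theta_def)

text \<open>The exit step is split into ranges. Below \<open>J\<close>, each step adds another fan
  to be avoided; from \<open>J\<close> to \<open>J2\<close>, avoiding the fans up to
  \<open>J\<close> has to suffice; from \<open>J2\<close> on, the path has most likely passed
  \<open>e\<close>, by \<open>path_prob\<close>.\<close>

definition exit_bound :: "nat \<Rightarrow> nat \<Rightarrow> real" where
  "exit_bound J J2 = gam * avoid_bound J 0 + (gam - 1) * (\<Sum>i\<in>{1..<J}. gam ^ i * avoid_bound J i)
     + real J2 * gam ^ J2 * avoid_bound J J + gam * exp (2 * theta * k) * lam ^ J2 / (1 - lam)"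

lemma sum_geometric_le:
  assumes "finite A" "\<And>j. j \<in> A \<Longrightarrow> m \<le> j"
  shows "(\<Sum>j\<in>A. lam ^ j) \<le> lam ^ m / (1 - lam)"
proof -
  have "(\<Sum>j\<in>A. lam ^ j) \<le> (\<Sum>j\<in>{m..<m + (Suc (Max (insert 0 A)))}. lam ^ j)"
  proof (intro sum_mono2)
    show "A \<subseteq> {m..<m + Suc (Max (insert 0 A))}"
    proof
      fix x assume "x \<in> A"
      then have "x \<le> Max (insert 0 A)" "m \<le> x" using assms by auto
      then show "x \<in> {m..<m + Suc (Max (insert 0 A))}" by simp
    qed
  qed (use lam in auto)
  also have "\<dots> = lam ^ m * (\<Sum>j<Suc (Max (insert 0 A)). lam ^ j)"
    by (subst sum.atLeastLessThan_shift_0) (simp only: sum_distrib_left power_add lessThan_atLeast0 add_diff_cancel_left' comp_def)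
  also have "(\<Sum>j<n. lam ^ j) \<le> 1 / (1 - lam)" for n
    using lam by (subst sum_gp_strict) (auto intro!: divide_right_mono)
  finally show ?thesis using lam by (simp add: mult_left_mono)
qed

lemma exit_weight_moment:
  assumes d: "8 * (k * M) \<le> d" "d < N" and e: "e = d - 2 * (k * M)" and J: "J < k" "J \<le> J2"
  shows "(\<integral>\<^sup>+\<alpha>. (\<integral>\<^sup>+\<kappa>. (\<Sum>v\<le>e. exit_weight d e J v \<kappa> \<alpha>) \<partial>Kp) \<partial>Ap) \<le> ennreal (exit_bound J J2)"
proof -
  have kM: "0 < k * M" "k \<le> k * M" using k_pos M_pos by auto
  have ed: "e < d" "d \<le> e + 2 * (k * M)" "J \<le> d" using d e kM J by linarith+
  let ?q = "avoid_bound J"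
  note q0 = avoid_bound_nonneg[of J]
  have S: "(\<integral>\<^sup>+\<alpha>. (\<integral>\<^sup>+\<kappa>. of_bool (avoid \<kappa> \<alpha> d e j) \<partial>Kp) \<partial>Ap) \<le> ennreal (?q j)" if "j \<le> J" for j
    using avoid_prob[OF d e that J(1)] by (simp add: avoid_bound_def)
  have "(\<integral>\<^sup>+\<alpha>. (\<integral>\<^sup>+\<kappa>. (\<Sum>v\<le>e. exit_weight d e J v \<kappa> \<alpha>) \<partial>Kp) \<partial>Ap)
    \<le> (\<integral>\<^sup>+\<alpha>. (\<integral>\<^sup>+\<kappa>. egam * of_bool (avoid \<kappa> \<alpha> d e 0)
     + ennreal (gam - 1) * (\<Sum>i\<in>{1..<J}. egam ^ i * of_bool (avoid \<kappa> \<alpha> d e i))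
     + (\<Sum>j\<in>{J..<d}. egam ^ Suc j * of_bool (e < path \<alpha> d j \<and> avoid \<kappa> \<alpha> d e J)) \<partial>Kp) \<partial>Ap)"
    by (intro nn_integral_mono sum_exit_weight_le ed)
  also have "\<dots> = egam * (\<integral>\<^sup>+\<alpha>. (\<integral>\<^sup>+\<kappa>. of_bool (avoid \<kappa> \<alpha> d e 0) \<partial>Kp) \<partial>Ap)
     + ennreal (gam - 1) * (\<Sum>i\<in>{1..<J}. egam ^ i * (\<integral>\<^sup>+\<alpha>. (\<integral>\<^sup>+\<kappa>. of_bool (avoid \<kappa> \<alpha> d e i) \<partial>Kp) \<partial>Ap))
     + (\<Sum>j\<in>{J..<d}. egam ^ Suc j * (\<integral>\<^sup>+\<alpha>. (\<integral>\<^sup>+\<kappa>. of_bool (e < path \<alpha> d j \<and> avoid \<kappa> \<alpha> d e J) \<partial>Kp) \<partial>Ap))"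
    by (simp only: nn_integral_add nn_integral_cmult nn_integral_sum measurable_count_space measurable_pmf_measure1 UNIV_I Pi_UNIV space_borel)
  also have "\<dots> \<le> ennreal (gam * ?q 0) + ennreal ((gam - 1) * (\<Sum>i\<in>{1..<J}. gam ^ i * ?q i))
     + (ennreal (real J2 * gam ^ J2 * ?q J) + ennreal (gam * exp (2 * theta * k) * lam ^ J2 / (1 - lam)))"
  proof (intro add_mono)
    have "egam * (\<integral>\<^sup>+\<alpha>. (\<integral>\<^sup>+\<kappa>. of_bool (avoid \<kappa> \<alpha> d e 0) \<partial>Kp) \<partial>Ap) \<le> egam * ennreal (?q 0)"
      by (intro mult_left_mono S) auto
    then show "egam * (\<integral>\<^sup>+\<alpha>. (\<integral>\<^sup>+\<kappa>. of_bool (avoid \<kappa> \<alpha> d e 0) \<partial>Kp) \<partial>Ap) \<le> ennreal (gam * ?q 0)"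
      using gam_gt_1 q0 by (simp add: ennreal_mult)
    have "ennreal (gam - 1) * (\<Sum>i\<in>{1..<J}. egam ^ i * (\<integral>\<^sup>+\<alpha>. (\<integral>\<^sup>+\<kappa>. of_bool (avoid \<kappa> \<alpha> d e i) \<partial>Kp) \<partial>Ap))
       \<le> ennreal (gam - 1) * (\<Sum>i\<in>{1..<J}. egam ^ i * ennreal (?q i))"
      by (intro mult_left_mono sum_mono S) auto
    also have "(\<Sum>i\<in>{1..<J}. egam ^ i * ennreal (?q i)) = ennreal (\<Sum>i\<in>{1..<J}. gam ^ i * ?q i)"
      using gam_gt_1 q0 by (subst sum_ennreal[symmetric]) (auto simp: ennreal_mult ennreal_power)
    also have "ennreal (gam - 1) * \<dots> = ennreal ((gam - 1) * (\<Sum>i\<in>{1..<J}. gam ^ i * ?q i))"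
      using gam_gt_1 q0 by (intro ennreal_mult[symmetric]) (auto intro!: sum_nonneg)
    finally show "ennreal (gam - 1) * (\<Sum>i\<in>{1..<J}. egam ^ i * (\<integral>\<^sup>+\<alpha>. (\<integral>\<^sup>+\<kappa>. of_bool (avoid \<kappa> \<alpha> d e i) \<partial>Kp) \<partial>Ap))
       \<le> ennreal ((gam - 1) * (\<Sum>i\<in>{1..<J}. gam ^ i * ?q i))" .
    let ?I = "\<lambda>j. \<integral>\<^sup>+\<alpha>. (\<integral>\<^sup>+\<kappa>. of_bool (e < path \<alpha> d j \<and> avoid \<kappa> \<alpha> d e J) \<partial>Kp) \<partial>Ap"
    have I1: "?I j \<le> ennreal (?q J)" for j
    proof -
      have "?I j \<le> (\<integral>\<^sup>+\<alpha>. (\<integral>\<^sup>+\<kappa>. of_bool (avoid \<kappa> \<alpha> d e J) \<partial>Kp) \<partial>Ap)"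
        by (intro nn_integral_mono) (auto simp: of_bool_def)
      also have "\<dots> \<le> ennreal (?q J)" by (rule S) simp
      finally show ?thesis .
    qed
    have I2: "?I j \<le> ennreal (exp (2 * theta * k) * (1 - theta / 3) ^ j)" for j
    proof -
      have "?I j \<le> (\<integral>\<^sup>+\<alpha>. (\<integral>\<^sup>+\<kappa>. of_bool (e < path \<alpha> d j) \<partial>Kp) \<partial>Ap)"
        by (intro nn_integral_mono) (auto simp: of_bool_def)
      also have "\<dots> = (\<integral>\<^sup>+\<alpha>. of_bool (e < path \<alpha> d j) \<partial>Ap)"
        by (simp add: measure_pmf.emeasure_space_1)
      also have "\<dots> \<le> ennreal (exp (2 * theta * k) * (1 - theta / 3) ^ j)"
        by (rule path_prob[OF d(2) ed(1,2)])
      finally show ?thesis .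
    qed
    have "(\<Sum>j\<in>{J..<d}. egam ^ Suc j * ?I j) \<le> (\<Sum>j\<in>{J..<d}. of_bool (j < J2) * ennreal (gam ^ J2 * ?q J)
        + of_bool (J2 \<le> j) * ennreal (gam * exp (2 * theta * k) * lam ^ j))"
    proof (intro sum_mono)
      fix j
      show "egam ^ Suc j * ?I j \<le> of_bool (j < J2) * ennreal (gam ^ J2 * ?q J)
        + of_bool (J2 \<le> j) * ennreal (gam * exp (2 * theta * k) * lam ^ j)"
      proof (cases "j < J2")
        case True
        then have "egam ^ Suc j \<le> egam ^ J2" using egam_ge_1 by (intro power_increasing) auto
        then have "egam ^ Suc j * ?I j \<le> egam ^ J2 * ennreal (?q J)" by (intro mult_mono I1) auto
        then show ?thesis using True gam_gt_1 q0 by (simp add: ennreal_mult ennreal_power)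
      next
        case False
        have "egam ^ Suc j * ?I j \<le> egam ^ Suc j * ennreal (exp (2 * theta * k) * (1 - theta / 3) ^ j)"
          by (intro mult_left_mono I2) simp
        also have "\<dots> = ennreal (gam ^ Suc j * (exp (2 * theta * k) * (1 - theta / 3) ^ j))"
        proof -
          have "0 \<le> exp (2 * theta * k) * (1 - theta / 3) ^ j" by (auto simp: theta_def)
          then show ?thesis using gam_gt_1 by (simp only: ennreal_power ennreal_mult zero_le_power less_imp_le[OF less_trans[OF zero_less_one gam_gt_1]])
        qed
        also have "gam ^ Suc j * (exp (2 * theta * k) * (1 - theta / 3) ^ j) = gam * exp (2 * theta * k) * lam ^ j"
          by (simp add: lam_def power_mult_distrib mult_ac)
        finally show ?thesis using False by simp
      qed
    qed
    also have "\<dots> = (\<Sum>j\<in>{J..<d}. of_bool (j < J2) * ennreal (gam ^ J2 * ?q J))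
        + (\<Sum>j\<in>{J..<d}. of_bool (J2 \<le> j) * ennreal (gam * exp (2 * theta * k) * lam ^ j))"
      by (rule sum.distrib)
    also have "\<dots> \<le> ennreal (real J2 * gam ^ J2 * ?q J) + ennreal (gam * exp (2 * theta * k) * lam ^ J2 / (1 - lam))"
    proof (intro add_mono)
      have "(\<Sum>j\<in>{J..<d}. of_bool (j < J2) * ennreal (gam ^ J2 * ?q J)) = (\<Sum>j\<in>{J..<d} \<inter> {..<J2}. ennreal (gam ^ J2 * ?q J))"
        by (intro sum.mono_neutral_cong_right) auto
      also have "\<dots> \<le> (\<Sum>j\<in>{..<J2}. ennreal (gam ^ J2 * ?q J))" by (intro sum_mono2) auto
      also have "\<dots> = ennreal (real (card {..<J2}) * (gam ^ J2 * ?q J))"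
        using gam_gt_1 q0 by (intro sum_ennreal_const) auto
      finally show "(\<Sum>j\<in>{J..<d}. of_bool (j < J2) * ennreal (gam ^ J2 * ?q J)) \<le> ennreal (real J2 * gam ^ J2 * ?q J)"
        by (simp add: mult.assoc)
      have "(\<Sum>j\<in>{J..<d}. of_bool (J2 \<le> j) * ennreal (gam * exp (2 * theta * k) * lam ^ j))
         = (\<Sum>j\<in>{J..<d} \<inter> {J2..}. ennreal (gam * exp (2 * theta * k) * lam ^ j))"
        by (intro sum.mono_neutral_cong_right) auto
      also have "\<dots> = ennreal (\<Sum>j\<in>{J..<d} \<inter> {J2..}. gam * exp (2 * theta * k) * lam ^ j)"
        using gam_gt_1 lam by (intro sum_ennreal) auto
      also have "\<dots> \<le> ennreal (gam * exp (2 * theta * k) * lam ^ J2 / (1 - lam))"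
      proof (intro ennreal_leI)
        have "(\<Sum>j\<in>{J..<d} \<inter> {J2..}. lam ^ j) \<le> lam ^ J2 / (1 - lam)" by (rule sum_geometric_le) auto
        then have "gam * exp (2 * theta * k) * (\<Sum>j\<in>{J..<d} \<inter> {J2..}. lam ^ j) \<le> gam * exp (2 * theta * k) * (lam ^ J2 / (1 - lam))"
          using gam_gt_1 by (intro mult_left_mono) auto
        then show "(\<Sum>j\<in>{J..<d} \<inter> {J2..}. gam * exp (2 * theta * k) * lam ^ j) \<le> gam * exp (2 * theta * k) * lam ^ J2 / (1 - lam)"
          by (simp add: sum_distrib_left)
      qed
      finally show "(\<Sum>j\<in>{J..<d}. of_bool (J2 \<le> j) * ennreal (gam * exp (2 * theta * k) * lam ^ j))
        \<le> ennreal (gam * exp (2 * theta * k) * lam ^ J2 / (1 - lam))" .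
    qed
    finally show "(\<Sum>j\<in>{J..<d}. egam ^ Suc j * ?I j) \<le> ennreal (real J2 * gam ^ J2 * ?q J) + ennreal (gam * exp (2 * theta * k) * lam ^ J2 / (1 - lam))" .
  qed
  also have "\<dots> = ennreal (exit_bound J J2)"
  proof -
    have "0 \<le> gam * ?q 0" "0 \<le> (gam - 1) * (\<Sum>i\<in>{1..<J}. gam ^ i * ?q i)" "0 \<le> real J2 * gam ^ J2 * ?q J"
      "0 \<le> gam * exp (2 * theta * k) * lam ^ J2 / (1 - lam)"
      using gam_gt_1 q0 lam by (auto intro!: mult_nonneg_nonneg sum_nonneg divide_nonneg_nonneg)
    then show ?thesis unfolding exit_bound_def by (simp add: ennreal_plus[symmetric] add.assoc del: ennreal_plus)
  qed
  finally show ?thesis .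
qed

text \<open>The exit weight reads links above \<open>e\<close> and the walk after the exit reads
  links at or below \<open>e\<close>, so the moment factors. The width \<open>2 * (k * M)\<close> of
  the zone leaves room for \<open>J < k\<close> steps with fans of depth \<open>k\<close>. Errors
  before the exit cost a geometric series in \<open>lam\<close>.\<close>

lemma fresh_moment:
  assumes d: "D0 \<le> d" "d < N" and J: "J < k" "J \<le> J2"
    and eps: "exit_bound J J2 + (eps_short + eps_half + eps_lose) * (exp (2 * theta * k) / (1 - lam)) \<le> 1"
    and IH: "\<And>x e. x < d \<Longrightarrow> x \<le> e + 2 * (k * M) \<Longrightarrow> (\<integral>\<^sup>+\<alpha>. F \<alpha> x e \<partial>Ap) \<le> ennreal (bnd x e)"
  shows "(\<integral>\<^sup>+\<alpha>. (\<integral>\<^sup>+\<kappa>. val \<kappa> \<alpha> d \<partial>Kp) \<partial>Ap) \<le> ennreal (phi d)"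
proof -
  have kM: "0 < k * M" using k_pos M_pos by simp
  define e where "e = d - 2 * (k * M)"
  have big: "8 * (k * M) \<le> d" "0 < e" "e < d" "d \<le> e + 2 * (k * M)" "D1 + k * M \<le> e" "8 * (k * M) \<le> e" "D0 \<le> 2 * e" "0 < d"
    using d(1) D0_D1 D1_ge kM unfolding e_def by linarith+
  let ?W = "exit_weight d e J"
  let ?c = "eps_short + eps_half + eps_lose"
  have c0: "0 \<le> ?c" using eps_nonneg by simp
  have unroll: "val \<kappa> \<alpha> d \<le> (\<Sum>j<d. egam ^ j * (of_bool (e < path \<alpha> d j) * rest0 \<kappa> \<alpha> (path \<alpha> d j) e)) + (\<Sum>v\<le>e. ?W v \<kappa> \<alpha> * val \<kappa> \<alpha> v)"
    if \<alpha>: "bounded_AL M \<alpha>" for \<kappa> \<alpha>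
  proof -
    \<comment> \<open>After \<open>d\<close> steps the path would be at distance \<open>0\<close>,
      so the remainder term of \<open>val_unroll\<close> vanishes.\<close>
    have "\<not> onpath \<kappa> \<alpha> d e d"
    proof
      assume "onpath \<kappa> \<alpha> d e d"
      from onpath_less[OF this big(3)] show False using path_le[of \<alpha> d d] by simp
    qed
    then have "val \<kappa> \<alpha> d \<le> (\<Sum>j<d. egam ^ j * (of_bool (e < path \<alpha> d j) * rest0 \<kappa> \<alpha> (path \<alpha> d j) e))
     + (\<Sum>j<d. \<Sum>v\<le>e. egam ^ Suc j * of_bool (onpath \<kappa> \<alpha> d e j \<and> (\<forall>i\<le>j. free \<kappa> \<alpha> (path \<alpha> d i)) \<and> exit_to \<kappa> \<alpha> d j v) * val \<kappa> \<alpha> v)"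
      using val_unroll[OF \<alpha> big(5,3), of \<kappa> d] by (simp del: power_Suc)
    also have "(\<Sum>j<d. \<Sum>v\<le>e. egam ^ Suc j * of_bool (onpath \<kappa> \<alpha> d e j \<and> (\<forall>i\<le>j. free \<kappa> \<alpha> (path \<alpha> d i)) \<and> exit_to \<kappa> \<alpha> d j v) * val \<kappa> \<alpha> v)
      \<le> (\<Sum>j<d. \<Sum>v\<le>e. egam ^ Suc j * of_bool (onpath \<kappa> \<alpha> d e j \<and> avoid \<kappa> \<alpha> d e (min j J) \<and> exit_to \<kappa> \<alpha> d j v) * val \<kappa> \<alpha> v)"
    proof (intro sum_mono mult_right_mono mult_left_mono)
      fix j v
      have "avoid \<kappa> \<alpha> d e (min j J)" if "onpath \<kappa> \<alpha> d e j" "\<forall>i\<le>j. free \<kappa> \<alpha> (path \<alpha> d i)"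
        unfolding avoid_def
      proof (intro allI impI)
        fix i and w :: "bool list" assume iw: "i \<le> min j J" "length w = k"
        then have "path \<alpha> d i < 2 * \<kappa> (node \<alpha> (path \<alpha> d i) w)" using that(2) by (auto simp: free_def words_def)
        moreover have "e < path \<alpha> d i" using onpath_path_less[OF that(1) big(3)] iw by simp
        ultimately show "e < 2 * \<kappa> (node \<alpha> (path \<alpha> d i) w)" by simp
      qed
      then show "of_bool (onpath \<kappa> \<alpha> d e j \<and> (\<forall>i\<le>j. free \<kappa> \<alpha> (path \<alpha> d i)) \<and> exit_to \<kappa> \<alpha> d j v)
        \<le> (of_bool (onpath \<kappa> \<alpha> d e j \<and> avoid \<kappa> \<alpha> d e (min j J) \<and> exit_to \<kappa> \<alpha> d j v) :: ennreal)"
        by (auto simp: of_bool_def)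
    qed simp_all
    also have "\<dots> = (\<Sum>v\<le>e. ?W v \<kappa> \<alpha> * val \<kappa> \<alpha> v)"
      unfolding exit_weight_def by (subst sum.swap) (simp only: sum_distrib_right)
    finally show ?thesis by (simp add: add_left_mono)
  qed
  have "(\<integral>\<^sup>+\<alpha>. (\<integral>\<^sup>+\<kappa>. val \<kappa> \<alpha> d \<partial>Kp) \<partial>Ap) \<le> (\<integral>\<^sup>+\<alpha>. (\<integral>\<^sup>+\<kappa>.
       (\<Sum>j<d. egam ^ j * (of_bool (e < path \<alpha> d j) * rest0 \<kappa> \<alpha> (path \<alpha> d j) e)) + (\<Sum>v\<le>e. ?W v \<kappa> \<alpha> * val \<kappa> \<alpha> v) \<partial>Kp) \<partial>Ap)"
    by (intro nn_integral_mono_AE AE_pmfI nn_integral_mono unroll bounded_AL_set)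
  also have "\<dots> = (\<Sum>j<d. egam ^ j * (\<integral>\<^sup>+\<alpha>. of_bool (e < path \<alpha> d j) * (\<integral>\<^sup>+\<kappa>. rest0 \<kappa> \<alpha> (path \<alpha> d j) e \<partial>Kp) \<partial>Ap))
      + (\<Sum>v\<le>e. \<integral>\<^sup>+\<alpha>. (\<integral>\<^sup>+\<kappa>. ?W v \<kappa> \<alpha> * val \<kappa> \<alpha> v \<partial>Kp) \<partial>Ap)"
    by (simp add: nn_integral_add nn_integral_cmult nn_integral_sum)
  also have "\<dots> \<le> ennreal (?c * (exp (2 * theta * k) / (1 - lam)) * phi d) + ennreal (exit_bound J J2 * phi d)"
  proof (intro add_mono)
    have "(\<Sum>j<d. egam ^ j * (\<integral>\<^sup>+\<alpha>. of_bool (e < path \<alpha> d j) * (\<integral>\<^sup>+\<kappa>. rest0 \<kappa> \<alpha> (path \<alpha> d j) e \<partial>Kp) \<partial>Ap))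
       \<le> (\<Sum>j<d. ennreal (?c * exp (2 * theta * k) * phi d * lam ^ j))"
    proof (intro sum_mono)
      fix j
      have "(\<integral>\<^sup>+\<alpha>. of_bool (e < path \<alpha> d j) * (\<integral>\<^sup>+\<kappa>. rest0 \<kappa> \<alpha> (path \<alpha> d j) e \<partial>Kp) \<partial>Ap)
        \<le> (\<integral>\<^sup>+\<alpha>. of_bool (e < path \<alpha> d j) * rest \<alpha> (path \<alpha> d j) e \<partial>Ap)"
      proof (intro nn_integral_mono_AE AE_pmfI)
        fix \<alpha> assume "\<alpha> \<in> set_pmf Ap"
        then have \<alpha>: "bounded_AL M \<alpha>" by (rule bounded_AL_set)
        let ?x = "path \<alpha> d j"
        have "(\<integral>\<^sup>+\<kappa>. rest0 \<kappa> \<alpha> ?x e \<partial>Kp) \<le> rest \<alpha> ?x e" if "e < ?x"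
        proof -
          have "?x \<le> d" using path_le[of \<alpha> d j] by simp
          then show ?thesis
            using rest_le[OF empty_in_plants[of ?x e] _ _ _ \<alpha>] that big d unfolding rest0_def plant_empty by simp
        qed
        then show "of_bool (e < ?x) * (\<integral>\<^sup>+\<kappa>. rest0 \<kappa> \<alpha> ?x e \<partial>Kp) \<le> of_bool (e < ?x) * rest \<alpha> ?x e"
          by (cases "e < ?x") auto
      qed
      also have "\<dots> \<le> (\<integral>\<^sup>+\<alpha>. of_bool (e < path \<alpha> d j) * ennreal (?c * phi d) \<partial>Ap)"
      proof (rule path_moment[where B = "\<lambda>_. ennreal (?c * phi d)", OF depends_on_rest])
        fix u assume u: "e < u" "u \<le> d"
        have "(\<integral>\<^sup>+\<alpha>. rest \<alpha> u e \<partial>Ap) \<le> ennreal (?c * phi u)"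
          by (rule rest_moment[OF _ _ _ u(1)]) (use u big d in \<open>auto intro!: IH\<close>)
        also have "\<dots> \<le> ennreal (?c * phi d)" using phi_mono[OF u(2)] c0 by (intro ennreal_leI mult_left_mono)
        finally show "(\<integral>\<^sup>+\<alpha>. rest \<alpha> u e \<partial>Ap) \<le> ennreal (?c * phi d)" .
      qed
      also have "\<dots> = (\<integral>\<^sup>+\<alpha>. of_bool (e < path \<alpha> d j) \<partial>Ap) * ennreal (?c * phi d)"
        by (rule nn_integral_multc) simp
      also have "\<dots> \<le> ennreal (exp (2 * theta * k) * (1 - theta / 3) ^ j) * ennreal (?c * phi d)"
        by (intro mult_right_mono path_prob[OF d(2) big(3,4)]) simp
      finally have "egam ^ j * (\<integral>\<^sup>+\<alpha>. of_bool (e < path \<alpha> d j) * (\<integral>\<^sup>+\<kappa>. rest0 \<kappa> \<alpha> (path \<alpha> d j) e \<partial>Kp) \<partial>Ap)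
        \<le> egam ^ j * (ennreal (exp (2 * theta * k) * (1 - theta / 3) ^ j) * ennreal (?c * phi d))"
        by (rule mult_left_mono) simp
      also have "\<dots> = ennreal (gam ^ j * (exp (2 * theta * k) * (1 - theta / 3) ^ j * (?c * phi d)))"
      proof -
        have a: "0 \<le> gam ^ j" "egam ^ j = ennreal (gam ^ j)" using gam_gt_1 by (auto simp: ennreal_power)
        have b: "0 \<le> exp (2 * theta * k) * (1 - theta / 3) ^ j" "0 \<le> ?c * phi d" using c0 by (auto simp: theta_def)
        show ?thesis unfolding a(2) ennreal_mult[OF a(1) mult_nonneg_nonneg[OF b]] ennreal_mult[OF b] ..
      qed
      also have "gam ^ j * (exp (2 * theta * k) * (1 - theta / 3) ^ j * (?c * phi d)) = ?c * exp (2 * theta * k) * phi d * lam ^ j"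
        by (simp add: lam_def power_mult_distrib mult_ac)
      finally show "egam ^ j * (\<integral>\<^sup>+\<alpha>. of_bool (e < path \<alpha> d j) * (\<integral>\<^sup>+\<kappa>. rest0 \<kappa> \<alpha> (path \<alpha> d j) e \<partial>Kp) \<partial>Ap)
        \<le> ennreal (?c * exp (2 * theta * k) * phi d * lam ^ j)" .
    qed
    also have "\<dots> = ennreal (\<Sum>j<d. ?c * exp (2 * theta * k) * phi d * lam ^ j)"
      using c0 lam by (intro sum_ennreal) auto
    also have "\<dots> = ennreal (?c * exp (2 * theta * k) * phi d * (\<Sum>j<d. lam ^ j))"
      by (simp only: sum_distrib_left)
    also have "\<dots> \<le> ennreal (?c * exp (2 * theta * k) * phi d * (lam ^ 0 / (1 - lam)))"
      using c0 by (intro ennreal_leI mult_left_mono sum_geometric_le) auto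
    finally show "(\<Sum>j<d. egam ^ j * (\<integral>\<^sup>+\<alpha>. of_bool (e < path \<alpha> d j) * (\<integral>\<^sup>+\<kappa>. rest0 \<kappa> \<alpha> (path \<alpha> d j) e \<partial>Kp) \<partial>Ap))
      \<le> ennreal (?c * (exp (2 * theta * k) / (1 - lam)) * phi d)" by (simp add: mult_ac)
  next
    have "(\<Sum>v\<le>e. \<integral>\<^sup>+\<alpha>. (\<integral>\<^sup>+\<kappa>. ?W v \<kappa> \<alpha> * val \<kappa> \<alpha> v \<partial>Kp) \<partial>Ap)
      \<le> (\<Sum>v\<le>e. (\<integral>\<^sup>+\<alpha>. (\<integral>\<^sup>+\<kappa>. ?W v \<kappa> \<alpha> \<partial>Kp) \<partial>Ap) * ennreal (phi d))"
    proof (intro sum_mono)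
      fix v assume "v \<in> {..e}"
      then have v: "v \<le> e" by simp
      have "(\<integral>\<^sup>+\<kappa>. ?W v \<kappa> \<alpha> * val \<kappa> \<alpha> v \<partial>Kp) = (\<integral>\<^sup>+\<kappa>. ?W v \<kappa> \<alpha> \<partial>Kp) * F \<alpha> v e" for \<alpha>
      proof -
        have "depends_on {e<..} (\<lambda>\<kappa>. ?W v \<kappa> \<alpha>)"
          using big by (intro depends_onI exit_weight_above) auto
        moreover have "depends_on (- {e<..}) (\<lambda>\<kappa>. val \<kappa> \<alpha> v)"
          using v by (intro depends_onI val_cong) auto
        ultimately show ?thesis
          unfolding F_fresh[OF v] by (intro nn_integral_Pi_pmf_mult) auto
      qed
      then have "(\<integral>\<^sup>+\<alpha>. (\<integral>\<^sup>+\<kappa>. ?W v \<kappa> \<alpha> * val \<kappa> \<alpha> v \<partial>Kp) \<partial>Ap) = (\<integral>\<^sup>+\<alpha>. (\<integral>\<^sup>+\<kappa>. ?W v \<kappa> \<alpha> \<partial>Kp) * F \<alpha> v e \<partial>Ap)"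
        by simp
      also have "\<dots> = (\<integral>\<^sup>+\<alpha>. (\<integral>\<^sup>+\<kappa>. ?W v \<kappa> \<alpha> \<partial>Kp) \<partial>Ap) * (\<integral>\<^sup>+\<alpha>. F \<alpha> v e \<partial>Ap)"
      proof (rule nn_integral_Pi_pmf_mult[where B = "{e<..}"])
        show "depends_on {e<..} (\<lambda>\<alpha>. \<integral>\<^sup>+\<kappa>. ?W v \<kappa> \<alpha> \<partial>Kp)"
          using big by (intro depends_onI nn_integral_cong exit_weight_above) auto
        show "depends_on (- {e<..}) (\<lambda>\<alpha>. F \<alpha> v e)"
          by (rule depends_on_mono[OF depends_on_F]) (use v in auto)
      qed simp
      also have "\<dots> \<le> (\<integral>\<^sup>+\<alpha>. (\<integral>\<^sup>+\<kappa>. ?W v \<kappa> \<alpha> \<partial>Kp) \<partial>Ap) * ennreal (phi d)"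
      proof (rule mult_left_mono)
        have "(\<integral>\<^sup>+\<alpha>. F \<alpha> v e \<partial>Ap) \<le> ennreal (phi v)" using IH[of v e] v big by (simp add: bnd_def)
        also have "\<dots> \<le> ennreal (phi d)" using v big by (intro ennreal_leI phi_mono) simp
        finally show "(\<integral>\<^sup>+\<alpha>. F \<alpha> v e \<partial>Ap) \<le> ennreal (phi d)" .
      qed simp
      finally show "(\<integral>\<^sup>+\<alpha>. (\<integral>\<^sup>+\<kappa>. ?W v \<kappa> \<alpha> * val \<kappa> \<alpha> v \<partial>Kp) \<partial>Ap) \<le> (\<integral>\<^sup>+\<alpha>. (\<integral>\<^sup>+\<kappa>. ?W v \<kappa> \<alpha> \<partial>Kp) \<partial>Ap) * ennreal (phi d)" .
    qed
    also have "\<dots> = (\<integral>\<^sup>+\<alpha>. (\<integral>\<^sup>+\<kappa>. (\<Sum>v\<le>e. ?W v \<kappa> \<alpha>) \<partial>Kp) \<partial>Ap) * ennreal (phi d)"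
      by (simp add: nn_integral_sum sum_distrib_right)
    also have "\<dots> \<le> ennreal (exit_bound J J2) * ennreal (phi d)"
      by (intro mult_right_mono exit_weight_moment[OF big(1) d(2) e_def J]) simp
    also have "\<dots> = ennreal (exit_bound J J2 * phi d)"
    proof -
      have "0 \<le> exit_bound J J2"
        using gam_gt_1 avoid_bound_nonneg lam unfolding exit_bound_def
        by (auto intro!: add_nonneg_nonneg mult_nonneg_nonneg sum_nonneg divide_nonneg_nonneg)
      then show ?thesis by (simp add: ennreal_mult)
    qed
    finally show "(\<Sum>v\<le>e. \<integral>\<^sup>+\<alpha>. (\<integral>\<^sup>+\<kappa>. ?W v \<kappa> \<alpha> * val \<kappa> \<alpha> v \<partial>Kp) \<partial>Ap) \<le> ennreal (exit_bound J J2 * phi d)" .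
  qed
  also have "\<dots> = ennreal ((exit_bound J J2 + ?c * (exp (2 * theta * k) / (1 - lam))) * phi d)"
  proof -
    have "0 \<le> exit_bound J J2"
      using gam_gt_1 avoid_bound_nonneg lam unfolding exit_bound_def
      by (auto intro!: add_nonneg_nonneg mult_nonneg_nonneg sum_nonneg divide_nonneg_nonneg)
    then have X: "0 \<le> exit_bound J J2 * phi d" by simp
    have "0 \<le> ?c * (exp (2 * theta * k) / (1 - lam))" using c0 lam by (intro mult_nonneg_nonneg) auto
    then have "0 \<le> ?c * (exp (2 * theta * k) / (1 - lam)) * phi d" by (rule mult_nonneg_nonneg) simp
    then show ?thesis using X unfolding distrib_right by (simp only: ennreal_plus add.commute)
  qed
  also have "\<dots> \<le> ennreal (1 * phi d)" by (intro ennreal_leI mult_right_mono eps) simp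
  finally show ?thesis by simp
qed

text \<open>From \<open>D0\<close> on, the induction over \<open>d\<close> treats all
  \<open>e\<close> at once, because a lost target leads to a stage with another border. The case
  \<open>e = d\<close> is the network none of whose links has been inspected.\<close>

theorem val_moment:
  assumes eps: "eps_plant + eps_short + eps_half + eps_lose \<le> 1 / 1000"
    and J: "J < k" "J \<le> J2"
    and eps2: "exit_bound J J2 + (eps_short + eps_half + eps_lose) * (exp (2 * theta * k) / (1 - lam)) \<le> 1"
    and d: "d < N"
  shows "(\<integral>\<^sup>+\<alpha>. (\<integral>\<^sup>+\<kappa>. val \<kappa> \<alpha> d \<partial>Kp) \<partial>Ap) \<le> ennreal (phi d)"
proof -
  have wild: "(\<integral>\<^sup>+\<alpha>. F \<alpha> d e \<partial>Ap) \<le> ennreal (phi d)" if "d < D0" "d < N" for d e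
    using that
  proof (induction d rule: less_induct)
    case (less d)
    show ?case
    proof (cases "d < D1")
      case True
      then show ?thesis using ennreal_leI[OF phi_ge_1[of d]] by (simp add: F_below measure_pmf.emeasure_space_1)
    next
      case False
      show ?thesis
        by (rule wild_moment) (use False less eps eps_nonneg in auto)
    qed
  qed
  have "\<forall>e. d \<le> e + 2 * (k * M) \<longrightarrow> (\<integral>\<^sup>+\<alpha>. F \<alpha> d e \<partial>Ap) \<le> ennreal (bnd d e)" if "d < N" for d
    using that
  proof (induction d rule: less_induct)
    case (less d)
    have IH: "(\<integral>\<^sup>+\<alpha>. F \<alpha> x e \<partial>Ap) \<le> ennreal (bnd x e)" if "x < d" "x \<le> e + 2 * (k * M)" for x e
      using less.IH[OF that(1)] less.prems that by simp
    show ?case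
    proof (intro allI impI)
      fix e assume e: "d \<le> e + 2 * (k * M)"
      show "(\<integral>\<^sup>+\<alpha>. F \<alpha> d e \<partial>Ap) \<le> ennreal (bnd d e)"
      proof (cases "d < D0")
        case True
        have "phi d \<le> bnd d e" using phi_le_bnd[of e d] by (cases "d \<le> e") (auto simp: bnd_def)
        then show ?thesis using wild[OF True less.prems, of e] by (meson ennreal_leI order_trans)
      next
        case D0: False
        show ?thesis
        proof (cases "e < d")
          case True
          show ?thesis by (rule stage_moment) (use D0 True e less.prems eps IH in auto)
        next
          case False
          then have "F \<alpha> d e = (\<integral>\<^sup>+\<kappa>. val \<kappa> \<alpha> d \<partial>Kp)" for \<alpha> by (intro F_fresh) simp
          then show ?thesis using fresh_moment[OF _ less.prems J eps2 IH] D0 False by (simp add: bnd_def)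
        qed
      qed
    qed
  qed
  from this[OF d] have "(\<integral>\<^sup>+\<alpha>. F \<alpha> d d \<partial>Ap) \<le> ennreal (bnd d d)" by simp
  then show ?thesis by (simp add: F_fresh bnd_def)
qed

end

subsection \<open>The final phase\<close>

text \<open>The test \<open>d \<le> g d\<close> makes the recursion terminate for every
  \<open>g\<close>. For greedy steps it holds at \<open>0\<close> only, so that the value is the
  number of hops to the target.\<close>

function greedy_time :: "(nat \<Rightarrow> nat) \<Rightarrow> nat \<Rightarrow> nat" where
  "greedy_time g d = (if d \<le> g d then 0 else Suc (greedy_time g (g d)))"
  by pat_completeness auto
termination by (relation "Wellfounded.measure snd") auto

declare greedy_time.simps [simp del]

lemma greedy_time_cong: "(\<And>i. i \<le> d \<Longrightarrow> g i = h i) \<Longrightarrow> greedy_time g d = greedy_time h d"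
proof (induction d rule: less_induct)
  case (less d)
  have gd: "g d = h d" using less.prems by simp
  show ?case
  proof (cases "d \<le> g d")
    case True
    then show ?thesis using gd by (simp add: greedy_time.simps[of g d] greedy_time.simps[of h d])
  next
    case False
    then have "greedy_time g (g d) = greedy_time h (g d)" using less.prems by (intro less.IH) auto
    then show ?thesis using gd False by (simp add: greedy_time.simps[of g d] greedy_time.simps[of h d])
  qed
qed

lemma greedy_time_0: "greedy_time g 0 = 0" by (simp add: greedy_time.simps)

context routing
begin

text \<open>\<open>1 + p / 2\<close> for the bound \<open>p = 1 / (4 * Z)\<close> of
  \<open>no_jump_prob\<close> on the chance to halve the distance.\<close>

definition bet :: real where "bet = 1 + 1 / (8 * Z)"

lemma bet_gt_1: "1 < bet" using Z_pos by (simp add: bet_def)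

text \<open>The AL-links enter only through the decreasing function \<open>ga\<close>, so they may
  be fixed. One step leads to at most \<open>d / 2\<close> with probability \<open>p\<close> or more
  and to at most \<open>d - 1\<close> otherwise; this gain of about \<open>p * d / 2\<close> cancels
  the factor \<open>1 + p / 2\<close> to first order.\<close>

lemma greedy_moment:
  assumes ga: "\<And>d. 0 < d \<Longrightarrow> ga d < d" and Z1: "1 \<le> Z" and d: "d < N"
  shows "(\<integral>\<^sup>+\<kappa>. ennreal (bet ^ greedy_time (\<lambda>d. min (\<kappa> d) (ga d)) d) \<partial>Kp) \<le> ennreal (real d + 1)"
  using d
proof (induction d rule: less_induct)
  case (less d)
  let ?T = "\<lambda>\<kappa>. greedy_time (\<lambda>d. min (\<kappa> d) (ga d))"
  have b: "0 \<le> bet" using bet_gt_1 by simp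
  show ?case
  proof (cases "d = 0")
    case True
    then show ?thesis by (simp add: greedy_time_0 measure_pmf.emeasure_space_1)
  next
    case False
    then have d0: "0 < d" by simp
    have "(\<integral>\<^sup>+\<kappa>. ennreal (bet ^ ?T \<kappa> d) \<partial>Kp) = (\<integral>\<^sup>+v. (\<integral>\<^sup>+\<kappa>. ennreal (bet * bet ^ ?T \<kappa> (min v (ga d))) \<partial>Kp) \<partial>Kd d)"
    proof (subst nn_integral_Pi_pmf_resample[where i = d])
      show "(\<integral>\<^sup>+v. (\<integral>\<^sup>+\<kappa>. ennreal (bet ^ ?T (\<kappa>(d := v)) d) \<partial>Kp) \<partial>Kd d) = (\<integral>\<^sup>+v. (\<integral>\<^sup>+\<kappa>. ennreal (bet * bet ^ ?T \<kappa> (min v (ga d))) \<partial>Kp) \<partial>Kd d)"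
      proof (intro nn_integral_cong arg_cong[of _ _ ennreal])
        fix v \<kappa>
        have lt: "min v (ga d) < d" using ga[OF d0] by simp
        have "?T (\<kappa>(d := v)) (min v (ga d)) = ?T \<kappa> (min v (ga d))"
          using lt by (intro greedy_time_cong) auto
        then show "bet ^ ?T (\<kappa>(d := v)) d = bet * bet ^ ?T \<kappa> (min v (ga d))"
          using lt by (subst greedy_time.simps) auto
      qed
    qed (use less.prems in auto)
    also have "\<dots> \<le> (\<integral>\<^sup>+v. ennreal (bet * (real (min v (ga d)) + 1)) \<partial>Kd d)"
    proof (intro nn_integral_mono)
      fix v
      have lt: "min v (ga d) < d" using ga[OF d0] by simp
      have "(\<integral>\<^sup>+\<kappa>. ennreal (bet * bet ^ ?T \<kappa> (min v (ga d))) \<partial>Kp) = ennreal bet * (\<integral>\<^sup>+\<kappa>. ennreal (bet ^ ?T \<kappa> (min v (ga d))) \<partial>Kp)"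
        using b by (simp add: ennreal_mult nn_integral_cmult)
      also have "\<dots> \<le> ennreal bet * ennreal (real (min v (ga d)) + 1)"
        using less.IH[OF lt] lt less.prems by (intro mult_left_mono) auto
      also have "\<dots> = ennreal (bet * (real (min v (ga d)) + 1))" using b by (intro ennreal_mult[symmetric]) auto
      finally show "(\<integral>\<^sup>+\<kappa>. ennreal (bet * bet ^ ?T \<kappa> (min v (ga d))) \<partial>Kp) \<le> ennreal (bet * (real (min v (ga d)) + 1))" .
    qed
    also have "\<dots> \<le> ennreal (real d + 1)"
    \<comment> \<open>\<open>no_jump_prob\<close> is applied with threshold \<open>d - 1\<close>,
      which requires \<open>d \<le> 2 * (d - 1)\<close>.\<close>
    proof (cases "d = 1")
      case True
      have "ga d = 0" using ga[OF d0] True by simp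
      moreover have "bet \<le> 2" using Z1 by (simp add: bet_def divide_simps)
      ultimately show ?thesis using True by (intro nn_integral_pmf_le_const) (use ennreal_leI[of bet 2] in auto)
    next
      case False
      then have d2: "2 \<le> d" using d0 by simp
      let ?c = "real d / 2 - 1" and ?p = "1 / (4 * Z)"
      have c0: "0 \<le> ?c" using d2 by simp
      have p: "0 \<le> ?p" "?p \<le> 1" using Z1 by auto
      have "(\<integral>\<^sup>+v. ennreal (bet * (real (min v (ga d)) + 1)) \<partial>Kd d)
         \<le> (\<integral>\<^sup>+v. ennreal (bet * (real d / 2 + 1)) + ennreal (bet * ?c) * of_bool (d - 1 < 2 * v) \<partial>Kd d)"
      proof (intro nn_integral_mono)
        fix v
        have "real (min v (ga d)) + 1 \<le> real d / 2 + 1 + ?c * of_bool (d - 1 < 2 * v)"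
          using ga[OF d0] d2 by (cases "d - 1 < 2 * v") (auto simp: min_def)
        then have "bet * (real (min v (ga d)) + 1) \<le> bet * (real d / 2 + 1 + ?c * of_bool (d - 1 < 2 * v))"
          by (rule mult_left_mono[OF _ b])
        then have "ennreal (bet * (real (min v (ga d)) + 1)) \<le> ennreal (bet * (real d / 2 + 1) + bet * ?c * of_bool (d - 1 < 2 * v))"
          by (intro ennreal_leI) (simp only: distrib_left mult.assoc)
        also have "\<dots> = ennreal (bet * (real d / 2 + 1)) + ennreal (bet * ?c) * of_bool (d - 1 < 2 * v)"
          using b c0 by (cases "d - 1 < 2 * v") auto
        finally show "ennreal (bet * (real (min v (ga d)) + 1)) \<le> ennreal (bet * (real d / 2 + 1)) + ennreal (bet * ?c) * of_bool (d - 1 < 2 * v)" .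
      qed
      also have "\<dots> = ennreal (bet * (real d / 2 + 1)) + ennreal (bet * ?c) * (\<integral>\<^sup>+v. of_bool (d - 1 < 2 * v) \<partial>Kd d)"
        by (simp add: nn_integral_add nn_integral_cmult measure_pmf.emeasure_space_1)
      also have "\<dots> \<le> ennreal (bet * (real d / 2 + 1)) + ennreal (bet * ?c) * ennreal (1 - ?p)"
        by (intro add_left_mono mult_left_mono no_jump_prob[of _ _ d]) (use d2 less.prems in auto)
      also have "\<dots> = ennreal (bet * (real d / 2 + 1) + bet * ?c * (1 - ?p))"
      proof -
        have "0 \<le> bet * ?c" "0 \<le> 1 - ?p" "0 \<le> bet * (real d / 2 + 1)" using b c0 p by auto
        then show ?thesis by (simp only: ennreal_mult[symmetric] ennreal_plus mult_nonneg_nonneg)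
      qed
      also have "\<dots> \<le> ennreal (real d + 1)"
      proof (intro ennreal_leI)
        have bp: "bet = 1 + ?p / 2" by (simp add: bet_def)
        have "(1 + q / 2) * (x / 2 + 1) + (1 + q / 2) * (x / 2 - 1) * (1 - q) = x - x * q\<^sup>2 / 4 + q * (1 + q / 2)"
          for q x :: real by (simp add: field_simps power2_eq_square)
        from this[of ?p "real d"] have "bet * (real d / 2 + 1) + bet * ?c * (1 - ?p) = real d - real d * ?p\<^sup>2 / 4 + ?p * (1 + ?p / 2)"
          unfolding bp .
        also have "\<dots> \<le> real d + 1"
        proof -
          have "?p \<le> 1 / 4" using Z1 by (simp add: divide_simps)
          then have "?p * (1 + ?p / 2) \<le> 1 / 4 * (1 + 1 / 2)" using p by (intro mult_mono) auto
          moreover have "0 \<le> real d * ?p\<^sup>2 / 4" by simp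
          moreover have "x - y + z \<le> x + 1" if "z \<le> 1 / 4 * (1 + 1 / 2)" "0 \<le> y" for x y z :: real
            using that by simp
          ultimately show ?thesis by blast
        qed
        finally show "bet * (real d / 2 + 1) + bet * ?c * (1 - ?p) \<le> real d + 1" .
      qed
      finally show ?thesis .
    qed
    finally show ?thesis .
  qed
qed

end

subsection \<open>Change of coordinates\<close>

text \<open>The map \<open>f d\<close> may depend on the coordinate, as the lengths of AL-links are
  measured from their own node.\<close>

lemma Pi_pmf_reindex_map:
  assumes "finite A" "inj_on h A"
  shows "map_pmf (\<lambda>G d. if d \<in> A then f d (G (h d)) else e) (Pi_pmf (h ` A) dflt p) =
     Pi_pmf A e (\<lambda>d. map_pmf (f d) (p (h d)))"
  using assms
proof (induction A rule: finite_induct)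
  case empty
  then show ?case by simp
next
  case (insert a A)
  have ha: "h a \<notin> h ` A" using insert.hyps insert.prems by auto
  have inj: "inj_on h A" using insert.prems by simp
  have hx: "h x \<noteq> h a" if "x \<in> A" for x using ha imageI[OF that, of h] by metis
  have "map_pmf (\<lambda>G d. if d \<in> insert a A then f d (G (h d)) else e) (Pi_pmf (h ` insert a A) dflt p)
    = map_pmf (\<lambda>(y, G). (\<lambda>d. if d \<in> A then f d (G (h d)) else e)(a := f a y)) (pair_pmf (p (h a)) (Pi_pmf (h ` A) dflt p))"
    using insert.hyps ha unfolding image_insert
    by (subst Pi_pmf_insert) (auto simp: hx pmf.map_comp case_prod_unfold fun_eq_iff intro!: map_pmf_cong)
  also have "\<dots> = map_pmf (\<lambda>(y, G). G(a := y)) (pair_pmf (map_pmf (f a) (p (h a))) (map_pmf (\<lambda>G d. if d \<in> A then f d (G (h d)) else e) (Pi_pmf (h ` A) dflt p)))"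
    by (simp add: map_pair[symmetric] pmf.map_comp comp_def case_prod_unfold)
  also have "\<dots> = Pi_pmf (insert a A) e (\<lambda>d. map_pmf (f d) (p (h d)))"
    using insert.hyps by (subst insert.IH[OF inj], subst Pi_pmf_insert) auto
  finally show ?case .
qed

lemma Pi_pmf_pair:
  assumes "finite A"
  shows "Pi_pmf A (a, b) (\<lambda>x. pair_pmf (p x) (q x)) =
     map_pmf (\<lambda>(f, g) x. (f x, g x)) (pair_pmf (Pi_pmf A a p) (Pi_pmf A b q))"
  using assms
proof (induction A rule: finite_induct)
  case empty
  then show ?case by simp
next
  case (insert x A)
  show ?case
    using insert.hyps unfolding Pi_pmf_insert[OF insert.hyps] insert.IH
    by (simp add: pair_pmf_def map_pmf_def bind_assoc_pmf bind_return_pmf case_prod_unfold fun_upd_def)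
       (subst (2) bind_commute_pmf, simp add: if_distrib cong: if_cong)
qed

definition at_dist :: "nat \<Rightarrow> nat \<Rightarrow> nat \<Rightarrow> nat" where
  "at_dist n t d = (t + n - d) mod n"

lemma int_at_dist: "d \<le> n \<Longrightarrow> int (at_dist n t d) = (int t - int d) mod int n"
proof -
  assume "d \<le> n"
  then have "int (at_dist n t d) = (int t - int d + int n) mod int n"
    by (simp add: at_dist_def zmod_int of_nat_diff algebra_simps)
  then show ?thesis by simp
qed

lemma int_ring_dist: "0 < n \<Longrightarrow> int (ring_dist n u v) = (int v - int u) mod int n"
  by (simp add: ring_dist_def)

lemma ring_dist_less: "0 < n \<Longrightarrow> ring_dist n u v < n"
  using int_ring_dist[of n u v] by (metis of_nat_less_iff pos_mod_bound of_nat_0_less_iff)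

lemma at_dist_less: "0 < n \<Longrightarrow> at_dist n t d < n"
  by (simp add: at_dist_def)

lemma ring_dist_at_dist_both:
  assumes "v \<le> d" "d < n"
  shows "ring_dist n (at_dist n t d) (at_dist n t v) = d - v"
proof -
  have n: "0 < n" using assms by simp
  have "int (ring_dist n (at_dist n t d) (at_dist n t v)) = (int d - int v) mod int n"
    using n assms by (simp add: int_ring_dist int_at_dist mod_simps)
  also have "\<dots> = int d - int v" using assms by (intro mod_pos_pos_trivial) auto
  finally show ?thesis using assms by linarith
qed

lemma at_dist_0: "t < n \<Longrightarrow> at_dist n t 0 = t"
  by (simp add: at_dist_def)

lemma ring_dist_at_dist: "t < n \<Longrightarrow> d < n \<Longrightarrow> ring_dist n (at_dist n t d) t = d"
  using ring_dist_at_dist_both[of 0 d n t] at_dist_0[of t n] by simp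

lemma at_dist_ring_dist: "x < n \<Longrightarrow> t < n \<Longrightarrow> at_dist n t (ring_dist n x t) = x"
proof -
  assume x: "x < n" "t < n"
  then have n: "0 < n" by simp
  have "int (at_dist n t (ring_dist n x t)) = (int t - (int t - int x) mod int n) mod int n"
    using ring_dist_less[OF n, of x t] n by (simp add: int_at_dist int_ring_dist)
  also have "\<dots> = int x mod int n" by (simp add: mod_simps)
  also have "\<dots> = int x" using x by simp
  finally show ?thesis by simp
qed

lemma ring_dist_eq_0_iff: "x < n \<Longrightarrow> t < n \<Longrightarrow> ring_dist n x t = 0 \<longleftrightarrow> x = t"
  using at_dist_ring_dist[of x n t] ring_dist_at_dist[of t n 0] at_dist_0[of t n] by auto

lemma ring_dist_forward:
  assumes "t < n" "d < n" "a \<le> n"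
  shows "ring_dist n ((at_dist n t d + a) mod n) t = (d + n - a) mod n"
proof -
  have n: "0 < n" using assms by simp
  have "int (ring_dist n ((at_dist n t d + a) mod n) t) = (int d - int a) mod int n"
    using n assms by (simp add: int_ring_dist int_at_dist zmod_int mod_simps)
  also have "\<dots> = (int d + int n - int a) mod int n"
    using mod_add_self2[of "int d - int a" "int n"] by (simp add: algebra_simps)
  also have "\<dots> = int ((d + n - a) mod n)" using assms by (simp add: zmod_int of_nat_diff)
  finally show ?thesis by simp
qed

lemma ring_dist_self_forward: "a < n \<Longrightarrow> ring_dist n u ((u + a) mod n) = a"
proof -
  assume a: "a < n"
  then have "int (ring_dist n u ((u + a) mod n)) = (int u + int a - int u) mod int n"
    by (simp add: int_ring_dist zmod_int mod_simps)
  then show ?thesis using a by simp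
qed

section \<open>Runs of the algorithm as walks on distances\<close>

definition K_dist :: "nat \<Rightarrow> nat \<Rightarrow> network \<Rightarrow> nat \<Rightarrow> nat" where
  "K_dist n t G d = (if d \<in> {..<n} then ring_dist n (fst (G (at_dist n t d))) t else 0)"

definition AL_jump :: "nat \<Rightarrow> nat \<Rightarrow> network \<Rightarrow> nat \<Rightarrow> nat \<times> nat" where
  "AL_jump n t G d = (if d \<in> {..<n} then
     (ring_dist n (at_dist n t d) (fst (snd (G (at_dist n t d)))) - 1,
      ring_dist n (at_dist n t d) (snd (snd (G (at_dist n t d)))) - 1) else (0, 0))"

text \<open>In the final phase an AL-link may pass the target and end almost a full ring away from
  it; \<open>mod n\<close> records this, and the R-link guarantees progress.\<close>

definition greedy_AL :: "nat \<Rightarrow> (nat \<Rightarrow> nat \<times> nat) \<Rightarrow> nat \<Rightarrow> nat" where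
  "greedy_AL n \<alpha> d = min (d - 1) (min ((d + n - Suc (fst (\<alpha> d))) mod n) ((d + n - Suc (snd (\<alpha> d))) mod n))"

lemma greedy_AL_less: "0 < d \<Longrightarrow> greedy_AL n \<alpha> d < d"
  by (auto simp: greedy_AL_def min_def)

text \<open>A single network with the properties that hold almost surely.
  \<open>k * M + M \<le> D1\<close> prevents the AL-paths considered inside the loop from reaching
  the target, so that the ring can be unrolled to a line.\<close>

locale ring_run = loop_params k D1 for k D1 :: nat +
  fixes n t M :: nat and G :: network
  assumes t: "t < n" and M: "0 < M" "M < n" and kM: "k * M + M \<le> D1"
    and K_valid: "\<And>u. u < n \<Longrightarrow> fst (G u) < n"
    and AL_valid: "\<And>u v. u < n \<Longrightarrow> v \<in> AL_nbrs G u \<Longrightarrow> \<exists>a\<in>{1..M}. v = (u + a) mod n"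
    and k_iff: "\<And>j. real j \<le> lg (lg (real n)) \<longleftrightarrow> j \<le> k"
begin

abbreviation "kap \<equiv> K_dist n t G"
abbreviation "alp \<equiv> AL_jump n t G"
abbreviation "pos \<equiv> at_dist n t"
abbreviation "dst x \<equiv> ring_dist n x t"

lemma n_pos: "0 < n" using t by simp

lemma AL_nbr_pick:
  assumes "d < n"
  shows "AL_nbrs G (pos d) = (\<lambda>b. (pos d + Suc (pick b (alp d))) mod n) ` UNIV" "Suc (pick b (alp d)) \<le> M"
proof -
  define tgt where "tgt b = (if b then fst (snd (G (pos d))) else snd (snd (G (pos d))))" for b
  have *: "tgt b = (pos d + Suc (pick b (alp d))) mod n \<and> Suc (pick b (alp d)) \<le> M" for b
  proof -
    have "tgt b \<in> AL_nbrs G (pos d)" by (auto simp: tgt_def AL_nbrs_def)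
    then obtain a where a: "a \<in> {1..M}" "tgt b = (pos d + a) mod n"
      using AL_valid[OF at_dist_less[OF n_pos]] by blast
    have "ring_dist n (pos d) (tgt b) = a" using a M by (simp add: ring_dist_self_forward)
    moreover have "pick b (alp d) = ring_dist n (pos d) (tgt b) - 1"
      using assms by (cases b) (auto simp: pick_def AL_jump_def tgt_def)
    ultimately have "Suc (pick b (alp d)) = a" using a by simp
    then show ?thesis using a by simp
  qed
  have "AL_nbrs G (pos d) = tgt ` UNIV" by (auto simp: AL_nbrs_def tgt_def)
  also have "\<dots> = (\<lambda>b. (pos d + Suc (pick b (alp d))) mod n) ` UNIV" using * by (intro image_cong refl) blast
  finally show "AL_nbrs G (pos d) = (\<lambda>b. (pos d + Suc (pick b (alp d))) mod n) ` UNIV" .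
  show "Suc (pick b (alp d)) \<le> M" using * by blast
qed

lemma bounded: "bounded_AL M alp"
  unfolding bounded_AL_def
proof
  fix i
  show "fst (alp i) < M \<and> snd (alp i) < M"
  proof (cases "i < n")
    case True
    then show ?thesis using AL_nbr_pick(2)[OF True, of True] AL_nbr_pick(2)[OF True, of False] by (simp add: pick_def Suc_le_eq)
  next
    case False
    then show ?thesis using M by (simp add: AL_jump_def)
  qed
qed

lemma AL_nbrs_pos:
  assumes "d < n" "M \<le> d"
  shows "AL_nbrs G (pos d) = (\<lambda>b. pos (d - Suc (pick b (alp d)))) ` UNIV"
proof -
  have "(pos d + Suc (pick b (alp d))) mod n = pos (d - Suc (pick b (alp d)))" for b
  proof -
    let ?a = "Suc (pick b (alp d))"
    have a: "?a \<le> M" by (rule AL_nbr_pick(2)[OF assms(1)])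
    have "ring_dist n ((pos d + ?a) mod n) t = (d + n - ?a) mod n"
      using a M by (intro ring_dist_forward[OF t assms(1)]) simp
    also have "d + n - ?a = (d - ?a) + n" using a assms by simp
    also have "\<dots> mod n = (d - ?a) mod n" by (rule mod_add_self2)
    also have "\<dots> = d - ?a" by (rule mod_less) (use assms in linarith)
    finally have "pos (ring_dist n ((pos d + ?a) mod n) t) = pos (d - ?a)" by simp
    then show ?thesis using n_pos t by (subst (asm) at_dist_ring_dist) auto
  qed
  then show ?thesis using AL_nbr_pick(1)[OF assms(1)] by simp
qed

lemma T_set_pos:
  assumes "d < n" "i * M \<le> d"
  shows "T_set G (pos d) i = {pos (node alp d w) |w. length w = i}"
  using assms(2)
proof (induction i)
  case 0
  then show ?case by auto
next
  case (Suc i)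
  have IH: "T_set G (pos d) i = {pos (node alp d w) |w. length w = i}" using Suc by simp
  have nb: "AL_nbrs G (pos (node alp d w)) = (\<lambda>b. pos (node alp d (w @ [b]))) ` UNIV" if "length w = i" for w
  proof -
    have "M \<le> node alp d w" using node_ge[OF bounded, of d w] Suc.prems that by simp
    moreover have "node alp d w < n" using node_le[of alp d w] assms(1) by simp
    ultimately show ?thesis by (simp add: AL_nbrs_pos node_append)
  qed
  show ?case
  proof (intro equalityI subsetI)
    fix z assume "z \<in> T_set G (pos d) (Suc i)"
    then obtain w where w: "length w = i" "z \<in> AL_nbrs G (pos (node alp d w))" using IH by auto
    then obtain b where "z = pos (node alp d (w @ [b]))" using nb by auto
    then show "z \<in> {pos (node alp d w) |w. length w = Suc i}" using w by (intro CollectI exI[of _ "w @ [b]"]) simp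
  next
    fix z assume "z \<in> {pos (node alp d w) |w. length w = Suc i}"
    then obtain v where v: "length v = Suc i" "z = pos (node alp d v)" by blast
    then obtain w b where wb: "v = w @ [b]" "length w = i" by (cases v rule: rev_cases) auto
    then have "z \<in> AL_nbrs G (pos (node alp d w))" using nb v by simp
    moreover have "pos (node alp d w) \<in> T_set G (pos d) i" using IH wb by blast
    ultimately show "z \<in> T_set G (pos d) (Suc i)" by auto
  qed
qed

lemma T_set_Cons: "y \<in> AL_nbrs G' x \<Longrightarrow> z \<in> T_set G' y i \<Longrightarrow> z \<in> T_set G' x (Suc i)"
proof (induction i arbitrary: z)
  case (Suc i)
  then obtain u where u: "u \<in> T_set G' y i" "z \<in> AL_nbrs G' u" by auto
  have "u \<in> T_set G' x (Suc i)" using Suc.IH Suc.prems(1) u(1) by blast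
  then show ?case using u(2) by (subst T_set.simps(2)) blast
qed simp

lemma successively_T_set:
  "successively (\<lambda>u v. v \<in> AL_nbrs G' u) (x # \<pi>) \<Longrightarrow> last (x # \<pi>) \<in> T_set G' x (length \<pi>)"
proof (induction \<pi> arbitrary: x)
  case (Cons y \<pi>)
  have "last (y # \<pi>) \<in> T_set G' y (length \<pi>)" using Cons.prems by (intro Cons.IH) auto
  then show ?case using Cons.prems T_set_Cons[of y G' x "last (y # \<pi>)" "length \<pi>"] by (simp del: T_set.simps)
qed simp

lemma AL_path_of_T_set:
  assumes "z \<in> T_set G' x j" "real j \<le> r"
  shows "\<exists>\<pi>. AL_path G' (A_set G' x r) x z \<pi> \<and> length \<pi> = Suc j"
  using assms
proof (induction j arbitrary: z)
  case 0
  then have "AL_path G' (A_set G' x r) x z [x]"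
    by (auto simp: AL_path_def A_set_def intro!: exI[of _ "0::nat"])
  then show ?case by (intro exI[of _ "[x]"]) simp
next
  case (Suc j)
  from Suc.prems obtain u where u: "u \<in> T_set G' x j" "z \<in> AL_nbrs G' u" by auto
  with Suc.IH[of u] Suc.prems obtain \<pi> where \<pi>: "AL_path G' (A_set G' x r) x u \<pi>" "length \<pi> = Suc j" by auto
  have "z \<in> A_set G' x r" using Suc.prems unfolding A_set_def by blast
  with \<pi> u have "AL_path G' (A_set G' x r) x z (\<pi> @ [z])"
    by (auto simp: AL_path_def successively_append_iff)
  then show ?case using \<pi> by (intro exI[of _ "\<pi> @ [z]"]) simp
qed

lemma kap_K_nbr: "d < n \<Longrightarrow> ring_dist n (K_nbr G (pos d)) t = kap d"
  by (simp add: K_dist_def K_nbr_def)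

lemma greedy_step_dist:
  assumes d: "d < n" "0 < d" and y: "greedy_step n G t (pos d) y"
  shows "y < n" "dst y = min (kap d) (greedy_AL n alp d)"
proof -
  let ?S = "immediate_nbrs n G (pos d)"
  have px: "pos d < n" by (rule at_dist_less[OF n_pos])
  have R: "dst ((pos d + 1) mod n) = d - 1"
  proof -
    have "dst ((pos d + 1) mod n) = (d + n - 1) mod n" using n_pos by (intro ring_dist_forward[OF t d(1)]) simp
    also have "d + n - 1 = (d - 1) + n" using d by simp
    also have "\<dots> mod n = (d - 1) mod n" by (rule mod_add_self2)
    also have "\<dots> = d - 1" by (rule mod_less) (use d in linarith)
    finally show ?thesis .
  qed
  have A: "dst ((pos d + Suc (pick b (alp d))) mod n) = (d + n - Suc (pick b (alp d))) mod n" for b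
    using AL_nbr_pick(2)[OF d(1), of b] M by (intro ring_dist_forward[OF t d(1)]) simp
  have S: "dst ` ?S = {d - 1, kap d, (d + n - Suc (fst (alp d))) mod n, (d + n - Suc (snd (alp d))) mod n}"
    unfolding immediate_nbrs_def AL_nbr_pick(1)[OF d(1)] image_Un image_insert image_image A image_empty R kap_K_nbr[OF d(1)]
    by (auto simp: pick_def UNIV_bool)
  have min: "y \<in> ?S" "\<And>v. v \<in> ?S \<Longrightarrow> dst y \<le> dst v"
    using y by (auto simp: greedy_step_def is_arg_min_linorder)
  have fin: "finite (dst ` ?S)" unfolding S by simp
  have "dst y = Min (dst ` ?S)"
    using min fin by (intro Min_eqI[symmetric]) auto
  also have "\<dots> = min (kap d) (greedy_AL n alp d)"
    unfolding S by (simp add: greedy_AL_def min.left_commute min.commute)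
  finally show "dst y = min (kap d) (greedy_AL n alp d)" .
  have "v < n" if "v \<in> ?S" for v
    using that K_valid[OF px] n_pos by (auto simp: immediate_nbrs_def K_nbr_def AL_nbr_pick(1)[OF d(1)])
  then show "y < n" using min by blast
qed

lemma greedy_AL_far:
  assumes "d < n" "M \<le> d"
  shows "greedy_AL n alp d = far_AL alp d"
proof -
  have "(d + n - Suc (pick b (alp d))) mod n = d - Suc (pick b (alp d))" for b
  proof -
    have a: "Suc (pick b (alp d)) \<le> d" using AL_nbr_pick(2)[OF assms(1), of b] assms by simp
    then have "d + n - Suc (pick b (alp d)) = (d - Suc (pick b (alp d))) + n" by simp
    then have "(d + n - Suc (pick b (alp d))) mod n = (d - Suc (pick b (alp d))) mod n"
      by (simp only: mod_add_self2)
    also have "\<dots> = d - Suc (pick b (alp d))" by (rule mod_less) (use assms in linarith)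
    finally show ?thesis .
  qed
  note this[of True] this[of False]
  moreover have "min (d - 1) (min (d - Suc a) (d - Suc b)) = min (d - Suc a) (d - Suc b)" for a b
    using diff_le_mono2[of 1 "Suc a" d] by (intro min_absorb2) (simp add: min_le_iff_disj)
  ultimately show ?thesis by (simp add: greedy_AL_def far_AL_def pick_def)
qed

lemma candidates_pos:
  assumes d: "d < n" "D1 \<le> d"
  shows "candidates n G t (pos d) = {pos (node alp d w) |w. cand kap alp d w}"
proof -
  have dk: "j * M \<le> d" if "j \<le> k" for j using mult_le_mono1[OF that, of M] kM d by linarith
  have A: "A_set G (pos d) (lg (lg (real n))) = {pos (node alp d w) |w. length w \<le> k}"
    unfolding A_set_def k_iff using T_set_pos[OF d(1) dk] by auto
  have c: "real (ring_dist n (K_nbr G (pos (node alp d w))) t) \<le> real (ring_dist n (pos d) t) / 2 \<longleftrightarrow> 2 * kap (node alp d w) \<le> d" for w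
  proof -
    have "node alp d w < n" using node_le[of alp d w] d by simp
    then have "ring_dist n (K_nbr G (pos (node alp d w))) t = kap (node alp d w)" by (rule kap_K_nbr)
    then show ?thesis using ring_dist_at_dist[OF t d(1)] by linarith
  qed
  show ?thesis
  proof (intro equalityI subsetI)
    fix z assume "z \<in> candidates n G t (pos d)"
    then have z: "z \<in> {pos (node alp d w) |w. length w \<le> k}" "real (ring_dist n (K_nbr G z) t) \<le> real (ring_dist n (pos d) t) / 2"
      unfolding candidates_def A by blast+
    then obtain w where w: "z = pos (node alp d w)" "length w \<le> k" by blast
    then have "cand kap alp d w" using z(2) c[of w] by (simp only: cand_def)
    then show "z \<in> {pos (node alp d w) |w. cand kap alp d w}" using w by blast
  next
    fix z assume "z \<in> {pos (node alp d w) |w. cand kap alp d w}"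
    then obtain w where w: "z = pos (node alp d w)" "cand kap alp d w" by blast
    then have "length w \<le> k" "real (ring_dist n (K_nbr G z) t) \<le> real (ring_dist n (pos d) t) / 2"
      using c[of w] by (simp_all only: cand_def)
    then show "z \<in> candidates n G t (pos d)" using w unfolding candidates_def A by blast
  qed
qed

text \<open>A shortest AL-path to \<open>z\<close> has \<open>AL_dist\<close> many links, which by
  the choice of \<open>z\<close> is the least length of a candidate word. Only its first link
  matters: followed by any word of the remaining length that leads to \<open>z\<close>, it is a
  shortest candidate word.\<close>

lemma loop_step_lstep:
  assumes d: "d < n" "D1 \<le> d" "0 < D1" and y: "loop_step n G t (pos d) y"
  shows "y < n" "lstep kap alp d (dst y)"
proof -
  have dM: "M \<le> d" using kM d by linarith
  have px: "pos d < n" by (rule at_dist_less[OF n_pos])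
  have "y < n \<and> lstep kap alp d (dst y)"
  proof (cases "\<exists>w. cand kap alp d w")
    case False
    then have "candidates n G t (pos d) = {}" using candidates_pos[OF d(1,2)] by auto
    then have g: "greedy_step n G t (pos d) y" using y by (simp add: loop_step_def)
    have "dst y = min (kap d) (far_AL alp d)"
      using greedy_step_dist(2)[OF d(1) _ g] greedy_AL_far[OF d(1) dM] d by simp
    then show ?thesis using greedy_step_dist(1)[OF d(1) _ g] False d by (simp add: lstep_def)
  next
    case True
    then have ne: "candidates n G t (pos d) \<noteq> {}" using candidates_pos[OF d(1,2)] by auto
    obtain z \<pi> where z: "is_arg_min (AL_dist G (pos d)) (\<lambda>z. z \<in> candidates n G t (pos d)) z"
      and \<pi>: "shortest_AL_path G (A_set G (pos d) (lg (lg (real n)))) (pos d) z \<pi>"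
      and y': "y = (if \<pi> = [pos d] then K_nbr G (pos d) else \<pi> ! 1)"
      using y ne by (auto simp: loop_step_def)
    have zc: "z \<in> candidates n G t (pos d)" and zmin: "\<And>z'. z' \<in> candidates n G t (pos d) \<Longrightarrow> AL_dist G (pos d) z \<le> AL_dist G (pos d) z'"
      using z by (auto simp: is_arg_min_linorder)
    define l where "l = AL_dist G (pos d) z"
    obtain j where j: "z \<in> T_set G (pos d) j" "j \<le> k"
      using zc by (auto simp: candidates_def A_set_def k_iff)
    have l: "z \<in> T_set G (pos d) l" "l \<le> k"
      using LeastI[of "\<lambda>j. z \<in> T_set G (pos d) j" j] Least_le[of "\<lambda>j. z \<in> T_set G (pos d) j" j] j
      by (auto simp: l_def AL_dist_def)
    have least: "l \<le> i" if "z \<in> T_set G (pos d) i" for i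
      using that unfolding l_def AL_dist_def by (rule Least_le)
    have dk: "i * M \<le> d" if "i \<le> k" for i using mult_le_mono1[OF that, of M] kM d by linarith
    have lmin: "l \<le> length w" if w: "cand kap alp d w" for w
    proof -
      have "pos (node alp d w) \<in> candidates n G t (pos d)" using candidates_pos[OF d(1,2)] w by auto
      then have "l \<le> AL_dist G (pos d) (pos (node alp d w))" unfolding l_def by (rule zmin)
      also have "pos (node alp d w) \<in> T_set G (pos d) (length w)"
        using T_set_pos[OF d(1) dk] w by (auto simp: cand_def)
      then have "AL_dist G (pos d) (pos (node alp d w)) \<le> length w" unfolding AL_dist_def by (rule Least_le)
      finally show ?thesis .
    qed
    have kz: "2 * kap (dst z) \<le> d" and zn: "z < n"
    proof -
      obtain w where w: "cand kap alp d w" "z = pos (node alp d w)" using zc candidates_pos[OF d(1,2)] by auto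
      have "node alp d w < n" using node_le[of alp d w] d by simp
      then show "2 * kap (dst z) \<le> d" "z < n" using w ring_dist_at_dist[OF t] at_dist_less[OF n_pos] by (auto simp: cand_def)
    qed
    have word: "2 * kap (node alp d w) \<le> d" if "z = pos (node alp d w)" for w
    proof -
      have "node alp d w < n" using node_le[of alp d w] d by simp
      then show ?thesis using kz ring_dist_at_dist[OF t] that by simp
    qed
    have path: "AL_path G (A_set G (pos d) (lg (lg (real n)))) (pos d) z \<pi>"
      and short: "\<And>\<pi>'. AL_path G (A_set G (pos d) (lg (lg (real n)))) (pos d) z \<pi>' \<Longrightarrow> length \<pi> \<le> length \<pi>'"
      using \<pi> by (auto simp: shortest_AL_path_def is_arg_min_linorder)
    have "length \<pi> \<le> Suc l" using AL_path_of_T_set[OF l(1)] l(2) k_iff short by metis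
    obtain \<pi>' where p: "\<pi> = pos d # \<pi>'" "last \<pi> = z" "successively (\<lambda>u v. v \<in> AL_nbrs G u) (pos d # \<pi>')"
      using path by (cases \<pi>) (auto simp: AL_path_def)
    have "z \<in> T_set G (pos d) (length \<pi>')" using successively_T_set[OF p(3)] p by simp
    then have len: "length \<pi>' = l" using least \<open>length \<pi> \<le> Suc l\<close> p by (simp add: le_antisym)
    show ?thesis
    proof (cases l)
      case 0
      then have "\<pi> = [pos d]" "z = pos d" using p len by auto
      then have y0: "y = K_nbr G (pos d)" using y' by simp
      have c0: "cand kap alp d []" using word[of "[]"] \<open>z = pos d\<close> by (simp add: cand_def)
      have "dst y = kap d" using y0 kap_K_nbr[OF d(1)] by simp
      then have "lstep kap alp d (dst y)" unfolding lstep_def using c0 by (auto intro!: exI[of _ "[]"])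
      moreover have "y < n" using y0 K_valid[OF px] by (simp add: K_nbr_def)
      ultimately show ?thesis by blast
    next
      case (Suc l')
      then obtain \<pi>'' where p2: "\<pi>' = y # \<pi>''" using len y' p by (cases \<pi>') auto
      have yA: "y \<in> AL_nbrs G (pos d)" using p(3) p2 by simp
      then obtain b where b: "y = pos (d - Suc (pick b (alp d)))" using AL_nbrs_pos[OF d(1) dM] by auto
      let ?u = "d - Suc (pick b (alp d))"
      have zy: "z \<in> T_set G (pos ?u) l'"
        using successively_T_set[of G y \<pi>''] p p2 len Suc b by simp
      have "M + l' * M \<le> d" using dk[OF l(2)] Suc by simp
      then have "l' * M \<le> ?u" using AL_nbr_pick(2)[OF d(1), of b] by linarith
      then obtain w where w: "z = pos (node alp ?u w)" "length w = l'"
        using T_set_pos[of ?u l'] zy d by auto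
      have "cand kap alp d (b # w)" using word[of "b # w"] w l(2) Suc by (simp add: cand_def)
      moreover have "\<forall>w'. cand kap alp d w' \<longrightarrow> length (b # w) \<le> length w'" using lmin w Suc by simp
      moreover have "dst y = ?u" using b ring_dist_at_dist[OF t, of ?u] d by simp
      ultimately have "lstep kap alp d (dst y)" unfolding lstep_def by (auto intro!: exI[of _ "b # w"])
      moreover have "y < n" using b at_dist_less[OF n_pos] by simp
      ultimately show ?thesis by blast
    qed
  qed
  then show "y < n" "lstep kap alp d (dst y)" by auto
qed

lemma chain_of_lsteps:
  "(\<And>i. j \<le> i \<Longrightarrow> i < j + m \<Longrightarrow> D1 \<le> D i \<and> lstep \<kappa> \<alpha> (D i) (D (Suc i))) \<Longrightarrow> chain \<kappa> \<alpha> m (D j)"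
proof (induction m arbitrary: j)
  case (Suc m)
  have "chain \<kappa> \<alpha> m (D (Suc j))" by (rule Suc.IH) (use Suc.prems in auto)
  then show ?case using Suc.prems[of j] by auto
qed simp

lemma lstep_less: "0 < d \<Longrightarrow> lstep \<kappa> \<alpha> d d' \<Longrightarrow> d' < d"
  using far_AL_le[of \<alpha> d] by (auto simp: lstep_def cand_def split: if_splits) (auto split: list.splits simp: cand_def)

text \<open>Every hop in the loop decreases the distance, so the loop is left after finitely many;
  up to then the run is a chain, and afterwards it takes \<open>greedy_time\<close> many hops. This
  holds for every run, whatever choices it makes in this network.\<close>

lemma run_hops:
  assumes run: "algorithm2_run c n G s t p" and s: "s < n" and D1: "0 < D1"
    and loop: "\<And>x. x < n \<Longrightarrow> in_loop c n t x \<longleftrightarrow> D1 \<le> dst x"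
  shows "\<exists>m d. chain kap alp m (dst s) \<and> d < D1 \<and> d < n \<and>
     hops p t \<le> of_nat m + of_nat (greedy_time (\<lambda>d. min (kap d) (greedy_AL n alp d)) d)"
proof -
  let ?D = "\<lambda>m. dst (p m)" and ?g = "\<lambda>d. min (kap d) (greedy_AL n alp d)"
  have p0: "p 0 = s" using run by (simp add: algorithm2_run_def)
  have step: "if p m = t then p (Suc m) = t else if \<forall>i\<le>m. in_loop c n t (p i) then loop_step n G t (p m) (p (Suc m))
      else greedy_step n G t (p m) (p (Suc m))" for m
    using run by (simp add: algorithm2_run_def)
  have pn: "p m < n" for m
  proof (induction m)
    case 0
    then show ?case using p0 s by simp
  next
    case (Suc m)
    have pos: "pos (?D m) = p m" and dn: "?D m < n" using at_dist_ring_dist[OF Suc t] ring_dist_less[OF n_pos] by auto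
    show ?case
    proof (cases "p m = t")
      case True
      then show ?thesis using step[of m] t by simp
    next
      case False
      then have d0: "0 < ?D m" using ring_dist_eq_0_iff[OF Suc t] by simp
      show ?thesis
      proof (cases "\<forall>i\<le>m. in_loop c n t (p i)")
        case True
        then have "D1 \<le> ?D m" using loop[OF Suc] by simp
        moreover have "loop_step n G t (pos (?D m)) (p (Suc m))" using step[of m] False True pos by simp
        ultimately show ?thesis using loop_step_lstep(1)[OF dn _ D1] by blast
      next
        case nl: False
        then have "greedy_step n G t (pos (?D m)) (p (Suc m))" using step[of m] False pos by simp
        then show ?thesis using greedy_step_dist(1)[OF dn d0] by blast
      qed
    qed
  qed
  have pos: "pos (?D m) = p m" and dn: "?D m < n" for m
    using at_dist_ring_dist[OF pn t] ring_dist_less[OF n_pos] by auto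
  have ls: "lstep kap alp (?D m) (?D (Suc m)) \<and> D1 \<le> ?D m" if "\<forall>i\<le>m. in_loop c n t (p i)" for m
  proof -
    have D: "D1 \<le> ?D m" using that loop[OF pn] by simp
    then have "p m \<noteq> t" using D1 ring_dist_eq_0_iff[OF pn[of m] t] by auto
    then have "loop_step n G t (pos (?D m)) (p (Suc m))" using step[of m] that pos by simp
    then show ?thesis using loop_step_lstep(2)[OF dn D D1] D by blast
  qed
  have ex: "\<exists>m. \<not> in_loop c n t (p m)"
  proof (rule ccontr)
    assume "\<not> ?thesis"
    then have "?D (Suc m) < ?D m" for m using ls[of m] lstep_less[of "?D m" kap alp "?D (Suc m)"] D1 by force
    then have "?D m + m \<le> ?D 0" for m
    proof (induction m)
      case (Suc m)
      then show ?case by (metis Suc_leI add_Suc_right add_Suc add_le_mono1 le_trans)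
    qed simp
    from this[of "Suc (?D 0)"] show False by simp
  qed
  define m0 where "m0 = (LEAST m. \<not> in_loop c n t (p m))"
  have m0: "\<not> in_loop c n t (p m0)" "\<And>i. i < m0 \<Longrightarrow> in_loop c n t (p i)"
    using LeastI_ex[OF ex] not_less_Least unfolding m0_def by blast+
  have ch: "chain kap alp m0 (dst s)"
    using chain_of_lsteps[of 0 m0 ?D kap alp] ls m0(2) p0 by (metis add_0 le_less_trans)
  have dm0: "?D m0 < D1" using m0(1) loop[OF pn] by simp
  have reach: "p (m + greedy_time ?g (?D m)) = t" if "m0 \<le> m" for m
    using that
  proof (induction "?D m" arbitrary: m rule: less_induct)
    case less
    show ?case
    proof (cases "p m = t")
      case True
      have "?D m = 0" by (rule iffD2[OF ring_dist_eq_0_iff[OF pn t] True])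
      then show ?thesis using True by (simp add: greedy_time_0)
    next
      case False
      then have d0: "0 < ?D m" using ring_dist_eq_0_iff[OF pn[of m] t] by simp
      have "\<not> (\<forall>i\<le>m. in_loop c n t (p i))" using m0(1) less.prems by blast
      then have "greedy_step n G t (pos (?D m)) (p (Suc m))" using step[of m] False pos by simp
      then have D: "?D (Suc m) = ?g (?D m)" by (rule greedy_step_dist(2)[OF dn d0])
      have lt: "?g (?D m) < ?D m" using greedy_AL_less[OF d0] by (simp add: min_less_iff_disj)
      then have "p (Suc m + greedy_time ?g (?D (Suc m))) = t" using less.hyps[of "Suc m"] D less.prems by simp
      moreover have "greedy_time ?g (?D m) = Suc (greedy_time ?g (?D (Suc m)))"
        using D lt by (subst greedy_time.simps) (simp only: not_le[symmetric] if_False)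
      ultimately show ?thesis by simp
    qed
  qed
  have "hops p t \<le> of_nat (m0 + greedy_time ?g (?D m0))"
    unfolding hops_def using reach[of m0] by (intro INF_lower) simp
  then show ?thesis using ch dm0 dn[of m0] by (intro exI[of _ m0] exI[of _ "?D m0"]) simp
qed

end

subsection \<open>The distribution of the network in distance coordinates\<close>

lemma harm_le_ln: "0 < n \<Longrightarrow> harm n \<le> 1 + ln (real n)"
  using decseqD[OF decseq_harm_diff_ln, of 0 "n - 1"] by (simp add: harm_def)

lemma ring_dist_forward_inverse:
  assumes "z < n" "u < n"
  shows "(u + ring_dist n u z) mod n = z"
proof -
  have "int ((u + ring_dist n u z) mod n) = (int u + (int z - int u) mod int n) mod int n"
    using assms by (simp add: zmod_int int_ring_dist)
  also have "\<dots> = int z mod int n" by (simp add: mod_simps)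
  finally show ?thesis using assms by simp
qed

text \<open>The directed distance from \<open>u\<close> takes each of the values
  \<open>1, ..., n - 1\<close> once, so the normalization is the same for all nodes.\<close>

lemma Z_sum_harm:
  assumes u: "u < n"
  shows "Z_sum n u = harm (n - 1)"
proof -
  have n: "0 < n" using u by simp
  have "Z_sum n u = (\<Sum>a\<in>{1..n - 1}. 1 / real a)"
    unfolding Z_sum_def
  proof (rule sum.reindex_bij_witness[of _ "\<lambda>a. (u + a) mod n" "ring_dist n u"])
    fix z assume z: "z \<in> {..<n} - {u}"
    then show "(u + ring_dist n u z) mod n = z" using ring_dist_forward_inverse u by simp
    show "ring_dist n u z \<in> {1..n - 1}"
      using z u ring_dist_less[OF n, of u z] ring_dist_pos[of u n z] by auto
  next
    fix a assume a: "a \<in> {1..n - 1}"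
    then have r: "ring_dist n u ((u + a) mod n) = a" using n by (intro ring_dist_self_forward) auto
    then show "ring_dist n u ((u + a) mod n) = a" .
    have "ring_dist n u u = 0" using ring_dist_self_forward[of 0 n u] n u by simp
    then show "(u + a) mod n \<in> {..<n} - {u}" using r a n by auto
  qed simp
  then show ?thesis by (simp add: harm_def inverse_eq_divide)
qed

definition K_dist_pmf :: "nat \<Rightarrow> nat \<Rightarrow> nat \<Rightarrow> nat pmf" where
  "K_dist_pmf n t d = map_pmf (\<lambda>v. ring_dist n v t) (K_link_pmf n (at_dist n t d))"

lemma set_K_link_pmf: "u < n \<Longrightarrow> 2 \<le> n \<Longrightarrow> set_pmf (K_link_pmf n u) \<subseteq> {..<n}"
  by (auto simp: set_pmf_iff pmf_K_link_pmf split: if_splits)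

lemma pmf_K_dist_pmf:
  assumes n: "2 \<le> n" "t < n" and v: "v < d" "d < n"
  shows "pmf (K_dist_pmf n t d) v = 1 / (harm (n - 1) * real (d - v))"
proof -
  let ?u = "at_dist n t d" and ?w = "at_dist n t v"
  have u: "?u < n" "?w < n" using n by (auto intro: at_dist_less)
  have dv: "ring_dist n ?u ?w = d - v" using v by (intro ring_dist_at_dist_both) auto
  have w: "ring_dist n ?w t = v" and "ring_dist n ?u t = d"
    using n v by (auto intro!: ring_dist_at_dist)
  then have ne: "?w \<noteq> ?u" using v by (metis less_irrefl)
  have p: "pmf (K_link_pmf n ?u) ?w = 1 / (harm (n - 1) * real (d - v))"
    unfolding pmf_K_link_pmf[OF u(1) n(1)] Z_sum_harm[OF u(1)] dv using u(2) ne by simp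
  have "harm (n - 1) > (0::real)" using n by (intro harm_pos) simp
  then have "pmf (K_link_pmf n ?u) ?w > 0" unfolding p using v by simp
  then have mem: "?w \<in> set_pmf (K_link_pmf n ?u)" by (simp add: set_pmf_iff)
  have inj: "inj_on (\<lambda>v. ring_dist n v t) (set_pmf (K_link_pmf n ?u))"
  proof (rule inj_onI)
    fix x y assume "x \<in> set_pmf (K_link_pmf n ?u)" "y \<in> set_pmf (K_link_pmf n ?u)" and eq: "ring_dist n x t = ring_dist n y t"
    then have "x < n" "y < n" using set_K_link_pmf[OF u(1) n(1)] by blast+
    then show "x = y" using at_dist_ring_dist[OF _ n(2)] eq by metis
  qed
  have "pmf (K_dist_pmf n t d) (ring_dist n ?w t) = pmf (K_link_pmf n ?u) ?w"
    unfolding K_dist_pmf_def by (rule pmf_map_inj[OF inj mem])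
  then show ?thesis unfolding w p .
qed

lemma AL_targets:
  "{v. u < v \<and> real v \<le> real u + (lg (real n))\<^sup>2} = {u<..u + nat \<lfloor>(lg (real n))\<^sup>2\<rfloor>}"
proof -
  have "real v \<le> real u + (lg (real n))\<^sup>2 \<longleftrightarrow> v \<le> u + nat \<lfloor>(lg (real n))\<^sup>2\<rfloor>" if "u < v" for v
  proof -
    have "real v \<le> real u + (lg (real n))\<^sup>2 \<longleftrightarrow> real (v - u) \<le> (lg (real n))\<^sup>2" using that by (simp add: of_nat_diff algebra_simps)
    also have "\<dots> \<longleftrightarrow> int (v - u) \<le> \<lfloor>(lg (real n))\<^sup>2\<rfloor>" by (simp add: le_floor_iff)
    also have "\<dots> \<longleftrightarrow> v - u \<le> nat \<lfloor>(lg (real n))\<^sup>2\<rfloor>" by (simp add: le_nat_iff)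
    finally show ?thesis using that by auto
  qed
  then show ?thesis by auto
qed

text \<open>As \<open>M < n\<close>, the possible targets are distinct modulo
  \<open>n\<close>.\<close>

lemma map_AL_link_pmf:
  assumes M: "M = nat \<lfloor>(lg (real n))\<^sup>2\<rfloor>" "0 < M" "M < n" and u: "u < n"
  shows "map_pmf (\<lambda>v. ring_dist n u v - 1) (AL_link_pmf n u) = pmf_of_set {..<M}"
proof -
  let ?f = "\<lambda>v. ring_dist n u (v mod n) - 1"
  have f: "?f v = v - u - 1" if "v \<in> {u<..u + M}" for v
  proof -
    have "ring_dist n u ((u + (v - u)) mod n) = v - u" using that M by (intro ring_dist_self_forward) auto
    then show ?thesis using that by simp
  qed
  have inj: "inj_on ?f {u<..u + M}"
  proof (rule inj_onI)
    fix x y assume m: "x \<in> {u<..u + M}" "y \<in> {u<..u + M}" and "?f x = ?f y"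
    then have "x - u - 1 = y - u - 1" unfolding f[OF m(1)] f[OF m(2)] by simp
    then show "x = y" using m by auto
  qed
  have img: "?f ` {u<..u + M} = {..<M}"
  proof -
    have "?f ` {u<..u + M} = (\<lambda>v. v - u - 1) ` {u<..u + M}" using f by (intro image_cong) auto
    also have "\<dots> = {..<M}"
    proof (intro equalityI subsetI)
      fix x assume "x \<in> {..<M}"
      then show "x \<in> (\<lambda>v. v - u - 1) ` {u<..u + M}" by (intro image_eqI[of _ _ "x + u + 1"]) auto
    qed auto
    finally show ?thesis .
  qed
  have "map_pmf (\<lambda>v. ring_dist n u v - 1) (AL_link_pmf n u) = map_pmf ?f (pmf_of_set {u<..u + M})"
    unfolding AL_link_pmf_def AL_targets M(1)[symmetric] by (simp add: map_pmf_comp)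
  also have "\<dots> = pmf_of_set {..<M}"
    unfolding img[symmetric] using M by (intro map_pmf_of_set_inj[OF inj]) auto
  finally show ?thesis .
qed

lemma at_dist_image: "t < n \<Longrightarrow> at_dist n t ` {..<n} = {..<n}" "t < n \<Longrightarrow> inj_on (at_dist n t) {..<n}"
proof -
  assume t: "t < n"
  show "inj_on (at_dist n t) {..<n}"
    by (rule inj_on_inverseI[of _ "\<lambda>v. ring_dist n v t"]) (use t in \<open>auto simp: ring_dist_at_dist\<close>)
  show "at_dist n t ` {..<n} = {..<n}"
  proof (intro equalityI subsetI)
    fix x assume "x \<in> {..<n}"
    then show "x \<in> at_dist n t ` {..<n}"
      using at_dist_ring_dist[of x n t] ring_dist_less[of n x t] t by (intro image_eqI[of _ _ "ring_dist n x t"]) auto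
  qed (use t in \<open>auto intro: at_dist_less\<close>)
qed

text \<open>Indexing by the distance to \<open>t\<close> permutes the independent nodes, and at each
  node the K-link is independent of the AL-links; \<open>Pi_pmf_pair\<close> separates the two
  families, so that K-links can be averaged with all AL-links fixed.\<close>

lemma KSWN_star_coordinates:
  assumes M: "M = nat \<lfloor>(lg (real n))\<^sup>2\<rfloor>" "0 < M" "M < n" and t: "t < n"
  shows "map_pmf (\<lambda>G. (K_dist n t G, AL_jump n t G)) (KSWN_star n)
    = pair_pmf (Pi_pmf {..<n} 0 (K_dist_pmf n t))
        (Pi_pmf {..<n} (0, 0) (\<lambda>_. pair_pmf (pmf_of_set {..<M}) (pmf_of_set {..<M})))"
proof -
  let ?at = "at_dist n t"
  let ?f = "\<lambda>d x. (ring_dist n (fst x) t, (ring_dist n (?at d) (fst (snd x)) - 1, ring_dist n (?at d) (snd (snd x)) - 1))"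
  let ?p = "\<lambda>u. pair_pmf (K_link_pmf n u) (pair_pmf (AL_link_pmf n u) (AL_link_pmf n u))"
  let ?U = "pmf_of_set {..<M}"
  have "map_pmf (\<lambda>G d. if d \<in> {..<n} then ?f d (G (?at d)) else (0, (0, 0))) (KSWN_star n)
     = Pi_pmf {..<n} (0, (0, 0)) (\<lambda>d. map_pmf (?f d) (?p (?at d)))"
    using Pi_pmf_reindex_map[of "{..<n}" ?at ?f "(0, (0, 0))" "(0, 0, 0)" ?p] at_dist_image[OF t]
    by (simp add: KSWN_star_def)
  also have "\<dots> = Pi_pmf {..<n} (0, (0, 0)) (\<lambda>d. pair_pmf (K_dist_pmf n t d) (pair_pmf ?U ?U))"
  proof (rule Pi_pmf_cong)
    fix d assume "d \<in> {..<n}"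
    then have A: "map_pmf (\<lambda>v. ring_dist n (?at d) v - 1) (AL_link_pmf n (?at d)) = ?U"
      using t by (intro map_AL_link_pmf[OF M]) (auto intro: at_dist_less)
    have "map_pmf (?f d) (?p (?at d)) = map_pmf (\<lambda>(a, b). (ring_dist n a t, (\<lambda>(x, y). (ring_dist n (?at d) x - 1, ring_dist n (?at d) y - 1)) b)) (?p (?at d))"
      by (intro map_pmf_cong) (auto simp: case_prod_unfold)
    also have "\<dots> = pair_pmf (K_dist_pmf n t d) (pair_pmf ?U ?U)"
      unfolding map_pair A K_dist_pmf_def ..
    finally show "map_pmf (?f d) (?p (?at d)) = pair_pmf (K_dist_pmf n t d) (pair_pmf ?U ?U)" .
  qed auto
  also have "\<dots> = map_pmf (\<lambda>(f, g) x. (f x, g x)) (pair_pmf (Pi_pmf {..<n} 0 (K_dist_pmf n t)) (Pi_pmf {..<n} (0, 0) (\<lambda>_. pair_pmf ?U ?U)))"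
    by (rule Pi_pmf_pair) simp
  finally have *: "map_pmf (\<lambda>G d. if d \<in> {..<n} then ?f d (G (?at d)) else (0, (0, 0))) (KSWN_star n) = \<dots>" .
  have "map_pmf (\<lambda>G. (K_dist n t G, AL_jump n t G)) (KSWN_star n)
     = map_pmf (\<lambda>h. (fst \<circ> h, snd \<circ> h)) (map_pmf (\<lambda>G d. if d \<in> {..<n} then ?f d (G (?at d)) else (0, (0, 0))) (KSWN_star n))"
    unfolding map_pmf_comp by (intro map_pmf_cong) (auto simp: fun_eq_iff K_dist_def AL_jump_def)
  also have "\<dots> = pair_pmf (Pi_pmf {..<n} 0 (K_dist_pmf n t)) (Pi_pmf {..<n} (0, 0) (\<lambda>_. pair_pmf ?U ?U))"
    unfolding * map_pmf_comp by (simp add: case_prod_unfold comp_def)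
  finally show ?thesis .
qed

lemma KSWN_star_links:
  assumes G: "G \<in> set_pmf (KSWN_star n)" and u: "u < n" and n: "2 \<le> n" and M: "M = nat \<lfloor>(lg (real n))\<^sup>2\<rfloor>" "0 < M"
  shows "fst (G u) < n" "v \<in> AL_nbrs G u \<Longrightarrow> \<exists>a\<in>{1..M}. v = (u + a) mod n"
proof -
  have "G \<in> PiE_dflt {..<n} (0, 0, 0) (\<lambda>u. set_pmf (pair_pmf (K_link_pmf n u) (pair_pmf (AL_link_pmf n u) (AL_link_pmf n u))))"
    using G unfolding KSWN_star_def set_Pi_pmf[OF finite_lessThan] comp_def .
  then have Gu: "G u \<in> set_pmf (K_link_pmf n u) \<times> set_pmf (AL_link_pmf n u) \<times> set_pmf (AL_link_pmf n u)"
    using u by (auto simp: PiE_dflt_def)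
  show "fst (G u) < n" using Gu set_K_link_pmf[OF u n] by auto
  have A: "\<exists>a\<in>{1..M}. v = (u + a) mod n" if "v \<in> set_pmf (AL_link_pmf n u)" for v
  proof -
    have "v \<in> (\<lambda>v. v mod n) ` {u<..u + M}"
      using that M unfolding AL_link_pmf_def AL_targets M(1)[symmetric] by simp
    then obtain w where "w \<in> {u<..u + M}" "v = w mod n" by blast
    then show ?thesis by (intro bexI[of _ "w - u"]) auto
  qed
  show "\<exists>a\<in>{1..M}. v = (u + a) mod n" if "v \<in> AL_nbrs G u"
    using that Gu A by (auto simp: AL_nbrs_def)
qed

subsection \<open>Numerical bounds\<close>

lemma gam_power_le: "gam ^ m \<le> exp (real m / 2000)"
proof -
  have "gam \<le> exp (1 / 2000)" using exp_ge_add_one_self[of "1 / 2000"] by (simp add: gam_def)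
  then have "gam ^ m \<le> exp (1 / 2000) ^ m" using gam_gt_1 by (intro power_mono) auto
  then show ?thesis by (simp add: exp_of_nat_mult[symmetric])
qed

context routing
begin

text \<open>Powers of \<open>2\<close> become exponentials, so that all errors are polynomials times
  exponentials in \<open>k\<close>. The rate \<open>1 / 2\<close> is below
  \<open>ln 2\<close>.\<close>

lemma half_power_le: "1 / 2 ^ m \<le> exp (- (real m / 2))"
proof -
  have "exp (1 / 2 :: real) \<le> 2"
  proof -
    have "exp (1 / 2 :: real) ^ 2 = exp 1" by (simp add: exp_of_nat_mult[symmetric])
    also have "\<dots> \<le> 2 ^ 2" using exp_le by simp
    finally show ?thesis by (rule power2_le_imp_le) simp
  qed
  then have "exp (1 / 2 :: real) ^ m \<le> 2 ^ m" by (intro power_mono) auto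
  then have "exp (real m / 2) \<le> 2 ^ m" by (simp add: exp_of_nat_mult[symmetric])
  then show ?thesis by (simp add: exp_minus divide_simps)
qed

lemma lam_power_le: "lam ^ m \<le> exp (- (real m / 400))"
proof -
  have "lam \<le> 1 - 1 / 400" by (simp add: lam_def gam_def theta_def)
  also have "\<dots> \<le> exp (- (1 / 400))" using exp_ge_add_one_self[of "- (1 / 400)"] by simp
  finally have "lam ^ m \<le> exp (- (1 / 400)) ^ m" using lam by (intro power_mono) auto
  then show ?thesis by (simp add: exp_of_nat_mult[symmetric])
qed

text \<open>Here the \<open>20\<close> in \<open>Lam\<close> matters: since
  \<open>(3/4) ^ 20 \<le> 1 / 256\<close>, the gain \<open>256 ^ Suc k\<close> exceeds both
  \<open>M \<le> 4 ^ Suc k\<close> and the \<open>2 ^ Suc k\<close> words by an exponential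
  factor.\<close>

lemma Lam_power: "(3/4 :: real) ^ Lam \<le> 1 / 256 ^ Suc k"
proof -
  have "(3/4 :: real) ^ Lam = ((3/4) ^ 20) ^ Suc k" unfolding Lam_def by (rule power_mult)
  also have "\<dots> \<le> (1 / 256) ^ Suc k" by (intro power_mono) (auto simp: power_divide)
  finally show ?thesis by (simp add: power_divide)
qed

context
  assumes M_lo: "4 ^ k \<le> 2 * M" and M_hi: "M \<le> 4 ^ Suc k" and Z_lo: "2 ^ k \<le> 2 * Z"
begin

lemma eps_plant_le: "eps_plant \<le> 2 * real k * exp (- real k)"
proof -
  have M: "real M \<le> 4 ^ Suc k" using of_nat_mono[OF M_hi, where 'a = real] by simp
  have "eps_plant \<le> 2 * (real k * 4 ^ Suc k * (1 / 256 ^ Suc k))"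
    unfolding eps_plant_def using M Lam_power by (intro mult_mono) (auto simp: gam_def intro!: mult_left_mono)
  also have "\<dots> = 2 * real k * (1 / 64 :: real) ^ Suc k"
  proof -
    have "(256::real) ^ Suc k = 4 ^ Suc k * 64 ^ Suc k" by (simp only: power_mult_distrib[symmetric]) simp
    then show ?thesis by (simp add: power_divide)
  qed
  also have "\<dots> \<le> 2 * real k * exp (- real k)"
  proof (intro mult_left_mono)
    have "(1 / 64 :: real) ^ Suc k \<le> (1 / 64) ^ k" by simp
    also have "\<dots> \<le> (1 / 4) ^ k" by (intro power_mono) auto
    also have "\<dots> = (1 / 2 ^ k) * (1 / 2 ^ k)" by (simp add: power_divide power_mult_distrib[symmetric])
    also have "\<dots> \<le> exp (- (real k / 2)) * exp (- (real k / 2))" by (intro mult_mono half_power_le) auto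
    also have "\<dots> = exp (- real k)" by (simp add: exp_add[symmetric])
    finally show "(1 / 64 :: real) ^ Suc k \<le> exp (- real k)" .
  qed simp
  finally show ?thesis .
qed

lemma inverse_Z: "1 / Z \<le> 2 * exp (- (real k / 2))"
proof -
  have "1 / Z \<le> 2 * (1 / 2 ^ k)" using Z_lo Z_pos by (simp add: divide_simps mult.commute)
  also have "\<dots> \<le> 2 * exp (- (real k / 2))" by (intro mult_left_mono half_power_le) auto
  finally show ?thesis .
qed

lemma eps_short_le: "eps_short \<le> 8 * exp (real k / 50) * (4 * real k + 3) * exp (- (real k / 2))"
proof -
  have kM: "0 < k * M" using k_pos M_pos by simp
  have "harm (2 * (k * M)) \<le> 1 + ln (real (2 * (k * M)))" using kM by (intro harm_le_ln) simp
  also have "ln (real (2 * (k * M))) \<le> 4 * real k + 2"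
  proof -
    have "ln (real (2 * (k * M))) = ln (real (2 * k)) + ln (real M)" using k_pos M_pos by (simp add: ln_mult)
    also have "ln (real (2 * k)) \<le> 2 * real k" using ln_le_minus_one[of "real (2 * k)"] k_pos by simp
    also have "ln (real M) \<le> ln (4 ^ Suc k)" using of_nat_mono[OF M_hi, where 'a = real] M_pos by simp
    also have "\<dots> = real (Suc k) * ln 4" by (rule ln_realpow)
    also have "ln 4 \<le> (2::real)"
    proof -
      have "ln 4 = 2 * ln (2::real)" using ln_realpow[of 2 2] by simp
      then show ?thesis using ln_le_minus_one[of 2] by simp
    qed
    finally show ?thesis by simp
  qed
  finally have h: "harm (2 * (k * M)) \<le> 4 * real k + 3" by simp
  have "harm (2 * (k * M)) / Z = harm (2 * (k * M)) * (1 / Z)" by simp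
  also have "\<dots> \<le> (4 * real k + 3) * (2 * exp (- (real k / 2)))"
    using h inverse_Z Z_pos by (intro mult_mono) auto
  finally have "eps_short \<le> 2 * (2 * exp (2 * theta * k)) * ((4 * real k + 3) * (2 * exp (- (real k / 2))))"
    unfolding eps_short_def using Z_pos harm_nonneg[of "2 * (k * M)", where 'a = real] by (intro mult_mono) (auto simp: gam_def)
  then show ?thesis by (simp add: theta_def mult_ac)
qed

lemma eps_half_le: "eps_half \<le> 16 * exp (- real k)"
proof -
  have "eps_half \<le> 2 ^ Suc k * gam ^ Suc k * (4 * (2 * (1 / 2 ^ k))) * (1 / 256 ^ Suc k)"
  proof -
    have "4 / Z \<le> 4 * (2 * (1 / 2 ^ k))" using Z_lo Z_pos by (simp add: divide_simps mult.commute)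
    then show ?thesis unfolding eps_half_def using gam_gt_1 Lam_power Z_pos by (intro mult_mono) auto
  qed
  also have "\<dots> = 16 * (gam / 256) ^ Suc k" by (simp add: power_divide)
  also have "\<dots> \<le> 16 * exp (- real k)"
  proof (intro mult_left_mono)
    have "(gam / 256) ^ Suc k \<le> (1 / 4) ^ Suc k" by (intro power_mono) (auto simp: gam_def)
    also have "\<dots> \<le> (1 / 4) ^ k" by simp
    also have "\<dots> = (1 / 2 ^ k) * (1 / 2 ^ k)" by (simp add: power_divide power_mult_distrib[symmetric])
    also have "\<dots> \<le> exp (- (real k / 2)) * exp (- (real k / 2))" by (intro mult_mono half_power_le) auto
    also have "\<dots> = exp (- real k)" by (simp add: exp_add[symmetric])
    finally show "(gam / 256) ^ Suc k \<le> exp (- real k)" .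
  qed simp
  finally show ?thesis .
qed

text \<open>The number \<open>2 ^ Suc k\<close> of words and the AL-range \<open>4 ^ Suc k\<close>
  cancel against \<open>D0 = 8 ^ Suc k\<close>, and the factor \<open>1 / Z\<close>, of the order
  \<open>1 / 2 ^ k\<close>, remains.\<close>

lemma eps_lose_le: "eps_lose \<le> 64 * (real k)\<^sup>2 * exp (real k / 2000) * exp (real k / 50) * exp (- (real k / 2))"
proof -
  have M: "real M \<le> 4 ^ Suc k" using of_nat_mono[OF M_hi, where 'a = real] by simp
  have D0: "real D0 = 8 ^ Suc k" by (simp add: D0_def)
  have 8: "8 / (Z * real D0) \<le> 16 / 2 ^ k / 8 ^ Suc k"
  proof -
    have "8 / Z \<le> 16 / 2 ^ k" using Z_lo Z_pos by (simp add: divide_simps mult.commute)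
    then have "8 / Z / real D0 \<le> 16 / 2 ^ k / real D0" by (intro divide_right_mono) auto
    then show ?thesis by (simp add: D0)
  qed
  have "real (k * M) * (8 / (Z * real D0)) \<le> (real k * 4 ^ Suc k) * (16 / 2 ^ k / 8 ^ Suc k)"
  proof (rule mult_mono)
    show "real (k * M) \<le> real k * 4 ^ Suc k" unfolding of_nat_mult using M by (rule mult_left_mono) simp
  qed (use 8 Z_pos in auto)
  then have "eps_lose \<le> 2 ^ Suc k * real k * exp (real k / 2000) * ((real k * 4 ^ Suc k) * (16 / 2 ^ k / 8 ^ Suc k)) * (2 * exp (2 * theta * k))"
    (is "_ \<le> ?a * ?b * ?c")
  proof -
    assume *: "real (k * M) * (8 / (Z * real D0)) \<le> ?b"
    have "2 ^ Suc k * real k * gam ^ k \<le> ?a" using gam_power_le[of k] by (intro mult_left_mono) auto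
    then have "2 ^ Suc k * real k * gam ^ k * (real (k * M) * (8 / (Z * real D0))) \<le> ?a * ?b"
      using * by (rule mult_mono) (use Z_pos in auto)
    then show ?thesis unfolding eps_lose_def by (rule mult_right_mono) simp
  qed
  also have "\<dots> = 32 * (real k)\<^sup>2 * exp (real k / 2000) * exp (2 * theta * k) * (2 ^ Suc k * 4 ^ Suc k / 8 ^ Suc k / 2 ^ k)"
    by (simp add: power2_eq_square)
  also have "(2::real) ^ Suc k * 4 ^ Suc k / 8 ^ Suc k = 1"
    by (simp add: power_mult_distrib[symmetric] del: power_Suc)
  also have "32 * (real k)\<^sup>2 * exp (real k / 2000) * exp (2 * theta * k) * (1 / 2 ^ k) \<le> 64 * (real k)\<^sup>2 * exp (real k / 2000) * exp (2 * theta * k) * exp (- (real k / 2))"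
    by (intro mult_mono half_power_le) auto
  finally show ?thesis by (simp add: theta_def)
qed

text \<open>The margin \<open>M / 2 ^ k\<close>, of the order \<open>2 ^ k\<close>, pays for the
  \<open>2 ^ J\<close> words; with \<open>J = k div 4\<close>, three quarters of the exponent
  remain.\<close>

lemma crowd_le:
  assumes J: "J = k div 4"
  shows "2 ^ J * (2 * (real (Suc J) * 2 ^ k) * (real (k + J) / real M)) \<le> 8 * real k * (real k + 1) * exp (- (3 * real k / 8))"
proof -
  have Mr: "4 ^ k \<le> 2 * real M" using of_nat_mono[OF M_lo, where 'a = real] by simp
  have JM: "1 / real M \<le> 2 / 4 ^ k" using Mr M_pos by (simp add: divide_simps)
  have "real (k + J) / real M = real (k + J) * (1 / real M)" by simp
  also have "\<dots> \<le> (2 * real k) * (2 / 4 ^ k)" using J JM by (intro mult_mono) auto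
  finally have "2 ^ J * (2 * (real (Suc J) * 2 ^ k) * (real (k + J) / real M)) \<le> 2 ^ J * (2 * ((real k + 1) * 2 ^ k) * ((2 * real k) * (2 / 4 ^ k)))"
    using J by (intro mult_mono mult_nonneg_nonneg) (auto intro!: mult_right_mono)
  also have "\<dots> = 8 * real k * (real k + 1) * (2 ^ J * 2 ^ k / 4 ^ k)" by simp
  also have "2 ^ J * 2 ^ k / 4 ^ k = (1 :: real) / 2 ^ (k - J)"
  proof -
    have "(4::real) ^ k = 2 ^ k * 2 ^ k" by (simp add: power_mult_distrib[symmetric])
    moreover have "(2::real) ^ k = 2 ^ J * 2 ^ (k - J)" using J by (simp add: power_add[symmetric])
    ultimately show ?thesis by simp
  qed
  also have "8 * real k * (real k + 1) * (1 / 2 ^ (k - J)) \<le> 8 * real k * (real k + 1) * exp (- (3 * real k / 8))"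
  proof (intro mult_left_mono)
    have "1 / 2 ^ (k - J) \<le> exp (- (real (k - J) / 2))" by (rule half_power_le)
    also have "\<dots> \<le> exp (- (3 * real k / 8))"
    proof -
      have "real J \<le> real k / 4" using J by (simp add: of_nat_div_le_of_nat)
      then show ?thesis using J by (simp add: of_nat_diff)
    qed
    finally show "1 / 2 ^ (k - J) \<le> exp (- (3 * real k / 8))" .
  qed simp
  finally show ?thesis .
qed

text \<open>Two parts do not vanish for large \<open>k\<close>: the first step, at most
  \<open>gam * (16 / 17)\<close> because \<open>exp (- 1 / 16) \<le> 16 / 17\<close>, and
  \<open>(gam - 1) * 20\<close> from a geometric series of ratio \<open>95 / 100\<close>. Together
  they stay below \<open>24 / 25\<close>. With \<open>J2 = 16 * k\<close>, the decay
  \<open>exp (- k / 25)\<close> of \<open>lam ^ J2\<close> beats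
  \<open>exp (k / 50)\<close>.\<close>

lemma exit_bound_le:
  fixes x :: real
  assumes J: "J = k div 4" "J2 = 16 * k" and x: "x = real k" and k1: "1 \<le> k"
  shows "exit_bound J J2 \<le> 24 / 25 +
     (16 * x * (x + 1) * exp (- (3 * x / 8)) + x * exp (x / 2000) * (8 * x * (x + 1) * exp (- (3 * x / 8)))
      + 16 * x * exp (x / 125) * (exp (- (x / 64)) + 8 * x * (x + 1) * exp (- (3 * x / 8)))
      + 2 * exp (x / 50) * exp (- (x / 25)) / (1 - lam))"
proof -
  define r where "r = exp (- (1 / 16 :: real))"
  define c where "c = 8 * x * (x + 1) * exp (- (3 * x / 8))"
  have c0: "0 \<le> c" using x by (simp add: c_def)
  have ab: "avoid_bound J j \<le> r ^ Suc j + c" for j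
  proof -
    have "exp (- (real (Suc j) / 16)) = r ^ Suc j" by (simp only: r_def exp_of_nat_mult[symmetric]) (simp add: field_simps)
    then show ?thesis using crowd_le[OF J(1)] by (simp add: avoid_bound_def c_def x)
  qed
  have "17 / 16 \<le> exp (1 / 16 :: real)" using exp_ge_add_one_self[of "1 / 16"] by simp
  then have r: "0 < r" "r \<le> 16 / 17" by (simp_all add: r_def exp_minus divide_simps)
  have gr: "0 \<le> gam * r" "gam * r \<le> 95 / 100"
  proof -
    have "gam * r \<le> gam * (16 / 17)" using r gam_gt_1 by (intro mult_left_mono) auto
    then show "gam * r \<le> 95 / 100" by (simp add: gam_def)
  qed (use r gam_gt_1 in auto)
  have 1: "gam * avoid_bound J 0 \<le> gam * (16 / 17) + 2 * c"
  proof -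
    have "gam * avoid_bound J 0 \<le> gam * (16 / 17 + c)" using ab[of 0] r gam_gt_1 by (intro mult_left_mono) auto
    also have "\<dots> \<le> gam * (16 / 17) + 2 * c" unfolding distrib_left using c0 by (intro add_left_mono mult_right_mono) (auto simp: gam_def)
    finally show ?thesis .
  qed
  have 2: "(gam - 1) * (\<Sum>i\<in>{1..<J}. gam ^ i * avoid_bound J i) \<le> 1 / 100 + x * exp (x / 2000) * c"
  proof -
    have "(\<Sum>i\<in>{1..<J}. gam ^ i * avoid_bound J i) \<le> (\<Sum>i\<in>{1..<J}. (95 / 100) ^ i + exp (x / 2000) * c)"
    proof (intro sum_mono)
      fix i assume i: "i \<in> {1..<J}"
      have "gam ^ i * avoid_bound J i \<le> gam ^ i * (r ^ Suc i + c)" using gam_gt_1 by (intro mult_left_mono ab) auto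
      also have "\<dots> = (gam * r) ^ i * r + gam ^ i * c" by (simp add: power_mult_distrib algebra_simps)
      also have "\<dots> \<le> (95 / 100) ^ i * 1 + exp (x / 2000) * c"
      proof (intro add_mono mult_mono power_mono)
        have "gam ^ i \<le> exp (real i / 2000)" by (rule gam_power_le)
        also have "\<dots> \<le> exp (x / 2000)"
        proof -
          have "i \<le> k" using i J div_le_dividend[of k 4] by (metis atLeastLessThan_iff less_imp_le order_trans)
          then show ?thesis using x by simp
        qed
        finally show "gam ^ i \<le> exp (x / 2000)" .
      qed (use gr r c0 gam_gt_1 in auto)
      finally show "gam ^ i * avoid_bound J i \<le> (95 / 100) ^ i + exp (x / 2000) * c" by simp
    qed
    also have "\<dots> = (\<Sum>i\<in>{1..<J}. (95 / 100) ^ i) + real (J - 1) * (exp (x / 2000) * c)" by (simp add: sum.distrib)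
    also have "\<dots> \<le> 20 + x * (exp (x / 2000) * c)"
    proof (intro add_mono mult_right_mono)
      have "(\<Sum>i\<in>{1..<J}. (95 / 100 :: real) ^ i) \<le> (\<Sum>i<J. (95 / 100) ^ i)" by (intro sum_mono2) auto
      also have "\<dots> = (1 - (95 / 100) ^ J) / (1 - 95 / 100)" by (subst sum_gp_strict) auto
      also have "\<dots> \<le> 20" by simp
      finally show "(\<Sum>i\<in>{1..<J}. (95 / 100 :: real) ^ i) \<le> 20" .
    qed (use J x c0 in auto)
    finally have "(gam - 1) * (\<Sum>i\<in>{1..<J}. gam ^ i * avoid_bound J i) \<le> (gam - 1) * (20 + x * (exp (x / 2000) * c))"
      using gam_gt_1 by (intro mult_left_mono) auto
    also have "\<dots> = (gam - 1) * 20 + (gam - 1) * (x * (exp (x / 2000) * c))" by (rule distrib_left)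
    also have "\<dots> \<le> 1 / 100 + 1 * (x * (exp (x / 2000) * c))"
      using x c0 by (intro add_mono mult_right_mono) (auto simp: gam_def)
    finally show ?thesis by (simp add: mult.assoc)
  qed
  have 3: "real J2 * gam ^ J2 * avoid_bound J J \<le> 16 * x * exp (x / 125) * (exp (- (x / 64)) + c)"
  proof -
    have "gam ^ J2 \<le> exp (x / 125)" using gam_power_le[of J2] J x by simp
    moreover have "avoid_bound J J \<le> exp (- (x / 64)) + c"
    proof -
      have "k \<le> 4 * Suc J" using J dividend_less_times_div[of 4 k] by simp
      then have "x \<le> 4 * real (Suc J)" using x by linarith
      then have "x / 64 \<le> real (Suc J) / 16" by simp
      then have "exp (- (real (Suc J) / 16)) \<le> exp (- (x / 64))" by simp
      moreover have "r ^ Suc J = exp (- (real (Suc J) / 16))" by (simp only: r_def exp_of_nat_mult[symmetric]) (simp add: field_simps)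
      ultimately show ?thesis using ab[of J] by linarith
    qed
    ultimately show ?thesis using J x avoid_bound_nonneg gam_gt_1 by (intro mult_mono) auto
  qed
  have 4: "gam * exp (2 * theta * k) * lam ^ J2 / (1 - lam) \<le> 2 * exp (x / 50) * exp (- (x / 25)) / (1 - lam)"
  proof (intro divide_right_mono mult_mono)
    show "lam ^ J2 \<le> exp (- (x / 25))" using lam_power_le[of J2] J x by simp
  qed (use lam x in \<open>auto simp: gam_def theta_def\<close>)
  have "gam * (16 / 17) + 1 / 100 \<le> 24 / 25" by (simp add: gam_def)
  then show ?thesis unfolding exit_bound_def using 1 2 3 4 by (simp add: c_def)
qed

end

end

subsection \<open>From exponential moments to expectations\<close>

text \<open>Beyond the cutoff \<open>A\<close>, Bernoulli's inequality bounds the excess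
  \<open>m - A\<close>. With \<open>b ^ A\<close> at least as large as the moment, the expectation
  is at most \<open>A + 1 / (b - 1)\<close>.\<close>

lemma of_nat_le_power_bound:
  assumes b: "1 < b"
  shows "of_nat m \<le> ennreal (real A) + ennreal (1 / (b ^ A * (b - 1))) * ennreal (b ^ m)"
proof -
  have "real m \<le> real A + 1 / (b ^ A * (b - 1)) * b ^ m"
  proof (cases "m \<le> A")
    case True
    have "0 \<le> 1 / (b ^ A * (b - 1)) * b ^ m" using b by simp
    then show ?thesis using True by linarith
  next
    case False
    then have m: "m = A + (m - A)" by simp
    have "1 + real (m - A) * (b - 1) \<le> (1 + (b - 1)) ^ (m - A)" using b by (intro Bernoulli_inequality) simp
    then have "real (m - A) \<le> b ^ (m - A) / (b - 1)" using b by (simp add: pos_le_divide_eq)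
    also have "\<dots> = 1 / (b ^ A * (b - 1)) * b ^ m"
      using b by (subst m, simp only: power_add) (simp add: divide_simps)
    finally show ?thesis using False by simp
  qed
  then have "ennreal (real m) \<le> ennreal (real A + 1 / (b ^ A * (b - 1)) * b ^ m)" by (rule ennreal_leI)
  also have "\<dots> = ennreal (real A) + ennreal (1 / (b ^ A * (b - 1))) * ennreal (b ^ m)"
    using b by (simp add: ennreal_plus[symmetric] ennreal_mult[symmetric] del: ennreal_plus)
  finally show ?thesis by (simp add: ennreal_of_nat_eq_real_of_nat)
qed

lemma ex_power_cutoff:
  fixes b y :: real
  assumes b: "1 < b" and y: "1 \<le> y"
  shows "\<exists>A. y \<le> b ^ A \<and> real A \<le> ln y / ln b + 1"
proof -
  define A where "A = nat \<lceil>ln y / ln b\<rceil>"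
  have pos: "0 < ln b" "0 \<le> ln y" using b y by auto
  then have nn: "0 \<le> ln y / ln b" by simp
  have A: "ln y / ln b \<le> real A" "real A \<le> ln y / ln b + 1"
    using nn unfolding A_def by linarith+
  have "ln y \<le> real A * ln b" using A(1) pos by (simp add: pos_divide_le_eq)
  also have "\<dots> = ln (b ^ A)" using b by (simp add: ln_realpow)
  finally have "y \<le> b ^ A" using b y by simp
  then show ?thesis using A by blast
qed

context routing
begin

lemma ln_phi_le:
  assumes "d < N"
  shows "ln (phi d) \<le> 8 * 8 ^ Suc k / real M + 20 * real (Suc k) * ln (real N)"
proof -
  have "ln (phi d) = 8 * real (min d D0) / real M + real Lam * ln (real d + 1)"
    by (simp add: phi_def ln_mult ln_realpow)
  also have "real Lam * ln (real d + 1) \<le> 20 * real (Suc k) * ln (real N)"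
    unfolding Lam_def using assms by (simp add: mult_left_mono)
  also have "8 * real (min d D0) / real M \<le> 8 * 8 ^ Suc k / real M"
  proof (rule divide_right_mono)
    have "real (min d D0) \<le> real D0" by simp
    then show "8 * real (min d D0) \<le> 8 * 8 ^ Suc k" by (simp add: D0_def)
  qed simp
  finally show ?thesis by simp
qed

text \<open>The distance at which the loop is left may depend on K-links that the final phase uses
  again, so the greedy moments are summed over all \<open>d < D1\<close>. The sum is at most
  \<open>(real D1 + 1) ^ 2\<close>, and a cutoff \<open>B\<close> of this size costs
  \<open>O(Z * ln D1)\<close>.\<close>

lemma expected_hops:
  fixes T :: "'a \<Rightarrow> ennreal"
  assumes coords: "map_pmf (\<lambda>G. (K G, J G)) P = pair_pmf Kp Ap"
    and val: "(\<integral>\<^sup>+\<alpha>. (\<integral>\<^sup>+\<kappa>. val \<kappa> \<alpha> s \<partial>Kp) \<partial>Ap) \<le> ennreal (phi s)"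
    and ga: "\<And>\<alpha> d. 0 < d \<Longrightarrow> ga \<alpha> d < d" and Z1: "1 \<le> Z"
    and T: "\<And>G. G \<in> set_pmf P \<Longrightarrow> \<exists>m d. egam ^ m \<le> val (K G) (J G) s \<and> d < D1 \<and> d < N \<and>
      T G \<le> of_nat m + of_nat (greedy_time (\<lambda>d. min (K G d) (ga (J G) d)) d)"
  shows "(\<integral>\<^sup>+G. T G \<partial>P) \<le> ennreal (2001 * ln (phi s) + 2 * ln (real D1 + 1) * (8 * Z + 1) + 8 * Z + 2002)"
proof -
  let ?g = "\<lambda>\<alpha> \<kappa> d. greedy_time (\<lambda>d. min (\<kappa> d) (ga \<alpha> d)) d"
  obtain A where A: "phi s \<le> gam ^ A" "real A \<le> ln (phi s) / ln gam + 1"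
    using ex_power_cutoff[OF gam_gt_1 phi_ge_1] by blast
  obtain B where B: "(real D1 + 1) ^ 2 \<le> bet ^ B" "real B \<le> ln ((real D1 + 1) ^ 2) / ln bet + 1"
    using ex_power_cutoff[OF bet_gt_1, of "(real D1 + 1) ^ 2"] by auto
  define a where "a = 1 / (gam ^ A * (gam - 1))"
  define b where "b = 1 / (bet ^ B * (bet - 1))"
  have ab: "0 \<le> a" "0 \<le> b" using gam_gt_1 bet_gt_1 by (simp_all add: a_def b_def)
  have I: "finite ({..<D1} \<inter> {..<N})" by simp
  let ?X = "\<lambda>\<kappa> \<alpha>. (ennreal (real A) + ennreal a * val \<kappa> \<alpha> s) + (ennreal (real B) + (\<Sum>d\<in>{..<D1} \<inter> {..<N}. ennreal b * ennreal (bet ^ ?g \<alpha> \<kappa> d)))"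
  have pt: "T G \<le> ?X (K G) (J G)" if G: "G \<in> set_pmf P" for G
  proof -
    let ?k = "K G" and ?a = "J G"
    obtain m d where m: "egam ^ m \<le> val ?k ?a s" and d: "d < D1" "d < N"
      and Tm: "T G \<le> of_nat m + of_nat (?g ?a ?k d)" using T[OF G] by blast
    have "of_nat m \<le> ennreal (real A) + ennreal a * ennreal (gam ^ m)"
      unfolding a_def by (rule of_nat_le_power_bound[OF gam_gt_1])
    also have "ennreal (gam ^ m) = egam ^ m" using gam_gt_1 by (simp add: ennreal_power)
    also have "ennreal a * egam ^ m \<le> ennreal a * val ?k ?a s" using m by (rule mult_left_mono) simp
    finally have 1: "of_nat m \<le> ennreal (real A) + ennreal a * val ?k ?a s" by (simp add: add_left_mono)
    have "of_nat (?g ?a ?k d) \<le> ennreal (real B) + ennreal b * ennreal (bet ^ ?g ?a ?k d)"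
      unfolding b_def by (rule of_nat_le_power_bound[OF bet_gt_1])
    also have "ennreal b * ennreal (bet ^ ?g ?a ?k d) \<le> (\<Sum>d\<in>{..<D1} \<inter> {..<N}. ennreal b * ennreal (bet ^ ?g ?a ?k d))"
      using d by (intro member_le_sum) auto
    finally have 2: "of_nat (?g ?a ?k d) \<le> ennreal (real B) + (\<Sum>d\<in>{..<D1} \<inter> {..<N}. ennreal b * ennreal (bet ^ ?g ?a ?k d))" by (simp add: add_left_mono)
    show ?thesis using Tm add_mono[OF 1 2] by (rule order_trans)
  qed
  have v: "(\<integral>\<^sup>+\<alpha>. (\<integral>\<^sup>+\<kappa>. (ennreal (real A) + ennreal a * val \<kappa> \<alpha> s) \<partial>Kp) \<partial>Ap) \<le> ennreal (real A + 2000)"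
  proof -
    have "(\<integral>\<^sup>+\<alpha>. (\<integral>\<^sup>+\<kappa>. (ennreal (real A) + ennreal a * val \<kappa> \<alpha> s) \<partial>Kp) \<partial>Ap)
      = ennreal (real A) + ennreal a * (\<integral>\<^sup>+\<alpha>. (\<integral>\<^sup>+\<kappa>. val \<kappa> \<alpha> s \<partial>Kp) \<partial>Ap)"
      by (simp add: nn_integral_add nn_integral_cmult)
    also have "\<dots> \<le> ennreal (real A) + ennreal a * ennreal (phi s)" using val by (intro add_left_mono mult_left_mono) auto
    also have "\<dots> = ennreal (real A + a * phi s)"
      using ab phi_nonneg by (simp add: ennreal_mult)
    also have "\<dots> \<le> ennreal (real A + 2000)"
    proof (intro ennreal_leI add_left_mono)
      have "a * phi s \<le> a * gam ^ A" using A ab by (intro mult_left_mono) auto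
      also have "\<dots> = 2000" using gam_gt_1 by (simp add: a_def) (simp add: gam_def)
      finally show "a * phi s \<le> 2000" .
    qed
    finally show ?thesis .
  qed
  have w: "(\<integral>\<^sup>+\<alpha>. (\<integral>\<^sup>+\<kappa>. (ennreal (real B) + (\<Sum>d\<in>{..<D1} \<inter> {..<N}. ennreal b * ennreal (bet ^ ?g \<alpha> \<kappa> d))) \<partial>Kp) \<partial>Ap)
      \<le> ennreal (real B + 8 * Z)"
  proof (rule nn_integral_pmf_le_const)
    fix \<alpha>
    have "(\<integral>\<^sup>+\<kappa>. (ennreal (real B) + (\<Sum>d\<in>{..<D1} \<inter> {..<N}. ennreal b * ennreal (bet ^ ?g \<alpha> \<kappa> d))) \<partial>Kp)
      = ennreal (real B) + (\<Sum>d\<in>{..<D1} \<inter> {..<N}. ennreal b * (\<integral>\<^sup>+\<kappa>. ennreal (bet ^ ?g \<alpha> \<kappa> d) \<partial>Kp))"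
      by (simp add: nn_integral_add nn_integral_cmult nn_integral_sum)
    also have "\<dots> \<le> ennreal (real B) + (\<Sum>d\<in>{..<D1} \<inter> {..<N}. ennreal (b * (real D1 + 1)))"
    proof (intro add_left_mono sum_mono)
      fix d assume d: "d \<in> {..<D1} \<inter> {..<N}"
      have "ennreal b * (\<integral>\<^sup>+\<kappa>. ennreal (bet ^ ?g \<alpha> \<kappa> d) \<partial>Kp) \<le> ennreal b * ennreal (real d + 1)"
        using d by (intro mult_left_mono greedy_moment[OF ga Z1]) auto
      also have "\<dots> = ennreal (b * (real d + 1))" using ab by (simp add: ennreal_mult)
      also have "\<dots> \<le> ennreal (b * (real D1 + 1))" using ab d by (intro ennreal_leI mult_left_mono) auto
      finally show "ennreal b * (\<integral>\<^sup>+\<kappa>. ennreal (bet ^ ?g \<alpha> \<kappa> d) \<partial>Kp) \<le> ennreal (b * (real D1 + 1))" .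
    qed
    also have "\<dots> = ennreal (real B + real (card ({..<D1} \<inter> {..<N})) * (b * (real D1 + 1)))"
      using ab by (subst sum_ennreal_const) (auto simp: ennreal_plus)
    also have "\<dots> \<le> ennreal (real B + 8 * Z)"
    proof (intro ennreal_leI add_left_mono)
      have "card ({..<D1} \<inter> {..<N}) \<le> card {..<D1}" by (intro card_mono) auto
      then have "real (card ({..<D1} \<inter> {..<N})) * (b * (real D1 + 1)) \<le> (real D1 + 1) * (b * (real D1 + 1))"
        using ab by (intro mult_right_mono) auto
      also have "\<dots> = b * (real D1 + 1) ^ 2" by (simp add: power2_eq_square)
      also have "\<dots> \<le> b * bet ^ B" using ab B by (intro mult_left_mono) auto
      also have "\<dots> = 1 / (bet - 1)" using bet_gt_1 by (simp add: b_def)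
      also have "\<dots> = 8 * Z" by (simp add: bet_def)
      finally show "real (card ({..<D1} \<inter> {..<N})) * (b * (real D1 + 1)) \<le> 8 * Z" .
    qed
    finally show "(\<integral>\<^sup>+\<kappa>. (ennreal (real B) + (\<Sum>d\<in>{..<D1} \<inter> {..<N}. ennreal b * ennreal (bet ^ ?g \<alpha> \<kappa> d))) \<partial>Kp) \<le> ennreal (real B + 8 * Z)" .
  qed
  have ln_ge: "x / (1 + x) \<le> ln (1 + x)" if "0 < x" for x :: real
  proof -
    have "ln (1 / (1 + x)) \<le> 1 / (1 + x) - 1" using that by (intro ln_le_minus_one) simp
    then show ?thesis using that by (simp add: ln_div field_simps)
  qed
  have Ab: "real A \<le> 2001 * ln (phi s) + 1"
  proof -
    have g: "1 / 2001 \<le> ln gam" using ln_ge[of "1 / 2000"] by (simp add: gam_def)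
    have "0 \<le> ln (phi s)" using phi_ge_1[of s] by simp
    then have "ln (phi s) / ln gam \<le> ln (phi s) / (1 / 2001)" using g by (intro divide_left_mono) auto
    then show ?thesis using A(2) by simp
  qed
  have Bb: "real B \<le> 2 * ln (real D1 + 1) * (8 * Z + 1) + 1"
  proof -
    have g: "1 / (8 * Z + 1) \<le> ln bet" using ln_ge[of "1 / (8 * Z)"] Z_pos by (simp add: bet_def field_simps)
    have "ln ((real D1 + 1) ^ 2) = 2 * ln (real D1 + 1)" by (simp add: ln_realpow)
    moreover have "2 * ln (real D1 + 1) / ln bet \<le> 2 * ln (real D1 + 1) / (1 / (8 * Z + 1))"
      using g Z_pos bet_gt_1 by (intro divide_left_mono) auto
    ultimately show ?thesis using B(2) by simp
  qed
  have "(\<integral>\<^sup>+G. T G \<partial>P) \<le> (\<integral>\<^sup>+G. ?X (K G) (J G) \<partial>P)"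
    using pt by (intro nn_integral_mono_AE) (simp add: AE_measure_pmf_iff)
  also have "\<dots> = (\<integral>\<^sup>+z. ?X (fst z) (snd z) \<partial>map_pmf (\<lambda>G. (K G, J G)) P)"
    by (simp add: nn_integral_map_pmf)
  also have "\<dots> = (\<integral>\<^sup>+\<kappa>. (\<integral>\<^sup>+\<alpha>. ?X \<kappa> \<alpha> \<partial>Ap) \<partial>Kp)"
    unfolding coords nn_integral_pair_pmf' by simp
  also have "\<dots> = (\<integral>\<^sup>+\<alpha>. (\<integral>\<^sup>+\<kappa>. ?X \<kappa> \<alpha> \<partial>Kp) \<partial>Ap)" by (rule nn_integral_pmf_swap)
  also have "\<dots> = (\<integral>\<^sup>+\<alpha>. (\<integral>\<^sup>+\<kappa>. (ennreal (real A) + ennreal a * val \<kappa> \<alpha> s) \<partial>Kp) \<partial>Ap)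
    + (\<integral>\<^sup>+\<alpha>. (\<integral>\<^sup>+\<kappa>. (ennreal (real B) + (\<Sum>d\<in>{..<D1} \<inter> {..<N}. ennreal b * ennreal (bet ^ ?g \<alpha> \<kappa> d))) \<partial>Kp) \<partial>Ap)"
    by (subst nn_integral_add[symmetric], simp, simp, subst nn_integral_add) auto
  also have "\<dots> \<le> ennreal (real A + 2000) + ennreal (real B + 8 * Z)" by (intro add_mono v w)
  also have "\<dots> = ennreal (real A + 2000 + (real B + 8 * Z))" using Z_pos by (intro ennreal_plus[symmetric]) auto
  also have "\<dots> \<le> ennreal (2001 * ln (phi s) + 2 * ln (real D1 + 1) * (8 * Z + 1) + 8 * Z + 2002)"
    using Ab Bb by (intro ennreal_leI) linarith
  finally show ?thesis .
qed

text \<open>The conditions are put in terms of the real variable \<open>x\<close>, with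
  \<open>1 - lam = 1701 / 600000\<close> evaluated, which is the form that
  \<open>eventually_small\<close> provides.\<close>

lemma val_moment_large_k:
  assumes M_lo: "4 ^ k \<le> 2 * M" and M_hi: "M \<le> 4 ^ Suc k" and Z_lo: "2 ^ k \<le> 2 * Z"
    and x: "x = real k"
    and E: "E = 8 * exp (x / 50) * (4 * x + 3) * exp (- (x / 2)) + 16 * exp (- x) + 64 * x\<^sup>2 * exp (x / 2000) * exp (x / 50) * exp (- (x / 2))"
    and small: "2 * x * exp (- x) + E \<le> 1 / 1000"
      "16 * x * (x + 1) * exp (- (3 * x / 8)) + x * exp (x / 2000) * (8 * x * (x + 1) * exp (- (3 * x / 8)))
        + 16 * x * exp (x / 125) * (exp (- (x / 64)) + 8 * x * (x + 1) * exp (- (3 * x / 8)))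
        + 2 * exp (x / 50) * exp (- (x / 25)) / (1701 / 600000) + E * (exp (x / 50) / (1701 / 600000)) \<le> 1 / 25"
    and d: "d < N"
  shows "(\<integral>\<^sup>+\<alpha>. (\<integral>\<^sup>+\<kappa>. val \<kappa> \<alpha> d \<partial>Kp) \<partial>Ap) \<le> ennreal (phi d)"
proof -
  have l: "1 - lam = 1701 / 600000" by (simp add: lam_def gam_def theta_def)
  note prem = M_lo M_hi Z_lo
  have e: "eps_short + eps_half + eps_lose \<le> E"
    using eps_short_le[OF prem] eps_half_le[OF prem] eps_lose_le[OF prem] unfolding E x by linarith
  have k1: "1 \<le> k" using k_pos by simp
  have ex: "exit_bound (k div 4) (16 * k) \<le> 24 / 25 + (16 * x * (x + 1) * exp (- (3 * x / 8)) + x * exp (x / 2000) * (8 * x * (x + 1) * exp (- (3 * x / 8)))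
        + 16 * x * exp (x / 125) * (exp (- (x / 64)) + 8 * x * (x + 1) * exp (- (3 * x / 8)))
        + 2 * exp (x / 50) * exp (- (x / 25)) / (1 - lam))"
    by (rule exit_bound_le[OF prem refl refl x k1])
  have th: "exp (2 * theta * real k) = exp (x / 50)" by (simp add: theta_def x)
  have "(eps_short + eps_half + eps_lose) * (exp (x / 50) / (1 - lam)) \<le> E * (exp (x / 50) / (1 - lam))"
    using e lam by (intro mult_right_mono) auto
  then have 2: "exit_bound (k div 4) (16 * k) + (eps_short + eps_half + eps_lose) * (exp (2 * theta * real k) / (1 - lam)) \<le> 1"
    using ex small(2) unfolding th l by linarith
  have 1: "eps_plant + eps_short + eps_half + eps_lose \<le> 1 / 1000"
    using eps_plant_le[OF prem] e small(1) unfolding x by linarith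
  have J: "k div 4 < k" "k div 4 \<le> 16 * k" using k_pos by simp_all
  show ?thesis by (rule val_moment[OF 1 J 2 d])
qed

end

lemma eventually_small:
  "eventually (\<lambda>x::real. 2 * x * exp (- x) + (8 * exp (x / 50) * (4 * x + 3) * exp (- (x / 2)) + 16 * exp (- x) + 64 * x\<^sup>2 * exp (x / 2000) * exp (x / 50) * exp (- (x / 2))) \<le> 1 / 1000) at_top"
  "eventually (\<lambda>x::real. 16 * x * (x + 1) * exp (- (3 * x / 8)) + x * exp (x / 2000) * (8 * x * (x + 1) * exp (- (3 * x / 8)))
        + 16 * x * exp (x / 125) * (exp (- (x / 64)) + 8 * x * (x + 1) * exp (- (3 * x / 8)))
        + 2 * exp (x / 50) * exp (- (x / 25)) / (1701 / 600000)
     + (8 * exp (x / 50) * (4 * x + 3) * exp (- (x / 2)) + 16 * exp (- x) + 64 * x\<^sup>2 * exp (x / 2000) * exp (x / 50) * exp (- (x / 2))) * (exp (x / 50) / (1701 / 600000)) \<le> 1 / 25) at_top"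
  by real_asymp+

lemma eventually_lg:
  fixes c :: real
  shows "eventually (\<lambda>L. 2 * ((c + 3) * (L\<^sup>2 * lg L) + 1) \<le> L ^ 3) at_top"
    "eventually (\<lambda>L. c * L\<^sup>2 * lg L + 2 \<le> L ^ 3) at_top"
    "eventually (\<lambda>L. 2001 * (256 * L + 20 * (lg L + 1) * L) + 6 * lg L * (8 * L + 1) + 8 * L + 2002 \<le> 100000 * L * lg L) at_top"
    "eventually (\<lambda>L::real. 2 \<le> L) at_top"
  by real_asymp+

lemma eventually_n:
  "eventually (\<lambda>n. 1 + ln (real n) \<le> lg (real n)) sequentially"
  "eventually (\<lambda>n. (lg (real n))\<^sup>2 < real n) sequentially"
  "filterlim (\<lambda>n. lg (real n)) at_top sequentially"
  "filterlim (\<lambda>n. real (nat \<lfloor>lg (lg (real n))\<rfloor>)) at_top sequentially"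
proof -
  have "eventually (\<lambda>n. 3 \<le> ln (real n)) sequentially" by real_asymp
  then show "eventually (\<lambda>n. 1 + ln (real n) \<le> lg (real n)) sequentially"
  proof eventually_elim
    case (elim n)
    have "1 + ln (real n) \<le> ln (real n) / (25 / 36)" using elim by simp
    also have "\<dots> \<le> ln (real n) / ln 2" using elim ln2_le_25_over_36 by (intro divide_left_mono) auto
    finally show ?case by (simp add: log_def)
  qed
  show "eventually (\<lambda>n. (lg (real n))\<^sup>2 < real n) sequentially" by real_asymp
  show "filterlim (\<lambda>n. lg (real n)) at_top sequentially" by real_asymp
  show "filterlim (\<lambda>n. real (nat \<lfloor>lg (lg (real n))\<rfloor>)) at_top sequentially" by real_asymp
qed

text \<open>Everything is tied to \<open>L = lg n\<close> by
  \<open>2 ^ k \<le> L < 2 ^ Suc k\<close>: \<open>M\<close> is the integer part of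
  \<open>L ^ 2\<close>, and \<open>Z\<close> lies between \<open>L / 2\<close> and \<open>L\<close>,
  as the harmonic sum exceeds \<open>ln n = L * ln 2\<close>. \<open>8 \<le> c\<close> yields
  \<open>D1_ge\<close>, and \<open>D0_ge\<close> holds as \<open>8 ^ Suc k\<close> exceeds
  \<open>L ^ 3\<close>.\<close>

lemma expected_hops_bound:
  fixes c :: real
  assumes c: "8 \<le> c" and s: "s < n" and t: "t < n"
    and k: "k = nat \<lfloor>lg (lg (real n))\<rfloor>" "0 < k"
    and L: "L = lg (real n)" "2 \<le> L" "1 + ln (real n) \<le> L" "L\<^sup>2 < real n"
      "2 * ((c + 3) * (L\<^sup>2 * lg L) + 1) \<le> L ^ 3" "c * L\<^sup>2 * lg L + 2 \<le> L ^ 3"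
    and x: "x = real k"
    and E: "E = 8 * exp (x / 50) * (4 * x + 3) * exp (- (x / 2)) + 16 * exp (- x) + 64 * x\<^sup>2 * exp (x / 2000) * exp (x / 50) * exp (- (x / 2))"
    and small: "2 * x * exp (- x) + E \<le> 1 / 1000"
      "16 * x * (x + 1) * exp (- (3 * x / 8)) + x * exp (x / 2000) * (8 * x * (x + 1) * exp (- (3 * x / 8)))
        + 16 * x * exp (x / 125) * (exp (- (x / 64)) + 8 * x * (x + 1) * exp (- (3 * x / 8)))
        + 2 * exp (x / 50) * exp (- (x / 25)) / (1701 / 600000) + E * (exp (x / 50) / (1701 / 600000)) \<le> 1 / 25"
    and run: "\<forall>G\<in>set_pmf (KSWN_star n). algorithm2_run c n G s t (p G)"
  shows "(\<integral>\<^sup>+ G. hops (p G) t \<partial>measure_pmf (KSWN_star n))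
    \<le> ennreal (2001 * (256 * L + 20 * (lg L + 1) * L) + 6 * lg L * (8 * L + 1) + 8 * L + 2002)"
proof -
  define M where "M = nat \<lfloor>(lg (real n))\<^sup>2\<rfloor>"
  define Z where "Z = (harm (n - 1) :: real)"
  define D1 where "D1 = nat \<lceil>c * L\<^sup>2 * lg L\<rceil>"
  have L2: "4 \<le> L\<^sup>2" using power_mono[OF L(2), of 2] by simp
  have n2: "2 \<le> n" using L2 L(4) by linarith
  have lgL: "1 \<le> lg L" using L(2) by simp
  have kl: "real k \<le> lg L" "lg L < real k + 1" using lgL unfolding k(1) L(1)[symmetric] by linarith+
  have pw: "2 ^ k \<le> L" "L < 2 ^ Suc k"
  proof -
    have "L = 2 powr lg L" using L(2) by simp
    moreover have "2 powr real k \<le> 2 powr lg L" "2 powr lg L < 2 powr real (Suc k)"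
      using kl by (auto intro: powr_mono powr_less_mono)
    ultimately show "2 ^ k \<le> L" "L < 2 ^ Suc k" by (simp_all only: powr_realpow[of 2] zero_less_numeral)
  qed
  have sq: "(2 ^ j)\<^sup>2 = (4 ^ j :: real)" for j :: nat by (simp add: power2_eq_square power_mult_distrib[symmetric])
  have Mr: "4 ^ k \<le> M" "real M \<le> L\<^sup>2"
  proof -
    have "(2 ^ k)\<^sup>2 \<le> L\<^sup>2" using pw(1) by (intro power_mono) auto
    then have "real (4 ^ k) \<le> L\<^sup>2" unfolding sq by simp
    then show "4 ^ k \<le> M" unfolding M_def L(1)[symmetric] by (intro le_nat_floor)
    show "real M \<le> L\<^sup>2" unfolding M_def L(1)[symmetric] by simp
  qed
  have M0: "0 < M" using Mr(1) by (metis less_le_trans zero_less_numeral zero_less_power)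
  have Mn: "M < n" using Mr(2) L(4) by linarith
  have M_hi: "M \<le> 4 ^ Suc k"
  proof -
    have "L\<^sup>2 \<le> (2 ^ Suc k)\<^sup>2" using pw(2) L(2) by (intro power_mono) auto
    then have "real M \<le> real (4 ^ Suc k)" using Mr(2) unfolding sq by simp
    then show ?thesis by (simp only: of_nat_le_iff)
  qed
  have kM: "real k * real M \<le> L\<^sup>2 * lg L"
    using mult_mono[OF kl(1) Mr(2)] lgL by (simp add: mult.commute)
  have L2l: "4 \<le> L\<^sup>2 * lg L" using mult_mono[OF L2 lgL] L2 by simp
  have cL: "8 * (L\<^sup>2 * lg L) \<le> c * (L\<^sup>2 * lg L)" using c L2l by (intro mult_right_mono) auto
  have D1r: "c * (L\<^sup>2 * lg L) \<le> real D1" "real D1 \<le> c * (L\<^sup>2 * lg L) + 1"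
    using cL L2l unfolding D1_def mult.assoc by linarith+
  have D1_ge: "8 * (k * M) \<le> D1"
  proof -
    have "real (8 * (k * M)) \<le> real D1" using kM cL D1r(1) by (simp del: of_nat_le_iff)
    then show ?thesis by (simp only: of_nat_le_iff)
  qed
  have D0_ge: "2 * (D1 + 3 * (k * M)) \<le> 8 ^ Suc k"
  proof -
    have "L ^ 3 \<le> (2 ^ Suc k) ^ 3" using pw(2) L(2) by (intro power_mono) auto
    also have "\<dots> = 8 ^ Suc k" by (simp only: power_mult[symmetric] mult.commute[of _ 3]) (simp only: power_mult, simp)
    finally have "L ^ 3 \<le> real (8 ^ Suc k)" by simp
    moreover have "real (2 * (D1 + 3 * (k * M))) \<le> 2 * ((c + 3) * (L\<^sup>2 * lg L) + 1)"
      using kM D1r(2) by (simp add: distrib_right)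
    ultimately have "real (2 * (D1 + 3 * (k * M))) \<le> real (8 ^ Suc k)" using L(5) by linarith
    then show ?thesis by (simp only: of_nat_le_iff)
  qed
  have n1: "0 < n - 1" "real (n - 1) + 1 = real n" using n2 by auto
  have Zb: "ln (real n) \<le> Z" "Z \<le> L" "1 \<le> Z"
  proof -
    show "ln (real n) \<le> Z" using ln_le_harm[of "n - 1"] n1 by (simp add: Z_def)
    have "Z \<le> 1 + ln (real (n - 1))" unfolding Z_def using n1 by (intro harm_le_ln)
    also have "\<dots> \<le> 1 + ln (real n)" using n1 by simp
    finally show "Z \<le> L" using L(3) by simp
    have "harm 1 \<le> (harm (n - 1) :: real)" using n1 by (intro harm_mono) simp
    moreover have "harm 1 = (1::real)" by (simp add: harm_def)
    ultimately show "1 \<le> Z" by (simp add: Z_def)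
  qed
  have LZ: "L \<le> 2 * Z"
  proof -
    have "1 / 2 \<le> ln (2::real)" using ln2_ge_two_thirds by simp
    then have "L * (1 / 2) \<le> L * ln 2" using L(2) by (intro mult_left_mono) auto
    also have "L * ln 2 = ln (real n)" unfolding L(1) by (simp add: log_def)
    finally show ?thesis using Zb(1) by simp
  qed
  interpret routing k D1 n M Z "K_dist_pmf n t"
  proof unfold_locales
    show "pmf (K_dist_pmf n t d) v = 1 / (Z * real (d - v))" if "v < d" "d < n" for v d
      unfolding Z_def by (rule pmf_K_dist_pmf[OF n2 t that])
    show "0 < Z" "Z \<le> 2 ^ Suc k" using Zb pw(2) by linarith+
  qed (use M0 k(2) D1_ge D0_ge in auto)
  have val: "(\<integral>\<^sup>+\<alpha>. (\<integral>\<^sup>+\<kappa>. val \<kappa> \<alpha> d \<partial>Kp) \<partial>Ap) \<le> ennreal (phi d)" if "d < n" for d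
  proof (rule val_moment_large_k[OF _ M_hi _ x E small that])
    show "4 ^ k \<le> 2 * M" using Mr(1) by linarith
    show "2 ^ k \<le> 2 * Z" using pw(1) LZ by linarith
  qed
  let ?s = "ring_dist n s t"
  have sn: "?s < n" using n2 by (intro ring_dist_less) simp
  have "(\<integral>\<^sup>+ G. hops (p G) t \<partial>measure_pmf (KSWN_star n))
    \<le> ennreal (2001 * ln (phi ?s) + 2 * ln (real D1 + 1) * (8 * Z + 1) + 8 * Z + 2002)"
  proof (rule expected_hops[where K = "K_dist n t" and J = "AL_jump n t" and ga = "greedy_AL n"])
    show "map_pmf (\<lambda>G. (K_dist n t G, AL_jump n t G)) (KSWN_star n) = pair_pmf Kp Ap"
      unfolding ALd_def by (rule KSWN_star_coordinates[OF M_def M0 Mn t])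
    show "(\<integral>\<^sup>+\<alpha>. (\<integral>\<^sup>+\<kappa>. val \<kappa> \<alpha> ?s \<partial>Kp) \<partial>Ap) \<le> ennreal (phi ?s)" by (rule val[OF sn])
    show "greedy_AL n \<alpha> d < d" if "0 < d" for \<alpha> d using that by (rule greedy_AL_less)
    show "1 \<le> Z" by (rule Zb)
    fix G assume G: "G \<in> set_pmf (KSWN_star n)"
    interpret r: ring_run k D1 n t M G
    proof unfold_locales
      show "k * M + M \<le> D1"
      proof -
        have "M \<le> k * M" using k(2) by simp
        then show ?thesis using D1_ge by linarith
      qed
      show "real j \<le> lg (lg (real n)) \<longleftrightarrow> j \<le> k" for j
        using lgL unfolding k(1) L(1) by (simp add: le_nat_iff le_floor_iff)
      show "fst (G u) < n" if "u < n" for u by (rule KSWN_star_links(1)[OF G that n2 M_def M0])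
      show "\<exists>a\<in>{1..M}. v = (u + a) mod n" if "u < n" "v \<in> AL_nbrs G u" for u v
        by (rule KSWN_star_links(2)[OF G that(1) n2 M_def M0 that(2)])
    qed (use t M0 Mn in auto)
    have D1_pos: "0 < D1" using D1r(1) cL L2l by simp
    have loop: "in_loop c n t x \<longleftrightarrow> D1 \<le> ring_dist n x t" for x
      unfolding in_loop_def D1_def L(1)[symmetric] by linarith
    have "algorithm2_run c n G s t (p G)" using run G by blast
    from r.run_hops[OF this s D1_pos loop]
    show "\<exists>m d. egam ^ m \<le> val (K_dist n t G) (AL_jump n t G) ?s \<and> d < D1 \<and> d < n \<and>
        hops (p G) t \<le> of_nat m + of_nat (greedy_time (\<lambda>d. min (K_dist n t G d) (greedy_AL n (AL_jump n t G) d)) d)"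
      using chain_le_val by blast
  qed
  also have "\<dots> \<le> ennreal (2001 * (256 * L + 20 * (lg L + 1) * L) + 6 * lg L * (8 * L + 1) + 8 * L + 2002)"
  proof (rule ennreal_leI)
    have lnn: "ln (real n) \<le> L" using Zb by linarith
    have "ln (phi ?s) \<le> 8 * 8 ^ Suc k / real M + 20 * real (Suc k) * ln (real n)" by (rule ln_phi_le[OF sn])
    also have "8 * 8 ^ Suc k / real M \<le> 64 * L"
    proof -
      have "(8::real) ^ k = 2 ^ k * 4 ^ k" by (simp add: power_mult_distrib[symmetric])
      also have "\<dots> \<le> L * real M" using pw(1) of_nat_mono[OF Mr(1), where 'a = real] L(2) by (intro mult_mono) auto
      finally have "8 * 8 ^ Suc k \<le> 64 * L * real M" by simp
      then show ?thesis using M0 by (simp add: pos_divide_le_eq)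
    qed
    also have "20 * real (Suc k) * ln (real n) \<le> 20 * (lg L + 1) * L"
      using kl(1) lnn lgL n2 by (intro mult_mono) auto
    finally have 1: "2001 * ln (phi ?s) \<le> 2001 * (256 * L + 20 * (lg L + 1) * L)" using L(2) by simp
    have "ln (real D1 + 1) \<le> ln (L ^ 3)"
    proof -
      have "real D1 + 1 \<le> L ^ 3" using D1r(2) L(6) by (simp add: mult.assoc)
      then show ?thesis using L(2) by (intro ln_mono) auto
    qed
    also have "\<dots> = 3 * ln L" using L(2) by (simp add: ln_realpow)
    also have "ln L \<le> lg L"
    proof -
      have "ln L / 1 \<le> ln L / ln 2" using L(2) ln2_le_25_over_36 by (intro divide_left_mono) auto
      then show ?thesis by (simp add: log_def)
    qed
    finally have "2 * ln (real D1 + 1) \<le> 6 * lg L" by simp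
    then have "2 * ln (real D1 + 1) * (8 * Z + 1) \<le> 6 * lg L * (8 * L + 1)"
      by (rule mult_mono) (use Zb lgL in auto)
    then show "2001 * ln (phi ?s) + 2 * ln (real D1 + 1) * (8 * Z + 1) + 8 * Z + 2002
      \<le> 2001 * (256 * L + 20 * (lg L + 1) * L) + 6 * lg L * (8 * L + 1) + 8 * L + 2002"
      using 1 Zb(2) by linarith
  qed
  finally show ?thesis .
qed

theorem theorem2:
  "\<exists>c0::real. \<forall>c\<ge>c0. \<exists>C::real. \<forall>\<^sub>F n in sequentially. \<forall>s<n. \<forall>t<n.
     \<forall>p :: network \<Rightarrow> nat \<Rightarrow> nat.
       (\<forall>G\<in>set_pmf (KSWN_star n). algorithm2_run c n G s t (p G)) \<longrightarrow>
       (\<integral>\<^sup>+ G. hops (p G) t \<partial>measure_pmf (KSWN_star n))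
         \<le> ennreal (C * lg (real n) * lg (lg (real n)))"
\<comment> \<open>The coefficient of \<open>L * lg L\<close> is \<open>2001 * 20 + 6 * 8\<close>, so
  \<open>100000\<close> serves for every \<open>c\<close>; the constant \<open>c\<close> only
  affects how large \<open>n\<close> has to be.\<close>
proof (rule exI[of _ 8], intro allI impI, rule exI[of _ 100000])
  fix c :: real assume c: "8 \<le> c"
  let ?L = "\<lambda>n. lg (real n)"
  let ?k = "\<lambda>n. nat \<lfloor>lg (?L n)\<rfloor>"
  have k: "filterlim ?k at_top sequentially"
    using eventually_n(4) by (simp add: filterlim_real_sequentially filterlim_sequentially_iff_filterlim_real)
  note E = eventually_small[THEN eventually_compose_filterlim, OF eventually_n(4)]
  note F = eventually_lg(1,2)[of c, THEN eventually_compose_filterlim, OF eventually_n(3)]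
    eventually_lg(3,4)[THEN eventually_compose_filterlim, OF eventually_n(3)]
  have "eventually (\<lambda>n. 1 \<le> ?k n) sequentially"
    using k unfolding filterlim_at_top by blast
  then have "eventually (\<lambda>n. 0 < ?k n) sequentially"
    by (rule eventually_mono) (rule less_le_trans[OF zero_less_one])
  with E F eventually_n(1,2)
  show "\<forall>\<^sub>F n in sequentially. \<forall>s<n. \<forall>t<n. \<forall>p :: network \<Rightarrow> nat \<Rightarrow> nat.
       (\<forall>G\<in>set_pmf (KSWN_star n). algorithm2_run c n G s t (p G)) \<longrightarrow>
       (\<integral>\<^sup>+ G. hops (p G) t \<partial>measure_pmf (KSWN_star n)) \<le> ennreal (100000 * ?L n * lg (?L n))"
  proof eventually_elim
    case (elim n)
    show ?case
    proof (intro allI impI)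
      fix s t p assume st: "s < n" "t < n" and run: "\<forall>G\<in>set_pmf (KSWN_star n). algorithm2_run c n G s t (p G)"
      show "(\<integral>\<^sup>+ G. hops (p G) t \<partial>measure_pmf (KSWN_star n)) \<le> ennreal (100000 * ?L n * lg (?L n))"
        by (rule order_trans[OF expected_hops_bound[OF c st refl _ refl _ _ _ _ _ refl refl _ _ run] ennreal_leI])
          (fact elim)+
    qed
  qed
qed

end
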